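(* Let $R$ be a complete discrete valuation ring with fraction field $K$ and perfect residue field $k$ of characteristic $p>3$. Let $E/K$ be an elliptic curve admitting a $K$-rational isogeny of prime degree $\ell>3$, where $p\neq \ell$. (i) If $\ell-1\equiv 2$ or $10 \pmod{12}$, then $E/K$ has either semi-stable reduction or reduction of Kodaira type I$_n^*$ for some $n\ge 0$. (ii) If $\ell-1\equiv 4$ or $8\pmod{12}$, then $E/K$ has either semi-stable reduction or reduction of Kodaira type III, III$^*$, or I$_n^*$ for some $n\geq 0$. (iii) If $\ell-1\equiv 6\pmod{12}$, then $E/K$ cannot have reduction of Kodaira type III or III$^*$.
   Context: A $K$-rational isogeny of $E/K$ is an isogeny $E\to E'$ defined over $K$ for some elliptic curve $E'/K$. Reduction types are the Kodaira–Néron types of the reduction of a minimal Weierstrass model of $E$ over $R$. *)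

theory Defs
  imports "HOL-Algebra.Algebraic_Closure_Type" "HOL-Number_Theory.Cong"
begin

section \<open>Complete discrete valuation rings\<close>

text \<open>
  A discrete valuation is normalised (it takes the value 1, hence has value group all of the
  integers).  Its value at 0 plays the role of infinity: it is left unspecified and never used.
\<close>

definition discrete_valuation :: "('a::field \<Rightarrow> int) \<Rightarrow> bool" where
  "discrete_valuation v \<longleftrightarrow>
     (\<forall>x y. x \<noteq> 0 \<longrightarrow> y \<noteq> 0 \<longrightarrow> v (x * y) = v x + v y) \<and>
     (\<forall>x y. x \<noteq> 0 \<longrightarrow> y \<noteq> 0 \<longrightarrow> x + y \<noteq> 0 \<longrightarrow> min (v x) (v y) \<le> v (x + y)) \<and>
     (\<exists>x. x \<noteq> 0 \<and> v x = 1)"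

definition valuation_ring :: "('a::field \<Rightarrow> int) \<Rightarrow> 'a set" where
  "valuation_ring v = {x. x = 0 \<or> 0 \<le> v x}"

text \<open>\<open>R\<close> is a discrete valuation ring whose fraction field is the ambient field.\<close>

definition is_dvr :: "'a::field set \<Rightarrow> bool" where
  "is_dvr R \<longleftrightarrow> (\<exists>v. discrete_valuation v \<and> R = valuation_ring v)"

text \<open>The valuation is determined by \<open>R\<close> on nonzero elements, so the choice is harmless.\<close>

definition dvr_ord :: "'a::field set \<Rightarrow> 'a \<Rightarrow> int" where
  "dvr_ord R = (SOME v. discrete_valuation v \<and> R = valuation_ring v)"

definition uniformizer :: "'a::field set \<Rightarrow> 'a \<Rightarrow> bool" where
  "uniformizer R \<pi> \<longleftrightarrow> \<pi> \<noteq> 0 \<and> dvr_ord R \<pi> = 1"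

text \<open>The \<open>n\<close>-th power of the maximal ideal.\<close>

definition max_pow :: "'a::field set \<Rightarrow> nat \<Rightarrow> 'a set" where
  "max_pow R n = {x. x = 0 \<or> int n \<le> dvr_ord R x}"

definition complete_dvr :: "'a::field set \<Rightarrow> bool" where
  "complete_dvr R \<longleftrightarrow> is_dvr R \<and>
     (\<forall>s :: nat \<Rightarrow> 'a. range s \<subseteq> R \<longrightarrow>
        (\<forall>N. \<exists>M. \<forall>i\<ge>M. \<forall>j\<ge>M. s i - s j \<in> max_pow R N) \<longrightarrow>
        (\<exists>x\<in>R. \<forall>N. \<exists>M. \<forall>i\<ge>M. s i - x \<in> max_pow R N))"

text \<open>
  The residue field is presented as a type \<open>'k\<close> together with the reduction map; only the
  values of \<open>res\<close> on \<open>R\<close> are relevant.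
\<close>

definition residue_map :: "'a::field set \<Rightarrow> ('a \<Rightarrow> 'k::field) \<Rightarrow> bool" where
  "residue_map R res \<longleftrightarrow>
     (\<forall>x\<in>R. \<forall>y\<in>R. res (x + y) = res x + res y) \<and>
     (\<forall>x\<in>R. \<forall>y\<in>R. res (x * y) = res x * res y) \<and>
     res 1 = 1 \<and>
     res ` R = UNIV \<and>
     (\<forall>x\<in>R. res x = 0 \<longleftrightarrow> x \<in> max_pow R 1)"

definition perfect_field :: "'k::field itself \<Rightarrow> bool" where
  "perfect_field (_ :: 'k itself) \<longleftrightarrow> CHAR('k) = 0 \<or> (\<forall>x::'k. \<exists>y. y ^ CHAR('k) = x)"


section \<open>Weierstrass equations\<close>

text \<open>\<open>Weierstrass a\<^sub>1 a\<^sub>2 a\<^sub>3 a\<^sub>4 a\<^sub>6\<close> is $y^2 + a_1 x y + a_3 y = x^3 + a_2 x^2 + a_4 x + a_6$.\<close>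

datatype 'a weierstrass =
  Weierstrass (a\<^sub>1: 'a) (a\<^sub>2: 'a) (a\<^sub>3: 'a) (a\<^sub>4: 'a) (a\<^sub>6: 'a)

definition weier_eval :: "'a::field weierstrass \<Rightarrow> 'a \<Rightarrow> 'a \<Rightarrow> 'a" where
  "weier_eval W x y =
     y^2 + a\<^sub>1 W * x * y + a\<^sub>3 W * y - (x^3 + a\<^sub>2 W * x^2 + a\<^sub>4 W * x + a\<^sub>6 W)"

definition b\<^sub>2 :: "'a::field weierstrass \<Rightarrow> 'a" where
  "b\<^sub>2 W = (a\<^sub>1 W)^2 + 4 * a\<^sub>2 W"

definition b\<^sub>4 :: "'a::field weierstrass \<Rightarrow> 'a" where
  "b\<^sub>4 W = 2 * a\<^sub>4 W + a\<^sub>1 W * a\<^sub>3 W"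

definition b\<^sub>6 :: "'a::field weierstrass \<Rightarrow> 'a" where
  "b\<^sub>6 W = (a\<^sub>3 W)^2 + 4 * a\<^sub>6 W"

definition b\<^sub>8 :: "'a::field weierstrass \<Rightarrow> 'a" where
  "b\<^sub>8 W = (a\<^sub>1 W)^2 * a\<^sub>6 W + 4 * a\<^sub>2 W * a\<^sub>6 W - a\<^sub>1 W * a\<^sub>3 W * a\<^sub>4 W
         + a\<^sub>2 W * (a\<^sub>3 W)^2 - (a\<^sub>4 W)^2"

definition discr :: "'a::field weierstrass \<Rightarrow> 'a" where
  "discr W = - ((b\<^sub>2 W)^2 * b\<^sub>8 W) - 8 * (b\<^sub>4 W)^3 - 27 * (b\<^sub>6 W)^2 + 9 * b\<^sub>2 W * b\<^sub>4 W * b\<^sub>6 W"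

text \<open>
  An elliptic curve over a field is given by a Weierstrass equation over that field with nonzero
  discriminant; its origin is the point at infinity.
\<close>

definition elliptic :: "'a::field weierstrass \<Rightarrow> bool" where
  "elliptic E \<longleftrightarrow> discr E \<noteq> 0"

text \<open>The equation obtained by substituting $x = u^2 x' + r$, $y = u^3 y' + u^2 s x' + t$.\<close>

definition change_vars :: "'a::field \<Rightarrow> 'a \<Rightarrow> 'a \<Rightarrow> 'a \<Rightarrow> 'a weierstrass \<Rightarrow> 'a weierstrass" where
  "change_vars u r s t W = Weierstrass
     ((a\<^sub>1 W + 2 * s) / u)
     ((a\<^sub>2 W - s * a\<^sub>1 W + 3 * r - s^2) / u^2)
     ((a\<^sub>3 W + r * a\<^sub>1 W + 2 * t) / u^3)
     ((a\<^sub>4 W - s * a\<^sub>3 W + 2 * r * a\<^sub>2 W - (t + r * s) * a\<^sub>1 W + 3 * r^2 - 2 * s * t) / u^4)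
     ((a\<^sub>6 W + r * a\<^sub>4 W + r^2 * a\<^sub>2 W + r^3 - t * a\<^sub>3 W - t^2 - r * t * a\<^sub>1 W) / u^6)"

text \<open>\<open>W\<close> is an integral Weierstrass model of \<open>E\<close> over \<open>R\<close>.\<close>

definition integral_model :: "'a::field set \<Rightarrow> 'a weierstrass \<Rightarrow> 'a weierstrass \<Rightarrow> bool" where
  "integral_model R E W \<longleftrightarrow>
     (\<exists>u r s t. u \<noteq> 0 \<and> W = change_vars u r s t E) \<and> set_weierstrass W \<subseteq> R"

definition minimal_model :: "'a::field set \<Rightarrow> 'a weierstrass \<Rightarrow> 'a weierstrass \<Rightarrow> bool" where
  "minimal_model R E W \<longleftrightarrow> integral_model R E W \<and>
     (\<forall>W'. integral_model R E W' \<longrightarrow> dvr_ord R (discr W) \<le> dvr_ord R (discr W'))"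


section \<open>Semi-stable reduction\<close>

text \<open>
  The point at infinity of a Weierstrass curve is always smooth, so only the affine geometric
  points have to be considered.
\<close>

definition singular_at :: "'b::field weierstrass \<Rightarrow> 'b \<Rightarrow> 'b \<Rightarrow> bool" where
  "singular_at C x y \<longleftrightarrow> weier_eval C x y = 0 \<and>
     a\<^sub>1 C * y - (3 * x^2 + 2 * a\<^sub>2 C * x + a\<^sub>4 C) = 0 \<and> 2 * y + a\<^sub>1 C * x + a\<^sub>3 C = 0"

definition nonsingular :: "'k::field weierstrass \<Rightarrow> bool" where
  "nonsingular C \<longleftrightarrow> (\<nexists>x y. singular_at (map_weierstrass to_ac C) x y)"

text \<open>
  A node is a singular point with two distinct tangent lines, here those of slopes \<open>\<alpha>\<close> and \<open>\<beta>\<close>.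
  The field is infinite, so the pointwise identity is an identity of polynomials.
\<close>

definition node_at :: "'b::field weierstrass \<Rightarrow> 'b \<Rightarrow> 'b \<Rightarrow> bool" where
  "node_at C x\<^sub>0 y\<^sub>0 \<longleftrightarrow> singular_at C x\<^sub>0 y\<^sub>0 \<and>
     (\<exists>\<alpha> \<beta>. \<alpha> \<noteq> \<beta> \<and> (\<forall>x y. weier_eval C x y =
        ((y - y\<^sub>0) - \<alpha> * (x - x\<^sub>0)) * ((y - y\<^sub>0) - \<beta> * (x - x\<^sub>0)) - (x - x\<^sub>0)^3))"

definition has_node :: "'k::field weierstrass \<Rightarrow> bool" where
  "has_node C \<longleftrightarrow> (\<exists>x\<^sub>0 y\<^sub>0. node_at (map_weierstrass to_ac C) x\<^sub>0 y\<^sub>0)"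

definition semistable_reduction ::
    "'a::field set \<Rightarrow> ('a \<Rightarrow> 'k::field) \<Rightarrow> 'a weierstrass \<Rightarrow> bool" where
  "semistable_reduction R res E \<longleftrightarrow>
     (\<exists>W. minimal_model R E W \<and>
        (nonsingular (map_weierstrass res W) \<or> has_node (map_weierstrass res W)))"


section \<open>Kodaira types\<close>

datatype kodaira =
    Kod_I nat | Kod_II | Kod_III | Kod_IV
  | Kod_I_star nat | Kod_IV_star | Kod_III_star | Kod_II_star

definition distinct_roots :: "'k::field poly \<Rightarrow> bool" where
  "distinct_roots p \<longleftrightarrow> card {z. poly (map_poly to_ac p) z = 0} = degree p"

text \<open>
  Kodaira types are read off by Tate's algorithm, which is valid over any discrete valuation ring
  with perfect residue field.  The clause for a type records the state in which the algorithm,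
  run on a minimal equation, stops with that type as its output, after the translations of the
  preceding steps have been carried out: the singular point of the reduction is $(0,0)$, and the
  multiple roots met on the way have been moved to 0.  The quotients \<open>a\<^sub>i W / \<pi>^m\<close> are Tate's
  $a_{i,m}$.  In the subprocedure for type I$_n^*$ with $n \ge 1$ the polynomial examined
  is $Y^2 + a_{3,m+1} Y - a_{6,2m+2}$ for $n = 2m-1$ and
  $a_{2,1} X^2 + a_{4,m+2} X + a_{6,2m+3}$ for $n = 2m$.
\<close>

fun tate_form ::
    "'a::field set \<Rightarrow> ('a \<Rightarrow> 'k::field) \<Rightarrow> 'a \<Rightarrow> 'a weierstrass \<Rightarrow> kodaira \<Rightarrow> bool" where
  "tate_form R res \<pi> W (Kod_I n) \<longleftrightarrow>
     (if n = 0 then discr W \<notin> max_pow R 1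
      else a\<^sub>3 W \<in> max_pow R 1 \<and> a\<^sub>4 W \<in> max_pow R 1 \<and> a\<^sub>6 W \<in> max_pow R 1 \<and>
           b\<^sub>2 W \<notin> max_pow R 1 \<and> discr W \<noteq> 0 \<and> dvr_ord R (discr W) = int n)"
| "tate_form R res \<pi> W Kod_II \<longleftrightarrow>
     a\<^sub>3 W \<in> max_pow R 1 \<and> a\<^sub>4 W \<in> max_pow R 1 \<and> a\<^sub>6 W \<in> max_pow R 1 \<and>
     b\<^sub>2 W \<in> max_pow R 1 \<and> a\<^sub>6 W \<notin> max_pow R 2"
| "tate_form R res \<pi> W Kod_III \<longleftrightarrow>
     a\<^sub>3 W \<in> max_pow R 1 \<and> a\<^sub>4 W \<in> max_pow R 1 \<and> a\<^sub>6 W \<in> max_pow R 2 \<and>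
     b\<^sub>2 W \<in> max_pow R 1 \<and> b\<^sub>8 W \<notin> max_pow R 3"
| "tate_form R res \<pi> W Kod_IV \<longleftrightarrow>
     a\<^sub>3 W \<in> max_pow R 1 \<and> a\<^sub>4 W \<in> max_pow R 1 \<and> a\<^sub>6 W \<in> max_pow R 2 \<and>
     b\<^sub>2 W \<in> max_pow R 1 \<and> b\<^sub>8 W \<in> max_pow R 3 \<and> b\<^sub>6 W \<notin> max_pow R 3"
| "tate_form R res \<pi> W (Kod_I_star n) \<longleftrightarrow>
     a\<^sub>1 W \<in> max_pow R 1 \<and>
     (if n = 0 then
        a\<^sub>2 W \<in> max_pow R 1 \<and> a\<^sub>3 W \<in> max_pow R 2 \<and>
        a\<^sub>4 W \<in> max_pow R 2 \<and> a\<^sub>6 W \<in> max_pow R 3 \<and>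
        distinct_roots [:res (a\<^sub>6 W / \<pi>^3), res (a\<^sub>4 W / \<pi>^2), res (a\<^sub>2 W / \<pi>), 1:]
      else
        a\<^sub>2 W \<in> max_pow R 1 \<and> a\<^sub>2 W \<notin> max_pow R 2 \<and>
        (if odd n then
           (let m = (n + 1) div 2 in
              a\<^sub>3 W \<in> max_pow R (m + 1) \<and> a\<^sub>4 W \<in> max_pow R (m + 2) \<and>
              a\<^sub>6 W \<in> max_pow R (2 * m + 2) \<and>
              distinct_roots [:- res (a\<^sub>6 W / \<pi>^(2 * m + 2)), res (a\<^sub>3 W / \<pi>^(m + 1)), 1:])
         else
           (let m = n div 2 in
              a\<^sub>3 W \<in> max_pow R (m + 2) \<and> a\<^sub>4 W \<in> max_pow R (m + 2) \<and>
              a\<^sub>6 W \<in> max_pow R (2 * m + 3) \<and>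
              distinct_roots
                [:res (a\<^sub>6 W / \<pi>^(2 * m + 3)), res (a\<^sub>4 W / \<pi>^(m + 2)), res (a\<^sub>2 W / \<pi>):])))"
| "tate_form R res \<pi> W Kod_IV_star \<longleftrightarrow>
     a\<^sub>1 W \<in> max_pow R 1 \<and> a\<^sub>2 W \<in> max_pow R 2 \<and> a\<^sub>3 W \<in> max_pow R 2 \<and>
     a\<^sub>4 W \<in> max_pow R 3 \<and> a\<^sub>6 W \<in> max_pow R 4 \<and>
     distinct_roots [:- res (a\<^sub>6 W / \<pi>^4), res (a\<^sub>3 W / \<pi>^2), 1:]"
| "tate_form R res \<pi> W Kod_III_star \<longleftrightarrow>
     a\<^sub>1 W \<in> max_pow R 1 \<and> a\<^sub>2 W \<in> max_pow R 2 \<and> a\<^sub>3 W \<in> max_pow R 3 \<and>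
     a\<^sub>4 W \<in> max_pow R 3 \<and> a\<^sub>6 W \<in> max_pow R 5 \<and> a\<^sub>4 W \<notin> max_pow R 4"
| "tate_form R res \<pi> W Kod_II_star \<longleftrightarrow>
     a\<^sub>1 W \<in> max_pow R 1 \<and> a\<^sub>2 W \<in> max_pow R 2 \<and> a\<^sub>3 W \<in> max_pow R 3 \<and>
     a\<^sub>4 W \<in> max_pow R 4 \<and> a\<^sub>6 W \<in> max_pow R 5 \<and> a\<^sub>6 W \<notin> max_pow R 6"

definition has_kodaira_type ::
    "'a::field set \<Rightarrow> ('a \<Rightarrow> 'k::field) \<Rightarrow> 'a weierstrass \<Rightarrow> kodaira \<Rightarrow> bool" where
  "has_kodaira_type R res E T \<longleftrightarrow>
     (\<exists>W \<pi>. minimal_model R E W \<and> uniformizer R \<pi> \<and> tate_form R res \<pi> W T)"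


section \<open>Rational isogenies and their degree\<close>

text \<open>
  The points of the projective closure of a Weierstrass curve: the affine points and
  $[0:1:0]$.
\<close>

datatype 'b point = Infty | Aff 'b 'b

fun proj_coords :: "'b::field point \<Rightarrow> 'b \<times> 'b \<times> 'b" where
  "proj_coords Infty = (0, 1, 0)"
| "proj_coords (Aff x y) = (x, y, 1)"

definition geom_points :: "'a::field weierstrass \<Rightarrow> 'a alg_closure point set" where
  "geom_points E =
     insert Infty {Aff x y | x y. weier_eval (map_weierstrass to_ac E) x y = 0}"

text \<open>
  The value, at the coordinates \<open>proj_coords P\<close>, of the ternary form
  $\sum_{i+j \le d} c_{ij} X^i Y^j Z^{d-i-j}$ of degree \<open>d\<close> with coefficients in the ground field.
\<close>

definition form_eval ::
    "nat \<Rightarrow> (nat \<Rightarrow> nat \<Rightarrow> 'a::field) \<Rightarrow> 'a alg_closure point \<Rightarrow> 'a alg_closure" where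
  "form_eval d c P = (case proj_coords P of (x, y, z) \<Rightarrow>
     (\<Sum>i\<le>d. \<Sum>j\<le>d - i. to_ac (c i j) * x^i * y^j * z^(d - i - j)))"

text \<open>
  A morphism defined over the ground field, as a map on geometric points: around every point it is
  given by three forms of equal degree with coefficients in the ground field.
\<close>

definition rational_morphism :: "'a::field weierstrass \<Rightarrow> 'a weierstrass \<Rightarrow>
    ('a alg_closure point \<Rightarrow> 'a alg_closure point) \<Rightarrow> bool" where
  "rational_morphism E E' \<phi> \<longleftrightarrow>
     \<phi> ` geom_points E \<subseteq> geom_points E' \<and>
     (\<forall>P\<in>geom_points E. \<exists>d F G H.
        (form_eval d F P, form_eval d G P, form_eval d H P) \<noteq> (0, 0, 0) \<and>
        (\<forall>Q\<in>geom_points E.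
           (form_eval d F Q, form_eval d G Q, form_eval d H Q) \<noteq> (0, 0, 0) \<longrightarrow>
           (\<exists>u. u \<noteq> 0 \<and> (case proj_coords (\<phi> Q) of (x, y, z) \<Rightarrow>
              (form_eval d F Q, form_eval d G Q, form_eval d H Q) = (u * x, u * y, u * z)))))"

definition rational_isogeny :: "'a::field weierstrass \<Rightarrow> 'a weierstrass \<Rightarrow>
    ('a alg_closure point \<Rightarrow> 'a alg_closure point) \<Rightarrow> bool" where
  "rational_isogeny E E' \<phi> \<longleftrightarrow>
     rational_morphism E E' \<phi> \<and> \<phi> Infty = Infty \<and> (\<exists>P\<in>geom_points E. \<phi> P \<noteq> Infty)"

text \<open>
  Elements of the function field over the ground field are represented by functions on the
  geometric points that are quotients of two forms of equal degree wherever the denominator does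
  not vanish; two functions represent the same element iff they agree outside a finite set.
\<close>

definition rational_function ::
    "'a::field weierstrass \<Rightarrow> ('a alg_closure point \<Rightarrow> 'a alg_closure) \<Rightarrow> bool" where
  "rational_function E f \<longleftrightarrow>
     (\<exists>d F G. (\<exists>P\<in>geom_points E. form_eval d G P \<noteq> 0) \<and>
        (\<forall>P\<in>geom_points E. form_eval d G P \<noteq> 0 \<longrightarrow> f P = form_eval d F P / form_eval d G P))"

definition same_function :: "'a::field weierstrass \<Rightarrow>
    ('a alg_closure point \<Rightarrow> 'a alg_closure) \<Rightarrow> ('a alg_closure point \<Rightarrow> 'a alg_closure) \<Rightarrow> bool" where
  "same_function E f g \<longleftrightarrow> finite {P \<in> geom_points E. f P \<noteq> g P}"

text \<open>
  The degree is $[K(E) : \varphi^* K(E')]$: the function field of \<open>E\<close> has a basis \<open>b 0, \<dots>, b (n - 1)\<close>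
  over the pullback of the function field of \<open>E'\<close>.
\<close>

definition isogeny_degree :: "'a::field weierstrass \<Rightarrow> 'a weierstrass \<Rightarrow>
    ('a alg_closure point \<Rightarrow> 'a alg_closure point) \<Rightarrow> nat \<Rightarrow> bool" where
  "isogeny_degree E E' \<phi> n \<longleftrightarrow>
     (\<exists>b. (\<forall>i<n. rational_function E (b i)) \<and>
        (\<forall>f. rational_function E f \<longrightarrow>
           (\<exists>c. (\<forall>i<n. rational_function E' (c i)) \<and>
              same_function E f (\<lambda>P. \<Sum>i<n. c i (\<phi> P) * b i P))) \<and>
        (\<forall>c. (\<forall>i<n. rational_function E' (c i)) \<longrightarrow>
           same_function E (\<lambda>P. \<Sum>i<n. c i (\<phi> P) * b i P) (\<lambda>_. 0) \<longrightarrow>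
           (\<forall>i<n. same_function E' (c i) (\<lambda>_. 0))))"

definition admits_rational_isogeny :: "'a::field weierstrass \<Rightarrow> nat \<Rightarrow> bool" where
  "admits_rational_isogeny E n \<longleftrightarrow>
     (\<exists>E' \<phi>. elliptic E' \<and> rational_isogeny E E' \<phi> \<and> isogeny_degree E E' \<phi> n)"

end

theory Submission
  imports Defs
begin

text \<open>
  Write the curve as $y^2 = x^3 + A x + B$ with discriminant \<open>\<Delta>\<close>, and the isogeny as
  $(x, y) \mapsto (N(x)/D(x), y V(x)/W(x))$.  Its kernel, the origin and the points over the roots of
  \<open>D\<close>, has order \<open>l\<close> and no element of order 2, so \<open>D\<close> is up to a constant the square of a polynomial
  over \<open>K\<close> with $d = (l-1)/2$ simple roots, and the product \<open>\<rho>\<close> of these roots lies in \<open>K\<close>.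

  Suppose that $A^3/\Delta$ is integral.  Over a valuation ring of the algebraic closure above \<open>R\<close>,
  scaling by \<open>u\<close> with $u^{12} = \Delta$ gives good reduction, and kernel points stay away from the
  origin because \<open>l\<close> is prime to the residue characteristic.  A kernel point whose first coordinate
  reduces to 0 would reduce to a point of order 2 if $B/u^6$ reduces to 0, as it does for odd
  $v(\Delta)$, and to a point of order 3 if $A/u^4$ reduces to 0, as it does for
  $3 \nmid v(\Delta)$; both are impossible.  So in these cases $\rho^6/\Delta^d$ is a unit and
  $6 \mid d\, v(\Delta)$.  It remains to read off the Kodaira type from \<open>v(A)\<close>, \<open>v(B)\<close> and
  \<open>v(\<Delta>)\<close>, which is possible in residue characteristic greater than 3.

  Closure of the kernel under addition and rationality of the isogeny in \<open>x\<close> both rest on the fact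
  that an elliptic curve has no nonconstant points over a rational function field.
\<close>

section \<open>Polynomials over algebraically closed fields\<close>

text \<open>The residues in the statement are those of d = (l-1)/2: l - 1 = 2c mod 12 means d = c
  mod 6. For d prime to 6, 6 divides v(\<Delta>), and a minimal potentially good model has
  v(\<Delta>) = 0 or 6, good reduction or I_0^*. For d prime to 3, the values 3 and 9 remain as
  well, which are III and III^*. For d odd, v(\<Delta>) is even, against the odd values of these two
  types. If neither argument about a first coordinate reducing to 0 applies, then 6 divides
  v(\<Delta>) already. Associativity of the addition is never established. Divisibility of the
  kernel order is obtained from translations by a single point, as permutations of a finite set;
  cancellation P + Q - Q = P, the absence of fixed points and an explicit computation for points of
  order 3 suffice. Neither is a reduced curve formed. That a point reduces to one of order 2 or 3 is
  expressed over the valuation ring: its double or triple would have a nonintegral first coordinate.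
  Only membership in the ring and in its maximal ideal is used, which is why any extension of the
  valuation to the algebraic closure will do.\<close>

lemma infinite_UNIV_alg_closed_field: "infinite (UNIV :: 'c::alg_closed_field set)"
proof
  assume fin: "finite (UNIV :: 'c set)"
  define P where "P = (\<Prod>a\<in>(UNIV :: 'c set). [:-a, 1:])"
  have "degree P = card (UNIV :: 'c set)"
    unfolding P_def by (subst degree_prod_eq_sum_degree) auto
  then have "degree P > 0" using fin by (simp add: card_gt_0_iff)
  then have "degree (P + 1) > 0" by (simp add: degree_add_eq_left)
  then obtain x where "poly (P + 1) x = 0" using alg_closed_imp_poly_has_root by blast
  moreover have "poly P x = 0"
    unfolding P_def poly_prod using fin by (intro prod_zero) auto
  ultimately show False by simp
qed

lemma poly_eqI_alg_closed:
  fixes p q :: "'c::alg_closed_field poly"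
  assumes "\<And>x. poly p x = poly q x"
  shows "p = q"
proof (rule ccontr)
  assume "p \<noteq> q"
  then have "finite {x. poly (p - q) x = 0}" by (intro poly_roots_finite) simp
  moreover have "{x. poly (p - q) x = 0} = UNIV" using assms by simp
  ultimately show False using infinite_UNIV_alg_closed_field[where 'c = 'c] by metis
qed

text \<open>Coprimality tested on roots: over an algebraically closed field nothing is lost, and
  coprimality to a product is immediate from coprimality to its factors.\<close>

definition no_common_root :: "'c::field poly \<Rightarrow> 'c poly \<Rightarrow> bool" where
  "no_common_root p q \<longleftrightarrow> (\<forall>x. poly p x = 0 \<longrightarrow> poly q x \<noteq> 0)"

lemma no_common_root_commute: "no_common_root p q \<longleftrightarrow> no_common_root q p"
  by (auto simp: no_common_root_def)

text \<open>Euclid's algorithm with the cofactors kept, which puts a fraction in lowest terms over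
  any field. The measure ranks q = 0 below the nonzero constants, which the degree alone would
  not.\<close>

lemma poly_bezout_cofactors:
  fixes p q :: "'c::field poly"
  assumes "p \<noteq> 0 \<or> q \<noteq> 0"
  shows "\<exists>g p' q' s t. p = g * p' \<and> q = g * q' \<and> s * p' + t * q' = 1"
  using assms
proof (induction "if q = 0 then 0 else Suc (degree q)" arbitrary: p q rule: less_induct)
  case less
  show ?case
  proof (cases "q = 0")
    case True
    have "p = p * 1 \<and> q = p * 0 \<and> 1 * 1 + 0 * 0 = (1::'c poly)" using True by simp
    then show ?thesis by blast
  next
    case False
    define k r where "k = p div q" and "r = p mod q"
    have pk: "p = q * k + r" by (simp add: k_def r_def)
    have "(if r = 0 then 0 else Suc (degree r)) < (if q = 0 then 0 else Suc (degree q))"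
      using False degree_mod_less[OF False, of p] by (auto simp: r_def)
    from less(1)[OF this] False obtain g q' r' s t
      where *: "q = g * q'" "r = g * r'" "s * q' + t * r' = 1" by blast
    have "p = g * (q' * k + r')" using pk * by (simp add: algebra_simps)
    moreover have "t * (q' * k + r') + (s - t * k) * q' = 1"
      using *(3) by (simp add: algebra_simps)
    ultimately show ?thesis using *(1) by blast
  qed
qed

lemma no_common_root_bezout:
  assumes "s * p + t * q = 1"
  shows "no_common_root p q"
proof -
  have "poly s x * poly p x + poly t x * poly q x = 1" for x
    by (metis assms poly_1 poly_add poly_mult)
  then show ?thesis by (metis add.right_neutral mult_zero_right no_common_root_def zero_neq_one)
qed

lemma sqrt_exists: "\<exists>y. y ^ 2 = (x::'c::alg_closed_field)"
  using nth_root_exists[of 2 x] by auto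

text \<open>Induction on the degree: at a root of even order a factor (X - r)^2 splits off and all
  orders stay even; constants are squares.\<close>

lemma even_orders_imp_square:
  fixes p :: "'c::alg_closed_field poly"
  assumes "p \<noteq> 0" "\<And>r. even (order r p)"
  shows "\<exists>s. p = s ^ 2"
  using assms
proof (induction "degree p" arbitrary: p rule: less_induct)
  case less
  show ?case
  proof (cases "degree p = 0")
    case True
    then obtain c where c: "p = [:c:]" by (meson degree_eq_zeroE)
    obtain y where "y ^ 2 = c" using sqrt_exists by blast
    then have "p = [:y:] ^ 2" using c by (simp add: power2_eq_square)
    then show ?thesis by blast
  next
    case False
    then obtain r where r: "poly p r = 0" using alg_closed_imp_poly_has_root by blast
    then have "order r p > 0" using less.prems(1) order_root by blast
    then have "order r p \<ge> 2" using less.prems(2)[of r] by (auto elim: evenE)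
    then obtain p' where p': "p = [:-r, 1:] ^ 2 * p'"
      by (metis dvdE order_divides)
    have p'0: "p' \<noteq> 0" using p' less.prems(1) by auto
    have "degree p = 2 + degree p'"
      using p' p'0 by (simp add: degree_mult_eq degree_power_eq)
    then have dl: "degree p' < degree p" by simp
    have "order x p = order x ([:-r, 1:] ^ 2) + order x p'" for x
      using order_mult p' less.prems(1) by blast
    moreover have "order x ([:-r, 1:] ^ 2) = 2 * order x [:-r, 1:]" for x
      by (simp only: power2_eq_square, subst order_mult) auto
    ultimately have "even (order x p')" for x
      using less.prems(2)[of x] by (metis dvd_triv_left even_add)
    from less.hyps[OF dl p'0 this] obtain s where "p' = s ^ 2" by blast
    then have "p = ([:-r, 1:] * s) ^ 2" using p' by (simp only: power_mult_distrib)
    then show ?thesis by blast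
  qed
qed

lemma degree_0_imp_square:
  fixes p :: "'c::alg_closed_field poly"
  assumes "degree p = 0" shows "\<exists>s. p = s ^ 2"
proof -
  obtain c where c: "p = [:c:]" using assms by (meson degree_eq_zeroE)
  obtain y where "y ^ 2 = c" using sqrt_exists by blast
  then have "p = [:y:] ^ 2" using c by (simp add: power2_eq_square)
  then show ?thesis by blast
qed

lemma no_common_root_0:
  fixes q :: "'c::alg_closed_field poly"
  assumes "no_common_root 0 q" shows "degree q = 0"
  using assms alg_closed_imp_poly_has_root[of q] by (auto simp: no_common_root_def)

lemma no_common_root_even_order:
  fixes a b :: "'c::alg_closed_field poly"
  assumes "no_common_root a b" "a * b \<noteq> 0" "\<And>r. even (order r (a * b))"
  shows "even (order r a)"
proof (cases "poly a r = 0")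
  case True
  then have "poly b r \<noteq> 0" using assms(1) by (auto simp: no_common_root_def)
  then have "order r b = 0" by (simp add: order_0I)
  then show ?thesis using assms(3)[of r] order_mult[OF assms(2), of r] by simp
qed (simp add: order_0I)

text \<open>A root of the product belongs to one factor only, so its even order is the order in that
  factor. If one factor is 0, the other is a constant.\<close>

lemma no_common_root_square:
  fixes a b :: "'c::alg_closed_field poly"
  assumes "no_common_root a b" "a * b = s ^ 2"
  shows "\<exists>s. a = s ^ 2"
proof (cases "a * b = 0")
  case True
  then show ?thesis
  proof (cases "a = 0")
    case True then show ?thesis by (intro exI[of _ 0]) simp
  next
    case False
    then have "b = 0" using True by simp
    then show ?thesis using assms(1) no_common_root_0[of a] degree_0_imp_square no_common_root_commute by metis
  qed
next
  case False
  then have "even (order r (a * b))" for r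
    using assms(2) by (auto simp: power2_eq_square order_mult)
  then show ?thesis
    using no_common_root_even_order[OF assms(1) False] even_orders_imp_square[of a] False by auto
qed

text \<open>
  Fermat's descent: if $u = r^2$, $v = s^2$, $k_1 = a^2$ and $k_2 = b^2$, then $r \pm a s$ and
  $r \pm b s$ are squares, and the latter two are, up to constants, combinations
  $u' - m v'$ of $u' = r - a s$ and $v' = r + a s$, whose degrees are smaller.
\<close>

lemma four_squares_descent:
  fixes u v :: "'c::alg_closed_field poly"
  assumes "(2::'c) \<noteq> 0" "no_common_root u v" "k1 \<noteq> 0" "k2 \<noteq> 0" "k1 \<noteq> k2"
    and "\<exists>s. u = s ^ 2" "\<exists>s. v = s ^ 2" "\<exists>s. u - smult k1 v = s ^ 2" "\<exists>s. u - smult k2 v = s ^ 2"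
  shows "degree u = 0 \<and> degree v = 0"
  using assms(2-)
proof (induction "max (degree u) (degree v)" arbitrary: u v k1 k2 rule: less_induct)
  case less
  obtain r s where r: "u = r ^ 2" and s: "v = s ^ 2" using less.prems by blast
  obtain a where a: "a ^ 2 = k1" using sqrt_exists by blast
  obtain b where b: "b ^ 2 = k2" using sqrt_exists by blast
  have a0: "a \<noteq> 0" and b0: "b \<noteq> 0" and ab: "a ^ 2 \<noteq> b ^ 2" using less.prems a b by auto
  have "b \<noteq> a" "b \<noteq> -a" using ab by auto
  then have ab1: "b - a \<noteq> 0" "b + a \<noteq> 0"
    using eq_neg_iff_add_eq_0[of b a] by simp_all
  have nrs: "no_common_root r s"
    using less.prems(1) by (auto simp: no_common_root_def r s)
  have nc: "no_common_root (r - smult c s) (r + smult c s)" if "c \<noteq> 0" for c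
    unfolding no_common_root_def
  proof (intro allI impI notI)
    fix x assume "poly (r - smult c s) x = 0" "poly (r + smult c s) x = 0"
    then have 1: "poly r x - c * poly s x = 0" "poly r x + c * poly s x = 0" by simp_all
    then have "(poly r x - c * poly s x) + (poly r x + c * poly s x) = 0" by simp
    then have "2 * poly r x = 0" by (simp add: algebra_simps)
    then have "poly r x = 0" using assms(1) by simp
    then have "poly s x = 0" using 1 that by simp
    then show False using \<open>poly r x = 0\<close> nrs by (auto simp: no_common_root_def)
  qed
  have fac: "(r - smult c s) * (r + smult c s) = u - smult (c^2) v" for c
    by (simp add: r s algebra_simps power2_eq_square)
  have sq: "(\<exists>s'. r - smult c s = s' ^ 2) \<and> (\<exists>s'. r + smult c s = s' ^ 2)"
    if c: "c \<noteq> 0" "\<exists>s'. u - smult (c^2) v = s' ^ 2" for c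
  proof -
    obtain w where w: "u - smult (c^2) v = w ^ 2" using c(2) by blast
    have n: "no_common_root (r + smult c s) (r - smult c s)"
      using nc[OF c(1)] no_common_root_commute by blast
    show ?thesis
      using no_common_root_square[OF nc[OF c(1)], of w] no_common_root_square[OF n, of w] fac[of c] w
      by (simp add: mult.commute)
  qed
  have sqa: "\<exists>s'. r - smult a s = s' ^ 2" "\<exists>s'. r + smult a s = s' ^ 2"
    and sqb: "\<exists>s'. r - smult b s = s' ^ 2" "\<exists>s'. r + smult b s = s' ^ 2"
    using sq[OF a0] sq[OF b0] less.prems a b by auto
  define u' v' where "u' = r - smult a s" and "v' = r + smult a s"
  have half: "\<exists>s'. smult c p = s' ^ 2" if "\<exists>s'. p = s' ^ 2" for c and p :: "'c poly"
  proof -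
    obtain d where "d ^ 2 = c" using sqrt_exists by blast
    with that show ?thesis by (metis smult_power)
  qed
  \<comment> \<open>r - c s is proportional to u' - m v' for m = (c - a)/(c + a). The choices c = b
    and c = -b give \<open>m1\<close> and its inverse \<open>m2\<close>; they differ because a b is
    nonzero and the characteristic is not 2.\<close>
  define m1 m2 where "m1 = (b - a) / (b + a)" and "m2 = (b + a) / (b - a)"
  have e0: "(r - smult a s) - smult m (r + smult a s) = smult (2 * a / (a + c)) (r - smult c s)"
    if "c + a \<noteq> 0" "m = (c - a) / (c + a)" for c m
  proof -
    have m1: "1 - m = 2 * a / (a + c)" and "1 + m = 2 * c / (a + c)"
      using that by (simp_all add: field_simps)
    then have "a + m * a = 2 * a / (a + c) * c"
      by (metis (no_types, lifting) distrib_left mult.assoc mult.commute mult.right_neutral times_divide_eq_right)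
    note m1 this
    moreover have "x - a * y - m * (x + a * y) = (1 - m) * x - (a + m * a) * y" for x y
      by (simp add: algebra_simps)
    ultimately show ?thesis
      by (intro poly_eqI) (simp add: right_diff_distrib mult.assoc)
  qed
  have e1: "u' - smult m1 v' = smult (2 * a / (a + b)) (r - smult b s)"
    unfolding u'_def v'_def using e0[of b m1] ab1 m1_def by simp
  have e2: "u' - smult m2 v' = smult (2 * a / (a - b)) (r + smult b s)"
  proof -
    have "-b - a = - (b + a)" "-b + a = - (b - a)" by simp_all
    then have "m2 = (-b - a) / (-b + a)" unfolding m2_def by (simp only: minus_divide_divide)
    moreover have "-b + a \<noteq> 0" using ab1(1) \<open>-b + a = - (b - a)\<close> by (metis neg_equal_0_iff_equal)
    ultimately show ?thesis
      unfolding u'_def v'_def using e0[of "-b" m2] by simp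
  qed
  have m: "m1 \<noteq> 0" "m2 \<noteq> 0" using ab1 by (auto simp: m1_def m2_def)
  have m12: "m1 \<noteq> m2"
  proof
    assume "m1 = m2"
    then have "(b - a) * (b - a) = (b + a) * (b + a)"
      using ab1 by (simp add: m1_def m2_def frac_eq_eq)
    then have "2 * 2 * (a * b) = 0" by (simp add: algebra_simps)
    then show False using a0 b0 assms(1) by (metis mult_eq_0_iff)
  qed
  have nc': "no_common_root u' v'" unfolding u'_def v'_def using nc a0 by blast
  have sq': "\<exists>s. u' = s ^ 2" "\<exists>s. v' = s ^ 2" "\<exists>s. u' - smult m1 v' = s ^ 2" "\<exists>s. u' - smult m2 v' = s ^ 2"
    using sqa half[OF sqb(1)] half[OF sqb(2)] e1 e2 by (auto simp: u'_def v'_def)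
  have deg: "degree u = 2 * degree r" "degree v = 2 * degree s"
    by (cases "r = 0"; cases "s = 0"; simp add: r s degree_power_eq)+
  \<comment> \<open>Combinations of r and s have at most half the degree of u and v, so the maximum
    drops unless both are constant.\<close>
  have le: "max (degree u') (degree v') \<le> max (degree r) (degree s)"
    unfolding u'_def v'_def
    using degree_diff_le_max[of r "smult a s"] degree_add_le_max[of r "smult a s"] a0 by simp
  show ?case
  proof (rule ccontr)
    assume "\<not> ?case"
    then have "max (degree u') (degree v') < max (degree u) (degree v)"
      using le deg by (auto simp: max_def split: if_splits)
    from less.hyps[OF this nc' m m12 sq'] have "degree u' = 0 \<and> degree v' = 0" .
    moreover have "smult 2 r = u' + v'" "smult (2 * a) s = v' - u'"
      unfolding u'_def v'_def
      by (rule poly_eqI, simp only: coeff_smult coeff_add coeff_diff, simp add: algebra_simps)+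
    ultimately have "degree (smult 2 r) = 0" "degree (smult (2 * a) s) = 0"
      by (metis degree_add_le le_0_eq, metis degree_diff_le le_0_eq)
    then show False using \<open>\<not> ?case\<close> deg assms(1) a0 by simp
  qed
qed

text \<open>\<open>e2\<close> is a root of the cofactor of X - e1, and \<open>e3\<close> is forced
  by the missing X^2 term. Distinctness holds because the discriminant expression is minus the
  square of the product of the root differences.\<close>

lemma cubic_distinct_roots:
  fixes A B :: "'c::alg_closed_field"
  assumes "4 * A ^ 3 + 27 * B ^ 2 \<noteq> 0"
  shows "\<exists>e1 e2 e3. e1 \<noteq> e2 \<and> e1 \<noteq> e3 \<and> e2 \<noteq> e3 \<and> e1 + e2 + e3 = 0 \<and>
    A = e1 * e2 + e1 * e3 + e2 * e3 \<and> B = - (e1 * e2 * e3) \<and>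
    (\<forall>x. x ^ 3 + A * x + B = (x - e1) * (x - e2) * (x - e3))"
proof -
  have "degree [:B, A, 0, 1:] = 3" by simp
  then obtain e1 where "poly [:B, A, 0, 1:] e1 = 0"
    using alg_closed_imp_poly_has_root[of "[:B, A, 0, 1:]"] by auto
  then have e1: "B + A * e1 + e1 ^ 3 = 0" by (simp add: algebra_simps power3_eq_cube)
  have "degree [:A + e1 ^ 2, e1, 1:] = 2" by simp
  then obtain e2 where "poly [:A + e1 ^ 2, e1, 1:] e2 = 0"
    using alg_closed_imp_poly_has_root[of "[:A + e1 ^ 2, e1, 1:]"] by auto
  then have e2: "A + e1 ^ 2 + e1 * e2 + e2 ^ 2 = 0" by (simp add: algebra_simps power2_eq_square)
  define e3 where "e3 = - e1 - e2"
  have A: "A = - (e1 ^ 2 + e1 * e2 + e2 ^ 2)" using e2 by (simp add: eq_neg_iff_add_eq_0 algebra_simps)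
  have "B = - (A * e1 + e1 ^ 3)" using e1 by (simp add: eq_neg_iff_add_eq_0 algebra_simps)
  also have "\<dots> = - (e1 * e2 * e3)" unfolding A e3_def by (simp add: algebra_simps power2_eq_square power3_eq_cube)
  finally have B: "B = - (e1 * e2 * e3)" .
  have disc: "4 * A ^ 3 + 27 * B ^ 2 = - (((e1 - e2) * (e1 - e3) * (e2 - e3)) ^ 2)"
    unfolding A B e3_def by (simp add: algebra_simps power2_eq_square power3_eq_cube)
  have "e1 \<noteq> e2" "e1 \<noteq> e3" "e2 \<noteq> e3" using assms disc by auto
  moreover have "e1 + e2 + e3 = 0" by (simp add: e3_def)
  moreover have "A = e1 * e2 + e1 * e3 + e2 * e3"
    unfolding A e3_def by (simp add: algebra_simps power2_eq_square)
  moreover have "x ^ 3 + A * x + B = (x - e1) * (x - e2) * (x - e3)" for x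
    unfolding A B e3_def by (simp add: algebra_simps power2_eq_square power3_eq_cube)
  ultimately show ?thesis using B by blast
qed

text \<open>With first coordinate p/q in lowest terms, the equation makes (p - e1 q)(p - e2 q)(p -
  e3 q) q a square up to the square of a polynomial. The four factors are pairwise coprime, so each
  is a square, and the descent applies to u = p - e1 q and v = q with constants e2 - e1 and e3 - e1.
  If a factor vanishes, p/q is one of the roots.\<close>

lemma rational_point_constant_poly:
  fixes p q r s :: "'c::alg_closed_field poly" and A B :: 'c
  assumes two: "(2::'c) \<noteq> 0" and disc: "4 * A ^ 3 + 27 * B ^ 2 \<noteq> 0"
    and nc: "no_common_root p q" and q: "q \<noteq> 0" and s: "s \<noteq> 0"
    and eq: "r ^ 2 * q ^ 3 = s ^ 2 * (p ^ 3 + smult A (p * q ^ 2) + smult B (q ^ 3))"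
  shows "degree p = 0 \<and> degree q = 0"
proof -
  obtain e1 e2 e3 where e: "e1 \<noteq> e2" "e1 \<noteq> e3" "e2 \<noteq> e3" "e1 + e2 + e3 = 0"
    "A = e1 * e2 + e1 * e3 + e2 * e3" "B = - (e1 * e2 * e3)"
    using cubic_distinct_roots[OF disc] by blast
  have e3: "e3 = - e1 - e2" using e(4) by (metis add_diff_cancel_left' diff_0 diff_diff_eq)
  define P where "P e = p - smult e q" for e
  have fac: "p ^ 3 + smult A (p * q ^ 2) + smult B (q ^ 3) = P e1 * P e2 * P e3"
  proof (rule poly_eqI_alg_closed)
    fix x show "poly (p ^ 3 + smult A (p * q ^ 2) + smult B (q ^ 3)) x = poly (P e1 * P e2 * P e3) x"
      unfolding P_def e(5,6) e3 by (simp add: algebra_simps power2_eq_square power3_eq_cube)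
  qed
  have ncP: "no_common_root (P e) (P e')" if "e \<noteq> e'" for e e'
    unfolding no_common_root_def
  proof (intro allI impI notI)
    fix x assume "poly (P e) x = 0" "poly (P e') x = 0"
    then have *: "poly p x = e * poly q x" "poly p x = e' * poly q x" by (simp_all add: P_def)
    then have "(e - e') * poly q x = 0" by (simp only: left_diff_distrib) simp
    then have "poly q x = 0" using that by simp
    then show False using * nc by (auto simp: no_common_root_def)
  qed
  have ncq: "no_common_root (P e) q" for e
    using nc by (auto simp: no_common_root_def P_def)
  have con: ?thesis if "P e = 0" for e
  proof -
    have "degree q = 0" using ncq[of e] that no_common_root_0 by metis
    moreover have "p = smult e q" using that by (simp add: P_def)
    ultimately show ?thesis by simp
  qed
  show ?thesis
  proof (cases "P e1 = 0 \<or> P e2 = 0 \<or> P e3 = 0")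
    case True then show ?thesis using con by blast
  next
    case False
    define M where "M = P e1 * P e2 * P e3 * q"
    have M0: "M \<noteq> 0" using False q by (simp add: M_def)
    have eq': "(r * q ^ 2) ^ 2 = s ^ 2 * M"
      using eq unfolding fac M_def by (simp add: algebra_simps power2_eq_square power3_eq_cube)
    have nz: "s ^ 2 * M \<noteq> 0" using s M0 by simp
    then have r0: "r * q ^ 2 \<noteq> 0" using eq' by auto
    have ev: "even (order x M)" for x
    proof -
      have "order x ((r * q ^ 2) ^ 2) = 2 * order x (r * q ^ 2)"
        by (simp only: power2_eq_square[of "r * q ^ 2"], subst order_mult) (use r0 in auto)
      moreover have "order x (s ^ 2 * M) = 2 * order x s + order x M"
        using nz s by (simp add: order_mult power2_eq_square)
      ultimately show ?thesis using eq' by (metis dvd_triv_left even_add)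
    qed
    have sub: "\<exists>s. a = s ^ 2" if "M = a * b" "no_common_root a b" for a b
      using no_common_root_even_order[of a b] even_orders_imp_square[of a] that M0 ev by auto
    have prod: "no_common_root a (b * c)" if "no_common_root a b" "no_common_root a c" for a b c :: "'c poly"
      using that by (auto simp: no_common_root_def)
    have 1: "\<exists>s. P e1 = s ^ 2"
      by (rule sub[of _ "P e2 * P e3 * q"]) (auto simp: M_def algebra_simps intro!: prod ncP ncq e)
    have 2: "\<exists>s. P e2 = s ^ 2"
      by (rule sub[of _ "P e1 * P e3 * q"]) (use e in \<open>auto simp: M_def algebra_simps intro!: prod ncP ncq\<close>)
    have 3: "\<exists>s. P e3 = s ^ 2"
      by (rule sub[of _ "P e1 * P e2 * q"]) (use e in \<open>auto simp: M_def algebra_simps intro!: prod ncP ncq\<close>)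
    have 4: "\<exists>s. q = s ^ 2"
      by (rule sub[of _ "P e1 * P e2 * P e3"]) (simp add: M_def algebra_simps, use prod[of q] ncq no_common_root_commute[of q] in simp)
    have d: "P e1 - smult (e - e1) q = P e" for e by (simp add: P_def smult_diff_left)
    have "degree (P e1) = 0 \<and> degree q = 0"
      by (rule four_squares_descent[OF two ncq, of "e2 - e1" "e3 - e1"]) (use e 1 2 3 4 in \<open>auto simp: d\<close>)
    moreover have "p = P e1 + smult e1 q" by (simp add: P_def)
    ultimately show ?thesis by (metis degree_add_le degree_smult_le le_0_eq)
  qed
qed

section \<open>Points over rational function fields\<close>

abbreviation const_fract :: "'c::field \<Rightarrow> 'c poly fract" where
  "const_fract c \<equiv> to_fract [:c:]"

lemma const_fract_add: "const_fract (x + y) = const_fract x + const_fract y"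
  by (simp flip: to_fract_add)

lemma const_fract_diff: "const_fract (x - y) = const_fract x - const_fract y"
  by (simp flip: to_fract_diff)

lemma const_fract_mult: "const_fract (x * y) = const_fract x * const_fract y"
  by (simp flip: to_fract_mult)

lemma const_fract_0: "const_fract 0 = 0" and const_fract_1: "const_fract 1 = 1"
  by (simp_all flip: one_pCons)

lemma const_fract_power: "const_fract (x ^ n) = const_fract x ^ n"
  by (induction n) (simp_all only: power_0 power_Suc const_fract_mult const_fract_1)

lemma const_fract_numeral: "const_fract (numeral k) = numeral k"
  by (induction k) (simp_all only: numeral.simps const_fract_add const_fract_1)

lemmas const_fract_simps = const_fract_add const_fract_diff const_fract_mult const_fract_power
  const_fract_0 const_fract_1 const_fract_numeral

lemma rational_point_constant:
  fixes u w :: "'c::alg_closed_field poly fract" and A B :: 'c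
  assumes two: "(2::'c) \<noteq> 0" and disc: "4 * A ^ 3 + 27 * B ^ 2 \<noteq> 0"
    and eq: "w ^ 2 = u ^ 3 + const_fract A * u + const_fract B"
  shows "\<exists>x0 y0. u = const_fract x0 \<and> w = const_fract y0"
proof -
  obtain p0 q0 where X0: "u = to_fract p0 / to_fract q0" "q0 \<noteq> 0"
    by (metis Fract_conv_to_fract Fract_cases)
  obtain r s where w: "w = to_fract r / to_fract s" "s \<noteq> 0"
    by (metis Fract_conv_to_fract Fract_cases)
  obtain g p q e f where b: "p0 = g * p" "q0 = g * q" "e * p + f * q = 1"
    using poly_bezout_cofactors[of p0 q0] X0(2) by blast
  have q: "q \<noteq> 0" "g \<noteq> 0" using b X0(2) by auto
  have nc: "no_common_root p q" using no_common_root_bezout[OF b(3)] .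
  have u: "u = to_fract p / to_fract q" using X0(1) b q by simp
  have tq: "to_fract q \<noteq> 0" "to_fract s \<noteq> 0" using q w(2) by simp_all
  have "to_fract r ^ 2 * to_fract q ^ 3 = to_fract s ^ 2 * (to_fract p ^ 3 + const_fract A * (to_fract p * to_fract q ^ 2) + const_fract B * to_fract q ^ 3)"
  proof -
    have "to_fract r ^ 2 * to_fract q ^ 3 = w ^ 2 * (to_fract s ^ 2 * to_fract q ^ 3)"
      using tq by (simp add: w power_divide)
    also have "\<dots> = to_fract s ^ 2 * (to_fract p ^ 3 + const_fract A * (to_fract p * to_fract q ^ 2) + const_fract B * to_fract q ^ 3)"
      unfolding eq u using tq by (simp add: field_simps power2_eq_square power3_eq_cube)
    finally show ?thesis .
  qed
  moreover have smult_eq: "smult c w = [:c:] * w" for c and w :: "'c poly" by simp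
  moreover have to_fract_power: "to_fract (w ^ n) = to_fract w ^ n" for w :: "'c poly" and n
    by (induction n) simp_all
  ultimately have "to_fract (r ^ 2 * q ^ 3) = to_fract (s ^ 2 * (p ^ 3 + smult A (p * q ^ 2) + smult B (q ^ 3)))"
    by (simp only: smult_eq to_fract_mult to_fract_add to_fract_power)
  then have "r ^ 2 * q ^ 3 = s ^ 2 * (p ^ 3 + smult A (p * q ^ 2) + smult B (q ^ 3))"
    by (simp only: to_fract_eq_iff)
  from rational_point_constant_poly[OF two disc nc q(1) w(2) this]
  obtain p1 q1 where pq: "p = [:p1:]" "q = [:q1:]" by (meson degree_eq_zeroE)
  have q1: "q1 \<noteq> 0" using q pq by simp
  have "const_fract (p1 / q1) * const_fract q1 = const_fract p1"
    unfolding const_fract_mult[symmetric] using q1 by simp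
  moreover have "const_fract q1 \<noteq> 0" using q1 by simp
  ultimately have Xc: "u = const_fract (p1 / q1)"
    unfolding u pq by (metis nonzero_divide_eq_eq)
  define k where "k = (p1 / q1) ^ 3 + A * (p1 / q1) + B"
  obtain y0 where y0: "y0 ^ 2 = k" using sqrt_exists by blast
  have "w ^ 2 = const_fract y0 ^ 2"
    unfolding eq Xc by (simp only: const_fract_simps(1,3,4)[symmetric] y0 k_def)
  then have "w = const_fract y0 \<or> w = - const_fract y0" by (simp only: power2_eq_iff)
  moreover have "- const_fract y0 = const_fract (- y0)"
    using const_fract_simps(2)[of 0 y0] by (simp only: const_fract_simps(5) diff_0)
  ultimately show ?thesis using Xc by metis
qed

text \<open>
  A point \<open>(a + b z, c + d z)\<close> of the curve over a quadratic extension \<open>z\<^sup>2 = q\<close> of the rational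
  function field spans with its conjugate a line defined over the rational function field, so the
  third intersection point is rational, hence constant.  The last alternative is the resulting
  relation between the trace \<open>2 a\<close> and the norm \<open>a\<^sup>2 - b\<^sup>2 q\<close> of the first coordinate.
\<close>

lemma quadratic_point_cases:
  fixes a b c d q :: "'c::alg_closed_field poly fract" and A B :: 'c
  assumes two: "(2::'c) \<noteq> 0" and disc: "4 * A ^ 3 + 27 * B ^ 2 \<noteq> 0"
    and eq1: "c ^ 2 + d ^ 2 * q = a ^ 3 + 3 * a * b ^ 2 * q + const_fract A * a + const_fract B"
    and eq2: "2 * c * d = 3 * a ^ 2 * b + b ^ 3 * q + const_fract A * b"
  obtains (odd) "b = 0" "c = 0"
  | (const) x0 y0 where "b = 0" "d = 0" "a = const_fract x0" "c = const_fract y0"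
  | (chord) x0 y0 where
      "((a ^ 2 - b ^ 2 * q) - const_fract x0 * (2 * a) - 2 * const_fract x0 ^ 2 - const_fract A) ^ 2
       = 4 * const_fract y0 ^ 2 * (2 * a + const_fract x0)"
proof (cases "b = 0")
  case True
  have "(2 :: 'c poly fract) \<noteq> 0"
    using two const_fract_numeral[of "num.Bit0 num.One", where 'a = 'c]
    by (metis pCons_eq_0_iff to_fract_eq_0_iff)
  then have "c = 0 \<or> d = 0" using eq2 True by simp
  then show ?thesis
  proof
    assume "c = 0" then show ?thesis using odd True by blast
  next
    assume "d = 0"
    then have "c ^ 2 = a ^ 3 + const_fract A * a + const_fract B" using eq1 True by simp
    from rational_point_constant[OF two disc this] show ?thesis using const True \<open>d = 0\<close> by blast
  qed
next
  case False
  \<comment> \<open>The chord through the two conjugate points has slope d/b; (\<open>X0\<close>,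
    \<open>Y0\<close>) is its third point with the curve, without the reflection of the group
    law.\<close>
  define L where "L = d / b"
  define X0 where "X0 = L ^ 2 - 2 * a"
  define Y0 where "Y0 = L * (X0 - a) + c"
  have d: "d = L * b" using False by (simp add: L_def)
  have "b * (2 * c * L) = b * (3 * a ^ 2 + b ^ 2 * q + const_fract A)"
    using eq2 unfolding d by (simp add: algebra_simps power2_eq_square power3_eq_cube)
  then have e2: "2 * c * L = 3 * a ^ 2 + b ^ 2 * q + const_fract A" using False by simp
  have A: "const_fract A = 2 * c * L - 3 * a ^ 2 - b ^ 2 * q" using e2 by simp
  have B: "const_fract B = c ^ 2 + d ^ 2 * q - a ^ 3 - 3 * a * b ^ 2 * q - const_fract A * a"
    using eq1 by simp
  have "Y0 ^ 2 = X0 ^ 3 + const_fract A * X0 + const_fract B"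
    unfolding B A Y0_def d X0_def by (simp add: algebra_simps power2_eq_square power3_eq_cube)
  from rational_point_constant[OF two disc this] obtain x0 y0
    where xy: "X0 = const_fract x0" "Y0 = const_fract y0" by blast
  \<comment> \<open>This is Vieta's second relation for the chord. Squaring it eliminates the
    unknown slope, since L^2 = 2 a + X0.\<close>
  have "(a ^ 2 - b ^ 2 * q) - X0 * (2 * a) - 2 * X0 ^ 2 - const_fract A = - (2 * L * Y0)"
    unfolding A Y0_def X0_def by (simp add: algebra_simps power2_eq_square)
  moreover have "L ^ 2 = 2 * a + X0" by (simp add: X0_def)
  ultimately have "((a ^ 2 - b ^ 2 * q) - X0 * (2 * a) - 2 * X0 ^ 2 - const_fract A) ^ 2 = 4 * Y0 ^ 2 * (2 * a + X0)"
    by (simp add: power_mult_distrib)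
  then show ?thesis using chord unfolding xy by blast
qed

text \<open>The same for the point \<open>((a + b z) / D, (c + d z) / W)\<close>, in terms of polynomials.\<close>

lemma quadratic_fraction_cases:
  fixes a b c d q D W :: "'c::alg_closed_field poly" and A B :: 'c
  assumes two: "(2::'c) \<noteq> 0" and disc: "4 * A ^ 3 + 27 * B ^ 2 \<noteq> 0" and D: "D \<noteq> 0" and W: "W \<noteq> 0"
    and eq1: "(c ^ 2 + d ^ 2 * q) * D ^ 3 = W ^ 2 * (a ^ 3 + 3 * a * b ^ 2 * q + smult A (a * D ^ 2) + smult B (D ^ 3))"
    and eq2: "2 * c * d * D ^ 3 = W ^ 2 * (3 * a ^ 2 * b + b ^ 3 * q + smult A (b * D ^ 2))"
  obtains (odd) "b = 0" "c = 0"
  | (const) e f where "b = 0" "d = 0" "a = smult e D" "c = smult f W"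
  | (chord) e f where
      "(a ^ 2 - b ^ 2 * q - smult (2 * e) (a * D) - smult (2 * e ^ 2 + A) (D ^ 2)) ^ 2
       = smult (4 * f ^ 2) (D ^ 3 * (2 * a + smult e D))"
proof -
  let ?t = "to_fract :: 'c poly \<Rightarrow> _"
  have tp: "?t (w ^ n) = ?t w ^ n" for w n by (induction n) simp_all
  have ts: "smult k w = [:k:] * w" for k and w :: "'c poly" by simp
  have tn: "?t (numeral k) = numeral k" for k
    using const_fract_numeral[of k, where 'a = 'c] by (simp flip: numeral_poly)
  note th = to_fract_mult to_fract_add to_fract_diff tp ts tn
  have nz: "?t D \<noteq> 0" "?t W \<noteq> 0" using D W by simp_all
  have e1: "(?t c ^ 2 + ?t d ^ 2 * ?t q) * ?t D ^ 3 = ?t W ^ 2 * (?t a ^ 3 + 3 * ?t a * ?t b ^ 2 * ?t q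
     + const_fract A * (?t a * ?t D ^ 2) + const_fract B * ?t D ^ 3)"
    using arg_cong[OF eq1, of ?t] by (simp only: th)
  have e2: "2 * ?t c * ?t d * ?t D ^ 3 = ?t W ^ 2 * (3 * ?t a ^ 2 * ?t b + ?t b ^ 3 * ?t q
     + const_fract A * (?t b * ?t D ^ 2))"
    using arg_cong[OF eq2, of ?t] by (simp only: th)
  define a' b' c' d' where "a' = ?t a / ?t D" and "b' = ?t b / ?t D" and "c' = ?t c / ?t W" and "d' = ?t d / ?t W"
  have ab: "?t a = a' * ?t D" "?t b = b' * ?t D" "?t c = c' * ?t W" "?t d = d' * ?t W"
    using nz by (simp_all add: a'_def b'_def c'_def d'_def)
  have "(?t W ^ 2 * ?t D ^ 3) * (c' ^ 2 + d' ^ 2 * ?t q) =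
      (?t W ^ 2 * ?t D ^ 3) * (a' ^ 3 + 3 * a' * b' ^ 2 * ?t q + const_fract A * a' + const_fract B)"
    using e1 unfolding ab by (simp add: algebra_simps power2_eq_square power3_eq_cube)
  then have f1: "c' ^ 2 + d' ^ 2 * ?t q = a' ^ 3 + 3 * a' * b' ^ 2 * ?t q + const_fract A * a' + const_fract B"
    using nz by simp
  have "(?t W ^ 2 * ?t D ^ 3) * (2 * c' * d') =
      (?t W ^ 2 * ?t D ^ 3) * (3 * a' ^ 2 * b' + b' ^ 3 * ?t q + const_fract A * b')"
    using e2 unfolding ab by (simp add: algebra_simps power2_eq_square power3_eq_cube)
  then have f2: "2 * c' * d' = 3 * a' ^ 2 * b' + b' ^ 3 * ?t q + const_fract A * b'"
    using nz by simp
  show ?thesis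
  proof (rule quadratic_point_cases[OF two disc f1 f2])
    assume "b' = 0" "c' = 0"
    then show ?thesis using odd ab(2,3) by simp
  next
    fix e f assume h: "b' = 0" "d' = 0" "a' = const_fract e" "c' = const_fract f"
    have "?t a = ?t (smult e D)" "?t c = ?t (smult f W)" using ab(1,3) h by (simp_all only: th)
    then show ?thesis using const[of e f] h ab(2,4) by simp
  next
    fix e f assume h: "((a' ^ 2 - b' ^ 2 * ?t q) - const_fract e * (2 * a') - 2 * const_fract e ^ 2 - const_fract A) ^ 2
       = 4 * const_fract f ^ 2 * (2 * a' + const_fract e)"
    have "(?t a ^ 2 - ?t b ^ 2 * ?t q - const_fract (2 * e) * (?t a * ?t D) - const_fract (2 * e ^ 2 + A) * ?t D ^ 2) ^ 2
      = ?t D ^ 4 * ((a' ^ 2 - b' ^ 2 * ?t q) - const_fract e * (2 * a') - 2 * const_fract e ^ 2 - const_fract A) ^ 2"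
      unfolding ab const_fract_simps by (simp add: algebra_simps eval_nat_numeral)
    also have "\<dots> = const_fract (4 * f ^ 2) * (?t D ^ 3 * (2 * ?t a + const_fract e * ?t D))"
      unfolding h ab const_fract_simps by (simp add: algebra_simps eval_nat_numeral)
    finally have "?t ((a ^ 2 - b ^ 2 * q - smult (2 * e) (a * D) - smult (2 * e ^ 2 + A) (D ^ 2)) ^ 2)
       = ?t (smult (4 * f ^ 2) (D ^ 3 * (2 * a + smult e D)))" by (simp only: th)
    then show ?thesis using chord by (simp only: to_fract_eq_iff)
  qed
qed

section \<open>Chord and tangent addition\<close>

fun on_curve :: "'c::field \<Rightarrow> 'c \<Rightarrow> 'c point \<Rightarrow> bool" where
  "on_curve a b Infty \<longleftrightarrow> True"
| "on_curve a b (Aff x y) \<longleftrightarrow> y ^ 2 = x ^ 3 + a * x + b"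

fun pneg :: "'c::field point \<Rightarrow> 'c point" where
  "pneg Infty = Infty"
| "pneg (Aff x y) = Aff x (- y)"

text \<open>On the curve, equal first coordinates and non-opposite points mean equal points, so the
  tangent slope can be taken at the first one.\<close>

fun padd :: "'c::field \<Rightarrow> 'c point \<Rightarrow> 'c point \<Rightarrow> 'c point" where
  "padd a Infty Q = Q"
| "padd a P Infty = P"
| "padd a (Aff x1 y1) (Aff x2 y2) =
     (if x1 = x2 \<and> y1 = - y2 then Infty
      else let l = (if x1 = x2 then (3 * x1 ^ 2 + a) / (2 * y1) else (y2 - y1) / (x2 - x1));
               x3 = l ^ 2 - x1 - x2
           in Aff x3 (- (y1 + l * (x3 - x1))))"

lemma padd_Infty_right [simp]: "padd a P Infty = P"
  by (cases P) auto

text \<open>The last three equations are Vieta's relations for x^3 + a x + b - (l x + n)^2, whose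
  roots with multiplicity are x1, x2, x3. In this form chords and tangents need not be distinguished
  any more.\<close>

lemma padd_line:
  fixes a b :: "'c::field"
  assumes two: "(2::'c) \<noteq> 0" and P: "on_curve a b (Aff x1 y1)" and Q: "on_curve a b (Aff x2 y2)"
    and no: "\<not> (x1 = x2 \<and> y1 = - y2)"
  obtains l n x3 where "y1 = l * x1 + n" "y2 = l * x2 + n"
    "padd a (Aff x1 y1) (Aff x2 y2) = Aff x3 (- (l * x3 + n))"
    "x1 + x2 + x3 = l ^ 2" "x1 * x2 + x1 * x3 + x2 * x3 = a - 2 * l * n" "x1 * x2 * x3 = n ^ 2 - b"
proof -
  define l where "l = (if x1 = x2 then (3 * x1 ^ 2 + a) / (2 * y1) else (y2 - y1) / (x2 - x1))"
  define n where "n = y1 - l * x1"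
  define x3 where "x3 = l ^ 2 - x1 - x2"
  have y1: "y1 = l * x1 + n" by (simp add: n_def)
  have add: "padd a (Aff x1 y1) (Aff x2 y2) = Aff x3 (- (l * x3 + n))"
    by (simp only: padd.simps if_not_P[OF no] Let_def l_def[symmetric] x3_def[symmetric]) (simp add: n_def algebra_simps)
  have E1: "(l * x1 + n) ^ 2 = x1 ^ 3 + a * x1 + b" using P y1 by simp
  have e1: "x1 + x2 + x3 = l ^ 2" by (simp add: x3_def)
  have y2e2: "y2 = l * x2 + n \<and> x1 * x2 + x1 * x3 + x2 * x3 = a - 2 * l * n"
  proof (cases "x1 = x2")
    case True
    then have "y1 ^ 2 = y2 ^ 2" using P Q by simp
    then have y12: "y1 = y2" using no True by (auto simp: power2_eq_iff)
    with no True have "y1 \<noteq> - y1" by auto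
    then have "2 * y1 \<noteq> 0" by (metis add_eq_0_iff mult_2)
    then have "l * (2 * y1) = 3 * x1 ^ 2 + a" using True by (simp add: l_def)
    then have "a = 2 * l * (l * x1 + n) - 3 * x1 ^ 2" using y1 by (simp add: algebra_simps)
    then have "x1 * x1 + x1 * x3 + x1 * x3 = a - 2 * l * n"
      by (simp add: x3_def True[symmetric] algebra_simps power2_eq_square)
    then show ?thesis using True y12 y1 by simp
  next
    case False
    have ls: "l * (x2 - x1) = y2 - y1" using False by (simp add: l_def)
    have "l * x2 + n = y1 + l * (x2 - x1)" by (simp add: n_def algebra_simps)
    then have y2: "y2 = l * x2 + n" unfolding ls by simp
    have E2: "(l * x2 + n) ^ 2 = x2 ^ 3 + a * x2 + b" using Q y2 by simp
    have "(x2 - x1) * (x1 ^ 2 + x1 * x2 + x2 ^ 2 + a - l ^ 2 * (x1 + x2) - 2 * l * n)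
      = (x2 ^ 3 + a * x2 + b - (l * x2 + n) ^ 2) - (x1 ^ 3 + a * x1 + b - (l * x1 + n) ^ 2)"
      by (simp add: algebra_simps power2_eq_square power3_eq_cube)
    also have "\<dots> = 0" using E1 E2 by simp
    finally have "x1 ^ 2 + x1 * x2 + x2 ^ 2 + a - l ^ 2 * (x1 + x2) - 2 * l * n = 0" using False by simp
    then have "a = l ^ 2 * (x1 + x2) + 2 * l * n - (x1 ^ 2 + x1 * x2 + x2 ^ 2)"
      by (simp add: algebra_simps)
    then have "x1 * x2 + x1 * x3 + x2 * x3 = a - 2 * l * n"
      by (simp add: x3_def algebra_simps power2_eq_square)
    then show ?thesis using y2 by simp
  qed
  have "b = (l * x1 + n) ^ 2 - x1 ^ 3 - a * x1" using E1 by (simp add: algebra_simps)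
  moreover have a: "a = x1 * x2 + x1 * x3 + x2 * x3 + 2 * l * n" using y2e2 by (simp add: algebra_simps)
  moreover have x2: "x2 = l ^ 2 - x1 - x3" using e1 by (simp add: algebra_simps)
  ultimately have "n ^ 2 - b = x1 * (l ^ 2 - x1 - x3) * x3"
    by (simp add: algebra_simps power2_eq_square power3_eq_cube)
  then have "n ^ 2 - b = x1 * x2 * x3" using x2 by simp
  then show ?thesis using that[of l n x3] y1 y2e2 add e1 by simp
qed

lemma padd_eqI:
  fixes a :: "'c::field"
  assumes two: "(2::'c) \<noteq> 0"
    and y: "y1 = l * x1 + n" "y2 = l * x2 + n"
    and no: "\<not> (x1 = x2 \<and> y1 = - y2)"
    and e1: "x1 + x2 + x3 = l ^ 2" and e2: "x1 * x2 + x1 * x3 + x2 * x3 = a - 2 * l * n"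
  shows "padd a (Aff x1 y1) (Aff x2 y2) = Aff x3 (- (l * x3 + n))"
proof -
  have x3: "x3 = l ^ 2 - x1 - x2" using e1 by (simp add: algebra_simps)
  have "(if x1 = x2 then (3 * x1 ^ 2 + a) / (2 * y1) else (y2 - y1) / (x2 - x1)) = l"
  proof (cases "x1 = x2")
    case True
    then have "y1 \<noteq> - y1" using y no by auto
    then have y0: "2 * y1 \<noteq> 0" by (metis add_eq_0_iff mult_2)
    have "a = x1 * x2 + x1 * x3 + x2 * x3 + 2 * l * n" using e2 by (simp add: algebra_simps)
    then have "3 * x1 ^ 2 + a = l * (2 * y1)"
      unfolding x3 True[symmetric] y by (simp add: algebra_simps power2_eq_square)
    then show ?thesis using True y0 by simp
  next
    case False
    have "y2 - y1 = l * (x2 - x1)" by (simp add: y algebra_simps)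
    then show ?thesis using False by simp
  qed
  note sl = this
  show ?thesis
    by (simp only: padd.simps if_not_P[OF no] Let_def sl x3[symmetric]) (simp add: y(1) algebra_simps)
qed

lemma on_curve_padd:
  fixes a b :: "'c::field"
  assumes "(2::'c) \<noteq> 0" "on_curve a b P" "on_curve a b Q"
  shows "on_curve a b (padd a P Q)"
proof (cases P; cases Q)
  fix x1 y1 x2 y2 assume PQ: "P = Aff x1 y1" "Q = Aff x2 y2"
  show ?thesis
  proof (cases "x1 = x2 \<and> y1 = - y2")
    case True then show ?thesis using PQ by simp
  next
    case False
    then obtain l n x3 where *: "y1 = l * x1 + n" "padd a P Q = Aff x3 (- (l * x3 + n))"
      "x1 + x2 + x3 = l ^ 2" "x1 * x2 + x1 * x3 + x2 * x3 = a - 2 * l * n" "x1 * x2 * x3 = n ^ 2 - b"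
      using padd_line[OF assms(1), of a b x1 y1 x2 y2] assms PQ by metis
    have r: "2 * l * n = a - (x1 * x2 + x1 * x3 + x2 * x3)" "n ^ 2 = x1 * x2 * x3 + b"
      using * by (simp_all add: algebra_simps)
    have "(l * x3 + n) ^ 2 = l ^ 2 * x3 ^ 2 + (2 * l * n) * x3 + n ^ 2"
      by (simp add: power2_eq_square algebra_simps)
    also have "\<dots> = x3 ^ 3 + a * x3 + b" unfolding r *(3)[symmetric]
      by (simp add: algebra_simps power2_eq_square power3_eq_cube)
    finally show ?thesis using *(2) by (simp only: on_curve.simps power2_minus)
  qed
qed (use assms in auto)

lemma singular_2_torsion:
  fixes a b x :: "'c::field"
  assumes "4 * a ^ 3 + 27 * b ^ 2 \<noteq> 0" "x ^ 3 + a * x + b = 0"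
  shows "3 * x ^ 2 + a \<noteq> 0"
proof
  assume "3 * x ^ 2 + a = 0"
  then have a: "a = - 3 * x ^ 2" by (simp add: eq_neg_iff_add_eq_0 add.commute)
  have "b = - (x ^ 3 + a * x)" using assms(2) by (metis add_eq_0_iff)
  then have "b = 2 * x ^ 3" unfolding a by (simp add: power2_eq_square power3_eq_cube)
  then have "4 * a ^ 3 + 27 * b ^ 2 = 0" unfolding a by (simp add: power2_eq_square power3_eq_cube)
  then show False using assms(1) by blast
qed

text \<open>x is a double root of the cubic minus (l X + n)^2. Since l x + n = 0, the derivative of
  the square vanishes at x too, hence so does the derivative of the cubic.\<close>

lemma double_root_2_torsion:
  fixes a b l n x y :: "'c::field"
  assumes "x + y + x = l ^ 2" "x * y + x * x + y * x = a - 2 * l * n" "l * x + n = 0"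
  shows "3 * x ^ 2 + a = 0"
proof -
  have "a = x * y + x * x + y * x + 2 * l * n" using assms(2) by simp
  moreover have "n = - (l * x)" using assms(3) by (simp add: eq_neg_iff_add_eq_0 add.commute)
  moreover have "y = l ^ 2 - x - x" using assms(1) by (simp add: algebra_simps)
  ultimately show ?thesis by (simp add: algebra_simps power2_eq_square)
qed

text \<open>P + Q = P puts -P on the chord. The chord is not vertical, so y1 = -y1 = 0 and x1 is a
  double root of the intersection, which makes P a singular point.\<close>

lemma padd_eq_left_imp_Infty:
  fixes a b :: "'c::field"
  assumes two: "(2::'c) \<noteq> 0" and disc: "4 * a ^ 3 + 27 * b ^ 2 \<noteq> 0"
    and "on_curve a b P" "on_curve a b Q" "padd a P Q = P"
  shows "Q = Infty"
proof (rule ccontr)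
  assume "Q \<noteq> Infty"
  then obtain x2 y2 where Q: "Q = Aff x2 y2" by (cases Q) auto
  then obtain x1 y1 where P: "P = Aff x1 y1" using assms by (cases P) auto
  have no: "\<not> (x1 = x2 \<and> y1 = - y2)" using assms P Q by auto
  obtain l n x3 where *: "y1 = l * x1 + n" "padd a P Q = Aff x3 (- (l * x3 + n))"
    "x1 + x2 + x3 = l ^ 2" "x1 * x2 + x1 * x3 + x2 * x3 = a - 2 * l * n"
    using padd_line[OF two, of a b x1 y1 x2 y2] no assms P Q by metis
  have "Aff x3 (- (l * x3 + n)) = Aff x1 y1" using *(2) assms(5) P by metis
  then have x3: "x3 = x1" and "- (l * x3 + n) = y1" by (metis point.inject)+
  then have "- y1 = y1" using *(1) by simp
  have "2 * y1 = 0" using \<open>- y1 = y1\<close> by (metis add.right_inverse mult_2)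
  then have y1: "y1 = 0" using two by simp
  have "3 * x1 ^ 2 + a = 0"
  proof (rule double_root_2_torsion)
    show "l * x1 + n = 0" using *(1) y1 by simp
    show "x1 + x2 + x1 = l ^ 2" "x1 * x2 + x1 * x1 + x2 * x1 = a - 2 * l * n"
      using *(3,4) x3 by simp_all
  qed
  then show False using singular_2_torsion[OF disc, of x1] assms(3) P y1 by simp
qed

text \<open>Reflection of the chord: P + Q and -Q lie on the line of slope -l and intercept -n,
  whose third point is -P. This is the substitute for associativity that makes translations
  injective.\<close>

lemma padd_cancel:
  fixes a b :: "'c::field"
  assumes two: "(2::'c) \<noteq> 0" and disc: "4 * a ^ 3 + 27 * b ^ 2 \<noteq> 0"
    and P: "on_curve a b P" and Q: "on_curve a b Q"
  shows "padd a (padd a P Q) (pneg Q) = P"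
proof (cases P; cases Q)
  fix x1 y1 x2 y2 assume PQ: "P = Aff x1 y1" "Q = Aff x2 y2"
  show ?thesis
  proof (cases "x1 = x2 \<and> y1 = - y2")
    case True then show ?thesis using PQ by simp
  next
    case False
    then obtain l n x3 where *: "y1 = l * x1 + n" "y2 = l * x2 + n" "padd a P Q = Aff x3 (- (l * x3 + n))"
      "x1 + x2 + x3 = l ^ 2" "x1 * x2 + x1 * x3 + x2 * x3 = a - 2 * l * n" "x1 * x2 * x3 = n ^ 2 - b"
      using padd_line[OF two, of a b x1 y1 x2 y2] P Q PQ by metis
    \<comment> \<open>Opposite points here would mean y2 = 0 and a double root at x2, again a
      singular point.\<close>
    have no: "\<not> (x3 = x2 \<and> - (l * x3 + n) = - (- y2))"
    proof
      assume h: "x3 = x2 \<and> - (l * x3 + n) = - (- y2)"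
      then have "- y2 = y2" using *(2) by (metis minus_minus)
      then have "2 * y2 = 0" by (metis add.right_inverse mult_2)
      then have y2: "y2 = 0" using two by simp
      have "3 * x2 ^ 2 + a = 0"
      proof (rule double_root_2_torsion)
        show "l * x2 + n = 0" using *(2) y2 by simp
        show "x2 + x1 + x2 = l ^ 2" "x2 * x1 + x2 * x2 + x1 * x2 = a - 2 * l * n"
          using *(4,5) h by (simp_all add: algebra_simps)
      qed
      then show False using singular_2_torsion[OF disc, of x2] Q PQ y2 by simp
    qed
    have "padd a (Aff x3 (- (l * x3 + n))) (Aff x2 (- y2)) = Aff x1 (- (- l * x1 + - n))"
      by (rule padd_eqI[OF two _ _ no]) (use * in \<open>auto simp: algebra_simps\<close>)
    then show ?thesis using * PQ by simp
  qed
qed (use assms in auto)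

text \<open>With the flex as origin and its tangent as axis the curve takes the normal form u (u + 2
  l h + c) = h^3, c = 2 yq, of a curve with a point of order 3. There translation by Q is (h, u) ->
  (-c u/h^2, -c^2 u/h^3), and the third iterate is computed to be the identity. The points with h =
  0 are treated apart.\<close>

lemma padd_flex_period_3:
  fixes a b :: "'c::field"
  assumes two: "(2::'c) \<noteq> 0" and disc: "4 * a ^ 3 + 27 * b ^ 2 \<noteq> 0"
    and P: "on_curve a b P" and Q: "on_curve a b Q" and Q0: "Q \<noteq> Infty"
    and flex: "padd a Q Q = pneg Q"
  shows "padd a (padd a (padd a P Q) Q) Q = P"
proof -
  obtain xq yq where Qeq: "Q = Aff xq yq" using Q0 by (cases Q) auto
  show ?thesis
  proof (cases "P = Infty \<or> P = Q \<or> P = pneg Q")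
    case True
    have "padd a (pneg Q) Q = Infty" by (simp add: Qeq)
    then show ?thesis using True flex by auto
  next
    case False
    have yq0: "yq \<noteq> - yq" using flex by (auto simp: Qeq)
    then obtain l n where *: "yq = l * xq + n" "xq + xq + xq = l ^ 2" 
       "xq * xq + xq * xq + xq * xq = a - 2 * l * n" "xq * xq * xq = n ^ 2 - b"
      using padd_line[OF two, of a b xq yq xq yq] Q flex unfolding Qeq
      by (metis pneg.simps(2) point.inject)
    have "2 * yq \<noteq> 0" using yq0 by (metis add_eq_0_iff mult_2)
    define c where "c = 2 * yq"
    have c0: "c \<noteq> 0" using \<open>2 * yq \<noteq> 0\<close> c_def by simp
    \<comment> \<open>\<open>h\<close> is the first coordinate relative to Q, and \<open>u\<close>
      the height above the flex tangent.\<close>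
    define pt where "pt h u = Aff (xq + h) (u + l * h + yq)" for h u
    have step: "padd a (pt h u) Q = pt (- c * u / h ^ 2) (- (c ^ 2) * u / h ^ 3)"
      if h: "h \<noteq> 0" and rel: "u * (u + 2 * l * h + c) = h ^ 3" for h u
    proof -
      define m where "m = u / h"
      have u: "u = m * h" using h by (simp add: m_def)
      have "h ^ 2 * (m * (m * h + 2 * l * h + c)) = h ^ 2 * h ^ 2"
      proof -
        have "h ^ 2 * (m * (m * h + 2 * l * h + c)) = h * (u * (u + 2 * l * h + c))"
          by (simp add: u algebra_simps power2_eq_square)
        then show ?thesis by (simp add: rel power2_eq_square power3_eq_cube)
      qed
      then have r1: "m * (m * h + 2 * l * h + c) = h ^ 2"
        using h by (metis mult_left_cancel power_eq_0_iff)
      define h' where "h' = - c * m / h"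
      have h': "m * m + 2 * l * m - h = h'"
        using r1 h by (simp add: h'_def field_simps power2_eq_square)
      have s: "(yq - (u + l * h + yq)) / (xq - (xq + h)) = m + l"
        using h by (simp add: u field_simps)
      have "padd a (pt h u) Q = Aff (xq + h') (- (u + l * h + yq + (m + l) * (xq + h' - (xq + h))))"
      proof -
        have "(m + l) ^ 2 - (xq + h) - xq = xq + h'"
        proof -
          have "(m + l) ^ 2 - (xq + h) - xq = m * m + 2 * l * m - h + (l ^ 2 - xq - xq)"
            by (simp add: power2_eq_square algebra_simps)
          also have "l ^ 2 - xq - xq = xq" using *(2) by (simp add: algebra_simps)
          finally show ?thesis using h' by (simp add: algebra_simps)
        qed
        moreover have "xq + h \<noteq> xq" using h by simp
        ultimately show ?thesis
          by (simp only: pt_def Qeq padd.simps Let_def s if_not_P if_False simp_thms)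
      qed
      also have "- (u + l * h + yq + (m + l) * (xq + h' - (xq + h))) = m * c * m / h * (c / c) * 0 + (c * m * m / h + 2 * l * (c * m / h) - c) + l * h' + yq"
        using h by (simp add: u h'_def c_def field_simps)
      also have "c * m * m / h + 2 * l * (c * m / h) - c = c / h * (m * m + 2 * l * m - h)"
        using h by (simp add: field_simps)
      also have "\<dots> = - (c ^ 2) * m / h ^ 2" unfolding h' h'_def by (simp add: power2_eq_square)
      finally show ?thesis unfolding pt_def h'_def m_def using h
        by (simp add: power2_eq_square power3_eq_cube field_simps)
    qed
    obtain x y where Pxy: "P = Aff x y" using False by (cases P) auto
    define h u where "h = x - xq" and "u = y - (l * x + n)"
    have Ppt: "P = pt h u" using * by (simp add: Pxy pt_def h_def u_def algebra_simps)
    have rel: "u * (u + 2 * l * h + c) = h ^ 3"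
    proof -
      have "u + 2 * l * h + c = y + (l * x + n)" by (simp add: u_def h_def c_def * algebra_simps)
      then have "u * (u + 2 * l * h + c) = (y - (l * x + n)) * (y + (l * x + n))" by (simp only: u_def)
      also have "\<dots> = y ^ 2 - (l * x + n) ^ 2" by (simp add: algebra_simps power2_eq_square)
      also have "\<dots> = x ^ 3 + a * x + b - (l ^ 2 * x ^ 2 + 2 * l * n * x + n ^ 2)"
        using P by (simp add: Pxy algebra_simps power2_eq_square)
      also have "\<dots> = x ^ 3 - l ^ 2 * x ^ 2 + (a - 2 * l * n) * x - (n ^ 2 - b)"
        by (simp add: algebra_simps)
      also have "\<dots> = h ^ 3" unfolding *(2-4)[symmetric]
        by (simp add: h_def algebra_simps power2_eq_square power3_eq_cube)
      finally show ?thesis .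
    qed
    have h0: "h \<noteq> 0"
    proof
      assume "h = 0"
      then have "x = xq" by (simp add: h_def)
      then have "y ^ 2 = yq ^ 2" using P Q by (simp add: Pxy Qeq)
      then show False using False \<open>x = xq\<close> by (auto simp: Pxy Qeq power2_eq_iff)
    qed
    have u0: "u \<noteq> 0" using rel h0 by auto
    \<comment> \<open>The images of (h, u) under one and two translations, the second pair in
      simplified form.\<close>
    define h1 u1 where "h1 = - c * u / h ^ 2" and "u1 = - (c ^ 2) * u / h ^ 3"
    define h2 u2 where "h2 = c * h / u" and "u2 = - c * h ^ 3 / u ^ 2"
    have nz1: "h1 \<noteq> 0" and nz2: "h2 \<noteq> 0" using c0 u0 h0 by (auto simp: h1_def h2_def)
    have rel1: "u1 * (u1 + 2 * l * h1 + c) = h1 ^ 3"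
    proof -
      have "u1 * (u1 + 2 * l * h1 + c) = - (c ^ 3 * u / h ^ 6) * (h ^ 3 - u * (u + 2 * l * h + c)) + h1 ^ 3 * ((u + 2 * l * h + c - u - 2 * l * h) / c)"
        using h0 u0 c0 by (simp add: h1_def u1_def field_simps eval_nat_numeral)
      then show ?thesis using rel c0 by simp
    qed
    have s1: "- c * u1 / h1 ^ 2 = h2" "- (c ^ 2) * u1 / h1 ^ 3 = u2"
      using h0 u0 c0 by (simp_all add: h1_def u1_def h2_def u2_def field_simps eval_nat_numeral)
    have rel2: "u2 * (u2 + 2 * l * h2 + c) = h2 ^ 3"
    proof -
      have "u2 * (u2 + 2 * l * h2 + c) = c ^ 2 * h ^ 3 / u ^ 4 * (h ^ 3 - u * (u + 2 * l * h + c)) + h2 ^ 3"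
        using h0 u0 c0 by (simp add: h2_def u2_def field_simps eval_nat_numeral)
      then show ?thesis using rel by simp
    qed
    have s2: "- c * u2 / h2 ^ 2 = h" "- (c ^ 2) * u2 / h2 ^ 3 = u"
      using h0 u0 c0 by (simp_all add: h2_def u2_def field_simps eval_nat_numeral)
    show ?thesis
      unfolding Ppt step[OF h0 rel] h1_def[symmetric] u1_def[symmetric] step[OF nz1 rel1] s1
        step[OF nz2 rel2] s2 ..
  qed
qed

text \<open>The orbit of a point has as many elements as the least period, a multiple of p. Removing
  one orbit leaves a smaller set to which the same hypotheses apply.\<close>

lemma prime_period_dvd_card:
  fixes T :: "'s \<Rightarrow> 's"
  assumes "finite S" "inj_on T S" "T ` S \<subseteq> S"
    and per: "\<And>P n. P \<in> S \<Longrightarrow> n > 0 \<Longrightarrow> (T ^^ n) P = P \<Longrightarrow> p dvd n"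
  shows "p dvd card S"
  using assms
proof (induction "card S" arbitrary: S rule: less_induct)
  case less
  show ?case
  proof (cases "S = {}")
    case True then show ?thesis by simp
  next
    case False
    then obtain P where P: "P \<in> S" by blast
    have inS: "(T ^^ n) P \<in> S" for n using P less.prems(3) by (induction n) auto
    have cancel: "\<exists>k\<le>j. (T ^^ k) P = P \<and> k = j - i" if "i \<le> j" "(T ^^ i) P = (T ^^ j) P" for i j
      using that
    proof (induction i arbitrary: j)
      case (Suc i)
      then obtain j' where j': "j = Suc j'" "i \<le> j'" by (cases j) auto
      then have "T ((T ^^ i) P) = T ((T ^^ j') P)" using Suc.prems by simp
      then have "(T ^^ i) P = (T ^^ j') P" using less.prems(2) inS by (meson inj_onD)
      from Suc.IH[OF j'(2) this] show ?case using j' by auto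
    qed auto
    have "\<exists>n>0. (T ^^ n) P = P"
    proof -
      have "\<not> inj_on (\<lambda>n. (T ^^ n) P) (UNIV :: nat set)"
      proof
        assume "inj_on (\<lambda>n. (T ^^ n) P) (UNIV :: nat set)"
        then have "infinite ((\<lambda>n. (T ^^ n) P) ` UNIV)" using finite_imageD infinite_UNIV_nat by blast
        then show False using inS less.prems(1) by (meson finite_subset image_subsetI)
      qed
      then obtain i j where "(T ^^ i) P = (T ^^ j) P" "i < j" by (auto simp: inj_on_def) (metis linorder_neqE_nat)
      then show ?thesis using cancel[of i j] by (metis less_imp_le_nat zero_less_diff)
    qed
    define n where "n = (LEAST n. n > 0 \<and> (T ^^ n) P = P)"
    have n: "n > 0" "(T ^^ n) P = P"
      using LeastI_ex[of "\<lambda>n. n > 0 \<and> (T ^^ n) P = P"] \<open>\<exists>n>0. (T ^^ n) P = P\<close> by (auto simp: n_def)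
    have nmin: "k \<ge> n" if "k > 0" "(T ^^ k) P = P" for k
      unfolding n_def using that by (intro Least_le) auto
    define Ob where "Ob = (\<lambda>i. (T ^^ i) P) ` {..<n}"
    have "inj_on (\<lambda>i. (T ^^ i) P) {..<n}"
    proof (rule linorder_inj_onI)
      fix i j assume ij: "i < j" "i \<in> {..<n}" "j \<in> {..<n}"
      show "(T ^^ i) P \<noteq> (T ^^ j) P"
      proof
        assume "(T ^^ i) P = (T ^^ j) P"
        then have "(T ^^ (j - i)) P = P" using cancel[of i j] ij by auto
        then show False using nmin[of "j - i"] ij by auto
      qed
    qed auto
    then have cardO: "card Ob = n" by (simp add: Ob_def card_image)
    have OS: "Ob \<subseteq> S" using inS by (auto simp: Ob_def)
    have TO: "T ` Ob = Ob"
    proof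
      show "T ` Ob \<subseteq> Ob"
      proof
        fix R assume "R \<in> T ` Ob"
        then obtain i where i: "i < n" "R = (T ^^ Suc i) P" by (auto simp: Ob_def)
        show "R \<in> Ob"
        proof (cases "Suc i = n")
          case True then have "R = (T ^^ 0) P" using i n by simp
          then show ?thesis using n unfolding Ob_def by blast
        next
          case False then show ?thesis using i unfolding Ob_def by (metis Suc_lessI imageI lessThan_iff)
        qed
      qed
      then show "Ob \<subseteq> T ` Ob"
        by (metis OS card_image endo_inj_surj finite_subset inj_on_subset less.prems(1,2) subset_refl)
    qed
    have "p dvd card (S - Ob)"
    proof (rule less.hyps)
      show "card (S - Ob) < card S"
        using cardO n OS less.prems(1) by (metis card_Diff_subset card_gt_0_iff diff_less finite_subset False)
      show "T ` (S - Ob) \<subseteq> S - Ob"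
      proof
        fix R assume "R \<in> T ` (S - Ob)"
        then obtain R' where R': "R' \<in> S" "R' \<notin> Ob" "R = T R'" by blast
        have "R \<notin> Ob"
        proof
          assume "R \<in> Ob"
          then obtain R'' where "R'' \<in> Ob" "T R' = T R''" using TO R' by (metis imageE)
          then show False using R' OS less.prems(2) by (metis inj_onD subsetD)
        qed
        then show "R \<in> S - Ob" using R' less.prems(3) by blast
      qed
    qed (use less.prems in \<open>auto simp: inj_on_def\<close>)
    moreover have "p dvd card Ob" using cardO less.prems(4)[OF P] n by simp
    moreover have "card S = card Ob + card (S - Ob)"
      using OS less.prems(1) by (metis card_Diff_subset card_mono finite_subset le_add_diff_inverse)
    ultimately show ?thesis by simp
  qed
qed

section \<open>Valuation subrings\<close>

locale valuation_subring =
  fixes V :: "'c::field set"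
  assumes one_mem: "1 \<in> V"
    and diff_mem: "x \<in> V \<Longrightarrow> y \<in> V \<Longrightarrow> x - y \<in> V"
    and mult_mem: "x \<in> V \<Longrightarrow> y \<in> V \<Longrightarrow> x * y \<in> V"
    and inverse_mem: "x \<notin> V \<Longrightarrow> inverse x \<in> V"
begin

definition M :: "'c set" where "M = {x \<in> V. x = 0 \<or> inverse x \<notin> V}"

lemma zero_mem: "0 \<in> V" using diff_mem[OF one_mem one_mem] by simp
lemma uminus_mem: "x \<in> V \<Longrightarrow> - x \<in> V" using diff_mem[OF zero_mem] by simp
lemma add_mem: "x \<in> V \<Longrightarrow> y \<in> V \<Longrightarrow> x + y \<in> V" using diff_mem[of x "- y"] uminus_mem by simp
lemma power_mem: "x \<in> V \<Longrightarrow> x ^ n \<in> V" by (induction n) (auto simp: one_mem mult_mem)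
lemma of_nat_mem: "of_nat n \<in> V" by (induction n) (auto simp: zero_mem one_mem add_mem)
lemma numeral_mem: "numeral k \<in> V" using of_nat_mem[of "numeral k"] by simp

lemmas mem_intros = zero_mem one_mem numeral_mem of_nat_mem uminus_mem add_mem diff_mem mult_mem power_mem

lemma M_mem: "x \<in> M \<Longrightarrow> x \<in> V" by (simp add: M_def)
lemma zero_M: "0 \<in> M" by (simp add: M_def zero_mem)
lemma one_not_M: "1 \<notin> M" by (simp add: M_def one_mem)

lemma unit_inverse: "x \<in> V \<Longrightarrow> x \<notin> M \<Longrightarrow> inverse x \<in> V" by (simp add: M_def)
lemma unit_nonzero: "x \<notin> M \<Longrightarrow> x \<noteq> 0" using zero_M by blast
lemma inverse_M: "x \<notin> V \<Longrightarrow> inverse x \<in> M"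
  using inverse_mem zero_mem by (auto simp: M_def)

lemma not_mem_iff: "x \<noteq> 0 \<Longrightarrow> x \<notin> V \<longleftrightarrow> inverse x \<in> M"
  using inverse_M by (auto simp: M_def)

lemma mult_M: "x \<in> V \<Longrightarrow> y \<in> M \<Longrightarrow> x * y \<in> M"
proof -
  assume x: "x \<in> V" and y: "y \<in> M"
  have "inverse y \<in> V" if "inverse (x * y) \<in> V" "x * y \<noteq> 0"
    using mult_mem[OF x that(1)] that(2) by (simp add: field_simps)
  then show ?thesis using x y by (auto simp: M_def mult_mem)
qed

lemma mult_M': "x \<in> M \<Longrightarrow> y \<in> V \<Longrightarrow> x * y \<in> M"
  using mult_M[of y x] by (simp add: mult.commute)

lemma uminus_M: "x \<in> M \<Longrightarrow> - x \<in> M" using mult_M[of "- 1" x] by (simp add: uminus_mem one_mem)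

lemma add_M: assumes "x \<in> M" "y \<in> M" shows "x + y \<in> M"
proof (cases "x = 0 \<or> y = 0")
  case True then show ?thesis using assms by auto
next
  case False
  have gen: "x + y \<in> M" if "x / y \<in> V" "y \<in> M" "y \<noteq> 0" for x y
  proof -
    have "(x / y + 1) * y \<in> M" using that by (intro mult_M add_mem one_mem)
    moreover have "(x / y + 1) * y = x + y" using that by (simp add: distrib_right)
    ultimately show ?thesis by simp
  qed
  show ?thesis
  proof (cases "x / y \<in> V")
    case True then show ?thesis using gen assms False by blast
  next
    case n: False
    then have "y / x \<in> V" using inverse_mem[OF n] by simp
    then show ?thesis using gen[of y x] assms False by (simp add: add.commute)
  qed
qed

lemma diff_M: "x \<in> M \<Longrightarrow> y \<in> M \<Longrightarrow> x - y \<in> M" using add_M[of x "- y"] uminus_M by simp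

lemma power_M: "x \<in> M \<Longrightarrow> n > 0 \<Longrightarrow> x ^ n \<in> M"
  by (induction n) (auto simp: M_mem mult_M' power_mem)

lemma M_prime: assumes "x * y \<in> M" "x \<in> V" "x \<notin> M" "y \<in> V" shows "y \<in> M"
proof -
  have "inverse x * (x * y) \<in> M" by (rule mult_M[OF unit_inverse[OF assms(2,3)] assms(1)])
  moreover have "inverse x * (x * y) = y" using unit_nonzero[OF assms(3)] by simp
  ultimately show ?thesis by simp
qed

lemma M_power_cancel: assumes "x ^ n \<in> M" "x \<in> V" shows "x \<in> M"
  using assms
proof (induction n)
  case 0 then show ?case using one_not_M by simp
next
  case (Suc n) then show ?case using M_prime[of x "x ^ n"] by (auto simp: power_mem)
qed

lemma mem_power_cancel: assumes "x ^ n \<in> V" "n > 0" shows "x \<in> V"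
proof (rule ccontr)
  assume "x \<notin> V"
  then have "inverse x ^ n \<in> M" using inverse_M power_M assms(2) by blast
  then have "inverse x ^ n * x ^ n \<in> M" using assms(1) by (rule mult_M')
  moreover have "inverse x ^ n * x ^ n = 1"
    using \<open>x \<notin> V\<close> zero_mem by (metis left_inverse power_mult_distrib power_one)
  ultimately show False using one_not_M by simp
qed

lemma unit_add_M: "x \<in> M \<Longrightarrow> y \<notin> M \<Longrightarrow> y + x \<notin> M"
  using diff_M[of "y + x" x] by auto

lemma unit_mult: "x \<in> V \<Longrightarrow> y \<in> V \<Longrightarrow> x \<notin> M \<Longrightarrow> y \<notin> M \<Longrightarrow> x * y \<notin> M"
  using M_prime by blast

end

text \<open>Chevalley's extension theorem. Zorn's lemma gives a subring V maximal among those that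
  contain A but not 1/t. If neither x nor 1/x lay in V, then 1/t would lie in V[x] and in V[1/x],
  and of two shortest expressions the longer could be shortened by means of the other.\<close>

lemma extend_to_valuation_subring:
  fixes A :: "'c::field set"
  assumes sub: "1 \<in> A" "\<And>x y. x \<in> A \<Longrightarrow> y \<in> A \<Longrightarrow> x - y \<in> A" "\<And>x y. x \<in> A \<Longrightarrow> y \<in> A \<Longrightarrow> x * y \<in> A"
    and t: "t \<in> A" "inverse t \<notin> A"
  shows "\<exists>V. valuation_subring V \<and> A \<subseteq> V \<and> inverse t \<notin> V"
proof -
  define subr where "subr S \<longleftrightarrow> 1 \<in> S \<and> (\<forall>x\<in>S. \<forall>y\<in>S. x - y \<in> S \<and> x * y \<in> S)" for S :: "'c set"
  define \<A> where "\<A> = {S. subr S \<and> A \<subseteq> S \<and> inverse t \<notin> S}"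
  have "A \<in> \<A>" using assms by (auto simp: \<A>_def subr_def)
  have "\<exists>N\<in>\<A>. \<forall>W\<in>\<A>. N \<subseteq> W \<longrightarrow> W = N"
  proof (rule subset_Zorn_nonempty)
    show "\<A> \<noteq> {}" using \<open>A \<in> \<A>\<close> by blast
    fix \<C> assume C: "\<C> \<noteq> {}" "subset.chain \<A> \<C>"
    have CA: "S \<in> \<A>" if "S \<in> \<C>" for S using C that by (auto simp: subset.chain_def)
    have "subr (\<Union>\<C>)"
      unfolding subr_def
    proof (intro conjI ballI)
      show "1 \<in> \<Union>\<C>" using C CA by (auto simp: \<A>_def subr_def)
      fix x y assume "x \<in> \<Union>\<C>" "y \<in> \<Union>\<C>"
      then obtain S1 S2 where S: "S1 \<in> \<C>" "S2 \<in> \<C>" "x \<in> S1" "y \<in> S2" by blast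
      then have "S1 \<subseteq> S2 \<or> S2 \<subseteq> S1" using C(2) by (auto simp: subset.chain_def)
      then obtain S where "S \<in> \<C>" "x \<in> S" "y \<in> S" using S by blast
      moreover have "subr S" using CA[OF \<open>S \<in> \<C>\<close>] by (simp add: \<A>_def)
      ultimately have "x - y \<in> S \<and> x * y \<in> S" by (simp add: subr_def)
      then show "x - y \<in> \<Union>\<C>" "x * y \<in> \<Union>\<C>" using \<open>S \<in> \<C>\<close> by blast+
    qed
    then show "\<Union>\<C> \<in> \<A>" using C CA by (auto simp: \<A>_def)
  qed
  then obtain V where V: "V \<in> \<A>" and max: "\<And>W. W \<in> \<A> \<Longrightarrow> V \<subseteq> W \<Longrightarrow> W = V" by blast
  have sr: "subr V" and AV: "A \<subseteq> V" and tV: "inverse t \<notin> V" using V by (auto simp: \<A>_def)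
  have V1: "1 \<in> V" and Vd: "x \<in> V \<Longrightarrow> y \<in> V \<Longrightarrow> x - y \<in> V" and Vm: "x \<in> V \<Longrightarrow> y \<in> V \<Longrightarrow> x * y \<in> V" for x y
    using sr by (auto simp: subr_def)
  have V0: "0 \<in> V" using Vd[OF V1 V1] by simp
  have Va: "x + y \<in> V" if "x \<in> V" "y \<in> V" for x y using Vd[OF that(1) Vd[OF V0 that(2)]] by simp
  have Vs: "(\<And>i. i \<in> I \<Longrightarrow> f i \<in> V) \<Longrightarrow> sum f I \<in> V" for f and I :: "nat set"
    by (induction I rule: infinite_finite_induct) (auto simp: V0 Va)
  have Vp: "x ^ n \<in> V" if "x \<in> V" for x n by (induction n) (auto simp: V1 Vm that)
  have t0: "t \<noteq> 0" using tV V0 by auto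
  have tV': "t \<in> V" using t AV by blast
  have ext: "\<exists>f n. (\<forall>i. f i \<in> V) \<and> 1 = t * (\<Sum>i\<le>n. f i * x ^ i)" if x: "x \<notin> V" for x
  proof -
    define Vx where "Vx = {poly p x | p. \<forall>i. coeff p i \<in> V}"
    have "subr Vx"
      unfolding subr_def
    proof (intro conjI ballI)
      show "1 \<in> Vx" unfolding Vx_def by (rule CollectI, rule exI[of _ 1]) (auto simp: V1 V0 coeff_1)
      fix u w assume "u \<in> Vx" "w \<in> Vx"
      then obtain p r where pr: "u = poly p x" "w = poly r x" "\<forall>i. coeff p i \<in> V" "\<forall>i. coeff r i \<in> V"
        by (auto simp: Vx_def)
      show "u - w \<in> Vx" unfolding Vx_def using pr by (intro CollectI exI[of _ "p - r"]) (auto simp: Vd)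
      show "u * w \<in> Vx" unfolding Vx_def using pr
        by (intro CollectI exI[of _ "p * r"]) (auto simp: coeff_mult intro!: Vs Vm)
    qed
    moreover have VVx: "V \<subseteq> Vx"
    proof
      fix u assume "u \<in> V"
      then show "u \<in> Vx" unfolding Vx_def
        by (intro CollectI exI[of _ "[:u:]"]) (auto simp: coeff_pCons V0 split: nat.splits)
    qed
    moreover have "x \<in> Vx" unfolding Vx_def
      by (intro CollectI exI[of _ "[:0, 1:]"]) (auto simp: coeff_pCons V0 V1 split: nat.splits)
    ultimately have "inverse t \<in> Vx" using max[of Vx] x AV by (auto simp: \<A>_def)
    then obtain p where "inverse t = poly p x" "\<forall>i. coeff p i \<in> V" by (auto simp: Vx_def)
    then have "1 = t * (\<Sum>i\<le>degree p. coeff p i * x ^ i) \<and> (\<forall>i. coeff p i \<in> V)"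
      using t0 by (simp add: poly_altdef[symmetric] field_simps)
    then show ?thesis by blast
  qed
  \<comment> \<open>Otherwise 1/t is a polynomial in the inverse of 1 - t u. Multiplication by a
    power of 1 - t u gives 1 - t g = t h with g, h in V, so 1/t = g + h.\<close>
  have unit: "inverse (1 - t * u) \<in> V \<and> 1 - t * u \<noteq> 0" if u: "u \<in> V" for u
  proof
    show n0: "1 - t * u \<noteq> 0"
    proof
      assume "1 - t * u = 0"
      then have "inverse t = u" using t0 by (simp add: field_simps)
      then show False using u tV by simp
    qed
    show "inverse (1 - t * u) \<in> V"
    proof (rule ccontr)
      assume "inverse (1 - t * u) \<notin> V"
      from ext[OF this] obtain f n where f: "\<forall>i. f i \<in> V"
        "1 = t * (\<Sum>i\<le>n. f i * inverse (1 - t * u) ^ i)" by blast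
      have w: "1 - t * u \<in> V" using V1 u tV' Vm Vd by blast
      have "(1 - t * u) ^ n = t * (\<Sum>i\<le>n. f i * (1 - t * u) ^ (n - i))"
      proof -
        have "(1 - t * u) ^ n = (1 - t * u) ^ n * (t * (\<Sum>i\<le>n. f i * inverse (1 - t * u) ^ i))"
          using f(2) by simp
        also have "\<dots> = t * (\<Sum>i\<le>n. f i * ((1 - t * u) ^ n * inverse (1 - t * u) ^ i))"
          by (simp add: sum_distrib_left mult_ac)
        also have "(\<Sum>i\<le>n. f i * ((1 - t * u) ^ n * inverse (1 - t * u) ^ i)) = (\<Sum>i\<le>n. f i * (1 - t * u) ^ (n - i))"
          using n0 by (intro sum.cong) (auto simp: power_diff field_simps)
        finally show ?thesis .
      qed
      moreover have "(\<Sum>i\<le>n. f i * (1 - t * u) ^ (n - i)) \<in> V" by (intro Vs Vm Vp) (use f w in auto)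
      moreover have "\<exists>g\<in>V. (1 - t * u) ^ k = 1 - t * g" for k
      proof (induction k)
        case 0 show ?case using V0 by (intro bexI[of _ 0]) auto
      next
        case (Suc k)
        then obtain g where "g \<in> V" and g: "(1 - t * u) ^ k = 1 - t * g" by blast
        have "(1 - t * u) ^ Suc k = 1 - t * (u + g - t * u * g)"
          by (simp only: power_Suc g) (simp add: algebra_simps)
        moreover have "u + g - t * u * g \<in> V" using \<open>g \<in> V\<close> u tV' by (auto intro!: Va Vd Vm)
        ultimately show ?case by blast
      qed
      ultimately obtain g h where "g \<in> V" "h \<in> V" "1 - t * g = t * h" by metis
      then have "inverse t = g + h" using t0 by (simp add: field_simps)
      then show False using Va \<open>g \<in> V\<close> \<open>h \<in> V\<close> tV by simp
    qed
  qed
  \<comment> \<open>The relation in 1/x has its constant term absorbed in the unit 1 - t g 0, so it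
    expresses x^n by lower powers; inserting this for the top term shortens the relation in x. It is
    stated for arbitrary x because it is applied to x and to its inverse.\<close>
  have red: False if f: "\<forall>i. f i \<in> V" "1 = t * (\<Sum>i\<le>n. f i * x ^ i)"
    and g: "\<forall>i. g i \<in> V" "1 = t * (\<Sum>i\<le>m. g i * inverse x ^ i)" and "m \<le> n" and x0: "x \<noteq> 0"
    and least: "\<And>f k. (\<forall>i. f i \<in> V) \<Longrightarrow> 1 = t * (\<Sum>i\<le>k. f i * x ^ i) \<Longrightarrow> n \<le> k" for x f g n m
  proof (cases n)
    case 0
    then have "inverse t = f 0" using f(2) t0 by (simp add: field_simps)
    then show False using f(1) tV by simp
  next
    case (Suc k)
    define u where "u = 1 - t * g 0"
    have u: "inverse u \<in> V" "u \<noteq> 0" using unit g(1) by (auto simp: u_def)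
    define h where "h j = (if j \<le> m then g j else 0)" for j
    have hV: "h j \<in> V" for j using g(1) V0 by (simp add: h_def)
    have "(\<Sum>i\<le>m. g i * inverse x ^ i) = (\<Sum>i\<le>n. h i * inverse x ^ i)"
      by (rule sum.mono_neutral_cong_left) (use \<open>m \<le> n\<close> in \<open>auto simp: h_def\<close>)
    also have "\<dots> = g 0 + (\<Sum>i<n. h (Suc i) * inverse x ^ Suc i)"
      unfolding Suc by (subst sum.atMost_Suc_shift) (simp add: h_def lessThan_Suc_atMost)
    finally have "u = t * (\<Sum>i<n. h (Suc i) * inverse x ^ Suc i)"
      using g(2) by (simp add: u_def algebra_simps)
    then have "u * x ^ n = t * ((\<Sum>i<n. h (Suc i) * inverse x ^ Suc i) * x ^ n)"
      by (simp only: mult.assoc)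
    also have "(\<Sum>i<n. h (Suc i) * inverse x ^ Suc i) * x ^ n = (\<Sum>i<n. h (Suc i) * (inverse x ^ Suc i * x ^ n))"
      by (simp only: sum_distrib_right mult.assoc)
    also have "(\<Sum>i<n. h (Suc i) * (inverse x ^ Suc i * x ^ n)) = (\<Sum>i<n. h (Suc i) * x ^ (n - Suc i))"
      using x0 by (intro sum.cong refl) (auto simp: power_diff field_simps simp del: power_Suc)
    also have "\<dots> = (\<Sum>i<n. h (n - i) * x ^ i)"
      by (subst sum.nat_diff_reindex[symmetric]) (auto intro!: sum.cong simp: Suc_diff_Suc)
    finally have xn: "x ^ n = t * inverse u * (\<Sum>i<n. h (n - i) * x ^ i)"
      using u by (simp add: field_simps)
    have "1 = t * ((\<Sum>i<n. f i * x ^ i) + f n * x ^ n)"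
      using f(2) by (simp add: lessThan_Suc_atMost[symmetric])
    also have "(\<Sum>i<n. f i * x ^ i) + f n * x ^ n = (\<Sum>i<n. (f i + f n * t * inverse u * h (n - i)) * x ^ i)"
      unfolding xn by (simp add: sum.distrib sum_distrib_left algebra_simps)
    finally have "1 = t * (\<Sum>i\<le>k. (f i + f n * t * inverse u * h (n - i)) * x ^ i)"
      by (simp add: Suc lessThan_Suc_atMost)
    moreover have "\<forall>i. f i + f n * t * inverse u * h (n - i) \<in> V"
      using f(1) hV u(1) tV' by (auto intro!: Va Vm)
    ultimately have "n \<le> k" using least[of "\<lambda>i. f i + f n * t * inverse u * h (n - i)" k] by blast
    then show False using Suc by simp
  qed
  have "inverse x \<in> V" if x: "x \<notin> V" for x
  proof (rule ccontr)
    assume x': "inverse x \<notin> V"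
    have x0: "x \<noteq> 0" using x V0 by auto
    define P where "P y n \<longleftrightarrow> (\<exists>f. (\<forall>i. f i \<in> V) \<and> 1 = t * (\<Sum>i\<le>n. f i * y ^ i))" for y n
    define n m where "n = (LEAST k. P x k)" and "m = (LEAST k. P (inverse x) k)"
    have n: "P x n" unfolding n_def using ext[OF x] by (intro LeastI_ex[of "P x"]) (auto simp: P_def)
    have m: "P (inverse x) m" unfolding m_def using ext[OF x'] by (intro LeastI_ex[of "P (inverse x)"]) (auto simp: P_def)
    have ln: "P x k \<Longrightarrow> n \<le> k" and lm: "P (inverse x) k \<Longrightarrow> m \<le> k" for k
      unfolding n_def m_def by (simp_all add: Least_le)
    obtain f where f: "\<forall>i. f i \<in> V" "1 = t * (\<Sum>i\<le>n. f i * x ^ i)" using n by (auto simp: P_def)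
    obtain g where g: "\<forall>i. g i \<in> V" "1 = t * (\<Sum>i\<le>m. g i * inverse x ^ i)" using m by (auto simp: P_def)
    have ln': "n \<le> k" if "\<forall>i. f i \<in> V" "1 = t * (\<Sum>i\<le>k. f i * x ^ i)" for f k
      using that ln[of k] unfolding P_def by blast
    have lm': "m \<le> k" if "\<forall>i. f i \<in> V" "1 = t * (\<Sum>i\<le>k. f i * inverse x ^ i)" for f k
      using that lm[of k] unfolding P_def by blast
    show False
    proof (cases "m \<le> n")
      case True
      show False using red[OF f g True x0 ln'] .
    next
      case False
      then have "n \<le> m" "inverse x \<noteq> 0" using x0 by simp_all
      from red[OF g _ _ this lm'] f show False by simp
    qed
  qed
  then have "valuation_subring V" using V1 Vd Vm by unfold_locales auto
  then show ?thesis using AV tV by blast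
qed

section \<open>Torsion points over valuation subrings\<close>

text \<open>Translation by a point of order 2 is an involution of S without fixed points, so all its
  periods are even.\<close>

lemma two_torsion_even_card:
  fixes a b :: "'c::field"
  assumes two: "(2::'c) \<noteq> 0" and disc: "4 * a ^ 3 + 27 * b ^ 2 \<noteq> 0"
    and S: "finite S" "\<And>P. P \<in> S \<Longrightarrow> on_curve a b P" "\<And>P Q. P \<in> S \<Longrightarrow> Q \<in> S \<Longrightarrow> padd a P Q \<in> S"
    and Q: "Aff x 0 \<in> S"
  shows "even (card S)"
proof (rule prime_period_dvd_card[OF S(1), of "\<lambda>P. padd a P (Aff x 0)"])
  have inv: "padd a (padd a P (Aff x 0)) (Aff x 0) = P" if "P \<in> S" for P
    using padd_cancel[OF two disc S(2)[OF that] S(2)[OF Q]] by simp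
  show "inj_on (\<lambda>P. padd a P (Aff x 0)) S"
    by (rule inj_on_inverseI[where g = "\<lambda>P. padd a P (Aff x 0)"]) (rule inv)
  show "(\<lambda>P. padd a P (Aff x 0)) ` S \<subseteq> S" using S(3) Q by auto
  fix P n assume P: "P \<in> S" and per: "((\<lambda>P. padd a P (Aff x 0)) ^^ n) P = P"
  have ev: "((\<lambda>P. padd a P (Aff x 0)) ^^ (2 * k)) P = P" for k
    by (induction k) (simp_all add: inv P)
  show "even n"
  proof (rule ccontr)
    assume "odd n"
    then obtain k where "n = Suc (2 * k)" by (metis oddE Suc_eq_plus1)
    then have "padd a P (Aff x 0) = P" using per ev[of k] by simp
    then show False using padd_eq_left_imp_Infty[OF two disc S(2)[OF P] S(2)[OF Q]] by simp
  qed
qed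

text \<open>Translation by a flex has order 3 and no fixed points on S, so all its periods are
  multiples of 3.\<close>

lemma flex_3_dvd_card:
  fixes a b :: "'c::field"
  assumes two: "(2::'c) \<noteq> 0" and disc: "4 * a ^ 3 + 27 * b ^ 2 \<noteq> 0"
    and S: "finite S" "\<And>P. P \<in> S \<Longrightarrow> on_curve a b P" "\<And>P Q. P \<in> S \<Longrightarrow> Q \<in> S \<Longrightarrow> padd a P Q \<in> S"
    and Q: "Aff x y \<in> S" and flex: "padd a (Aff x y) (Aff x y) = pneg (Aff x y)"
  shows "3 dvd card S"
proof (rule prime_period_dvd_card[OF S(1), of "\<lambda>P. padd a P (Aff x y)"])
  let ?T = "\<lambda>P. padd a P (Aff x y)"
  have T3: "?T (?T (?T P)) = P" if "P \<in> S" for P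
    using padd_flex_period_3[OF two disc S(2)[OF that] S(2)[OF Q] _ flex] by simp
  show "inj_on ?T S" by (rule inj_on_inverseI[of _ "\<lambda>P. ?T (?T P)"]) (use T3 in auto)
  show "?T ` S \<subseteq> S" using S(3) Q by auto
  fix P n assume P: "P \<in> S" and per: "(?T ^^ n) P = P"
  have no: "?T P \<noteq> P" using padd_eq_left_imp_Infty[OF two disc S(2)[OF P] S(2)[OF Q]] by auto
  have it: "(?T ^^ (3 * k)) P = P" for k
  proof (induction k)
    case (Suc k)
    have "3 * Suc k = Suc (Suc (Suc (3 * k)))" by simp
    then show ?case by (simp only: funpow.simps comp_def Suc T3[OF P])
  qed simp
  have "(?T ^^ (n mod 3 + 3 * (n div 3))) P = P" using per unfolding mod_mult_div_eq .
  then have r: "(?T ^^ (n mod 3)) P = P" by (simp only: funpow_add comp_def it)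
  show "3 dvd n"
  proof (rule ccontr)
    assume "\<not> 3 dvd n"
    then consider "n mod 3 = 1" | "n mod 3 = 2" by (metis mod_eq_0_iff_dvd mod_less_divisor less_Suc_eq
        numeral_3_eq_3 less_one One_nat_def Suc_1 zero_less_Suc not_less_zero)
    then show False
    proof cases
      case 1
      have "(?T ^^ 1) P = P" using r unfolding 1 .
      then show ?thesis using no by (simp only: funpow.simps One_nat_def comp_def id_apply)
    next
      case 2
      have "(?T ^^ 2) P = P" using r unfolding 2 .
      then have "?T (?T P) = P" by (simp only: Suc_1[symmetric] One_nat_def funpow.simps comp_def id_apply)
      then have "?T P = P" using T3[OF P] by simp
      then show ?thesis using no by blast
    qed
  qed
qed

context valuation_subring
begin

lemma one_plus_M: "x \<in> M \<Longrightarrow> 1 + x \<notin> M" and one_minus_M: "x \<in> M \<Longrightarrow> 1 - x \<notin> M"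
  using unit_add_M[OF _ one_not_M] uminus_M[of x] unit_add_M[OF _ one_not_M, of "- x"] by auto

text \<open>z is, up to sign, the usual parameter at the origin, and 1/x = z^2 e with a unit e. The
  equation for e is the curve equation divided by x^3; it replaces the power series of e in
  z.\<close>

lemma near_infinity_parameter:
  assumes ab: "a \<in> V" "b \<in> V" and P: "on_curve a b (Aff x y)" and x: "x \<notin> V"
  obtains z e where "z \<in> M" "z \<noteq> 0" "e \<in> V" "e \<notin> M" "e = 1 + a * z ^ 4 * e ^ 2 + b * z ^ 6 * e ^ 3"
    "x = 1 / (z ^ 2 * e)" "y = 1 / (z ^ 3 * e)" "x / y = z"
proof -
  define i where "i = inverse x"
  have x0: "x \<noteq> 0" using x zero_mem by auto
  have i: "i \<in> M" using inverse_M[OF x] by (simp add: i_def)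
  define e where "e = 1 + (a * i ^ 2 + b * i ^ 3)"
  have m: "a * i ^ 2 + b * i ^ 3 \<in> M" by (intro add_M mult_M power_M ab i) simp_all
  have eV: "e \<in> V" unfolding e_def by (intro add_mem one_mem M_mem[OF m])
  have eM: "e \<notin> M" unfolding e_def by (rule one_plus_M[OF m])
  have e0: "e \<noteq> 0" using unit_nonzero[OF eM] .
  have y2: "y ^ 2 = x ^ 3 * e"
    using P x0 by (simp add: e_def i_def field_simps power2_eq_square power3_eq_cube)
  have y0: "y \<noteq> 0" using y2 x0 e0 by auto
  define z where "z = x / y"
  have z2: "z ^ 2 = i * inverse e"
    using x0 e0 by (simp add: z_def i_def power_divide y2) (simp add: field_simps power2_eq_square power3_eq_cube)
  have z2M: "z ^ 2 \<in> M" unfolding z2 by (rule mult_M'[OF i unit_inverse[OF eV eM]])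
  have zV: "z \<in> V" by (rule mem_power_cancel[OF M_mem[OF z2M]]) simp
  have zM: "z \<in> M" by (rule M_power_cancel[OF z2M zV])
  have z0: "z \<noteq> 0" using x0 y0 by (simp add: z_def)
  have iz: "i = z ^ 2 * e" using z2 e0 by simp
  have r: "e = 1 + a * z ^ 4 * e ^ 2 + b * z ^ 6 * e ^ 3"
  proof -
    have "e = 1 + (a * (z ^ 2 * e) ^ 2 + b * (z ^ 2 * e) ^ 3)" using e_def iz by simp
    then show ?thesis by (simp add: power_mult_distrib add.assoc mult.assoc flip: power_mult)
  qed
  have "x = 1 / (z ^ 2 * e)" using iz x0 by (metis i_def inverse_eq_divide inverse_inverse_eq)
  moreover have "y = 1 / (z ^ 3 * e)"
    using x0 y0 e0 y2 by (simp add: z_def power_divide field_simps) (simp add: power2_eq_square power3_eq_cube)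
  ultimately show ?thesis using that[of z e] zM z0 eV eM r z_def by metis
qed

text \<open>The first-order terms are the invariant vector field (2 y, 3 x^2 + a), negated because z
  = x/y is minus the usual parameter. The content is that the remainders are z^2 times elements of
  V.\<close>

lemma padd_near_infinity_integral:
  assumes ab: "a \<in> V" "b \<in> V" and xy: "x1 \<in> V" "y1 \<in> V"
    and z: "z \<in> M" "z \<noteq> 0" and e: "e \<in> V" "e = 1 + a * z ^ 4 * e ^ 2 + b * z ^ 6 * e ^ 3" "e \<notin> M"
  obtains h h' where "h \<in> V" "h' \<in> V"
    "padd a (Aff x1 y1) (Aff (1 / (z ^ 2 * e)) (1 / (z ^ 3 * e)))
     = Aff (x1 - 2 * y1 * z + z ^ 2 * h) (y1 - (3 * x1 ^ 2 + a) * z + z ^ 2 * h')"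
proof -
  have zV: "z \<in> V" using z M_mem by blast
  have e0: "e \<noteq> 0" using unit_nonzero e(3) by blast
  define D where "D = 1 - x1 * z ^ 2 * e"
  have "x1 * z ^ 2 * e \<in> M" by (intro mult_M' mult_M power_M xy z e) simp
  then have DM: "D \<notin> M" unfolding D_def by (rule one_minus_M)
  have DV: "D \<in> V" unfolding D_def by (intro mem_intros xy zV e)
  define J where "J = inverse D"
  have J: "J \<in> V" unfolding J_def by (rule unit_inverse[OF DV DM])
  have D0: "D \<noteq> 0" using unit_nonzero DM by blast
  have JD: "J * D = 1" using D0 by (simp add: J_def)
  define d where "d = a * z ^ 3 * e ^ 2 + b * z ^ 5 * e ^ 3"
  have dV: "d \<in> V" unfolding d_def by (intro mem_intros ab zV e)
  have ed: "e = 1 + z * d" using e(2) by (simp add: d_def algebra_simps eval_nat_numeral)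
  define c where "c = a * e + b * z ^ 2 * e ^ 2"
  have cV: "c \<in> V" unfolding c_def by (intro mem_intros ab zV e)
  have dc: "d = z ^ 3 * e * c" by (simp add: d_def c_def algebra_simps eval_nat_numeral)
  \<comment> \<open>The chord has slope 1/z + z k. As e - 1 is divisible by z^4, \<open>k\<close>
    equals x1 - y1 z up to z^2 times the integral \<open>h1\<close>.\<close>
  define k where "k = (x1 - y1 * z) * e * J"
  have kV: "k \<in> V" unfolding k_def by (intro mem_intros xy zV e J)
  define h1' where "h1' = (- (y1 * x1) + (x1 - y1 * z) * (x1 * d + z * e * c) + x1 ^ 3 * z * e) * J"
  have h1'V: "h1' \<in> V" unfolding h1'_def by (intro mem_intros xy zV e J dV cV)
  define h1 where "h1 = x1 ^ 2 + z * h1'"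
  have h1V: "h1 \<in> V" unfolding h1_def by (intro mem_intros xy zV h1'V)
  have h1D: "h1 * D = (x1 - y1 * z) * (z ^ 2 * e * c + x1 * e)"
  proof -
    have "h1 * D = x1 ^ 2 * D + z * (h1' * D)" by (simp add: h1_def algebra_simps)
    also have "h1' * D = - (y1 * x1) + (x1 - y1 * z) * (x1 * d + z * e * c) + x1 ^ 3 * z * e"
      using JD by (simp add: h1'_def mult.assoc)
    also have "x1 ^ 2 * D + z * (- (y1 * x1) + (x1 - y1 * z) * (x1 * d + z * e * c) + x1 ^ 3 * z * e)
      = (x1 - y1 * z) * (z ^ 2 * e * c + x1 * (1 + z * d))"
      by (simp add: D_def algebra_simps power2_eq_square power3_eq_cube)
    finally show ?thesis unfolding ed[symmetric] .
  qed
  have k: "k = (x1 - y1 * z) + z ^ 2 * h1"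
  proof -
    have "k * D = (x1 - y1 * z) * e" using JD by (simp add: k_def mult.assoc)
    also have "\<dots> = (x1 - y1 * z) * (1 + z * d)" using ed by simp
    also have "\<dots> = (x1 - y1 * z) * D + z ^ 2 * ((x1 - y1 * z) * (z ^ 2 * e * c + x1 * e))"
      unfolding dc by (simp add: D_def algebra_simps eval_nat_numeral)
    also have "\<dots> = ((x1 - y1 * z) + z ^ 2 * h1) * D"
      unfolding h1D[symmetric] by (simp only: distrib_right mult.assoc)
    finally show ?thesis using D0 by simp
  qed
  define h where "h = 2 * h1 + k ^ 2 + c"
  have hV: "h \<in> V" unfolding h_def by (intro mem_intros h1V kV cV)
  \<comment> \<open>The second-order term of the new first coordinate is 3 x1^2 + a up to a multiple
    of z. Multiplied by the slope, it yields the first-order term of the second coordinate.\<close>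
  define h2 where "h2 = 2 * h1' + 2 * x1 * (- y1 + z * h1) + z * (- y1 + z * h1) ^ 2 + a * d + b * z * e ^ 2"
  have h2V: "h2 \<in> V" unfolding h2_def by (intro mem_intros h1V h1'V xy zV ab dV e)
  have hh2: "h = (3 * x1 ^ 2 + a) + z * h2"
  proof -
    have "h = 2 * (x1 ^ 2 + z * h1') + (x1 + z * (- y1 + z * h1)) ^ 2 + (a * (1 + z * d) + b * z ^ 2 * e ^ 2)"
      unfolding h_def c_def k ed[symmetric] h1_def[symmetric] by (simp add: algebra_simps power2_eq_square)
    then show ?thesis by (simp add: h2_def algebra_simps power2_eq_square)
  qed
  define l where "l = (1 / (z ^ 3 * e) - y1) / (1 / (z ^ 2 * e) - x1)"
  have den: "1 / (z ^ 2 * e) - x1 = D / (z ^ 2 * e)"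
    using z e0 by (simp add: D_def field_simps)
  then have ne: "1 / (z ^ 2 * e) - x1 \<noteq> 0" using D0 z e0 by simp
  have zl: "z * l = 1 + z ^ 2 * k"
  proof -
    have "z * l = (1 - y1 * z ^ 3 * e) * J"
      unfolding l_def den J_def using z e0 D0 by (simp add: field_simps eval_nat_numeral)
    also have "1 - y1 * z ^ 3 * e = D + z ^ 2 * ((x1 - y1 * z) * e)"
      by (simp add: D_def algebra_simps eval_nat_numeral)
    finally show ?thesis using JD by (simp add: k_def algebra_simps)
  qed
  define x3 where "x3 = l ^ 2 - x1 - 1 / (z ^ 2 * e)"
  have "z ^ 2 * (e * x3) = z ^ 2 * (e * (x1 - 2 * y1 * z + z ^ 2 * h))"
  proof -
    have "z ^ 2 * (e * x3) = e * (z * l) ^ 2 - z ^ 2 * e * x1 - z ^ 2 * e * (1 / (z ^ 2 * e))"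
      by (simp add: x3_def algebra_simps power2_eq_square)
    also have "z ^ 2 * e * (1 / (z ^ 2 * e)) = 1" using z e0 by simp
    also have "e * (z * l) ^ 2 - z ^ 2 * e * x1 - 1 = z * d + z ^ 2 * e * (2 * k + z ^ 2 * k ^ 2 - x1)"
      unfolding zl using ed by (simp add: algebra_simps power2_eq_square)
    also have "z * d = z ^ 2 * e * (z ^ 2 * c)" by (simp add: dc algebra_simps eval_nat_numeral)
    also have "z ^ 2 * e * (z ^ 2 * c) + z ^ 2 * e * (2 * k + z ^ 2 * k ^ 2 - x1)
      = z ^ 2 * (e * (2 * k - x1 + z ^ 2 * (k ^ 2 + c)))" by (simp add: algebra_simps)
    also have "2 * k - x1 + z ^ 2 * (k ^ 2 + c) = x1 - 2 * y1 * z + z ^ 2 * h"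
    proof -
      have "2 * k = 2 * (x1 - y1 * z) + z ^ 2 * (2 * h1)" by (subst k) (simp add: algebra_simps)
      then show ?thesis by (simp add: h_def algebra_simps)
    qed
    finally show ?thesis .
  qed
  then have x3: "x3 = x1 - 2 * y1 * z + z ^ 2 * h" using z e0 by simp
  have "l * (x3 - x1) = (z * l) * (z * h - 2 * y1)"
    unfolding x3 by (simp add: algebra_simps power2_eq_square)
  then have y3: "- (y1 + l * (x3 - x1)) = y1 - (3 * x1 ^ 2 + a) * z + z ^ 2 * (k * (2 * y1 - z * h) - h2)"
    unfolding zl hh2 by (simp add: algebra_simps power2_eq_square)
  have nx: "x1 \<noteq> 1 / (z ^ 2 * e)" using ne by auto
  have pa: "padd a (Aff x1 y1) (Aff (1 / (z ^ 2 * e)) (1 / (z ^ 3 * e))) = Aff x3 (- (y1 + l * (x3 - x1)))"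
    by (simp only: padd.simps Let_def nx if_False simp_thms l_def[symmetric] x3_def[symmetric])
  show ?thesis
    by (rule that[OF hV _ pa[unfolded y3, unfolded x3]]) (intro mem_intros kV xy zV hV h2V)
qed

text \<open>The kernel of reduction; the origin itself belongs to it.\<close>

definition near_infinity :: "'c point \<Rightarrow> bool" where
  "near_infinity P \<longleftrightarrow> (\<forall>x y. P = Aff x y \<longrightarrow> x \<notin> V)"

fun local_param :: "'c point \<Rightarrow> 'c" where
  "local_param Infty = 0"
| "local_param (Aff x y) = x / y"

text \<open>In the coordinates z = x/y, w = 1/y the curve is w = z^3 + a z w^2 + b w^3 and the chord
  is w = L z + m with L in M. The three z-coordinates on it add up to -m r with r in M, and m is a
  multiple of the parameter of Q because that parameter divides the one of P. This is the formal
  group law to first order, obtained without power series.\<close>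

lemma padd_near_infinity:
  assumes ab: "a \<in> V" "b \<in> V" and two: "(2::'c) \<noteq> 0"
    and P: "on_curve a b P" "near_infinity P" and Q: "on_curve a b Q" "near_infinity Q" "Q \<noteq> Infty"
    and le: "local_param P / local_param Q \<in> V"
  shows "near_infinity (padd a P Q) \<and>
    (\<exists>m\<in>M. local_param (padd a P Q) = local_param P + local_param Q + local_param Q * m)"
proof (cases "P = Infty \<or> padd a P Q = Infty")
  case True
  then show ?thesis
  proof
    assume "P = Infty" then show ?thesis using Q(2) zero_M by auto
  next
    assume inf: "padd a P Q = Infty"
    have "local_param P + local_param Q = 0"
      using inf by (cases P; cases Q) (auto simp: Let_def split: if_splits)
    then show ?thesis using inf zero_M by (auto simp: near_infinity_def intro!: bexI[of _ 0])
  qed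
next
  case False
  then obtain x1 y1 where Pxy: "P = Aff x1 y1" by (cases P) auto
  obtain x2 y2 where Qxy: "Q = Aff x2 y2" using Q by (cases Q) auto
  have no: "\<not> (x1 = x2 \<and> y1 = - y2)" using False Pxy Qxy by auto
  obtain z1 e1 where p1: "z1 \<in> M" "z1 \<noteq> 0" "e1 \<in> V" "e1 \<notin> M" "e1 = 1 + a * z1 ^ 4 * e1 ^ 2 + b * z1 ^ 6 * e1 ^ 3"
    "x1 = 1 / (z1 ^ 2 * e1)" "y1 = 1 / (z1 ^ 3 * e1)" "x1 / y1 = z1"
    using near_infinity_parameter[OF ab, of x1 y1] P Pxy by (auto simp: near_infinity_def)
  obtain z2 e2 where p2: "z2 \<in> M" "z2 \<noteq> 0" "e2 \<in> V" "e2 \<notin> M" "e2 = 1 + a * z2 ^ 4 * e2 ^ 2 + b * z2 ^ 6 * e2 ^ 3"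
    "x2 = 1 / (z2 ^ 2 * e2)" "y2 = 1 / (z2 ^ 3 * e2)" "x2 / y2 = z2"
    using near_infinity_parameter[OF ab, of x2 y2] Q Qxy by (auto simp: near_infinity_def)
  have e0: "e1 \<noteq> 0" "e2 \<noteq> 0" using p1 p2 unit_nonzero by auto
  have y0: "y1 \<noteq> 0" "y2 \<noteq> 0" using p1(2,7) p2(2,7) e0 by auto
  define w1 w2 where "w1 = 1 / y1" and "w2 = 1 / y2"
  have w: "w1 = z1 ^ 3 * e1" "w2 = z2 ^ 3 * e2" by (simp_all add: w1_def w2_def p1(7) p2(7))
  have wV: "w1 \<in> V" "w2 \<in> V" unfolding w using p1 p2 M_mem by (auto intro!: mem_intros)
  have zV: "z1 \<in> V" "z2 \<in> V" using p1 p2 M_mem by auto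
  have wM: "w1 \<in> M" "w2 \<in> M" unfolding w using p1 p2 by (auto intro!: mult_M' power_M)
  have w0: "w1 \<noteq> 0" "w2 \<noteq> 0" using y0 by (auto simp: w1_def w2_def)
  have xw: "x1 = z1 / w1" "y1 = 1 / w1" "x2 = z2 / w2" "y2 = 1 / w2"
    using y0 p1(8) p2(8) by (auto simp: w1_def w2_def)
  have cw: "w1 = z1 ^ 3 + a * z1 * w1 ^ 2 + b * w1 ^ 3" "w2 = z2 ^ 3 + a * z2 * w2 ^ 2 + b * w2 ^ 3"
    using P(1) Q(1) w0 unfolding Pxy Qxy xw by (simp_all add: field_simps eval_nat_numeral)
  obtain l n x3 where ln: "y1 = l * x1 + n" "y2 = l * x2 + n"
    "padd a (Aff x1 y1) (Aff x2 y2) = Aff x3 (- (l * x3 + n))"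
    "x1 + x2 + x3 = l ^ 2" "x1 * x2 + x1 * x3 + x2 * x3 = a - 2 * l * n" "x1 * x2 * x3 = n ^ 2 - b"
    using padd_line[OF two, of a b x1 y1 x2 y2] P(1) Q(1) Pxy Qxy no by metis
  have lw: "1 = l * z1 + n * w1" "1 = l * z2 + n * w2"
    using ln(1,2) w0 unfolding xw by (simp_all add: field_simps)
  \<comment> \<open>Subtracting the two equations in (z, w) gives (w2 - w1) Den = (z2 - z1) N with a
    unit \<open>Den\<close> and \<open>N\<close> in M. The quotient is the slope also when the
    points coincide.\<close>
  define Den where "Den = 1 - (a * z2 * (w1 + w2) + b * (w1 ^ 2 + w1 * w2 + w2 ^ 2))"
  have "a * z2 * (w1 + w2) + b * (w1 ^ 2 + w1 * w2 + w2 ^ 2) \<in> M"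
    by (intro add_M mult_M mult_M'[OF mult_M] ab p2 mem_intros wV power_M wM) simp_all
  then have DenM: "Den \<notin> M" unfolding Den_def by (rule one_minus_M)
  have DenV: "Den \<in> V" unfolding Den_def by (intro mem_intros ab zV wV)
  have Den0: "Den \<noteq> 0" using unit_nonzero DenM by blast
  define N where "N = z1 ^ 2 + z1 * z2 + z2 ^ 2 + a * w1 ^ 2"
  have NM: "N \<in> M" unfolding N_def by (intro add_M mult_M power_M ab p1 p2 wM zV) simp_all
  define L where "L = N / Den"
  have LM: "L \<in> M" unfolding L_def divide_inverse by (rule mult_M'[OF NM unit_inverse[OF DenV DenM]])
  have LV: "L \<in> V" using LM M_mem by blast
  have LD: "L * Den = N" using Den0 by (simp add: L_def)
  have dw: "w2 - w1 = L * (z2 - z1)"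
  proof -
    have "(w2 - w1) * Den = (z2 - z1) * N + (w2 - (z2 ^ 3 + a * z2 * w2 ^ 2 + b * w2 ^ 3))
        - (w1 - (z1 ^ 3 + a * z1 * w1 ^ 2 + b * w1 ^ 3))"
      by (simp add: Den_def N_def algebra_simps eval_nat_numeral)
    moreover have "w2 - (z2 ^ 3 + a * z2 * w2 ^ 2 + b * w2 ^ 3) = 0" "w1 - (z1 ^ 3 + a * z1 * w1 ^ 2 + b * w1 ^ 3) = 0"
      using cw by (simp_all only: right_minus_eq)
    ultimately have "(w2 - w1) * Den = (L * (z2 - z1)) * Den" by (simp add: LD[symmetric] algebra_simps)
    then show ?thesis using Den0 by simp
  qed
  \<comment> \<open>The line y = l x + n reads 1 = l z + n w, so its slope in the (z, w)-plane is
    -l/n and its intercept 1/n. For coincident points the tangent slope is compared with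
    \<open>N / Den\<close> directly.\<close>
  have lL: "l = - (L * n)"
  proof (cases "z1 = z2")
    case False
    have "l * (z2 - z1) = - n * (w2 - w1)" using lw by (simp add: algebra_simps)
    also have "\<dots> = - (L * n) * (z2 - z1)" unfolding dw by (simp add: algebra_simps)
    finally show ?thesis using False mult_right_cancel[of "z2 - z1" l "- (L * n)"] by simp
  next
    case True
    then have w12: "w1 = w2" using dw by simp
    then have x12: "x1 = x2" using True xw by simp
    have "x3 = l ^ 2 - x1 - x1" using ln(4) x12 by (simp add: algebra_simps)
    moreover have "a = x1 * x2 + x1 * x3 + x2 * x3 + 2 * l * n" using ln(5) by simp
    ultimately have "a = x1 * x1 + 2 * (x1 * (l ^ 2 - x1 - x1)) + 2 * l * n"
      unfolding x12[symmetric] by (simp only:) (simp add: algebra_simps)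
    then have "l * (2 * (l * x1 + n)) = 3 * x1 ^ 2 + a" by (simp add: algebra_simps power2_eq_square)
    then have "l * (2 * y1) = 3 * x1 ^ 2 + a" using ln(1) by simp
    then have t: "2 * (l * w1) = N"
      using w0 True w12 unfolding N_def xw by (simp add: field_simps power2_eq_square)
    have "2 * l * z1 * w1 = z1 * N" using t by (simp add: algebra_simps)
    also have "\<dots> = 3 * z1 ^ 3 + a * z1 * w1 ^ 2"
      using True by (simp add: N_def algebra_simps eval_nat_numeral)
    also have "z1 ^ 3 = w1 - a * z1 * w1 ^ 2 - b * w1 ^ 3"
      using right_minus_eq[THEN iffD2, OF cw(1)] by (simp add: algebra_simps)
    also have "3 * (w1 - a * z1 * w1 ^ 2 - b * w1 ^ 3) + a * z1 * w1 ^ 2 = (2 + Den) * w1"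
      using True w12 by (simp add: Den_def algebra_simps eval_nat_numeral)
    finally have "2 * l * z1 = 2 + Den" using mult_right_cancel[OF w0(1)] by blast
    then have D: "Den = 2 * l * z1 - 2" by simp
    have "(l * w1) * Den = - (2 * (l * w1)) * (1 - l * z1)" unfolding D by (simp add: algebra_simps)
    also have "1 - l * z1 = n * w1" using lw(1) by (metis add_diff_cancel_left')
    also have "- (2 * (l * w1)) * (n * w1) = - (L * Den) * (n * w1)" unfolding t LD ..
    finally have "(l * w1) * Den = (- (L * n) * w1) * Den" by simp
    then have "l * w1 = - (L * n) * w1" using mult_right_cancel[OF Den0] by blast
    then show ?thesis using mult_right_cancel[OF w0(1)] by blast
  qed
  define m where "m = w1 - L * z1"
  have nm: "n * m = 1" using lw(1) unfolding lL m_def by (simp add: algebra_simps)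
  have n0: "n \<noteq> 0" using nm by auto
  define t where "t = z1 / z2"
  have tV: "t \<in> V" using le p1(8) p2(8) by (simp add: t_def Pxy Qxy)
  have z1t: "z1 = z2 * t" using p2(2) by (simp add: t_def)
  have "m = z2 * (t * (z1 ^ 2 * e1 - L))"
    unfolding m_def w by (subst (1 3) z1t) (simp add: algebra_simps eval_nat_numeral z1t)
  then obtain m' where m': "m = z2 * m'" "m' \<in> V" using tV zV p1(3) LV by (metis mem_intros(7,8,9))
  define U where "U = 1 + (a * L ^ 2 + b * L ^ 3)"
  have "a * L ^ 2 + b * L ^ 3 \<in> M" by (intro add_M mult_M power_M ab LM) simp_all
  then have UM: "U \<notin> M" unfolding U_def by (rule one_plus_M)
  have UV: "U \<in> V" unfolding U_def by (intro mem_intros ab LV)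
  have U0: "U \<noteq> 0" using unit_nonzero UM by blast
  define y3 where "y3 = l * x3 + n"
  have a_eq: "a = x1 * x2 + x1 * x3 + x2 * x3 + 2 * l * n" using ln(5) by simp
  have b_eq: "b = n ^ 2 - x1 * x2 * x3" using ln(6) by simp
  \<comment> \<open>This product and the sum of the x_i y_j y_k are symmetric in the three points of
    the chord, so Vieta's relations evaluate both; their quotient is the sum of the
    z-coordinates.\<close>
  have prod: "y1 * y2 * y3 = n ^ 3 * U"
  proof -
    have "y1 * y2 * y3 = l ^ 3 * (x1 * x2 * x3) + l ^ 2 * n * (x1 * x2 + x1 * x3 + x2 * x3) + l * n ^ 2 * (x1 + x2 + x3) + n ^ 3"
      by (simp add: ln(1,2) y3_def algebra_simps eval_nat_numeral)
    also have "\<dots> = n ^ 3 * U"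
      unfolding ln(4-6) U_def lL by (simp add: algebra_simps eval_nat_numeral)
    finally show ?thesis .
  qed
  have num: "x1 * y2 * y3 + x2 * y1 * y3 + x3 * y1 * y2 = - (n ^ 2 * (2 * a * L + 3 * b * L ^ 2))"
  proof -
    have "x1 * y2 * y3 + x2 * y1 * y3 + x3 * y1 * y2 =
      3 * l ^ 2 * (x1 * x2 * x3) + 2 * l * n * (x1 * x2 + x1 * x3 + x2 * x3) + n ^ 2 * (x1 + x2 + x3)"
      by (simp add: ln(1,2) y3_def algebra_simps eval_nat_numeral)
    also have "\<dots> = - (n ^ 2 * (2 * a * L + 3 * b * L ^ 2))"
      unfolding ln(4-6) lL by (simp add: algebra_simps eval_nat_numeral)
    finally show ?thesis .
  qed
  have y30: "y3 \<noteq> 0" using prod n0 U0 by auto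
  define r where "r = (2 * a * L + 3 * b * L ^ 2) / U"
  have "2 * a * L + 3 * b * L ^ 2 \<in> M" by (intro add_M mult_M power_M mem_intros ab LM) simp_all
  then have rM: "r \<in> M" unfolding r_def divide_inverse by (rule mult_M'[OF _ unit_inverse[OF UV UM]])
  have sum: "z1 + z2 + x3 / y3 = - (m * r)"
  proof -
    have "(z1 + z2 + x3 / y3) * (y1 * y2 * y3) = x1 * y2 * y3 + x2 * y1 * y3 + x3 * y1 * y2"
      using y0 y30 unfolding p1(8)[symmetric] p2(8)[symmetric] by (simp add: field_simps)
    also have "\<dots> = - (m * r) * (y1 * y2 * y3)"
    proof -
      have "r * U = 2 * a * L + 3 * b * L ^ 2" using U0 by (simp add: r_def)
      moreover have "- (m * r) * (n ^ 3 * U) = - ((n * m) * (n ^ 2 * (r * U)))"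
        by (simp add: algebra_simps eval_nat_numeral)
      ultimately show ?thesis unfolding num prod nm by simp
    qed
    finally have "(z1 + z2 + x3 / y3) * (y1 * y2 * y3) = - (m * r) * (y1 * y2 * y3)" .
    moreover have "y1 * y2 * y3 \<noteq> 0" using y0 y30 by simp
    ultimately show ?thesis using mult_right_cancel by blast
  qed
  have res: "padd a P Q = Aff x3 (- y3)" using ln(3) by (simp add: Pxy Qxy y3_def)
  have "z1 + z2 + x3 / y3 = - (z2 * (m' * r))" using sum unfolding m'(1) by (simp add: mult.assoc)
  then have x3y3: "x3 / y3 = - (z2 * (m' * r)) - (z1 + z2)" by (metis add_diff_cancel_left')
  have lp: "local_param (padd a P Q) = z1 + z2 + z2 * (m' * r)"
    unfolding res using x3y3 by simp
  have m'rM: "m' * r \<in> M" using m' rM by (intro mult_M)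
  have z3M: "x3 / y3 \<in> M"
    unfolding x3y3 by (intro uminus_M diff_M add_M p1 p2 mult_M zV m'rM)
  \<comment> \<open>An integral x3 would make y3 integral, while 1/y3 = m + L (x3/y3) lies in
    M.\<close>
  have "x3 \<notin> V"
  proof
    assume x3: "x3 \<in> V"
    have "l * (x3 / y3) + n * (1 / y3) = (l * x3 + n) / y3" by (simp add: add_divide_distrib)
    then have "l * (x3 / y3) + n * (1 / y3) = y3 / y3" by (simp only: y3_def)
    then have "1 = l * (x3 / y3) + n * (1 / y3)" using y30 by simp
    then have "m = m * l * (x3 / y3) + (m * n) * (1 / y3)" by (metis mult.assoc mult.right_neutral distrib_left)
    moreover have "m * l = - L" unfolding lL using nm by (simp add: algebra_simps)
    ultimately have "m = - L * (x3 / y3) + 1 / y3" using nm by (simp add: mult.commute[of m n])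
    then have "1 / y3 = m + L * (x3 / y3)" by (simp only: mult_minus_left) simp
    moreover have "m + L * (x3 / y3) \<in> M" unfolding m_def by (intro add_M diff_M mult_M wM p1 LV z3M)
    ultimately have iy: "inverse y3 \<in> M" by (simp add: inverse_eq_divide)
    have "on_curve a b (Aff x3 (- y3))" using on_curve_padd[OF two P(1) Q(1)] res by simp
    then have "y3 ^ 2 \<in> V" using x3 ab by (simp add: mem_intros)
    then have "y3 \<in> V" using mem_power_cancel by (metis zero_less_numeral)
    then show False using iy y30 not_mem_iff by blast
  qed
  then show ?thesis using lp m'rM p1(8) p2(8) res by (auto simp: near_infinity_def Pxy Qxy)
qed

lemma finite_max_valuation:
  assumes "finite Z" "Z \<noteq> {}" "0 \<notin> Z"
  shows "\<exists>m\<in>Z. \<forall>z\<in>Z. z / m \<in> V"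
  using assms
proof (induction Z rule: finite_ne_induct)
  case (singleton x) then show ?case by (simp add: one_mem)
next
  case (insert x F)
  then obtain m where m: "m \<in> F" "\<forall>z\<in>F. z / m \<in> V" by auto
  have nz: "x \<noteq> 0" "m \<noteq> 0" using insert.prems m by auto
  show ?case
  proof (cases "x / m \<in> V")
    case True then show ?thesis using m by auto
  next
    case False
    then have mx: "m / x \<in> V" using inverse_mem[OF False] by simp
    have "z / x \<in> V" if "z \<in> F" for z
      using mult_mem[OF m(2)[rule_format, OF that] mx] nz by simp
    then show ?thesis using nz by (intro bexI[of _ x]) (auto simp: one_mem)
  qed
qed

text \<open>Smoothness of the reduction: on the curve the discriminant is an integral combination of
  3 x^2 + a and y^2.\<close>

lemma discriminant_not_M:
  assumes "a \<in> V" "b \<in> V" "x \<in> V" "y \<in> V" and P: "on_curve a b (Aff x y)"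
    and "4 * a ^ 3 + 27 * b ^ 2 \<notin> M" "y \<in> M"
  shows "3 * x ^ 2 + a \<notin> M"
proof
  assume f: "3 * x ^ 2 + a \<in> M"
  have b: "b = y ^ 2 - x ^ 3 - a * x" using P by simp
  have "4 * a ^ 3 + 27 * b ^ 2 = 4 * (a ^ 2 - 3 * a * x ^ 2 + 9 * x ^ 4) * (3 * x ^ 2 + a)
     + 27 * (b + 2 * x ^ 3) * (y ^ 2 - x * (3 * x ^ 2 + a))"
    unfolding b by (simp add: algebra_simps eval_nat_numeral)
  also have "\<dots> \<in> M" by (intro add_M diff_M mult_M mem_intros assms f power_M) simp
  finally show False using assms by blast
qed

text \<open>The iterates stay congruent to the starting point modulo z, so the first-order
  displacement varies only by multiples of z^2 and n steps add up to n times it.\<close>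

lemma translate_iterate_integral:
  assumes ab: "a \<in> V" "b \<in> V" and xy: "x1 \<in> V" "y1 \<in> V"
    and Q: "on_curve a b Q" "Q = Aff xq yq" "xq \<notin> V" and z: "z = local_param Q"
  shows "\<exists>h\<in>V. \<exists>h'\<in>V. ((\<lambda>P. padd a P Q) ^^ n) (Aff x1 y1)
    = Aff (x1 - of_nat n * (2 * y1) * z + z ^ 2 * h) (y1 - of_nat n * (3 * x1 ^ 2 + a) * z + z ^ 2 * h')"
proof (induction n)
  case 0 show ?case using zero_mem by (auto intro!: bexI[of _ 0])
next
  case (Suc n)
  obtain z' e where p: "z' \<in> M" "z' \<noteq> 0" "e \<in> V" "e \<notin> M" "e = 1 + a * z' ^ 4 * e ^ 2 + b * z' ^ 6 * e ^ 3"
    "xq = 1 / (z' ^ 2 * e)" "yq = 1 / (z' ^ 3 * e)" "xq / yq = z'"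
    using near_infinity_parameter[OF ab, of xq yq] Q by auto
  have zz: "z' = z" using p(8) z Q(2) by simp
  note p = p[unfolded zz]
  have zV: "z \<in> V" using p(1) M_mem by blast
  obtain h h' where h: "h \<in> V" "h' \<in> V" and I: "((\<lambda>P. padd a P Q) ^^ n) (Aff x1 y1)
    = Aff (x1 - of_nat n * (2 * y1) * z + z ^ 2 * h) (y1 - of_nat n * (3 * x1 ^ 2 + a) * z + z ^ 2 * h')"
    using Suc by blast
  define k where "k = - of_nat n * (2 * y1) + z * h"
  define k' where "k' = - of_nat n * (3 * x1 ^ 2 + a) + z * h'"
  have k: "k \<in> V" "k' \<in> V" unfolding k_def k'_def by (intro mem_intros xy zV h ab)+
  define u v where "u = x1 + z * k" and "v = y1 + z * k'"
  have uv: "u \<in> V" "v \<in> V" unfolding u_def v_def by (intro mem_intros xy zV k)+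
  have I': "((\<lambda>P. padd a P Q) ^^ n) (Aff x1 y1) = Aff u v"
    unfolding I u_def v_def k_def k'_def by (simp add: algebra_simps power2_eq_square)
  obtain g g' where g: "g \<in> V" "g' \<in> V" and A: "padd a (Aff u v) (Aff (1 / (z ^ 2 * e)) (1 / (z ^ 3 * e)))
     = Aff (u - 2 * v * z + z ^ 2 * g) (v - (3 * u ^ 2 + a) * z + z ^ 2 * g')"
    using padd_near_infinity_integral[OF ab uv p(1,2,3,5,4)] by blast
  have "((\<lambda>P. padd a P Q) ^^ Suc n) (Aff x1 y1) = Aff (u - 2 * v * z + z ^ 2 * g) (v - (3 * u ^ 2 + a) * z + z ^ 2 * g')"
    using A I' p(6,7) Q(2) by simp
  moreover have "u - 2 * v * z + z ^ 2 * g = x1 - of_nat (Suc n) * (2 * y1) * z + z ^ 2 * (h - 2 * k' + g)"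
    unfolding u_def v_def k_def by (simp add: algebra_simps power2_eq_square)
  moreover have "v - (3 * u ^ 2 + a) * z + z ^ 2 * g' = y1 - of_nat (Suc n) * (3 * x1 ^ 2 + a) * z
      + z ^ 2 * (h' - 3 * k * (2 * x1 + z * k) + g')"
    unfolding u_def v_def k'_def by (simp add: algebra_simps power2_eq_square)
  moreover have "h - 2 * k' + g \<in> V" "h' - 3 * k * (2 * x1 + z * k) + g' \<in> V"
    by (intro mem_intros h k g xy zV)+
  ultimately show ?case by metis
qed

text \<open>The parameter of Q divides that of every iterate, so \<open>padd_near_infinity\<close>
  applies at each step and the errors collect in M.\<close>

lemma translate_iterate_near_infinity:
  assumes ab: "a \<in> V" "b \<in> V" and two: "(2::'c) \<noteq> 0"
    and P: "on_curve a b P" "near_infinity P" and Q: "on_curve a b Q" "near_infinity Q" "Q \<noteq> Infty"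
    and z: "local_param Q \<noteq> 0" and le: "local_param P / local_param Q \<in> V"
  shows "on_curve a b (((\<lambda>P. padd a P Q) ^^ n) P) \<and> near_infinity (((\<lambda>P. padd a P Q) ^^ n) P) \<and>
    (\<exists>m\<in>M. local_param (((\<lambda>P. padd a P Q) ^^ n) P) = local_param P + of_nat n * local_param Q + local_param Q * m)"
proof (induction n)
  case 0 show ?case using P zero_M by (auto intro!: bexI[of _ 0])
next
  case (Suc n)
  define R where "R = ((\<lambda>P. padd a P Q) ^^ n) P"
  obtain m where R: "on_curve a b R" "near_infinity R" "m \<in> M"
    "local_param R = local_param P + of_nat n * local_param Q + local_param Q * m"
    using Suc unfolding R_def by blast
  have "local_param R / local_param Q = local_param P / local_param Q + of_nat n + m"
    using z by (simp add: R(4) field_simps)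
  also have "\<dots> \<in> V" by (intro mem_intros le M_mem R)
  finally have "near_infinity (padd a R Q) \<and>
    (\<exists>m\<in>M. local_param (padd a R Q) = local_param R + local_param Q + local_param Q * m)"
    by (intro padd_near_infinity[OF ab two R(1,2) Q])
  then obtain m' where m': "near_infinity (padd a R Q)" "m' \<in> M"
    "local_param (padd a R Q) = local_param R + local_param Q + local_param Q * m'" by blast
  have "local_param (padd a R Q) = local_param P + of_nat (Suc n) * local_param Q + local_param Q * (m + m')"
    by (simp add: m'(3) R(4) algebra_simps)
  moreover have "m + m' \<in> M" using R(3) m'(2) by (rule add_M)
  moreover have "on_curve a b (padd a R Q)" using on_curve_padd[OF two R(1) Q(1)] .
  ultimately show ?case using m'(1) unfolding R_def by auto
qed

text \<open>
  To first order, translation by a point \<open>Q\<close> near the origin adds the value of the local parameter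
  at \<open>Q\<close>.  If that value divides those at all points of \<open>S\<close> near the origin, then all periods of the translation on \<open>S\<close> are
  divisible by \<open>p\<close>, hence so is \<open>card S\<close>.
\<close>

lemma torsion_point_integral:
  assumes ab: "a \<in> V" "b \<in> V" and two: "(2::'c) \<notin> M" and disc: "4 * a ^ 3 + 27 * b ^ 2 \<notin> M"
    and char: "\<And>n. of_nat n \<in> M \<Longrightarrow> p dvd n"
    and S: "finite S" "\<And>P. P \<in> S \<Longrightarrow> on_curve a b P" "\<And>P Q. P \<in> S \<Longrightarrow> Q \<in> S \<Longrightarrow> padd a P Q \<in> S"
    and p: "\<not> p dvd card S" and P: "Aff x y \<in> S"
  shows "x \<in> V"
proof (rule ccontr)
  assume x: "x \<notin> V"
  have two0: "(2::'c) \<noteq> 0" and disc0: "4 * a ^ 3 + 27 * b ^ 2 \<noteq> 0" using two disc unit_nonzero by auto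
  define N where "N = {P \<in> S. near_infinity P \<and> P \<noteq> Infty}"
  have nz: "local_param Q \<noteq> 0" if "Q \<in> N" for Q
  proof -
    have "Q \<in> S" "near_infinity Q" "Q \<noteq> Infty" using that by (simp_all add: N_def)
    then obtain u v where uv: "Q = Aff u v" "u \<notin> V" "on_curve a b Q"
      using S(2)[of Q] by (metis near_infinity_def point.exhaust)
    then obtain z where "z \<noteq> 0" "u / v = z" using near_infinity_parameter[OF ab, of u v] by metis
    then show ?thesis using uv by simp
  qed
  have "Aff x y \<in> N" using P x by (simp add: N_def near_infinity_def)
  then have "local_param ` N \<noteq> {}" "finite (local_param ` N)" "0 \<notin> local_param ` N"
    using S(1) nz by (auto simp: N_def)
  from finite_max_valuation[OF this(2,1,3)] obtain Q where Q: "Q \<in> N"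
    and max: "\<And>P. P \<in> N \<Longrightarrow> local_param P / local_param Q \<in> V" by auto
  have QS: "Q \<in> S" "near_infinity Q" "Q \<noteq> Infty" "on_curve a b Q" using Q S(2) by (auto simp: N_def)
  obtain xq yq where Qxy: "Q = Aff xq yq" using QS by (cases Q) auto
  have xq: "xq \<notin> V" using QS(2) by (simp add: near_infinity_def Qxy)
  define z where "z = local_param Q"
  have z0: "z \<noteq> 0" using nz Q by (simp add: z_def)
  have "on_curve a b (Aff xq yq)" using QS(4) Qxy by simp
  from near_infinity_parameter[OF ab this xq] have "xq / yq \<in> M" by metis
  then have zM: "z \<in> M" by (simp add: z_def Qxy)
  have "p dvd card S"
  proof (rule prime_period_dvd_card[OF S(1), of "\<lambda>P. padd a P Q"])
    show "inj_on (\<lambda>P. padd a P Q) S"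
      by (rule inj_on_inverseI[of _ "\<lambda>P. padd a P (pneg Q)"]) (use padd_cancel[OF two0 disc0] S(2) QS(4) in auto)
    show "(\<lambda>P. padd a P Q) ` S \<subseteq> S" using S(3) QS(1) by auto
    fix P n assume P: "P \<in> S" and per: "((\<lambda>P. padd a P Q) ^^ n) P = P"
    show "p dvd n"
    proof (cases "near_infinity P")
      case True
      have "local_param P / local_param Q \<in> V"
        using max[of P] P True zero_mem by (cases "P = Infty") (auto simp: N_def)
      from translate_iterate_near_infinity[OF ab two0 S(2)[OF P] True QS(4,2,3) _ this, of n] nz[OF Q] per
      obtain m where "m \<in> M" "local_param P = local_param P + of_nat n * z + z * m" by (auto simp: z_def)
      then have "z * (of_nat n + m) = 0" by (simp add: algebra_simps)
      then have "of_nat n + m = 0" using z0 by simp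
      then have "of_nat n = - m" by (simp add: eq_neg_iff_add_eq_0)
      then show ?thesis using char uminus_M[OF \<open>m \<in> M\<close>] by simp
    next
      case False
      then obtain x1 y1 where P1: "P = Aff x1 y1" "x1 \<in> V" by (auto simp: near_infinity_def)
      have oc: "on_curve a b (Aff x1 y1)" using S(2)[OF P] P1 by simp
      then have "y1 ^ 2 \<in> V" using P1 ab by (simp add: mem_intros)
      then have y1: "y1 \<in> V" by (rule mem_power_cancel) simp
      from translate_iterate_integral[OF ab P1(2) y1 QS(4) Qxy xq z_def, of n] per P1(1)
      obtain h h' where h: "h \<in> V" "h' \<in> V" "x1 = x1 - of_nat n * (2 * y1) * z + z ^ 2 * h"
        "y1 = y1 - of_nat n * (3 * x1 ^ 2 + a) * z + z ^ 2 * h'" by auto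
      have "z * (of_nat n * (2 * y1)) = z * (z * h)" "z * (of_nat n * (3 * x1 ^ 2 + a)) = z * (z * h')"
        using h(3,4) by (simp_all add: algebra_simps power2_eq_square)
      then have m: "of_nat n * (2 * y1) \<in> M" "of_nat n * (3 * x1 ^ 2 + a) \<in> M"
        using z0 mult_M'[OF zM h(1)] mult_M'[OF zM h(2)] by simp_all
      show ?thesis
      proof (rule ccontr)
        assume "\<not> p dvd n"
        then have n: "of_nat n \<notin> M" using char by blast
        \<comment> \<open>With n a unit, y1 and 3 x1^2 + a would both lie in M, so P would reduce to
          a singular point.\<close>
        have "2 * y1 \<in> M" by (rule M_prime[OF m(1) of_nat_mem n]) (intro mem_intros y1)
        then have "y1 \<in> M" by (rule M_prime[OF _ numeral_mem two y1])
        then have "3 * x1 ^ 2 + a \<notin> M" using discriminant_not_M[OF ab P1(2) y1 oc disc] by blast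
        moreover have "3 * x1 ^ 2 + a \<in> M" by (rule M_prime[OF m(2) of_nat_mem n]) (intro mem_intros P1 ab)
        ultimately show False by blast
      qed
    qed
  qed
  then show False using p by blast
qed

text \<open>As b reduces to 0, the reduction has j = 1728 and (0, 0) is a point of order 2 on it. A
  point of S over it has y in M but y nonzero, since the order is odd. The tangent slope (3 x^2 +
  a)/(2 y), with a unit numerator, is then not integral, and neither is the first coordinate of the
  double.\<close>

lemma torsion_point_unit_4:
  assumes ab: "a \<in> V" "b \<in> M" and two: "(2::'c) \<notin> M" and disc: "4 * a ^ 3 + 27 * b ^ 2 \<notin> M"
    and S: "finite S" "\<And>P. P \<in> S \<Longrightarrow> on_curve a b P" "\<And>P Q. P \<in> S \<Longrightarrow> Q \<in> S \<Longrightarrow> padd a P Q \<in> S"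
    and int: "\<And>x y. Aff x y \<in> S \<Longrightarrow> x \<in> V" and odd: "odd (card S)" and P: "Aff x y \<in> S"
  shows "x \<notin> M"
proof
  assume x: "x \<in> M"
  have two0: "(2::'c) \<noteq> 0" and disc0: "4 * a ^ 3 + 27 * b ^ 2 \<noteq> 0" using two disc unit_nonzero by auto
  have oc: "y ^ 2 = x ^ 3 + a * x + b" using S(2)[OF P] by simp
  have "x ^ 3 + a * x + b \<in> M" by (intro add_M mult_M power_M x ab) simp
  then have "y ^ 2 \<in> M" using oc by simp
  moreover from this have yV: "y \<in> V" using mem_power_cancel[of y 2] M_mem by simp
  ultimately have y: "y \<in> M" using M_power_cancel by blast
  have aM: "a \<notin> M"
  proof
    assume "a \<in> M"
    then have "4 * a ^ 3 + 27 * b ^ 2 \<in> M" using ab by (intro add_M mult_M power_M numeral_mem) auto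
    then show False using disc by blast
  qed
  have "y \<noteq> 0"
    using two_torsion_even_card[OF two0 disc0 S, of x] odd P by auto
  then have y2: "y \<noteq> - y" using two0 by (metis add.right_inverse mult_2 mult_eq_0_iff)
  define l where "l = (3 * x ^ 2 + a) / (2 * y)"
  define x3 where "x3 = l ^ 2 - x - x"
  have nc: "\<not> (x = x \<and> y = - y)" using y2 by simp
  have "padd a (Aff x y) (Aff x y) = Aff x3 (- (y + l * (x3 - x)))"
    by (simp only: padd.simps if_not_P[OF nc]) (simp add: Let_def l_def[symmetric] x3_def)
  moreover have "padd a (Aff x y) (Aff x y) \<in> S" using S(3) P by blast
  ultimately have "x3 \<in> V" using int by metis
  then have "x3 + (x + x) \<in> V" using x M_mem by (intro add_mem) auto
  then have "l ^ 2 \<in> V" by (simp add: x3_def)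
  then have lV: "l \<in> V" using mem_power_cancel[of l 2] by simp
  have "3 * x ^ 2 + a = 2 * l * y" using \<open>y \<noteq> 0\<close> two0 by (simp add: l_def)
  also have "\<dots> \<in> M" by (intro mult_M mem_intros lV y)
  finally have "(3 * x ^ 2 + a) - 3 * x ^ 2 \<in> M" by (rule diff_M) (intro mult_M power_M x numeral_mem, simp)
  then show False using aM by simp
qed

text \<open>As a reduces to 0, the reduction has j = 0 and its points with first coordinate 0 are
  flexes. For P over such a point the tangent slope lies in M, and 2 P reduces to -P. If 2 P = -P,
  then 3 divides the order; otherwise the chord from 2 P to P has a unit over an element of M as
  slope, so the triple of P has a nonintegral first coordinate.\<close>

lemma torsion_point_unit_3:
  assumes ab: "a \<in> M" "b \<in> V" and two: "(2::'c) \<notin> M" and disc: "4 * a ^ 3 + 27 * b ^ 2 \<notin> M"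
    and S: "finite S" "\<And>P. P \<in> S \<Longrightarrow> on_curve a b P" "\<And>P Q. P \<in> S \<Longrightarrow> Q \<in> S \<Longrightarrow> padd a P Q \<in> S"
    and int: "\<And>x y. Aff x y \<in> S \<Longrightarrow> x \<in> V" and three: "\<not> 3 dvd card S" and P: "Aff x y \<in> S"
  shows "x \<notin> M"
proof
  assume x: "x \<in> M"
  have two0: "(2::'c) \<noteq> 0" and disc0: "4 * a ^ 3 + 27 * b ^ 2 \<noteq> 0" using two disc unit_nonzero by auto
  have oc: "y ^ 2 = x ^ 3 + a * x + b" using S(2)[OF P] by simp
  have bM: "b \<notin> M"
  proof
    assume "b \<in> M"
    then have "4 * a ^ 3 + 27 * b ^ 2 \<in> M" using ab by (intro add_M mult_M power_M numeral_mem) auto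
    then show False using disc by blast
  qed
  have "x ^ 3 + a * x \<in> M" by (intro add_M mult_M power_M x M_mem[OF ab(1)]) simp
  then have "b + (x ^ 3 + a * x) \<notin> M" by (rule unit_add_M[OF _ bM])
  then have y2M: "y ^ 2 \<notin> M" using oc by (simp add: add.commute)
  have "y ^ 2 \<in> V" using oc x ab M_mem by (auto intro!: mem_intros)
  then have yV: "y \<in> V" using mem_power_cancel[of y 2] by simp
  have yM: "y \<notin> M" using y2M power_M[of y 2] by auto
  have y0: "y \<noteq> 0" using yM unit_nonzero by blast
  then have y2: "y \<noteq> - y" using two0 by (metis add.right_inverse mult_2 mult_eq_0_iff)
  have tyM: "2 * y \<notin> M" using unit_mult[OF numeral_mem yV two yM] .
  define l where "l = (3 * x ^ 2 + a) / (2 * y)"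
  have lM: "l \<in> M" unfolding l_def divide_inverse
    by (rule mult_M'[OF _ unit_inverse[OF _ tyM]]) (intro add_M mult_M power_M x ab mem_intros yV; simp)+
  define x3 where "x3 = l ^ 2 - x - x"
  define y3 where "y3 = - (y + l * (x3 - x))"
  have x3M: "x3 \<in> M" unfolding x3_def by (intro diff_M power_M lM x) simp
  have QQ: "padd a (Aff x y) (Aff x y) = Aff x3 y3"
  proof -
    have nc: "\<not> (x = x \<and> y = - y)" using y2 by simp
    show ?thesis
      by (simp only: padd.simps if_not_P[OF nc]) (simp add: Let_def l_def[symmetric] x3_def y3_def)
  qed
  have in2: "Aff x3 y3 \<in> S" using S(3)[OF P P] QQ by simp
  have yy: "y - y3 \<notin> M"
  proof -
    have "l * (x3 - x) \<in> M" by (intro mult_M diff_M x x3M M_mem[OF lM])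
    then have "2 * y + l * (x3 - x) \<notin> M" by (rule unit_add_M[OF _ tyM])
    then show ?thesis by (simp add: y3_def algebra_simps)
  qed
  show False
  proof (cases "x3 = x")
    case True
    then have "y3 = - y" by (simp add: y3_def)
    then have "padd a (Aff x y) (Aff x y) = pneg (Aff x y)" using QQ True by simp
    then show False using flex_3_dvd_card[OF two0 disc0 S P] three by simp
  next
    case False
    define l' where "l' = (y - y3) / (x - x3)"
    have "padd a (Aff x3 y3) (Aff x y) \<in> S" using S(3)[OF in2 P] .
    then have "l' ^ 2 - x3 - x \<in> V" using False int by (auto simp: l'_def[symmetric] Let_def)
    then have "(l' ^ 2 - x3 - x) + (x3 + x) \<in> V" using x x3M M_mem by (intro add_mem) auto
    then have "l' ^ 2 \<in> V" by simp
    then have "l' \<in> V" using mem_power_cancel[of l' 2] by simp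
    then have "l' * (x - x3) \<in> M" by (intro mult_M diff_M x x3M)
    moreover have "l' * (x - x3) = y - y3" using False by (simp add: l'_def)
    ultimately show False using yy by simp
  qed
qed

end

section \<open>The kernel of an isogeny\<close>

lemma sum_order_eq_degree:
  fixes p :: "'c::alg_closed_field poly"
  assumes "p \<noteq> 0"
  shows "(\<Sum>r | poly p r = 0. order r p) = degree p"
proof -
  obtain A where A: "size A = degree p" "p = smult (lead_coeff p) (\<Prod>x\<in>#A. [:-x, 1:])"
    using alg_closed_imp_factorization[OF assms] by blast
  have "proots p = proots (\<Prod>x\<in>#A. [:-x, 1:])"
    by (subst A(2)) (simp add: assms)
  also have "\<dots> = A"
  proof (induction A)
    case (add x A)
    have "(\<Prod>x\<in>#A. [:-x, 1:]) \<noteq> 0" by (auto simp: prod_mset_zero_iff)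
    then show ?case using add
      by (simp only: image_mset_add_mset prod_mset.add_mset, subst proots_mult) (auto simp: proots_linear_factor)
  qed simp
  finally have "size (proots p) = degree p" using A(1) by simp
  then show ?thesis using assms by (simp add: size_multiset_overloaded_eq)
qed

lemma order_le_imp_dvd:
  fixes p q :: "'c::alg_closed_field poly"
  assumes "p \<noteq> 0" "q \<noteq> 0" "\<And>r. order r p \<le> order r q"
  shows "p dvd q"
  using assms
proof (induction "degree p" arbitrary: p q rule: less_induct)
  case less
  show ?case
  proof (cases "degree p = 0")
    case True
    then show ?thesis using less.prems(1) by (metis is_unit_iff_degree unit_imp_dvd)
  next
    case False
    then obtain r where r: "poly p r = 0" using alg_closed_imp_poly_has_root by blast
    then have "order r p \<noteq> 0" using less.prems(1) order_root by blast
    then have "poly q r = 0" using less.prems(3)[of r] order_root by (metis le_zero_eq)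
    then obtain q' where q': "q = [:-r, 1:] * q'" by (metis dvdE poly_eq_0_iff_dvd)
    obtain p' where p': "p = [:-r, 1:] * p'" using r by (metis dvdE poly_eq_0_iff_dvd)
    have nz: "p' \<noteq> 0" "q' \<noteq> 0" using p' q' less.prems by auto
    have "degree p = Suc (degree p')" unfolding p' using nz by (subst degree_mult_eq) auto
    moreover have "order x p' \<le> order x q'" for x
    proof -
      have "order x p = order x [:-r, 1:] + order x p'" using order_mult p' less.prems(1) by blast
      moreover have "order x q = order x [:-r, 1:] + order x q'" using order_mult q' less.prems(2) by blast
      ultimately show ?thesis using less.prems(3)[of x] by simp
    qed
    ultimately have "p' dvd q'" using less.hyps[of p' q'] nz by simp
    then show ?thesis unfolding p' q' by (rule mult_dvd_mono[OF dvd_refl])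
  qed
qed

lemma power_dvd_pderiv:
  fixes p :: "'c::field poly"
  assumes "[:-r, 1:] ^ Suc k dvd p"
  shows "[:-r, 1:] ^ k dvd pderiv p"
proof -
  obtain h where h: "p = [:-r, 1:] ^ Suc k * h" using assms by (rule dvdE)
  have "pderiv p = [:-r, 1:] ^ k * (smult (of_nat (Suc k)) h + [:-r, 1:] * pderiv h)"
    unfolding h pderiv_mult pderiv_power_Suc by (simp add: pderiv_pCons algebra_simps)
  then show ?thesis by simp
qed

lemma degree_diff_eq_left: "degree q < degree p \<Longrightarrow> degree (p - q) = degree p"
  and degree_diff_eq_right: "degree p < degree q \<Longrightarrow> degree (p - q) = degree q"
  for p q :: "'c::field poly"
  using degree_add_eq_left[of "- q" p] degree_add_eq_right[of p "- q"] by simp_all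

lemma degree_pderiv_le_pred:
  fixes p :: "'c::field poly"
  shows "degree (pderiv p) \<le> degree p - 1"
  by (rule degree_le) (auto simp: coeff_pderiv coeff_eq_0)

definition cubic :: "'c::field \<Rightarrow> 'c \<Rightarrow> 'c poly" where "cubic A B = [:B, A, 0, 1:]"

lemma poly_cubic [simp]: "poly (cubic A B) x = x ^ 3 + A * x + B"
  by (simp add: cubic_def algebra_simps power3_eq_cube)

lemma degree_cubic [simp]: "degree (cubic A B) = 3" and cubic_nonzero [simp]: "cubic A B \<noteq> 0"
  by (simp_all add: cubic_def)

lemma order_cubic:
  fixes A B :: "'c::field"
  assumes "4 * A ^ 3 + 27 * B ^ 2 \<noteq> 0"
  shows "order r (cubic A B) = (if poly (cubic A B) r = 0 then 1 else 0)"
proof (cases "poly (cubic A B) r = 0")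
  case True
  have "\<not> 2 \<le> order r (cubic A B)"
  proof
    assume "2 \<le> order r (cubic A B)"
    then have "[:-r, 1:] ^ Suc 1 dvd cubic A B" by (simp only: order_divides) simp
    then have "[:-r, 1:] ^ 1 dvd pderiv (cubic A B)" by (rule power_dvd_pderiv)
    then have "poly (pderiv (cubic A B)) r = 0" by (simp add: poly_eq_0_iff_dvd)
    then have "3 * r ^ 2 + A = 0" by (simp add: cubic_def pderiv_pCons algebra_simps power2_eq_square)
    then show False using singular_2_torsion[OF assms] True by simp
  qed
  moreover have "order r (cubic A B) \<noteq> 0" using True order_root cubic_nonzero by metis
  ultimately show ?thesis using True by simp
next
  case False then show ?thesis by (simp add: order_0I)
qed

text \<open>\<open>eq\<close> says that (N/D, y V/W) lies on the target curve, \<open>deg\<close>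
  that N/D has a pole at infinity, so that the origin goes to the origin, and
  \<open>separable\<close> that the derivative of N/D is nonzero.\<close>

locale isogeny_x_coordinate =
  fixes A B A' B' :: "'c::alg_closed_field" and N D V W :: "'c poly"
  assumes two: "(2::'c) \<noteq> 0"
    and disc: "4 * A ^ 3 + 27 * B ^ 2 \<noteq> 0" and disc': "4 * A' ^ 3 + 27 * B' ^ 2 \<noteq> 0"
    and coprime: "no_common_root N D" and D0: "D \<noteq> 0" and W0: "W \<noteq> 0"
    and deg: "degree D < degree N"
    and eq: "cubic A B * V ^ 2 * D ^ 3 = W ^ 2 * (N ^ 3 + smult A' (N * D ^ 2) + smult B' (D ^ 3))"
    and separable: "pderiv N * D \<noteq> N * pderiv D"
begin

definition G :: "'c poly" where "G = N ^ 3 + smult A' (N * D ^ 2) + smult B' (D ^ 3)"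

text \<open>The derivative of N/D is this polynomial divided by D^2.\<close>

definition Wr :: "'c poly" where "Wr = pderiv N * D - N * pderiv D"

lemma N0: "N \<noteq> 0" using deg by auto

lemma degree_G: "degree G = 3 * degree N"
proof -
  have 1: "degree (smult A' (N * D ^ 2)) < 3 * degree N"
    using deg by (intro le_less_trans[OF degree_smult_le]) (simp add: degree_mult_eq N0 D0 degree_power_eq)
  have 2: "degree (smult B' (D ^ 3)) < 3 * degree N"
    using deg by (intro le_less_trans[OF degree_smult_le]) (simp add: D0 degree_power_eq)
  have "degree (smult A' (N * D ^ 2) + smult B' (D ^ 3)) < degree (N ^ 3)"
    using 1 2 by (simp add: degree_power_eq N0 degree_add_less)
  then show ?thesis unfolding G_def add.assoc by (simp add: degree_add_eq_left degree_power_eq N0)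
qed

lemma G0: "G \<noteq> 0" using degree_G deg by auto

lemma poly_G_root: "poly D r = 0 \<Longrightarrow> poly G r \<noteq> 0"
  using coprime by (auto simp: G_def no_common_root_def)

lemma V0: "V \<noteq> 0" using eq W0 G0 by (auto simp: G_def)

lemma order_DG:
  "order r D + order r G + 2 * order r W = order r (cubic A B) + 2 * (order r V + 2 * order r D)"
proof -
  have e: "D * (cubic A B * V ^ 2 * D ^ 3) = D * (W ^ 2 * G)" unfolding eq G_def ..
  have "order r (D * (cubic A B * V ^ 2 * D ^ 3)) = order r (cubic A B) + 2 * (order r V + 2 * order r D)"
    using V0 D0 by (simp add: order_mult power2_eq_square power3_eq_cube)
  moreover have "order r (D * (W ^ 2 * G)) = order r D + order r G + 2 * order r W"
    using W0 D0 G0 by (simp add: order_mult power2_eq_square)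
  ultimately show ?thesis using e by simp
qed

text \<open>The equation gives 2 ord W <= ord(cubic) + 2 (ord V + 2 ord D), and the simple roots of
  the cubic contribute at most 1, which parity absorbs.\<close>

lemma W_dvd: "W dvd V * D ^ 2"
proof (rule order_le_imp_dvd)
  show "W \<noteq> 0" "V * D ^ 2 \<noteq> 0" using W0 V0 D0 by auto
  fix r
  have "order r (cubic A B) \<le> 1" using order_cubic[OF disc] by simp
  then have "order r W \<le> order r V + 2 * order r D" using order_DG[of r] by presburger
  then show "order r W \<le> order r (V * D ^ 2)" using V0 D0 by (simp add: order_mult power2_eq_square)
qed

text \<open>V/W = U/D^2, so the isogeny pulls dx/y back to (Wr/U) dx/y. That this is a constant
  multiple of dx/y is what the comparison of orders and degrees below amounts to.\<close>

definition U :: "'c poly" where "U = V * D ^ 2 div W"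

lemma WU: "W * U = V * D ^ 2" using W_dvd by (simp add: U_def)

lemma U0: "U \<noteq> 0" using WU V0 D0 by auto

lemma DG_eq: "D * G = cubic A B * U ^ 2"
proof -
  have "W ^ 2 * (D * G) = cubic A B * V ^ 2 * D ^ 3 * D" using eq by (simp add: G_def algebra_simps)
  also have "\<dots> = cubic A B * (V * D ^ 2) ^ 2" by (simp add: eval_nat_numeral algebra_simps)
  also have "\<dots> = W ^ 2 * (cubic A B * U ^ 2)" unfolding WU[symmetric] by (simp add: power_mult_distrib algebra_simps)
  finally show ?thesis using W0 by simp
qed

lemma order_DG_U: "order r D + order r G = order r (cubic A B) + 2 * order r U"
proof -
  have "order r (D * G) = order r D + order r G" by (simp add: order_mult D0 G0)
  moreover have "order r (cubic A B * U ^ 2) = order r (cubic A B) + 2 * order r U"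
    using U0 by (simp add: order_mult power2_eq_square)
  ultimately show ?thesis using DG_eq by simp
qed

lemma Wr0: "Wr \<noteq> 0" using separable by (simp add: Wr_def)

lemma power_dvd_Wr:
  assumes "[:-r, 1:] ^ Suc k dvd D \<or> [:-r, 1:] ^ Suc k dvd N - smult e D"
  shows "[:-r, 1:] ^ k dvd Wr"
proof -
  have W': "Wr = pderiv (N - smult e D) * D - (N - smult e D) * pderiv D"
    by (simp add: Wr_def pderiv_diff pderiv_smult algebra_simps)
  have le: "[:-r, 1:] ^ k dvd p" if "[:-r, 1:] ^ Suc k dvd p" for p
    using that by (metis dvd_mult_left power_Suc2)
  show ?thesis using assms
  proof
    assume "[:-r, 1:] ^ Suc k dvd D"
    then show ?thesis unfolding Wr_def
      by (intro dvd_diff dvd_mult dvd_mult2 power_dvd_pderiv le) auto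
  next
    assume h: "[:-r, 1:] ^ Suc k dvd N - smult e D"
    show ?thesis unfolding W'
      by (intro dvd_diff dvd_mult dvd_mult2 power_dvd_pderiv le h)
  qed
qed

text \<open>A root of order k of D or of N - e D is a root of order at least k - 1 of
  \<open>Wr\<close>. \<open>G\<close> is the product of N - e D over the three roots e of the target
  cubic, and at a given point at most one of these three and D vanishes.\<close>

lemma order_Wr: "order r D + order r G \<le> Suc (order r Wr)"
proof (cases "poly D r = 0")
  case True
  then have "order r G = 0" using poly_G_root order_0I by blast
  moreover obtain k where k: "order r D = Suc k" using True D0 order_root by (metis not0_implies_Suc)
  have "[:-r, 1:] ^ Suc k dvd D" by (simp only: order_divides k) simp
  then have "[:-r, 1:] ^ k dvd Wr" using power_dvd_Wr by blast
  then have "k \<le> order r Wr" using Wr0 by (simp add: order_divides)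
  ultimately show ?thesis using k by simp
next
  case False
  then have Dr: "order r D = 0" by (rule order_0I)
  show ?thesis
  proof (cases "poly G r = 0")
    case False then show ?thesis using Dr by (simp add: order_0I)
  next
    case True
    obtain e1 e2 e3 where e: "e1 \<noteq> e2" "e1 \<noteq> e3" "e2 \<noteq> e3"
      "\<forall>x. x ^ 3 + A' * x + B' = (x - e1) * (x - e2) * (x - e3)" "e1 + e2 + e3 = 0"
      "A' = e1 * e2 + e1 * e3 + e2 * e3" "B' = - (e1 * e2 * e3)"
      using cubic_distinct_roots[OF disc'] by blast
    have e3: "e3 = - e1 - e2" using e(5) by (metis add_diff_cancel_left' diff_0 diff_diff_eq)
    define L where "L e = N - smult e D" for e
    have fac: "G = L e1 * L e2 * L e3"
    proof (rule poly_eqI_alg_closed)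
      fix x
      have "poly G x = poly N x ^ 3 + A' * (poly N x * poly D x ^ 2) + B' * poly D x ^ 3" by (simp add: G_def)
      also have "\<dots> = (poly N x - e1 * poly D x) * (poly N x - e2 * poly D x) * (poly N x - e3 * poly D x)"
        unfolding e(6,7) e3 by (simp add: algebra_simps power2_eq_square power3_eq_cube)
      finally show "poly G x = poly (L e1 * L e2 * L e3) x" by (simp add: L_def)
    qed
    have L0: "L e \<noteq> 0" for e
      using deg D0 by (cases "e = 0") (auto simp: L_def N0 dest: arg_cong[of _ _ degree])
    have only: "poly (L e') r \<noteq> 0" if "poly (L e) r = 0" "e' \<noteq> e" for e e'
    proof
      assume "poly (L e') r = 0"
      then have "(e' - e) * poly D r = 0" using that(1) by (simp add: L_def algebra_simps)
      then show False using False that by simp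
    qed
    have main: ?thesis if h: "poly (L e) r = 0" "order r G = order r (L e)" for e
    proof -
      obtain k where k: "order r (L e) = Suc k" using h(1) L0 order_root by (metis not0_implies_Suc)
      have "[:-r, 1:] ^ Suc k dvd L e" by (simp only: order_divides k) simp
      then have "[:-r, 1:] ^ k dvd Wr" using power_dvd_Wr[of r k e] by (simp add: L_def)
      then have "k \<le> order r Wr" using Wr0 by (simp add: order_divides)
      then show ?thesis using k h Dr by simp
    qed
    have og: "order r G = order r (L e1) + order r (L e2) + order r (L e3)"
      unfolding fac using L0 by (simp add: order_mult)
    consider "poly (L e1) r = 0" | "poly (L e2) r = 0" | "poly (L e3) r = 0"
      using True unfolding fac by auto
    then show ?thesis
    proof cases
      case 1 then show ?thesis using main[OF 1] only[OF 1] e og by (simp add: order_0I)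
    next
      case 2 then show ?thesis using main[OF 2] only[OF 2] e og by (simp add: order_0I)
    next
      case 3 then show ?thesis using main[OF 3] only[OF 3] e og by (simp add: order_0I)
    qed
  qed
qed

lemma order_U_le_Wr: "order r U \<le> order r Wr"
  using order_Wr[of r] order_DG_U[of r] order_cubic[OF disc, of r] by (auto split: if_splits)

lemma degree_Wr: "degree Wr < degree N + degree D"
proof -
  have "degree (pderiv N * D) < degree N + degree D"
    using degree_pderiv_le_pred[of N] degree_mult_le[of "pderiv N" D] deg by linarith
  moreover have "degree (N * pderiv D) < degree N + degree D"
  proof (cases "degree D = 0")
    case True
    then have "pderiv D = 0" by (metis degree_eq_zeroE pderiv_pCons pderiv_0 add_0 pCons_0_0)
    then show ?thesis using deg by simp
  next
    case False
    then show ?thesis using degree_pderiv_le_pred[of D] degree_mult_le[of N "pderiv D"] by linarith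
  qed
  ultimately show ?thesis unfolding Wr_def by (simp add: degree_diff_less)
qed

lemma degree_U: "3 * degree N + degree D = 3 + 2 * degree U"
proof -
  have "degree (D * G) = degree D + 3 * degree N" by (simp add: degree_mult_eq D0 G0 degree_G)
  moreover have "degree (cubic A B * U ^ 2) = 3 + 2 * degree U"
    using U0 by (simp add: degree_mult_eq degree_power_eq)
  ultimately show ?thesis using DG_eq by simp
qed

lemma U_dvd_Wr: "U dvd Wr"
  by (rule order_le_imp_dvd[OF U0 Wr0 order_U_le_Wr])

text \<open>Riemann--Hurwitz for the isogeny, in terms of the derivative of \<open>N / D\<close>.\<close>

lemma degree_D: "degree N = Suc (degree D)"
  \<comment> \<open>With n, d the degrees of N and D: 3 n + d - 3 = 2 degree U <= 2 (n + d - 1), so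
    n - d <= 1.\<close>
  using degree_U degree_Wr dvd_imp_degree_le[OF U_dvd_Wr Wr0] deg by linarith

lemma order_Wr_eq: "order r Wr = order r U"
proof -
  obtain h where h: "Wr = U * h" using U_dvd_Wr by (rule dvdE)
  then have h0: "h \<noteq> 0" using Wr0 by auto
  have "degree Wr = degree U + degree h" using h h0 U0 by (simp add: degree_mult_eq)
  then have "degree h = 0" using degree_Wr degree_U degree_D by linarith
  then have "order r h = 0" using h0 by (metis degree_eq_zeroE order_0I poly_const_conv pCons_0_0)
  then show ?thesis using h Wr0 by (simp add: order_mult)
qed

text \<open>Let c be 1 or 0 according to whether the cubic vanishes at r. Then ord D = c + 2 ord U
  while ord D <= 1 + ord U, so ord U <= 1 - c; as ord D is positive, only ord D = 1 for c = 1 and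
  ord D = 2 for c = 0 remain.\<close>

lemma order_D_root:
  assumes "poly D r = 0"
  shows "order r D = (if poly (cubic A B) r = 0 then 1 else 2)"
proof -
  have "order r G = 0" using poly_G_root[OF assms] order_0I by blast
  moreover have "order r D \<noteq> 0" using assms D0 order_root by blast
  ultimately show ?thesis
    using order_Wr[of r] order_DG_U[of r] order_Wr_eq[of r] order_cubic[OF disc, of r]
    by (auto split: if_splits)
qed

definition kernel :: "'c point set" where
  "kernel = insert Infty {Aff x y | x y. y ^ 2 = x ^ 3 + A * x + B \<and> poly D x = 0}"

lemma kernel_on_curve: "P \<in> kernel \<Longrightarrow> on_curve A B P"
  by (auto simp: kernel_def)

lemma card_square_roots: "card {y. y ^ 2 = (c::'c)} = (if c = 0 then 1 else 2)"
proof (cases "c = 0")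
  case True
  then have "{y. y ^ 2 = c} = {0}" by auto
  then show ?thesis using True by simp
next
  case False
  obtain s where s: "s ^ 2 = c" using sqrt_exists by blast
  have "{y. y ^ 2 = c} = {s, - s}" using s by (auto simp: power2_eq_iff)
  moreover have "s \<noteq> - s" using False s two by (metis add.right_inverse mult_2 mult_eq_0_iff zero_power2)
  ultimately show ?thesis using False by simp
qed

lemma finite_roots_D: "finite {x. poly D x = 0}" using poly_roots_finite[OF D0] .

lemma finite_square_roots: "finite {y. y ^ 2 = (c::'c)}"
  using card_square_roots[of c] by (metis card.infinite zero_neq_numeral zero_neq_one)

text \<open>The order of a root of D equals the number of points over it, one for a point of order 2
  and two otherwise. So there are \<open>degree D\<close> affine points, and the origin makes up the
  missing one.\<close>

lemma card_kernel: "finite kernel \<and> card kernel = degree N"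
proof -
  define K where "K = {Aff x y | x y. y ^ 2 = x ^ 3 + A * x + B \<and> poly D x = 0}"
  define S where "S = Sigma {x. poly D x = 0} (\<lambda>x. {y. y ^ 2 = x ^ 3 + A * x + B})"
  have K: "K = (\<lambda>(x, y). Aff x y) ` S" by (auto simp: K_def S_def)
  have inj: "inj_on (\<lambda>(x, y). Aff x y) S" by (auto simp: inj_on_def)
  have fS: "finite S" unfolding S_def by (intro finite_SigmaI finite_roots_D finite_square_roots)
  have "card K = card S" unfolding K using card_image[OF inj] .
  also have "\<dots> = (\<Sum>x | poly D x = 0. card {y. y ^ 2 = x ^ 3 + A * x + B})"
    unfolding S_def by (intro card_SigmaI finite_roots_D ballI finite_square_roots)
  also have "\<dots> = (\<Sum>x | poly D x = 0. order x D)"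
    by (intro sum.cong refl) (simp add: card_square_roots order_D_root)
  also have "\<dots> = degree D" by (rule sum_order_eq_degree[OF D0])
  finally have "card K = degree D" .
  moreover have "finite K" using fS K by simp
  moreover have "Infty \<notin> K" by (auto simp: K_def)
  moreover have "kernel = insert Infty K" by (simp add: kernel_def K_def)
  ultimately show ?thesis using degree_D by simp
qed

end

section \<open>Closure of the kernel under addition\<close>

text \<open>For each t both signs of z are available, and z is nonzero away from the roots of q, so
  u and v vanish separately at all but finitely many t.\<close>

lemma quadratic_components_zero:
  fixes q u v :: "'c::alg_closed_field poly"
  assumes two: "(2::'c) \<noteq> 0" and q0: "q \<noteq> 0" and "finite F" and eq: "\<And>t z. t \<notin> F \<Longrightarrow> z ^ 2 = poly q t \<Longrightarrow> poly u t + poly v t * z = 0"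
  shows "u = 0 \<and> v = 0"
proof -
  define F' where "F' = F \<union> {t. poly q t = 0}"
  have F': "finite F'" using assms(3) poly_roots_finite[OF q0] by (simp add: F'_def)
  have uv: "poly u t = 0 \<and> poly v t = 0" if "t \<notin> F'" for t
  proof -
    obtain z where z: "z ^ 2 = poly q t" using sqrt_exists by blast
    have z0: "z \<noteq> 0" using that z by (auto simp: F'_def)
    have 1: "poly u t + poly v t * z = 0" using eq z that by (simp add: F'_def)
    have 2: "poly u t - poly v t * z = 0" using eq[of t "- z"] z that by (simp add: F'_def)
    have "2 * poly u t = 0" using arg_cong2[OF 1 2, of "(+)"] by (simp add: algebra_simps)
    then have "poly u t = 0" using two by simp
    then show ?thesis using 1 z0 by simp
  qed
  have inf: "infinite (- F')" using F' infinite_UNIV_alg_closed_field[where 'c = 'c]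
    by (metis finite_compl)
  have zero: "p = 0" if "\<And>t. t \<notin> F' \<Longrightarrow> poly p t = 0" for p :: "'c poly"
  proof (rule ccontr)
    assume "p \<noteq> 0"
    then have "finite {t. poly p t = 0}" by (rule poly_roots_finite)
    moreover have "- F' \<subseteq> {t. poly p t = 0}" using that by auto
    ultimately show False using inf finite_subset by blast
  qed
  show ?thesis using uv zero by blast
qed

text \<open>
  Projection from the point \<open>(r, - s)\<close> presents the curve \<open>y\<^sup>2 = x\<^sup>3 + A x + B\<close> as the double cover
  \<open>z\<^sup>2 = q(t)\<close> of the line of slopes: the line of slope \<open>t\<close> through \<open>(r, - s)\<close> meets the curve again
  in two points with first coordinates \<open>\<alpha>(t) \<plusminus> z\<close>.
\<close>

locale slope_cover =
  fixes A B r s :: "'c::alg_closed_field"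
  assumes two: "(2::'c) \<noteq> 0" and disc: "4 * A ^ 3 + 27 * B ^ 2 \<noteq> 0"
    and on_curve: "s ^ 2 = r ^ 3 + A * r + B"
begin

text \<open>By Vieta for the line y = t (x - r) - s, the two remaining first coordinates have sum
  t^2 - r and product r t^2 + 2 s t + A + r^2. So \<open>al\<close> is half the sum and
  \<open>q\<close> the square of half the difference.\<close>

definition al :: "'c poly" where "al = [:- (r / 2), 0, 1 / 2:]"

definition q :: "'c poly" where "q = al ^ 2 - [:A + r ^ 2, 2 * s, r:]"

lemma poly_al: "2 * poly al t = t ^ 2 - r"
proof -
  have "2 * poly al t = t ^ 2 * (2 / 2) - r * (2 / 2)"
    by (simp add: al_def algebra_simps power2_eq_square)
  then show ?thesis using two by simp
qed

lemma poly_q: "poly q t = poly al t ^ 2 - (r * t ^ 2 + 2 * s * t + A + r ^ 2)"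
  by (simp add: q_def algebra_simps power2_eq_square)

lemma degree_al: "degree al = 2" using two by (simp add: al_def)

lemma q0: "q \<noteq> 0"
proof
  assume "q = 0"
  then have "al ^ 2 = [:A + r ^ 2, 2 * s, r:]" by (simp add: q_def)
  moreover have "degree (al ^ 2) = 4" using degree_al two by (simp add: degree_power_eq al_def)
  moreover have "degree [:A + r ^ 2, 2 * s, r:] \<le> 2" by simp
  ultimately show False by simp
qed

lemma point_on_curve:
  assumes "z ^ 2 = poly q t"
  shows "(t * (poly al t + z - r) - s) ^ 2 = (poly al t + z) ^ 3 + A * (poly al t + z) + B"
proof -
  define x where "x = poly al t + z"
  have t2: "t ^ 2 = 2 * poly al t + r" using poly_al[of t] by simp
  have "(x - poly al t) ^ 2 = poly al t ^ 2 - (r * t ^ 2 + 2 * s * t + A + r ^ 2)"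
    using assms by (simp add: x_def poly_q)
  then have "x ^ 2 = 2 * poly al t * x - (r * t ^ 2 + 2 * s * t + A + r ^ 2)"
    by (simp add: power2_eq_square algebra_simps)
  then have "x ^ 2 = (t ^ 2 - r) * x - (r * t ^ 2 + 2 * s * t + A + r ^ 2)"
    by (simp add: poly_al)
  then have "(x - r) * (x ^ 2 - ((t ^ 2 - r) * x - (r * t ^ 2 + 2 * s * t + A + r ^ 2))) = 0" by simp
  moreover have "(x - r) * (x ^ 2 - ((t ^ 2 - r) * x - (r * t ^ 2 + 2 * s * t + A + r ^ 2)))
    = x ^ 3 + A * x - (t * (x - r) - s) ^ 2 + s ^ 2 - r ^ 3 - A * r"
    by (simp add: algebra_simps power2_eq_square power3_eq_cube)
  ultimately show ?thesis using on_curve unfolding x_def[symmetric] by (simp add: algebra_simps)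
qed

text \<open>The value of a polynomial at \<open>\<alpha>(t) + z\<close> as an element \<open>u(t) + v(t) z\<close> of the quadratic extension.\<close>

lemma poly_at_point:
  "\<exists>u v. \<forall>t z. z ^ 2 = poly q t \<longrightarrow> poly p (poly al t + z) = poly u t + poly v t * z"
proof (induction p)
  case 0
  show ?case by (rule exI[of _ 0], rule exI[of _ 0]) simp
next
  case (pCons c p)
  then obtain u v where uv: "\<And>t z. z ^ 2 = poly q t \<Longrightarrow> poly p (poly al t + z) = poly u t + poly v t * z" by blast
  show ?case
  proof (rule exI[of _ "[:c:] + al * u + q * v"], rule exI[of _ "u + al * v"], intro allI impI)
    fix t z assume z: "z ^ 2 = poly q t"
    show "poly (pCons c p) (poly al t + z) = poly ([:c:] + al * u + q * v) t + poly (u + al * v) t * z"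
      using uv[OF z] z[symmetric] by (simp add: algebra_simps power2_eq_square)
  qed
qed

lemmas components_eq = quadratic_components_zero[OF two q0]

lemma norm_linear:
  assumes "z ^ 2 = poly q t"
  shows "(poly al t + z - x0) * (poly al t - z - x0) = (r - x0) * t ^ 2 + 2 * s * t + (x0 ^ 2 + x0 * r + r ^ 2 + A)"
proof -
  have "(poly al t + z - x0) * (poly al t - z - x0) = poly al t ^ 2 - z ^ 2 - x0 * (2 * poly al t) + x0 ^ 2"
    by (simp add: algebra_simps power2_eq_square)
  also have "\<dots> = (r - x0) * t ^ 2 + 2 * s * t + (x0 ^ 2 + x0 * r + r ^ 2 + A)"
    unfolding assms poly_q poly_al by (simp add: algebra_simps power2_eq_square)
  finally show ?thesis .
qed

text \<open>By multiplicativity everything reduces to X - x0, whose norm is a polynomial in t with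
  t^2-coefficient r - x0. The drop of degree reflects the position t = infinity: the vertical line
  through (r, - s) meets the curve further in (r, s) and the origin.\<close>

lemma poly_norm:
  assumes "p \<noteq> 0"
  shows "\<exists>n. n \<noteq> 0 \<and> (\<forall>t z. z ^ 2 = poly q t \<longrightarrow> poly n t = poly p (poly al t + z) * poly p (poly al t - z)) \<and>
    (if poly p r = 0 then degree n < 2 * degree p else degree n = 2 * degree p)"
  using assms
proof (induction "degree p" arbitrary: p rule: less_induct)
  case less
  show ?case
  proof (cases "degree p = 0")
    case True
    then obtain c where c: "p = [:c:]" by (meson degree_eq_zeroE)
    show ?thesis using less.prems by (intro exI[of _ "[:c ^ 2:]"]) (simp add: c power2_eq_square)
  next
    case False
    then obtain x0 where "poly p x0 = 0" using alg_closed_imp_poly_has_root by blast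
    then obtain p' where p': "p = [:-x0, 1:] * p'" by (metis dvdE poly_eq_0_iff_dvd)
    have p'0: "p' \<noteq> 0" using p' less.prems by auto
    have dp: "degree p = Suc (degree p')" unfolding p' using p'0 by (subst degree_mult_eq) auto
    obtain n where n: "n \<noteq> 0" "\<And>t z. z ^ 2 = poly q t \<Longrightarrow> poly n t = poly p' (poly al t + z) * poly p' (poly al t - z)"
      "if poly p' r = 0 then degree n < 2 * degree p' else degree n = 2 * degree p'"
      using less.hyps[of p'] dp p'0 by auto
    define h where "h = [:x0 ^ 2 + x0 * r + r ^ 2 + A, 2 * s, r - x0:]"
    have h0: "h \<noteq> 0"
    proof
      assume "h = 0"
      then have "x0 = r" "s = 0" "x0 ^ 2 + x0 * r + r ^ 2 + A = 0" using two by (auto simp: h_def)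
      then have "3 * r ^ 2 + A = 0" "r ^ 3 + A * r + B = 0" using on_curve by (auto simp: power2_eq_square)
      then show False using singular_2_torsion[OF disc] by blast
    qed
    have ph: "poly h t = (r - x0) * t ^ 2 + 2 * s * t + (x0 ^ 2 + x0 * r + r ^ 2 + A)" for t
      by (simp add: h_def algebra_simps power2_eq_square)
    have dh: "if x0 = r then degree h < 2 else degree h = 2" by (auto simp: h_def)
    have pr: "poly p r = 0 \<longleftrightarrow> x0 = r \<or> poly p' r = 0" unfolding p' by auto
    have "degree (h * n) = degree h + degree n" using h0 n(1) by (rule degree_mult_eq)
    then have "if poly p r = 0 then degree (h * n) < 2 * degree p else degree (h * n) = 2 * degree p"
      using dh n(3) pr dp by (auto split: if_splits)
    moreover have "poly (h * n) t = poly p (poly al t + z) * poly p (poly al t - z)" if z: "z ^ 2 = poly q t" for t z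
    proof -
      have "poly (h * n) t = ((poly al t + z - x0) * (poly al t - z - x0)) * (poly p' (poly al t + z) * poly p' (poly al t - z))"
        unfolding norm_linear[OF z] using n(2)[OF z] by (simp add: ph)
      then show ?thesis unfolding p' by (simp add: algebra_simps)
    qed
    ultimately show ?thesis using h0 n(1) by (intro exI[of _ "h * n"]) auto
  qed
qed

end

lemma quadratic_point_expand:
  fixes z :: "'c::comm_ring_1"
  assumes "z ^ 2 = q"
  shows "(c ^ 2 + d ^ 2 * q) * D ^ 3 - w ^ 2 * (a ^ 3 + 3 * a * b ^ 2 * q + A * (a * D ^ 2) + B * D ^ 3)
     + (2 * c * d * D ^ 3 - w ^ 2 * (3 * a ^ 2 * b + b ^ 3 * q + A * (b * D ^ 2))) * z
   = (c + d * z) ^ 2 * D ^ 3 - w ^ 2 * ((a + b * z) ^ 3 + A * ((a + b * z) * D ^ 2) + B * D ^ 3)"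
  unfolding assms[symmetric] by (simp add: algebra_simps power2_eq_square power3_eq_cube)

lemma quadratic_point_factor:
  fixes y :: "'c::comm_ring_1"
  shows "(y * v * w') ^ 2 * (D * D') ^ 3 - (w * w') ^ 2 * ((n * D') ^ 3 + A * (n * D' * (D * D') ^ 2) + B * (D * D') ^ 3)
    = w' ^ 2 * D' ^ 3 * (y ^ 2 * v ^ 2 * D ^ 3 - w ^ 2 * (n ^ 3 + A * (n * D ^ 2) + B * D ^ 3))"
  by (simp add: power_mult_distrib algebra_simps power2_eq_square power3_eq_cube)

context isogeny_x_coordinate
begin

text \<open>Let (x3, s) be the sum of the two points. On the line of slope t through (x3, -s) the
  two further points are conjugate over the functions of t, and so are their images;
  \<open>quadratic_fraction_cases\<close> says in effect that the sum of the images is constant. At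
  t = l both images are the origin, so the sum is not affine, and the images are opposite for all t.
  At t = infinity the two points are the origin and (x3, s), so the latter goes to the origin as
  well.\<close>

lemma padd_kernel_affine:
  assumes P: "Aff x1 y1 \<in> kernel" and Q: "Aff x2 y2 \<in> kernel" and no: "\<not> (x1 = x2 \<and> y1 = - y2)"
  shows "padd A (Aff x1 y1) (Aff x2 y2) \<in> kernel"
proof -
  obtain l n x3 where ln: "y1 = l * x1 + n" "y2 = l * x2 + n"
    "padd A (Aff x1 y1) (Aff x2 y2) = Aff x3 (- (l * x3 + n))"
    "x1 + x2 + x3 = l ^ 2" "x1 * x2 + x1 * x3 + x2 * x3 = A - 2 * l * n" "x1 * x2 * x3 = n ^ 2 - B"
    using padd_line[OF two kernel_on_curve[OF P] kernel_on_curve[OF Q] no] by metis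
  define s where "s = - (l * x3 + n)"
  have R: "on_curve A B (Aff x3 s)"
    using on_curve_padd[OF two kernel_on_curve[OF P] kernel_on_curve[OF Q]] ln(3) by (simp add: s_def)
  interpret slope_cover A B x3 s
    by unfold_locales (use two disc R in auto)
  define z0 where "z0 = (x1 - x2) / 2"
  have al_l: "2 * poly al l = x1 + x2" unfolding poly_al ln(4)[symmetric] by simp
  have x12: "poly al l + z0 = x1" "poly al l - z0 = x2"
  proof -
    have "2 * z0 = x1 - x2" using two by (simp add: z0_def)
    then have "2 * (poly al l + z0) = 2 * x1" "2 * (poly al l - z0) = 2 * x2"
      using al_l by (simp_all add: algebra_simps)
    then show "poly al l + z0 = x1" "poly al l - z0 = x2" using mult_left_cancel[OF two] by blast+
  qed
  have z0q: "z0 ^ 2 = poly q l"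
  proof -
    have "z0 ^ 2 = poly al l ^ 2 - (poly al l + z0) * (poly al l - z0)"
      by (simp add: algebra_simps power2_eq_square)
    also have "(poly al l + z0) * (poly al l - z0) = x1 * x2" by (simp only: x12)
    also have "x1 * x2 = A - 2 * l * n - (x1 + x2) * x3" using ln(5) by (simp add: algebra_simps)
    also have "\<dots> = x3 * l ^ 2 + 2 * s * l + A + x3 ^ 2"
    proof -
      have e: "x1 + x2 = l ^ 2 - x3" using ln(4) by (simp add: algebra_simps)
      show ?thesis unfolding e by (simp add: s_def algebra_simps power2_eq_square)
    qed
    finally show ?thesis by (simp only: poly_q)
  qed
  obtain un vn where un: "\<And>t z. z ^ 2 = poly q t \<Longrightarrow> poly N (poly al t + z) = poly un t + poly vn t * z"
    using poly_at_point by blast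
  obtain ud vd where ud: "\<And>t z. z ^ 2 = poly q t \<Longrightarrow> poly D (poly al t + z) = poly ud t + poly vd t * z"
    using poly_at_point by blast
  obtain uv vv where uv: "\<And>t z. z ^ 2 = poly q t \<Longrightarrow> poly V (poly al t + z) = poly uv t + poly vv t * z"
    using poly_at_point by blast
  obtain uw vw where uw: "\<And>t z. z ^ 2 = poly q t \<Longrightarrow> poly W (poly al t + z) = poly uw t + poly vw t * z"
    using poly_at_point by blast
  have conj: "poly N (poly al t - z) = poly un t - poly vn t * z"
    "poly D (poly al t - z) = poly ud t - poly vd t * z"
    "poly W (poly al t - z) = poly uw t - poly vw t * z" if "z ^ 2 = poly q t" for t z
    using un[of "- z" t] ud[of "- z" t] uw[of "- z" t] that by simp_all
  define dd where "dd = ud ^ 2 - vd ^ 2 * q"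
  define ww where "ww = uw ^ 2 - vw ^ 2 * q"
  define nn where "nn = un ^ 2 - vn ^ 2 * q"
  \<comment> \<open>a + b z is N at the point times D at its conjugate, so (a + b z)/dd is N/D at
    the point. In the same way (c + d z)/ww is y V/W.\<close>
  define a b where "a = un * ud - vn * vd * q" and "b = vn * ud - un * vd"
  define yu where "yu = [:0, 1:] * (al - [:x3:]) - [:s:]"
  define cu cv where "cu = yu * uv + [:0, 1:] * vv * q" and "cv = yu * vv + [:0, 1:] * uv"
  define c d where "c = cu * uw - cv * vw * q" and "d = cv * uw - cu * vw"
  have dd: "poly dd t = poly D (poly al t + z) * poly D (poly al t - z)" if "z ^ 2 = poly q t" for t z
    unfolding ud[OF that] conj(2)[OF that] dd_def using that[symmetric] by (simp add: algebra_simps power2_eq_square)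
  have ww: "poly ww t = poly W (poly al t + z) * poly W (poly al t - z)" if "z ^ 2 = poly q t" for t z
    unfolding uw[OF that] conj(3)[OF that] ww_def using that[symmetric] by (simp add: algebra_simps power2_eq_square)
  have nn: "poly nn t = poly N (poly al t + z) * poly N (poly al t - z)" if "z ^ 2 = poly q t" for t z
    unfolding un[OF that] conj(1)[OF that] nn_def using that[symmetric] by (simp add: algebra_simps power2_eq_square)
  have uniq: "m = m'" if "\<And>t z. z ^ 2 = poly q t \<Longrightarrow> poly m t = poly m' t" for m m' :: "'c poly"
    using that sqrt_exists by (metis poly_eqI_alg_closed)
  have norm_prop: "m \<noteq> 0 \<and> (if poly p x3 = 0 then degree m < 2 * degree p else degree m = 2 * degree p)"
    if mp: "p \<noteq> 0" "\<And>t z. z ^ 2 = poly q t \<Longrightarrow> poly m t = poly p (poly al t + z) * poly p (poly al t - z)" for m p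
  proof -
    obtain m' where m': "m' \<noteq> 0" "\<And>t z. z ^ 2 = poly q t \<Longrightarrow> poly m' t = poly p (poly al t + z) * poly p (poly al t - z)"
      "if poly p x3 = 0 then degree m' < 2 * degree p else degree m' = 2 * degree p"
      using poly_norm[OF mp(1)] by blast
    have "m = m'" using uniq[of m m'] mp(2) m'(2) by simp
    then show ?thesis using m' by simp
  qed
  have dd0: "dd \<noteq> 0" using norm_prop[OF D0 dd] by blast
  have ww0: "ww \<noteq> 0" using norm_prop[OF W0 ww] by blast
  have X: "poly N (poly al t + z) * poly D (poly al t - z) = poly a t + poly b t * z"
    and Y: "(t * (poly al t + z - x3) - s) * poly V (poly al t + z) * poly W (poly al t - z) = poly c t + poly d t * z"
    if "z ^ 2 = poly q t" for t z
  proof -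
    show "poly N (poly al t + z) * poly D (poly al t - z) = poly a t + poly b t * z"
      unfolding un[OF that] conj[OF that] a_def b_def using that[symmetric]
      by (simp add: algebra_simps power2_eq_square)
    have 1: "t * (poly al t + z - x3) - s = poly yu t + t * z" by (simp add: yu_def algebra_simps)
    have 2: "(poly yu t + t * z) * (poly uv t + poly vv t * z) = poly cu t + poly cv t * z"
      unfolding cu_def cv_def using that[symmetric] by (simp add: algebra_simps power2_eq_square)
    show "(t * (poly al t + z - x3) - s) * poly V (poly al t + z) * poly W (poly al t - z) = poly c t + poly d t * z"
      unfolding 1 uv[OF that] 2 conj[OF that] c_def d_def using that[symmetric]
      by (simp add: algebra_simps power2_eq_square)
  qed
  define E1 where "E1 = (c ^ 2 + d ^ 2 * q) * dd ^ 3 - ww ^ 2 * (a ^ 3 + 3 * a * b ^ 2 * q + smult A' (a * dd ^ 2) + smult B' (dd ^ 3))"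
  define E2 where "E2 = 2 * c * d * dd ^ 3 - ww ^ 2 * (3 * a ^ 2 * b + b ^ 3 * q + smult A' (b * dd ^ 2))"
  have "E1 = 0 \<and> E2 = 0"
  proof (rule components_eq[of "{}"])
    fix t z assume z: "z ^ 2 = poly q t"
    define x x' where "x = poly al t + z" and "x' = poly al t - z"
    define y where "y = t * (x - x3) - s"
    have yx: "y ^ 2 = poly (cubic A B) x" using point_on_curve[OF z] by (simp add: y_def x_def)
    have eqx: "poly (cubic A B) x * poly V x ^ 2 * poly D x ^ 3
        = poly W x ^ 2 * (poly N x ^ 3 + A' * (poly N x * poly D x ^ 2) + B' * poly D x ^ 3)"
      using arg_cong[OF eq, of "\<lambda>p. poly p x"] by (simp add: algebra_simps)
    have ab: "poly N x * poly D x' = poly a t + poly b t * z" "poly dd t = poly D x * poly D x'"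
       "y * poly V x * poly W x' = poly c t + poly d t * z" "poly ww t = poly W x * poly W x'"
      unfolding x_def x'_def y_def by (fact X[OF z] dd[OF z] Y[OF z] ww[OF z])+
    have "poly E1 t + poly E2 t * z = (poly c t + poly d t * z) ^ 2 * poly dd t ^ 3
       - poly ww t ^ 2 * ((poly a t + poly b t * z) ^ 3 + A' * ((poly a t + poly b t * z) * poly dd t ^ 2) + B' * poly dd t ^ 3)"
    proof -
      have "poly E1 t = (poly c t ^ 2 + poly d t ^ 2 * poly q t) * poly dd t ^ 3 - poly ww t ^ 2 *
         (poly a t ^ 3 + 3 * poly a t * poly b t ^ 2 * poly q t + A' * (poly a t * poly dd t ^ 2) + B' * poly dd t ^ 3)"
        unfolding E1_def by (simp only: poly_add poly_diff poly_mult poly_smult poly_power poly_numeral)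
      moreover have "poly E2 t = 2 * poly c t * poly d t * poly dd t ^ 3 - poly ww t ^ 2 *
         (3 * poly a t ^ 2 * poly b t + poly b t ^ 3 * poly q t + A' * (poly b t * poly dd t ^ 2))"
        unfolding E2_def by (simp only: poly_add poly_diff poly_mult poly_smult poly_power poly_numeral)
      ultimately show ?thesis using quadratic_point_expand[OF z] by (simp only:)
    qed
    also have "\<dots> = poly W x' ^ 2 * poly D x' ^ 3 * (y ^ 2 * poly V x ^ 2 * poly D x ^ 3
        - poly W x ^ 2 * (poly N x ^ 3 + A' * (poly N x * poly D x ^ 2) + B' * poly D x ^ 3))"
      unfolding ab(1,3)[symmetric] ab(2,4) by (rule quadratic_point_factor)
    also have "\<dots> = 0" unfolding yx eqx by simp
    finally show "poly E1 t + poly E2 t * z = 0" .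
  qed simp
  then have E: "(c ^ 2 + d ^ 2 * q) * dd ^ 3 = ww ^ 2 * (a ^ 3 + 3 * a * b ^ 2 * q + smult A' (a * dd ^ 2) + smult B' (dd ^ 3))"
    "2 * c * d * dd ^ 3 = ww ^ 2 * (3 * a ^ 2 * b + b ^ 3 * q + smult A' (b * dd ^ 2))"
    by (simp_all add: E1_def E2_def)
  have aq: "a ^ 2 - b ^ 2 * q = nn * dd"
    unfolding a_def b_def nn_def dd_def by (simp add: algebra_simps power2_eq_square)
  have mdd: "((un - smult e ud) ^ 2 - (vn - smult e vd) ^ 2 * q) * dd = (a - smult e dd) ^ 2 - b ^ 2 * q" for e
  proof -
    define u' v' where "u' = un - smult e ud" and "v' = vn - smult e vd"
    have "u' * ud - v' * vd * q = a - smult e dd"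
      unfolding u'_def v'_def a_def dd_def by (simp add: algebra_simps power2_eq_square smult_diff_right)
    moreover have "v' * ud - u' * vd = b"
      unfolding u'_def v'_def b_def by (simp add: algebra_simps)
    moreover have "(u' ^ 2 - v' ^ 2 * q) * dd = (u' * ud - v' * vd * q) ^ 2 - (v' * ud - u' * vd) ^ 2 * q"
      unfolding dd_def by (simp add: algebra_simps power2_eq_square)
    ultimately show ?thesis unfolding u'_def[symmetric] v'_def[symmetric] by simp
  qed
  have D12: "poly D x1 = 0" "poly D x2 = 0" using P Q by (auto simp: kernel_def)
  have N12: "poly N x1 \<noteq> 0" "poly N x2 \<noteq> 0" using D12 coprime by (auto simp: no_common_root_def)
  have concl: "poly D x3 = 0"
  proof (rule quadratic_fraction_cases[OF two disc' dd0 ww0 E])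
    \<comment> \<open>After cancellation of dd^2 the relation is evaluated at t = l. There dd and a
      vanish, which leaves N(x1) N(x2) = 0, against coprimality.\<close>
    fix e f assume ef: "(a ^ 2 - b ^ 2 * q - smult (2 * e) (a * dd) - smult (2 * e ^ 2 + A') (dd ^ 2)) ^ 2
        = smult (4 * f ^ 2) (dd ^ 3 * (2 * a + smult e dd))"
    have "dd ^ 2 * (nn - smult (2 * e) a - smult (2 * e ^ 2 + A') dd) ^ 2
        = dd ^ 2 * smult (4 * f ^ 2) (dd * (2 * a + smult e dd))" (is "_ * ?l = _ * ?r")
    proof -
      have "dd ^ 2 * (nn - smult (2 * e) a - smult (2 * e ^ 2 + A') dd) ^ 2 =
          (a ^ 2 - b ^ 2 * q - smult (2 * e) (a * dd) - smult (2 * e ^ 2 + A') (dd ^ 2)) ^ 2"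
        unfolding aq by (simp add: algebra_simps power2_eq_square)
      also note ef
      also have "smult (4 * f ^ 2) (dd ^ 3 * (2 * a + smult e dd)) = dd ^ 2 * smult (4 * f ^ 2) (dd * (2 * a + smult e dd))"
        by (simp add: power2_eq_square power3_eq_cube mult.assoc)
      finally show ?thesis .
    qed
    moreover have "dd ^ 2 \<noteq> 0" using dd0 by simp
    ultimately have "(nn - smult (2 * e) a - smult (2 * e ^ 2 + A') dd) ^ 2 = smult (4 * f ^ 2) (dd * (2 * a + smult e dd))"
      using mult_left_cancel by blast
    then have "poly ((nn - smult (2 * e) a - smult (2 * e ^ 2 + A') dd) ^ 2) l = poly (smult (4 * f ^ 2) (dd * (2 * a + smult e dd))) l"
      by simp
    moreover have "poly dd l = 0" using dd[OF z0q] D12 x12 by simp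
    moreover have "poly a l = 0"
    proof -
      have "poly a l + poly b l * z0 = 0" using X[OF z0q] D12 x12 by simp
      moreover have "poly a l - poly b l * z0 = 0"
        using X[of "- z0" l] z0q D12 x12 by simp
      ultimately have "2 * poly a l = 0" by (metis add_diff_cancel_left' diff_add_cancel diff_add_eq mult_2 mult_eq_0_iff diff_self diff_minus_eq_add add.commute diff_eq_eq minus_diff_eq neg_0_equal_iff_equal)
      then show ?thesis using two by simp
    qed
    ultimately have "poly nn l = 0" by simp
    then show ?thesis using nn[OF z0q] N12 x12 by simp
  next
    fix e assume b0: "b = 0" and ae: "a = smult e dd"
    define p where "p = N - smult e D"
    have p0: "p \<noteq> 0" using deg D0 by (cases "e = 0") (auto simp: p_def N0 dest: arg_cong[of _ _ degree])
    define m where "m = (un - smult e ud) ^ 2 - (vn - smult e vd) ^ 2 * q"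
    have pm: "poly m t = poly p (poly al t + z) * poly p (poly al t - z)" if "z ^ 2 = poly q t" for t z
      unfolding m_def p_def poly_diff poly_smult un[OF that] ud[OF that] conj[OF that] using that[symmetric]
      by (simp add: algebra_simps power2_eq_square)
    have "m * dd = (a - smult e dd) ^ 2 - b ^ 2 * q"
      unfolding m_def by (rule mdd)
    then have "m * dd = 0" using b0 ae by simp
    then show ?thesis using dd0 norm_prop[OF p0 pm] by simp
  next
    assume b0: "b = 0"
    have key: "2 * degree (a - smult e dd) = degree m + degree dd \<and> m \<noteq> 0"
      if "m = (un - smult e ud) ^ 2 - (vn - smult e vd) ^ 2 * q" "m \<noteq> 0" for e m
    proof -
      have md: "m * dd = (a - smult e dd) ^ 2"
        unfolding that(1) mdd b0 by simp
      then have "a - smult e dd \<noteq> 0" using that(2) dd0 by auto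
      then show ?thesis using arg_cong[OF md, of degree] that(2) dd0 by (simp add: degree_mult_eq degree_power_eq)
    qed
    show "poly D x3 = 0"
    proof (rule ccontr)
      assume Dx: "poly D x3 \<noteq> 0"
      have ddeg: "degree dd = 2 * degree D" using norm_prop[OF D0 dd] Dx by simp
      \<comment> \<open>The common value of N/D at the two points would be both infinite and equal
        to e at t = infinity. In degrees: \<open>a - smult e dd\<close> falls short of degree N +
        degree D for this e but not for e + 1, although the two differ by \<open>dd\<close>, of
        degree 2 degree D.\<close>
      define e where "e = poly N x3 / poly D x3"
      define m where "m e = (un - smult e ud) ^ 2 - (vn - smult e vd) ^ 2 * q" for e
      have p0: "N - smult e D \<noteq> 0" for e
        using deg D0 by (cases "e = 0") (auto simp: N0 dest: arg_cong[of _ _ degree])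
      have pdeg: "degree (N - smult e D) = degree N" for e
        using deg by (intro degree_diff_eq_left) (auto intro: le_less_trans[OF degree_smult_le])
      have pm: "poly (m e) t = poly (N - smult e D) (poly al t + z) * poly (N - smult e D) (poly al t - z)"
        if "z ^ 2 = poly q t" for t z e
        unfolding m_def poly_diff poly_smult un[OF that] ud[OF that] conj[OF that] using that[symmetric]
        by (simp add: algebra_simps power2_eq_square)
      have "poly (N - smult e D) x3 = 0" using Dx by (simp add: e_def)
      then have 1: "degree (m e) < 2 * degree N" "m e \<noteq> 0" using norm_prop[OF p0 pm, of e] pdeg by auto
      have "poly (N - smult (e + 1) D) x3 \<noteq> 0" using Dx by (simp add: e_def algebra_simps)
      then have 2: "degree (m (e + 1)) = 2 * degree N" "m (e + 1) \<noteq> 0"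
        using norm_prop[OF p0 pm, of "e + 1"] pdeg by auto
      have k1: "2 * degree (a - smult e dd) < 2 * degree N + 2 * degree D"
        using key[OF m_def 1(2)] 1 ddeg by simp
      have k2: "degree (a - smult (e + 1) dd) = degree N + degree D"
        using key[OF m_def 2(2)] 2 ddeg by simp
      have "a - smult (e + 1) dd = (a - smult e dd) - dd" by (simp add: algebra_simps smult_add_left)
      moreover have "degree ((a - smult e dd) - dd) < degree N + degree D"
        by (rule degree_diff_less) (use k1 ddeg deg in auto)
      ultimately show False using k2 by (metis less_irrefl)
    qed
  qed
  show ?thesis using concl R ln(3) by (simp add: kernel_def s_def)
qed

lemma padd_kernel:
  assumes "P \<in> kernel" "Q \<in> kernel"
  shows "padd A P Q \<in> kernel"
proof (cases P; cases Q)
  fix x1 y1 x2 y2 assume PQ: "P = Aff x1 y1" "Q = Aff x2 y2"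
  show ?thesis
  proof (cases "x1 = x2 \<and> y1 = - y2")
    case True then show ?thesis using PQ by (simp add: kernel_def)
  next
    case False then show ?thesis using padd_kernel_affine assms PQ by blast
  qed
qed (use assms in auto)

end

section \<open>Polynomials over the ground field viewed over its algebraic closure\<close>

abbreviation ac :: "'a::field poly \<Rightarrow> 'a alg_closure poly" where "ac \<equiv> map_poly to_ac"

lemma ac_add [simp]: "ac (p + q) = ac p + ac q" and ac_diff [simp]: "ac (p - q) = ac p - ac q"
  and ac_minus [simp]: "ac (- p) = - ac p"
  by (rule poly_eqI; simp add: coeff_map_poly)+

lemma ac_mult [simp]: "ac (p * q) = ac p * ac q"
  by (rule poly_eqI) (simp add: coeff_map_poly coeff_mult to_ac_sum)

lemma ac_smult [simp]: "ac (smult c p) = smult (to_ac c) (ac p)"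
  by (rule poly_eqI) (simp add: coeff_map_poly)

lemma ac_pCons [simp]: "ac (pCons c p) = pCons (to_ac c) (ac p)"
  by (rule poly_eqI) (simp add: coeff_map_poly coeff_pCons split: nat.splits)

lemma ac_1 [simp]: "ac 1 = 1"
  by (simp add: one_pCons)

lemma ac_power [simp]: "ac (p ^ n) = ac p ^ n"
  by (induction n) simp_all

lemma ac_numeral [simp]: "ac (numeral k) = numeral k"
  by (simp add: numeral_poly)

lemma degree_ac [simp]: "degree (ac p) = degree p"
  by (rule degree_map_poly) simp

lemma ac_eq_0_iff [simp]: "ac p = 0 \<longleftrightarrow> p = 0"
  by (rule map_poly_eq_0_iff) auto

lemma ac_eq_iff [simp]: "ac p = ac q \<longleftrightarrow> p = q"
  using ac_eq_0_iff[of "p - q"] by (simp del: ac_eq_0_iff)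

lemma pderiv_ac: "pderiv (ac p) = ac (pderiv p)"
  by (rule poly_eqI) (simp add: coeff_map_poly coeff_pderiv)

lemma ac_cubic [simp]: "ac (cubic A B) = cubic (to_ac A) (to_ac B)"
  by (simp add: cubic_def)

section \<open>Short Weierstrass form\<close>

text \<open>This and \<open>short_B\<close> are -c4/48 and -c6/864 in terms of the usual invariants;
  x + \<open>b\<^sub>2\<close>/12 is the first coordinate of the short form.\<close>

definition short_A :: "'a::field weierstrass \<Rightarrow> 'a" where
  "short_A E = b\<^sub>4 E / 2 - 3 * (b\<^sub>2 E / 12) ^ 2"

definition short_B :: "'a::field weierstrass \<Rightarrow> 'a" where
  "short_B E = 2 * (b\<^sub>2 E / 12) ^ 3 - (b\<^sub>2 E / 12) * (b\<^sub>4 E / 2) + b\<^sub>6 E / 4"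

lemma four_twelve:
  assumes two: "(2::'a::field) \<noteq> 0" and three: "(3::'a) \<noteq> 0"
  shows "(4::'a) \<noteq> 0" "(12::'a) \<noteq> 0" "(16::'a) \<noteq> 0"
proof -
  have "(4::'a) = 2 * 2" "(12::'a) = 2 * 2 * 3" "(16::'a) = 2 * 2 * 2 * 2" by simp_all
  then show "(4::'a) \<noteq> 0" "(12::'a) \<noteq> 0" "(16::'a) \<noteq> 0" using two three by (metis mult_eq_0_iff)+
qed

lemma weier_eval_short:
  fixes E :: "'a::field weierstrass"
  assumes two: "(2::'a) \<noteq> 0" and three: "(3::'a) \<noteq> 0"
  shows "weier_eval E x y = (y + (a\<^sub>1 E * x + a\<^sub>3 E) / 2) ^ 2
    - ((x + b\<^sub>2 E / 12) ^ 3 + short_A E * (x + b\<^sub>2 E / 12) + short_B E)"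
proof -
  define e where "e = b\<^sub>2 E / 12"
  define h where "h = (1::'a) / 2"
  have h: "2 * h = 1" using two by (simp add: h_def)
  have e: "3 * e = h * h * b\<^sub>2 E"
  proof -
    have "12 * e = b\<^sub>2 E" using four_twelve[OF two three] by (simp add: e_def)
    moreover have "4 * (h * h * b\<^sub>2 E) = (2 * h) * (2 * h) * b\<^sub>2 E" by simp
    ultimately have "4 * (3 * e) = 4 * (h * h * b\<^sub>2 E)" using h by simp
    then show ?thesis using mult_left_cancel[OF four_twelve(1)[OF two three]] by blast
  qed
  have half: "u / 2 = h * u" and quarter: "u / 4 = h * h * u" for u
  proof -
    show "u / 2 = h * u" by (simp add: h_def)
    have "4 * (h * h * u) = (2 * h) * (2 * h) * u" by simp
    also have "\<dots> = 4 * (u / 4)" using h four_twelve(1)[OF two three] by simp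
    finally show "u / 4 = h * h * u" using mult_left_cancel[OF four_twelve(1)[OF two three]] by metis
  qed
  have "(y + h * (a\<^sub>1 E * x + a\<^sub>3 E)) ^ 2 - ((x + e) ^ 3 + short_A E * (x + e) + short_B E)
    = (y + h * (a\<^sub>1 E * x + a\<^sub>3 E)) ^ 2 - (x ^ 3 + (3 * e) * x ^ 2 + (h * b\<^sub>4 E) * x + h * h * b\<^sub>6 E)"
    unfolding short_A_def short_B_def e_def[symmetric] half quarter
    by (simp add: algebra_simps power2_eq_square power3_eq_cube)
  also have "\<dots> = y ^ 2 + (2 * h) * (a\<^sub>1 E * x + a\<^sub>3 E) * y
      - (x ^ 3 + (2 * h) * (2 * h) * a\<^sub>2 E * x ^ 2 + (2 * h) * a\<^sub>4 E * x + (2 * h) * (2 * h) * a\<^sub>6 E)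
      + h * (2 * h - 1) * (a\<^sub>1 E * a\<^sub>3 E * x)"
    unfolding e b\<^sub>2_def b\<^sub>4_def b\<^sub>6_def
    by (simp add: algebra_simps power2_eq_square power3_eq_cube)
  finally show ?thesis unfolding h e_def[symmetric] weier_eval_def half by (simp add: algebra_simps)
qed

lemma short_discriminant:
  fixes E :: "'a::field weierstrass"
  assumes two: "(2::'a) \<noteq> 0" and three: "(3::'a) \<noteq> 0"
  shows "- 16 * (4 * short_A E ^ 3 + 27 * short_B E ^ 2) = discr E"
proof -
  define e where "e = b\<^sub>2 E / 12"
  define m where "m = b\<^sub>4 E / 2"
  define n where "n = b\<^sub>6 E / 4"
  have b2: "b\<^sub>2 E = 12 * e" and b4: "b\<^sub>4 E = 2 * m" and b6: "b\<^sub>6 E = 4 * n"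
    using two four_twelve[OF two three] by (simp_all add: e_def m_def n_def)
  have "4 * b\<^sub>8 E = b\<^sub>2 E * b\<^sub>6 E - b\<^sub>4 E ^ 2"
    by (simp add: b\<^sub>8_def b\<^sub>2_def b\<^sub>4_def b\<^sub>6_def algebra_simps power2_eq_square)
  also have "\<dots> = 4 * (12 * e * n - m ^ 2)" unfolding b2 b4 b6 by (simp add: algebra_simps power2_eq_square)
  finally have b8: "b\<^sub>8 E = 12 * e * n - m ^ 2"
    using mult_left_cancel[OF four_twelve(1)[OF two three]] by blast
  show ?thesis
    unfolding short_A_def short_B_def discr_def e_def[symmetric] m_def[symmetric] n_def[symmetric] b8
    unfolding b2 b4 b6
    by (simp add: algebra_simps eval_nat_numeral)
qed

lemma map_weierstrass_short:
  "b\<^sub>2 (map_weierstrass to_ac E) = to_ac (b\<^sub>2 E)" "b\<^sub>4 (map_weierstrass to_ac E) = to_ac (b\<^sub>4 E)"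
  "b\<^sub>6 (map_weierstrass to_ac E) = to_ac (b\<^sub>6 E)"
  "short_A (map_weierstrass to_ac E) = to_ac (short_A E)" "short_B (map_weierstrass to_ac E) = to_ac (short_B E)"
  by (simp_all add: b\<^sub>2_def b\<^sub>4_def b\<^sub>6_def short_A_def short_B_def weierstrass.map_sel)

definition from_short :: "'a::field weierstrass \<Rightarrow> 'a alg_closure \<Rightarrow> 'a alg_closure \<Rightarrow> 'a alg_closure point" where
  "from_short E x y = Aff (x - to_ac (b\<^sub>2 E / 12))
     (y - (to_ac (a\<^sub>1 E) * (x - to_ac (b\<^sub>2 E / 12)) + to_ac (a\<^sub>3 E)) / 2)"

abbreviation on_short :: "'a::field weierstrass \<Rightarrow> 'a alg_closure \<Rightarrow> 'a alg_closure \<Rightarrow> bool" where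
  "on_short E x y \<equiv> y ^ 2 = poly (ac (cubic (short_A E) (short_B E))) x"

lemma ac_two_three:
  assumes "(2::'a::field) \<noteq> 0" "(3::'a) \<noteq> 0"
  shows "(2::'a alg_closure) \<noteq> 0" "(3::'a alg_closure) \<noteq> 0"
  using assms to_ac_eq_0_iff[of "2::'a"] to_ac_eq_0_iff[of "3::'a"] by simp_all

lemma Aff_geom_points_iff:
  fixes E :: "'a::field weierstrass"
  assumes "(2::'a) \<noteq> 0" "(3::'a) \<noteq> 0"
  shows "from_short E x y \<in> geom_points E \<longleftrightarrow> on_short E x y"
  using weier_eval_short[OF ac_two_three[OF assms], of "map_weierstrass to_ac E"]
  by (auto simp: geom_points_def from_short_def map_weierstrass_short weierstrass.map_sel)

lemma geom_points_cases:
  fixes E :: "'a::field weierstrass"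
  assumes "(2::'a) \<noteq> 0" "(3::'a) \<noteq> 0" "P \<in> geom_points E" "P \<noteq> Infty"
  shows "\<exists>x y. P = from_short E x y \<and> on_short E x y"
proof -
  obtain x y where P: "P = Aff x y" using assms(4) by (cases P) auto
  define x1 where "x1 = x + to_ac (b\<^sub>2 E / 12)"
  define y1 where "y1 = y + (to_ac (a\<^sub>1 E) * x + to_ac (a\<^sub>3 E)) / 2"
  have "P = from_short E x1 y1" by (simp add: P from_short_def x1_def y1_def)
  then show ?thesis using Aff_geom_points_iff[OF assms(1,2)] assms(3) by blast
qed

section \<open>The affine coordinate ring\<close>

text \<open>The norm of a + b y down to polynomials in x, where y^2 = f. For a cubic f its degree is
  the pole order at infinity of a nonzero a + b y, with x of order 2 and y of order 3.\<close>

definition qnorm :: "'c::field poly \<Rightarrow> 'c poly \<Rightarrow> 'c poly \<Rightarrow> 'c poly" where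
  "qnorm f a b = a ^ 2 - f * b ^ 2"

lemma qnorm_mult: "qnorm f (a * a' + f * b * b') (a * b' + a' * b) = qnorm f a b * qnorm f a' b'"
  by (simp add: qnorm_def algebra_simps power2_eq_square)

lemma qnorm_smult: "qnorm f (smult c a) (smult c b) = smult (c ^ 2) (qnorm f a b)"
  by (simp add: qnorm_def smult_diff_right power2_eq_square)

text \<open>The degrees of a^2 and f b^2 have different parity, so no cancellation can
  occur.\<close>

lemma degree_qnorm:
  fixes f a b :: "'c::field poly"
  assumes "degree f = 3"
  shows "degree (qnorm f a b) = (if b = 0 then 2 * degree a else max (2 * degree a) (2 * degree b + 3))"
proof (cases "b = 0")
  case True
  then show ?thesis by (cases "a = 0") (simp_all add: qnorm_def degree_power_eq)
next
  case b: False
  have f0: "f \<noteq> 0" using assms by auto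
  have db: "degree (f * b ^ 2) = 2 * degree b + 3"
    using b f0 assms by (simp add: degree_mult_eq degree_power_eq)
  have da: "degree (a ^ 2) = 2 * degree a" by (cases "a = 0") (simp_all add: degree_power_eq)
  have "degree (a ^ 2) \<noteq> degree (f * b ^ 2)" unfolding da db by presburger
  then consider "degree (a ^ 2) < degree (f * b ^ 2)" | "degree (f * b ^ 2) < degree (a ^ 2)" by linarith
  then show ?thesis
  proof cases
    case 1
    then have "degree (a ^ 2 - f * b ^ 2) = degree (f * b ^ 2)" by (rule degree_diff_eq_right)
    then show ?thesis using b 1 unfolding qnorm_def da db by (simp add: max_def)
  next
    case 2
    then have "degree (a ^ 2 - f * b ^ 2) = degree (a ^ 2)" by (rule degree_diff_eq_left)
    then show ?thesis using b 2 unfolding qnorm_def da db by (simp add: max_def)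
  qed
qed

lemma qnorm_eq_0_iff:
  fixes f a b :: "'c::field poly"
  assumes "degree f = 3"
  shows "qnorm f a b = 0 \<longleftrightarrow> a = 0 \<and> b = 0"
proof
  assume h: "qnorm f a b = 0"
  then have "b = 0" using degree_qnorm[OF assms, of a b] by (auto split: if_splits)
  then show "a = 0 \<and> b = 0" using h by (simp add: qnorm_def)
qed (simp add: qnorm_def)

lemma degree_qnorm_add_le:
  fixes f :: "'c::field poly"
  assumes "degree f = 3" "degree (qnorm f a b) \<le> n" "degree (qnorm f a' b') \<le> n"
  shows "degree (qnorm f (a + a') (b + b')) \<le> n"
  using assms(2,3) degree_add_le_max[of a a'] degree_add_le_max[of b b']
  unfolding degree_qnorm[OF assms(1)] by (auto split: if_splits)

lemma degree_qnorm_add_eq: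
  fixes f :: "'c::field poly"
  assumes f: "degree f = 3" and "degree (qnorm f a b) = n" "degree (qnorm f a' b') < n"
  shows "degree (qnorm f (a + a') (b + b')) = n"
proof (rule antisym)
  show "degree (qnorm f (a + a') (b + b')) \<le> n" using degree_qnorm_add_le[OF f] assms by simp
  show "n \<le> degree (qnorm f (a + a') (b + b'))"
  proof (rule ccontr)
    assume h: "\<not> n \<le> degree (qnorm f (a + a') (b + b'))"
    have "degree (qnorm f (- a') (- b')) = degree (qnorm f a' b')" by (simp add: qnorm_def)
    have "degree (qnorm f (a + a' + - a') (b + b' + - b')) \<le> n - 1"
    proof (rule degree_qnorm_add_le[OF f])
      show "degree (qnorm f (a + a') (b + b')) \<le> n - 1" using h by linarith
      show "degree (qnorm f (- a') (- b')) \<le> n - 1" using assms(3) \<open>degree (qnorm f (- a') (- b')) = _\<close> by linarith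
    qed
    moreover have "a + a' + - a' = a" "b + b' + - b' = b" by simp_all
    ultimately have "degree (qnorm f a b) \<le> n - 1" by (simp only:)
    then show False using assms(2,3) by linarith
  qed
qed

text \<open>
  \<open>has_rep E n h\<close>: the function \<open>h\<close> is regular on the affine part of the curve, defined over the
  ground field, and has a pole of order at most \<open>n\<close> at infinity.
\<close>

definition rep :: "'a::field weierstrass \<Rightarrow> 'a poly \<Rightarrow> 'a poly \<Rightarrow> ('a alg_closure \<Rightarrow> 'a alg_closure \<Rightarrow> 'a alg_closure) \<Rightarrow> bool" where
  "rep E a b h \<longleftrightarrow> (\<forall>x y. on_short E x y \<longrightarrow> h x y = poly (ac a) x + poly (ac b) x * y)"

abbreviation wdeg :: "'a::field weierstrass \<Rightarrow> 'a poly \<Rightarrow> 'a poly \<Rightarrow> nat" where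
  "wdeg E a b \<equiv> degree (qnorm (cubic (short_A E) (short_B E)) a b)"

definition has_rep :: "'a::field weierstrass \<Rightarrow> nat \<Rightarrow> ('a alg_closure \<Rightarrow> 'a alg_closure \<Rightarrow> 'a alg_closure) \<Rightarrow> bool" where
  "has_rep E n h \<longleftrightarrow> (\<exists>a b. rep E a b h \<and> wdeg E a b \<le> n)"

lemma rep_add: "rep E a b h \<Longrightarrow> rep E a' b' h' \<Longrightarrow> rep E (a + a') (b + b') (\<lambda>x y. h x y + h' x y)"
  by (simp add: rep_def algebra_simps)

lemma rep_mult:
  "rep E a b h \<Longrightarrow> rep E a' b' h' \<Longrightarrow>
   rep E (a * a' + cubic (short_A E) (short_B E) * b * b') (a * b' + a' * b) (\<lambda>x y. h x y * h' x y)"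
  unfolding rep_def
proof (intro allI impI)
  fix x y assume h: "\<forall>x y. on_short E x y \<longrightarrow> h x y = poly (ac a) x + poly (ac b) x * y"
    and h': "\<forall>x y. on_short E x y \<longrightarrow> h' x y = poly (ac a') x + poly (ac b') x * y" and xy: "on_short E x y"
  have "poly (ac (a * a' + cubic (short_A E) (short_B E) * b * b')) x
      = poly (ac a) x * poly (ac a') x + y ^ 2 * poly (ac b) x * poly (ac b') x"
    by (simp only: ac_add ac_mult poly_add poly_mult xy)
  then show "h x y * h' x y = poly (ac (a * a' + cubic (short_A E) (short_B E) * b * b')) x + poly (ac (a * b' + a' * b)) x * y"
    unfolding h[rule_format, OF xy] h'[rule_format, OF xy] by (simp add: algebra_simps power2_eq_square)
qed

lemma has_rep_add: "has_rep E n h \<Longrightarrow> has_rep E n h' \<Longrightarrow> has_rep E n (\<lambda>x y. h x y + h' x y)"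
  unfolding has_rep_def using rep_add degree_qnorm_add_le[OF degree_cubic] by blast

lemma has_rep_mono: "has_rep E n h \<Longrightarrow> n \<le> m \<Longrightarrow> has_rep E m h"
  unfolding has_rep_def using le_trans by blast

lemma has_rep_mult:
  assumes "has_rep E n h" "has_rep E m h'"
  shows "has_rep E (n + m) (\<lambda>x y. h x y * h' x y)"
proof -
  obtain a b a' b' where *: "rep E a b h" "wdeg E a b \<le> n" "rep E a' b' h'" "wdeg E a' b' \<le> m"
    using assms unfolding has_rep_def by blast
  let ?f = "cubic (short_A E) (short_B E)"
  have "wdeg E (a * a' + ?f * b * b') (a * b' + a' * b) \<le> n + m"
    unfolding qnorm_mult using degree_mult_le[of "qnorm ?f a b" "qnorm ?f a' b'"] *(2,4) by linarith
  then show ?thesis unfolding has_rep_def using rep_mult[OF *(1,3)] by blast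
qed

lemma has_rep_const: "has_rep E n (\<lambda>x y. to_ac c)"
  unfolding has_rep_def rep_def
  by (rule exI[of _ "[:c:]"], rule exI[of _ 0]) (simp add: qnorm_def power2_eq_square)

lemma has_rep_x: "has_rep E 2 (\<lambda>x y. x)"
  unfolding has_rep_def rep_def
  by (rule exI[of _ "[:0, 1:]"], rule exI[of _ 0]) (simp add: qnorm_def degree_power_eq)

lemma has_rep_power: "has_rep E n h \<Longrightarrow> has_rep E (n * i) (\<lambda>x y. h x y ^ i)"
proof (induction i)
  case 0 show ?case using has_rep_const[of E 0 1] by simp
next
  case (Suc i) then show ?case using has_rep_mult[of E n h "n * i"] by (simp add: add.commute)
qed

lemma has_rep_sum: "(\<And>i. i \<in> I \<Longrightarrow> has_rep E n (h i)) \<Longrightarrow> has_rep E n (\<lambda>x y. \<Sum>i\<in>I. h i x y)"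
proof (induction I rule: infinite_finite_induct)
  case (insert i I)
  then show ?case using has_rep_add[of E n "h i"] by simp
qed (use has_rep_const[of E n 0] in simp_all)

definition xc :: "'a::field weierstrass \<Rightarrow> 'a alg_closure \<Rightarrow> 'a alg_closure" where
  "xc E x = x - to_ac (b\<^sub>2 E / 12)"

definition yc :: "'a::field weierstrass \<Rightarrow> 'a alg_closure \<Rightarrow> 'a alg_closure \<Rightarrow> 'a alg_closure" where
  "yc E x y = y - (to_ac (a\<^sub>1 E) * xc E x + to_ac (a\<^sub>3 E)) / 2"

lemma from_short_xc: "from_short E x y = Aff (xc E x) (yc E x y)"
  by (simp add: from_short_def xc_def yc_def)

lemma has_rep_xc: "has_rep E 2 (\<lambda>x y. xc E x)"
  using has_rep_add[OF has_rep_x has_rep_const[of E 2 "- (b\<^sub>2 E / 12)"]] by (simp add: xc_def)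

lemma rep_yc:
  obtains a where "rep E a 1 (yc E)" "wdeg E a 1 = 3" "degree a \<le> 1"
proof
  define a where "a = [:(a\<^sub>1 E * (b\<^sub>2 E / 12) - a\<^sub>3 E) / 2, - (a\<^sub>1 E / 2):]"
  show da: "degree a \<le> 1" by (simp add: a_def)
  show "wdeg E a 1 = 3" using da by (simp add: degree_qnorm)
  show "rep E a 1 (yc E)"
    unfolding rep_def a_def by (simp add: yc_def xc_def diff_divide_distrib add_divide_distrib algebra_simps)
qed

lemma has_rep_yc: "has_rep E 3 (yc E)"
  using rep_yc[of E] unfolding has_rep_def by (metis order_refl)

lemma rep_yc_power:
  "\<exists>a b. rep E a b (\<lambda>x y. yc E x y ^ d) \<and> wdeg E a b = 3 * d \<and> (a \<noteq> 0 \<or> b \<noteq> 0)"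
proof (induction d)
  case 0
  show ?case unfolding rep_def by (rule exI[of _ 1], rule exI[of _ 0]) (simp add: qnorm_def)
next
  case (Suc d)
  then obtain a b where ab: "rep E a b (\<lambda>x y. yc E x y ^ d)" "wdeg E a b = 3 * d" "a \<noteq> 0 \<or> b \<noteq> 0" by blast
  obtain a' where a': "rep E a' 1 (yc E)" "wdeg E a' 1 = 3" using rep_yc by blast
  let ?f = "cubic (short_A E) (short_B E)"
  let ?a = "a' * a + ?f * 1 * b" and ?b = "a' * b + 1 * a"
  have nz: "qnorm ?f a' 1 \<noteq> 0" "qnorm ?f a b \<noteq> 0" using ab(3) by (simp_all add: qnorm_eq_0_iff)
  have q: "qnorm ?f ?a ?b = qnorm ?f a' 1 * qnorm ?f a b"
    using qnorm_mult[of ?f a' a 1 b] by (simp add: add.commute)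
  have "wdeg E ?a ?b = 3 * Suc d" unfolding q using nz ab(2) a'(2) by (simp add: degree_mult_eq)
  moreover have "?a \<noteq> 0 \<or> ?b \<noteq> 0" using q nz by (metis degree_cubic mult_eq_0_iff qnorm_eq_0_iff)
  moreover have "rep E ?a ?b (\<lambda>x y. yc E x y ^ Suc d)" using rep_mult[OF a'(1) ab(1)] by simp
  ultimately show ?case by blast
qed

lemma rep_smult: "rep E a b h \<Longrightarrow> rep E (smult c a) (smult c b) (\<lambda>x y. to_ac c * h x y)"
  by (simp add: rep_def algebra_simps)

lemma form_eval_from_short:
  "form_eval d c (from_short E x y) = (\<Sum>i\<le>d. \<Sum>j\<le>d - i. to_ac (c i j) * xc E x ^ i * yc E x y ^ j)"
  by (simp add: form_eval_def from_short_xc)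

lemma form_eval_Infty: "form_eval d c Infty = to_ac (c 0 d)"
proof -
  have "form_eval d c Infty = (\<Sum>i\<le>d. \<Sum>j\<le>d - i. to_ac (c i j) * 0 ^ i * 0 ^ (d - i - j))"
    by (simp add: form_eval_def)
  also have "\<dots> = (\<Sum>i\<le>d. if i = 0 then to_ac (c 0 d) else 0)"
  proof (rule sum.cong[OF refl])
    fix i
    show "(\<Sum>j\<le>d - i. to_ac (c i j) * 0 ^ i * 0 ^ (d - i - j)) = (if i = 0 then to_ac (c 0 d) else (0 :: 'a alg_closure))"
    proof (cases "i = 0")
      case True
      have "(\<Sum>j\<le>d. to_ac (c 0 j) * 0 ^ (d - j)) = (\<Sum>j\<le>d. if j = d then to_ac (c 0 d) else (0 :: 'a alg_closure))"
        by (rule sum.cong) (auto simp: power_0_left)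
      then show ?thesis using True by simp
    qed (simp add: power_0_left)
  qed
  finally show ?thesis by simp
qed

text \<open>Among the x^i y^j with i + j <= d only y^d has pole order 3 d; its coefficient is the
  value of the form at infinity.\<close>

lemma form_eval_decompose:
  "\<exists>h. has_rep E (3 * d - 1) h \<and>
    (\<forall>x y. form_eval d c (from_short E x y) = to_ac (c 0 d) * yc E x y ^ d + h x y)"
proof -
  define T where "T i j x y = to_ac (c i j) * xc E x ^ i * yc E x y ^ j" for i j x y
  define h where "h x y = (\<Sum>i\<le>d. \<Sum>j\<le>d - i. if i = 0 \<and> j = d then 0 else T i j x y)" for x y
  have T: "has_rep E (2 * i + 3 * j) (T i j)" for i j
    unfolding T_def
    using has_rep_mult[OF has_rep_mult[OF has_rep_const[of E 0 "c i j"] has_rep_power[OF has_rep_xc, of E i]]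
        has_rep_power[OF has_rep_yc, of E j]] by simp
  have "has_rep E (3 * d - 1) h"
    unfolding h_def
  proof (intro has_rep_sum)
    fix i j assume ij: "i \<in> {..d}" "j \<in> {..d - i}"
    show "has_rep E (3 * d - 1) (\<lambda>x y. if i = 0 \<and> j = d then 0 else T i j x y)"
    proof (cases "i = 0 \<and> j = d")
      case True then show ?thesis using has_rep_const[of E "3 * d - 1" 0] by simp
    next
      case False
      then have "2 * i + 3 * j \<le> 3 * d - 1" using ij by auto
      then have "has_rep E (3 * d - 1) (T i j)" using T has_rep_mono by blast
      then show ?thesis using False by (simp only: if_False)
    qed
  qed
  moreover have "form_eval d c (from_short E x y) = to_ac (c 0 d) * yc E x y ^ d + h x y" for x y
  proof -
    have "form_eval d c (from_short E x y) = (\<Sum>i\<le>d. \<Sum>j\<le>d - i. T i j x y)"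
      by (simp add: form_eval_from_short T_def)
    also have "\<dots> = (\<Sum>i\<le>d. (if i = 0 then T 0 d x y else 0) + (\<Sum>j\<le>d - i. if i = 0 \<and> j = d then 0 else T i j x y))"
    proof (rule sum.cong[OF refl])
      fix i
      have "(\<Sum>j\<le>d - i. T i j x y) = (\<Sum>j\<le>d - i. (if i = 0 \<and> j = d then T 0 d x y else 0) + (if i = 0 \<and> j = d then 0 else T i j x y))"
        by (rule sum.cong) auto
      also have "\<dots> = (\<Sum>j\<le>d - i. if i = 0 \<and> j = d then T 0 d x y else 0) + (\<Sum>j\<le>d - i. if i = 0 \<and> j = d then 0 else T i j x y)"
        by (rule sum.distrib)
      also have "(\<Sum>j\<le>d - i. if i = 0 \<and> j = d then T 0 d x y else 0) = (if i = 0 then T 0 d x y else 0)"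
        by (cases "i = 0") simp_all
      finally show "(\<Sum>j\<le>d - i. T i j x y) = (if i = 0 then T 0 d x y else 0) + (\<Sum>j\<le>d - i. if i = 0 \<and> j = d then 0 else T i j x y)" .
    qed
    also have "\<dots> = T 0 d x y + h x y" by (simp add: sum.distrib h_def)
    finally show ?thesis by (simp add: T_def)
  qed
  ultimately show ?thesis by blast
qed

lemma rep_form:
  obtains a b where "rep E a b (\<lambda>x y. form_eval d c (from_short E x y))"
    "c 0 d = 0 \<Longrightarrow> wdeg E a b \<le> 3 * d - 1" "c 0 d \<noteq> 0 \<Longrightarrow> wdeg E a b = 3 * d \<and> (a \<noteq> 0 \<or> b \<noteq> 0)"
proof -
  obtain h where h: "has_rep E (3 * d - 1) h"
    "\<And>x y. form_eval d c (from_short E x y) = to_ac (c 0 d) * yc E x y ^ d + h x y"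
    using form_eval_decompose[of E d c] by blast
  obtain a b where ab: "rep E a b h" "wdeg E a b \<le> 3 * d - 1" using h(1) by (auto simp: has_rep_def)
  obtain a' b' where ab': "rep E a' b' (\<lambda>x y. yc E x y ^ d)" "wdeg E a' b' = 3 * d" "a' \<noteq> 0 \<or> b' \<noteq> 0"
    using rep_yc_power by blast
  show ?thesis
  proof (cases "c 0 d = 0")
    case True
    then show ?thesis using that[of a b] ab h(2) by simp
  next
    case False
    let ?a = "smult (c 0 d) a' + a" and ?b = "smult (c 0 d) b' + b"
    have r: "rep E ?a ?b (\<lambda>x y. form_eval d c (from_short E x y))"
      unfolding h(2) using rep_add[OF rep_smult[OF ab'(1)] ab(1)] .
    have s: "wdeg E (smult (c 0 d) a') (smult (c 0 d) b') = 3 * d"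
      using ab'(2) False by (simp add: qnorm_smult)
    show ?thesis
    \<comment> \<open>For d = 0 the bound 3 d - 1 is truncated to 0 and no longer strict; the form
      is then a constant.\<close>
    proof (cases "d = 0")
      case d: True
      have r0: "rep E [:c 0 0:] 0 (\<lambda>x y. form_eval d c (from_short E x y))"
        by (simp add: rep_def d form_eval_from_short)
      show ?thesis by (rule that[OF r0]) (use False d in \<open>auto simp: qnorm_def power2_eq_square\<close>)
    next
      case d: False
      have w: "wdeg E ?a ?b = 3 * d"
        by (rule degree_qnorm_add_eq[OF degree_cubic s]) (use ab(2) d in linarith)
      have "?a \<noteq> 0 \<or> ?b \<noteq> 0"
      proof (rule ccontr)
        assume "\<not> (?a \<noteq> 0 \<or> ?b \<noteq> 0)"
        then have "?a = 0" "?b = 0" by blast+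
        then have "wdeg E ?a ?b = 0" by (simp only: qnorm_def) simp
        then show False using w d by simp
      qed
      then show ?thesis using that[OF r] w False by simp
    qed
  qed
qed

lemma point_over:
  obtains y where "on_short E x y"
  using sqrt_exists by metis

lemma rep_nonzero_off_norm:
  assumes "rep E a b h" "on_short E x y" "poly (ac (qnorm (cubic (short_A E) (short_B E)) a b)) x \<noteq> 0"
  shows "h x y \<noteq> 0"
proof
  assume "h x y = 0"
  then have "poly (ac a) x + poly (ac b) x * y = 0" using assms(1,2) by (simp add: rep_def)
  then have "(poly (ac a) x + poly (ac b) x * y) * (poly (ac a) x - poly (ac b) x * y) = 0" by simp
  then have "poly (ac a) x ^ 2 - poly (ac b) x ^ 2 * y ^ 2 = 0" by (simp add: algebra_simps power2_eq_square)
  then show False using assms(2,3) by (simp add: qnorm_def algebra_simps del: ac_cubic poly_cubic)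
qed

section \<open>Isogenies in short Weierstrass form\<close>

lemma exists_nonroot:
  fixes p :: "'c::alg_closed_field poly"
  assumes "p \<noteq> 0"
  shows "\<exists>x. poly p x \<noteq> 0"
proof (rule ccontr)
  assume "\<nexists>x. poly p x \<noteq> 0"
  then have "p = 0" by (intro poly_eqI_alg_closed) simp
  then show False using assms by blast
qed

text \<open>The degree inequalities say that (c + d y)/w, respectively (a + b y)/w, has a pole at
  infinity: if the second coordinate has one, so has the first. Otherwise the right side, after
  cancellation of w^2, has degree at most 3 degree w, while c^2 + d^2 f suffers no cancellation and
  makes the left side larger.\<close>

lemma degree_cubic_relation:
  fixes a b c d f w :: "'a::field poly"
  assumes f: "degree f = 3" and w: "w \<noteq> 0"
    and eq: "(c ^ 2 + d ^ 2 * f) * w ^ 3 = w ^ 2 * (a ^ 3 + 3 * a * b ^ 2 * f + smult A (a * w ^ 2) + smult B (w ^ 3))"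
    and c: "2 * degree w < degree (qnorm f c d)"
  shows "2 * degree w < degree (qnorm f a b)"
proof (rule ccontr)
  assume "\<not> 2 * degree w < degree (qnorm f a b)"
  then have k: "degree (qnorm f a b) \<le> 2 * degree w" by simp
  have a: "degree a \<le> degree w" and b: "b = 0 \<or> 2 * degree b + 3 \<le> 2 * degree w"
    using k unfolding degree_qnorm[OF f] by (auto split: if_splits)
  have "w ^ 2 * ((c ^ 2 + d ^ 2 * f) * w) = w ^ 2 * (a ^ 3 + 3 * a * b ^ 2 * f + smult A (a * w ^ 2) + smult B (w ^ 3))"
    using eq by (simp add: power2_eq_square power3_eq_cube mult_ac)
  moreover have "w ^ 2 \<noteq> 0" using w by simp
  ultimately have e: "(c ^ 2 + d ^ 2 * f) * w = a ^ 3 + 3 * a * b ^ 2 * f + smult A (a * w ^ 2) + smult B (w ^ 3)"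
    using mult_left_cancel by blast
  have pw: "degree (p ^ n) \<le> n * degree p" for p :: "'a poly" and n using degree_power_le[of p n] by (simp add: mult.commute)
  have "degree (a ^ 3) \<le> 3 * degree w" using pw[of a 3] a by linarith
  moreover have "degree (3 * a * b ^ 2 * f) \<le> 3 * degree w"
  proof (cases "b = 0")
    case False
    have "degree (3 * a * b ^ 2 * f) \<le> degree (3 :: 'a poly) + degree a + degree (b ^ 2) + degree f"
      by (meson add_le_mono degree_mult_le le_refl le_trans)
    then show ?thesis using pw[of b 2] a b False f by simp
  qed simp
  moreover have "degree (smult A (a * w ^ 2)) \<le> 3 * degree w"
    using degree_smult_le[of A "a * w ^ 2"] degree_mult_le[of a "w ^ 2"] pw[of w 2] a by linarith
  moreover have "degree (smult B (w ^ 3)) \<le> 3 * degree w"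
    using degree_smult_le[of B "w ^ 3"] pw[of w 3] by linarith
  ultimately have r: "degree ((c ^ 2 + d ^ 2 * f) * w) \<le> 3 * degree w"
    unfolding e by (intro degree_add_le)
  have q: "c ^ 2 + d ^ 2 * f = qnorm (- f) c d" by (simp add: qnorm_def mult.commute)
  have "degree (- f) = 3" using f by simp
  then have dq: "degree (c ^ 2 + d ^ 2 * f) = degree (qnorm f c d)"
    unfolding q degree_qnorm[OF f] by (simp add: degree_qnorm)
  then have "c ^ 2 + d ^ 2 * f \<noteq> 0" using c by auto
  then have "degree ((c ^ 2 + d ^ 2 * f) * w) = degree (qnorm f c d) + degree w"
    using w dq by (simp add: degree_mult_eq)
  then show False using r c by linarith
qed

text \<open>On the left the norm dominates, so the left side has degree 2 k with k the pole order of
  a + b y; the right side has degree at most 3 degree w plus the larger of degree a and degree w,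
  which is smaller. So a point with a pole at infinity and its conjugate cannot lie on a chord with
  constant affine third point.\<close>

lemma chord_impossible:
  fixes a b f w :: "'c::field poly"
  assumes f: "degree f = 3" and k: "2 * degree w < degree (qnorm f a b)"
    and eq: "(a ^ 2 - b ^ 2 * f - smult e (a * w) - smult e' (w ^ 2)) ^ 2 = smult g (w ^ 3 * (2 * a + smult e'' w))"
  shows False
proof -
  let ?k = "degree (qnorm f a b)"
  have q: "a ^ 2 - b ^ 2 * f = qnorm f a b" by (simp add: qnorm_def mult.commute)
  have a: "2 * degree a \<le> ?k" unfolding degree_qnorm[OF f] by simp
  have pw: "degree (p ^ n) \<le> n * degree p" for p :: "'c poly" and n using degree_power_le[of p n] by (simp add: mult.commute)
  have "degree (smult e (a * w)) < ?k"
    using degree_smult_le[of e "a * w"] degree_mult_le[of a w] a k by linarith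
  moreover have "degree (smult e' (w ^ 2)) < ?k"
    using degree_smult_le[of e' "w ^ 2"] pw[of w 2] k by linarith
  ultimately have l: "degree (a ^ 2 - b ^ 2 * f - smult e (a * w) - smult e' (w ^ 2)) = ?k"
    unfolding q by (simp add: degree_diff_eq_left)
  then have "a ^ 2 - b ^ 2 * f - smult e (a * w) - smult e' (w ^ 2) \<noteq> 0" using k by auto
  then have L: "degree ((a ^ 2 - b ^ 2 * f - smult e (a * w) - smult e' (w ^ 2)) ^ 2) = 2 * ?k"
    using l by (simp add: degree_power_eq)
  have "degree (2 * a) \<le> degree a" using degree_mult_le[of 2 a] by simp
  moreover have "degree (smult e'' w) \<le> degree w" by (rule degree_smult_le)
  ultimately have "degree (2 * a + smult e'' w) \<le> max (degree a) (degree w)"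
    by (intro degree_add_le) auto
  then have "degree (smult g (w ^ 3 * (2 * a + smult e'' w))) \<le> 3 * degree w + max (degree a) (degree w)"
    using degree_smult_le[of g "w ^ 3 * (2 * a + smult e'' w)"] degree_mult_le[of "w ^ 3" "2 * a + smult e'' w"] pw[of w 3]
    by linarith
  then show False using L eq a k by (auto simp: max_def split: if_splits)
qed

lemma short_discriminant_nonzero:
  fixes E :: "'a::field weierstrass"
  assumes "(2::'a) \<noteq> 0" "(3::'a) \<noteq> 0" "elliptic E"
  shows "4 * short_A E ^ 3 + 27 * short_B E ^ 2 \<noteq> 0"
    "4 * to_ac (short_A E) ^ 3 + 27 * to_ac (short_B E) ^ 2 \<noteq> 0"
proof -
  show *: "4 * short_A E ^ 3 + 27 * short_B E ^ 2 \<noteq> 0"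
  proof
    assume "4 * short_A E ^ 3 + 27 * short_B E ^ 2 = 0"
    then have "discr E = - 16 * 0" using short_discriminant[OF assms(1,2), of E] by simp
    then show False using assms(3) by (simp add: elliptic_def)
  qed
  have "4 * to_ac (short_A E) ^ 3 + 27 * to_ac (short_B E) ^ 2 = to_ac (4 * short_A E ^ 3 + 27 * short_B E ^ 2)"
    by simp
  then show "4 * to_ac (short_A E) ^ 3 + 27 * to_ac (short_B E) ^ 2 \<noteq> 0" using * by (metis to_ac_eq_0_iff)
qed

definition local_forms where
  "local_forms E \<phi> d F G H \<longleftrightarrow> (\<forall>Q\<in>geom_points E. (form_eval d F Q, form_eval d G Q, form_eval d H Q) \<noteq> (0, 0, 0) \<longrightarrow>
     (\<exists>u. u \<noteq> 0 \<and> (case proj_coords (\<phi> Q) of (x, y, z) \<Rightarrow>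
        (form_eval d F Q, form_eval d G Q, form_eval d H Q) = (u * x, u * y, u * z))))"

lemma local_formsD:
  assumes "local_forms E \<phi> d F G H" "Q \<in> geom_points E"
    "(form_eval d F Q, form_eval d G Q, form_eval d H Q) \<noteq> (0, 0, 0)"
  shows "\<exists>u. u \<noteq> 0 \<and> (case \<phi> Q of Infty \<Rightarrow> form_eval d F Q = 0 \<and> form_eval d H Q = 0
    | Aff x y \<Rightarrow> form_eval d F Q = u * x \<and> form_eval d G Q = u * y \<and> form_eval d H Q = u)"
proof -
  from bspec[OF assms(1)[unfolded local_forms_def] assms(2), THEN mp, OF assms(3)]
  obtain u where "u \<noteq> 0 \<and> (case proj_coords (\<phi> Q) of (x, y, z) \<Rightarrow>
        (form_eval d F Q, form_eval d G Q, form_eval d H Q) = (u * x, u * y, u * z))" by (rule exE)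
  then show ?thesis by (intro exI[of _ u]) (cases "\<phi> Q"; simp)
qed

lemma local_forms_Aff:
  assumes "local_forms E \<phi> d F G H" "Q \<in> geom_points E" "form_eval d H Q \<noteq> 0"
  shows "\<phi> Q = Aff (form_eval d F Q / form_eval d H Q) (form_eval d G Q / form_eval d H Q)"
proof -
  have "(form_eval d F Q, form_eval d G Q, form_eval d H Q) \<noteq> (0, 0, 0)" using assms(3) by simp
  from local_formsD[OF assms(1,2) this] show ?thesis using assms(3) by (cases "\<phi> Q") auto
qed

lemma local_forms_Infty:
  assumes "local_forms E \<phi> d F G H" "Q \<in> geom_points E" "form_eval d H Q = 0"
    "(form_eval d F Q, form_eval d G Q, form_eval d H Q) \<noteq> (0, 0, 0)"
  shows "\<phi> Q = Infty"
  using local_formsD[OF assms(1,2,4)] assms(3) by (cases "\<phi> Q") auto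

text \<open>P and -P are conjugate over the rational functions of x, hence so are their images.
  \<open>quadratic_fraction_cases\<close> applies to the image point written over the field of
  functions of x and y; the pole at infinity leaves only the case that the images are opposite, in
  which the first coordinate is free of y and the second is y times a function of x.\<close>

lemma isogeny_short_form:
  fixes E E' :: "'a::field weierstrass"
  assumes two: "(2::'a) \<noteq> 0" and three: "(3::'a) \<noteq> 0" and ell': "elliptic E'"
    and iso: "rational_isogeny E E' \<phi>"
  obtains N D V W s t :: "'a poly" where "s * N + t * D = 1" "D \<noteq> 0" "W \<noteq> 0" "V \<noteq> 0" "degree D < degree N"
    "cubic (short_A E) (short_B E) * V ^ 2 * D ^ 3
       = W ^ 2 * (N ^ 3 + smult (short_A E') (N * D ^ 2) + smult (short_B E') (D ^ 3))"
    "\<And>x y. on_short E x y \<Longrightarrow> poly (ac W) x \<noteq> 0 \<Longrightarrow> poly (ac D) x \<noteq> 0 \<and>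
       on_short E' (poly (ac N) x / poly (ac D) x) (y * poly (ac V) x / poly (ac W) x) \<and>
       \<phi> (from_short E x y) = from_short E' (poly (ac N) x / poly (ac D) x) (y * poly (ac V) x / poly (ac W) x)"
proof -
  define f where "f = cubic (short_A E) (short_B E)"
  have f3: "degree f = 3" by (simp add: f_def)
  have two': "(2::'a alg_closure) \<noteq> 0" using ac_two_three[OF two three] by blast
  have rm: "rational_morphism E E' \<phi>" and \<phi>0: "\<phi> Infty = Infty"
    and nonconst: "\<exists>P\<in>geom_points E. \<phi> P \<noteq> Infty"
    using iso unfolding rational_isogeny_def by simp_all
  have mor: "\<phi> ` geom_points E \<subseteq> geom_points E'"
    using rm unfolding rational_morphism_def by (rule conjunct1)
  have mor': "\<forall>P\<in>geom_points E. \<exists>d F G H. (form_eval d F P, form_eval d G P, form_eval d H P) \<noteq> (0, 0, 0) \<and>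
      local_forms E \<phi> d F G H"
    using rm unfolding rational_morphism_def local_forms_def by (rule conjunct2)
  note loc = bspec[OF mor']
  have inf: "Infty \<in> geom_points E" by (simp add: geom_points_def)
  from loc[OF this] obtain d F G H where
    nzI: "(form_eval d F Infty, form_eval d G Infty, form_eval d H Infty) \<noteq> (0, 0, 0)"
    and at: "local_forms E \<phi> d F G H" by (elim exE conjE)
  have H0d: "H 0 d = 0"
    using local_forms_Aff[OF at inf] \<phi>0 by (auto simp: form_eval_Infty)
  have F0d: "F 0 d = 0" using local_formsD[OF at inf nzI] by (auto simp: \<phi>0 form_eval_Infty)
  have FGH0: "F 0 d = 0" "H 0 d = 0" "G 0 d \<noteq> 0"
    using F0d H0d nzI by (simp_all add: form_eval_Infty)
  obtain aF bF where rF: "rep E aF bF (\<lambda>x y. form_eval d F (from_short E x y))" "wdeg E aF bF \<le> 3 * d - 1"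
    using rep_form[where E = E and d = d and c = F] FGH0 by metis
  obtain aH bH where rH: "rep E aH bH (\<lambda>x y. form_eval d H (from_short E x y))" "wdeg E aH bH \<le> 3 * d - 1"
    using rep_form[where E = E and d = d and c = H] FGH0 by metis
  obtain aG bG where rG: "rep E aG bG (\<lambda>x y. form_eval d G (from_short E x y))" "wdeg E aG bG = 3 * d" "aG \<noteq> 0 \<or> bG \<noteq> 0"
    using rep_form[where E = E and d = d and c = G] FGH0 by metis
  have geom: "from_short E x y \<in> geom_points E" if "on_short E x y" for x y
    using Aff_geom_points_iff[OF two three] that by blast
  \<comment> \<open>If H vanished at all affine points, the isogeny would give the origin wherever G
    is nonzero, while the chart at a point not sent to the origin gives affine values wherever its
    own third form is nonzero. Both hold for all but finitely many x.\<close>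
  have "\<exists>x y. on_short E x y \<and> form_eval d H (from_short E x y) \<noteq> 0"
  proof (rule ccontr)
    assume "\<not> ?thesis"
    then have H0: "form_eval d H (from_short E x y) = 0" if "on_short E x y" for x y using that by blast
    obtain P where P: "P \<in> geom_points E" "\<phi> P \<noteq> Infty" using nonconst by blast
    then have "P \<noteq> Infty" using \<phi>0 by auto
    then obtain x1 y1 where xy1: "P = from_short E x1 y1" "on_short E x1 y1"
      using geom_points_cases[OF two three P(1)] by blast
    from loc[OF P(1)] obtain d1 F1 G1 H1 where
      nz1: "(form_eval d1 F1 P, form_eval d1 G1 P, form_eval d1 H1 P) \<noteq> (0, 0, 0)"
      and at1: "local_forms E \<phi> d1 F1 G1 H1" by (elim exE conjE)
    have H1P: "form_eval d1 H1 P \<noteq> 0" using local_forms_Infty[OF at1 P(1) _ nz1] P(2) by blast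
    obtain a1 b1 where r1: "rep E a1 b1 (\<lambda>x y. form_eval d1 H1 (from_short E x y))"
      using rep_form[where E = E and d = d1 and c = H1] by metis
    have nz: "a1 \<noteq> 0 \<or> b1 \<noteq> 0" using r1 H1P xy1 by (auto simp: rep_def)
    have "qnorm f aG bG \<noteq> 0" "qnorm f a1 b1 \<noteq> 0" using nz rG(3) by (simp_all add: qnorm_eq_0_iff[OF f3])
    then have "ac (qnorm f aG bG * qnorm f a1 b1) \<noteq> 0" by simp
    then obtain x where "poly (ac (qnorm f aG bG * qnorm f a1 b1)) x \<noteq> 0" using exists_nonroot by blast
    then have x: "poly (ac (qnorm f aG bG)) x \<noteq> 0" "poly (ac (qnorm f a1 b1)) x \<noteq> 0" by auto
    obtain y where y: "on_short E x y" using point_over by blast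
    let ?Q = "from_short E x y"
    have GQ: "form_eval d G ?Q \<noteq> 0" and HQ: "form_eval d1 H1 ?Q \<noteq> 0"
      using rep_nonzero_off_norm[OF rG(1) y] rep_nonzero_off_norm[OF r1 y] x unfolding f_def by auto
    have "\<phi> ?Q = Infty" using local_forms_Infty[OF at geom[OF y] H0[OF y]] GQ by simp
    moreover have "\<phi> ?Q \<noteq> Infty" using local_forms_Aff[OF at1 geom[OF y] HQ] by simp
    ultimately show False by blast
  qed
  then obtain x0 y0 where xy0: "on_short E x0 y0" "form_eval d H (from_short E x0 y0) \<noteq> 0" by blast
  have H0: "aH \<noteq> 0 \<or> bH \<noteq> 0" using rH(1) xy0 by (auto simp: rep_def)
  have d0: "d \<noteq> 0"
  proof
    assume "d = 0"
    then show False using xy0(2) FGH0(2) by (simp add: form_eval_from_short)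
  qed
  define w where "w = qnorm f aH bH"
  have w0: "w \<noteq> 0" using H0 by (simp add: w_def qnorm_eq_0_iff[OF f3])
  have dw: "degree w < 3 * d" using rH(2) d0 by (simp add: w_def f_def)
  \<comment> \<open>\<beta>, \<gamma> and \<delta> pass to the short form of \<open>E'\<close>: the
    new coordinates are X + \<beta> and Y + \<gamma> X + \<delta>.\<close>
  define \<beta> where "\<beta> = b\<^sub>2 E' / 12"
  define aX bX where "aX = aF + smult \<beta> aH" and "bX = bF + smult \<beta> bH"
  define \<gamma> \<delta> where "\<gamma> = a\<^sub>1 E' / 2" and "\<delta> = a\<^sub>3 E' / 2"
  define aY bY where "aY = aG + (smult \<gamma> aF + smult \<delta> aH)" and "bY = bG + (smult \<gamma> bF + smult \<delta> bH)"
  \<comment> \<open>Since the origin goes to the origin, G has pole order exactly 3 d while F and H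
    have less, so the shift cannot lower it.\<close>
  have dY: "degree (qnorm f aY bY) = 3 * d"
  proof -
    have sm: "degree (qnorm f (smult c a') (smult c b')) \<le> degree (qnorm f a' b')" for c a' b'
      unfolding qnorm_smult by (rule degree_smult_le)
    have "degree (qnorm f (smult \<gamma> aF + smult \<delta> aH) (smult \<gamma> bF + smult \<delta> bH)) \<le> 3 * d - 1"
      by (rule degree_qnorm_add_le[OF f3])
        (use sm[of \<gamma> aF bF] sm[of \<delta> aH bH] rF(2) rH(2) in \<open>simp_all add: f_def\<close>)
    then have "degree (qnorm f (smult \<gamma> aF + smult \<delta> aH) (smult \<gamma> bF + smult \<delta> bH)) < 3 * d" using d0 by simp
    then show ?thesis unfolding aY_def bY_def using rG(2) by (intro degree_qnorm_add_eq[OF f3]) (simp_all add: f_def)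
  qed
  \<comment> \<open>Multiplication by the conjugate aH - bH y turns the common denominator into its
    norm \<open>w\<close>.\<close>
  define a b where "a = aX * aH + f * bX * (- bH)" and "b = aX * (- bH) + aH * bX"
  define c d' where "c = aY * aH + f * bY * (- bH)" and "d' = aY * (- bH) + aH * bY"
  have wm: "qnorm f aH (- bH) = w" by (simp add: w_def qnorm_def)
  have qc: "qnorm f c d' = qnorm f aY bY * w" unfolding c_def d'_def qnorm_mult wm ..
  have "degree (qnorm f c d') = 3 * d + degree w"
    unfolding qc using w0 dY d0 by (subst degree_mult_eq) auto
  then have kc: "2 * degree w < degree (qnorm f c d')" using dw by simp
  have good: "\<exists>u v. \<phi> (from_short E x y) = from_short E' u v \<and> on_short E' u v \<and>
      u * poly (ac w) x = poly (ac a) x + poly (ac b) x * y \<and> v * poly (ac w) x = poly (ac c) x + poly (ac d') x * y"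
    if xy: "on_short E x y" and wx: "poly (ac w) x \<noteq> 0" for x y
  proof -
    let ?P = "from_short E x y"
    define F0 G0 H0 where "F0 = form_eval d F ?P" and "G0 = form_eval d G ?P" and "H0 = form_eval d H ?P"
    have H0nz: "H0 \<noteq> 0" using rep_nonzero_off_norm[OF rH(1) xy] wx by (simp add: H0_def w_def f_def)
    then have \<phi>P: "\<phi> ?P = Aff (F0 / H0) (G0 / H0)"
      using local_forms_Aff[OF at geom[OF xy]] unfolding F0_def G0_def H0_def by blast
    have "\<phi> ?P \<in> geom_points E'" using mor geom[OF xy] by blast
    then obtain u v where uv: "\<phi> ?P = from_short E' u v" "on_short E' u v"
      using geom_points_cases[OF two three, of "\<phi> ?P" E'] \<phi>P by auto
    have "xc E' u = F0 / H0" "yc E' u v = G0 / H0" using uv(1) \<phi>P by (simp_all add: from_short_xc)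
    then have FG: "F0 = xc E' u * H0" "G0 = yc E' u v * H0" using H0nz by simp_all
    have Hx: "H0 = poly (ac aH) x + poly (ac bH) x * y" "F0 = poly (ac aF) x + poly (ac bF) x * y"
      "G0 = poly (ac aG) x + poly (ac bG) x * y"
      using rH(1) rF(1) rG(1) xy by (simp_all add: rep_def F0_def G0_def H0_def)
    have u1: "u * H0 = poly (ac aX) x + poly (ac bX) x * y"
    proof -
      have "u * H0 = F0 + to_ac \<beta> * H0" unfolding FG(1) by (simp add: xc_def \<beta>_def algebra_simps)
      then show ?thesis unfolding Hx aX_def bX_def by (simp add: algebra_simps)
    qed
    have v1: "v * H0 = poly (ac aY) x + poly (ac bY) x * y"
    proof -
      have "v = yc E' u v + (to_ac \<gamma> * xc E' u + to_ac \<delta>)"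
        by (simp add: yc_def \<gamma>_def \<delta>_def add_divide_distrib)
      then have "v * H0 = G0 + (to_ac \<gamma> * F0 + to_ac \<delta> * H0)"
        unfolding FG by (metis distrib_right mult.assoc)
      then show ?thesis unfolding Hx aY_def bY_def by (simp add: algebra_simps)
    qed
    have r: "poly (ac (p * aH + f * q * (- bH))) x + poly (ac (p * (- bH) + aH * q)) x * y
       = (poly (ac p) x + poly (ac q) x * y) * (poly (ac aH) x - poly (ac bH) x * y)" for p q
    proof -
      have "poly (ac (p * aH + f * q * (- bH))) x = poly (ac p) x * poly (ac aH) x - y ^ 2 * poly (ac q) x * poly (ac bH) x"
        by (simp only: ac_add ac_mult ac_minus poly_add poly_mult poly_minus xy f_def) simp
      then show ?thesis by (simp add: algebra_simps power2_eq_square)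
    qed
    have "poly (ac w) x = H0 * (poly (ac aH) x - poly (ac bH) x * y)"
    proof -
      have "poly (ac w) x = poly (ac aH) x ^ 2 - y ^ 2 * poly (ac bH) x ^ 2"
        by (simp only: w_def qnorm_def ac_diff ac_mult ac_power poly_diff poly_mult poly_power xy f_def)
      then show ?thesis unfolding Hx by (simp add: algebra_simps power2_eq_square)
    qed
    then have "u * poly (ac w) x = poly (ac a) x + poly (ac b) x * y" "v * poly (ac w) x = poly (ac c) x + poly (ac d') x * y"
      unfolding a_def b_def c_def d'_def r u1[symmetric] v1[symmetric] by (simp_all add: mult.assoc)
    then show ?thesis using uv by blast
  qed
  let ?A = "short_A E'" and ?B = "short_B E'"
  define E1 where "E1 = (c ^ 2 + d' ^ 2 * f) * w ^ 3 - w ^ 2 * (a ^ 3 + 3 * a * b ^ 2 * f + smult ?A (a * w ^ 2) + smult ?B (w ^ 3))"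
  define E2 where "E2 = 2 * c * d' * w ^ 3 - w ^ 2 * (3 * a ^ 2 * b + b ^ 3 * f + smult ?A (b * w ^ 2))"
  have "ac E1 = 0 \<and> ac E2 = 0"
  proof (rule quadratic_components_zero[OF two', where q = "ac f" and F = "{x. poly (ac w) x = 0}"])
    show "ac f \<noteq> 0" using f3 by auto
    show "finite {x. poly (ac w) x = 0}" by (rule poly_roots_finite) (use w0 in simp)
    fix x y assume "x \<notin> {x. poly (ac w) x = 0}" and y: "y ^ 2 = poly (ac f) x"
    then have wx: "poly (ac w) x \<noteq> 0" and xy: "on_short E x y" by (simp_all add: f_def)
    obtain u v where uv: "on_short E' u v"
      "u * poly (ac w) x = poly (ac a) x + poly (ac b) x * y" "v * poly (ac w) x = poly (ac c) x + poly (ac d') x * y"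
      using good[OF xy wx] by blast
    have v2: "v ^ 2 = u ^ 3 + to_ac ?A * u + to_ac ?B" using uv(1) by simp
    have e1: "poly (ac E1) x = (poly (ac c) x ^ 2 + poly (ac d') x ^ 2 * poly (ac f) x) * poly (ac w) x ^ 3 - poly (ac w) x ^ 2 *
         (poly (ac a) x ^ 3 + 3 * poly (ac a) x * poly (ac b) x ^ 2 * poly (ac f) x
          + to_ac ?A * (poly (ac a) x * poly (ac w) x ^ 2) + to_ac ?B * poly (ac w) x ^ 3)"
      unfolding E1_def by (simp only: ac_add ac_diff ac_mult ac_smult ac_power ac_numeral poly_add poly_diff poly_mult poly_smult poly_power poly_numeral)
    have e2: "poly (ac E2) x = 2 * poly (ac c) x * poly (ac d') x * poly (ac w) x ^ 3 - poly (ac w) x ^ 2 *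
         (3 * poly (ac a) x ^ 2 * poly (ac b) x + poly (ac b) x ^ 3 * poly (ac f) x
          + to_ac ?A * (poly (ac b) x * poly (ac w) x ^ 2))"
      unfolding E2_def by (simp only: ac_add ac_diff ac_mult ac_smult ac_power ac_numeral poly_add poly_diff poly_mult poly_smult poly_power poly_numeral)
    have "poly (ac E1) x + poly (ac E2) x * y = (v * poly (ac w) x) ^ 2 * poly (ac w) x ^ 3 - poly (ac w) x ^ 2 *
        ((u * poly (ac w) x) ^ 3 + to_ac ?A * ((u * poly (ac w) x) * poly (ac w) x ^ 2) + to_ac ?B * poly (ac w) x ^ 3)"
      unfolding e1 e2 uv(2,3) by (rule quadratic_point_expand[OF y])
    also have "\<dots> = poly (ac w) x ^ 5 * (v ^ 2 - (u ^ 3 + to_ac ?A * u + to_ac ?B))"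
      by (simp add: algebra_simps eval_nat_numeral)
    also have "\<dots> = 0" unfolding v2 by simp
    finally show "poly (ac E1) x + poly (ac E2) x * y = 0" .
  qed
  then have E12: "E1 = 0" "E2 = 0" by simp_all
  then have eq1: "(c ^ 2 + d' ^ 2 * f) * w ^ 3 = w ^ 2 * (a ^ 3 + 3 * a * b ^ 2 * f + smult ?A (a * w ^ 2) + smult ?B (w ^ 3))"
    and eq2: "2 * c * d' * w ^ 3 = w ^ 2 * (3 * a ^ 2 * b + b ^ 3 * f + smult ?A (b * w ^ 2))"
    by (simp_all add: E1_def E2_def)
  have ka: "2 * degree w < degree (qnorm f a b)" by (rule degree_cubic_relation[OF f3 w0 eq1 kc])
  have acq: "ac (qnorm f p q) = qnorm (ac f) (ac p) (ac q)" for p q by (simp add: qnorm_def)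
  have f3': "degree (ac f) = 3" using f3 by simp
  have ka': "2 * degree (ac w) < degree (qnorm (ac f) (ac a) (ac b))"
    using ka unfolding acq[symmetric] degree_ac .
  have eq1': "(ac c ^ 2 + ac d' ^ 2 * ac f) * ac w ^ 3 = ac w ^ 2 * (ac a ^ 3 + 3 * ac a * ac b ^ 2 * ac f
       + smult (to_ac ?A) (ac a * ac w ^ 2) + smult (to_ac ?B) (ac w ^ 3))"
    using arg_cong[OF eq1, of ac] by (simp only: ac_add ac_mult ac_smult ac_power ac_numeral)
  have eq2': "2 * ac c * ac d' * ac w ^ 3 = ac w ^ 2 * (3 * ac a ^ 2 * ac b + ac b ^ 3 * ac f + smult (to_ac ?A) (ac b * ac w ^ 2))"
    using arg_cong[OF eq2, of ac] by (simp only: ac_add ac_mult ac_smult ac_power ac_numeral)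
  have w0': "ac w \<noteq> 0" using w0 by simp
  have bc: "b = 0 \<and> c = 0"
  proof (rule quadratic_fraction_cases[OF two' short_discriminant_nonzero(2)[OF two three ell'] w0' w0' eq1' eq2'])
    fix e g assume h: "ac b = 0" "ac d' = 0" "ac a = smult e (ac w)" "ac c = smult g (ac w)"
    then have "d' = 0" "degree (ac c) \<le> degree (ac w)" using degree_smult_le by simp_all
    then have "degree (qnorm f c d') \<le> 2 * degree w" unfolding degree_qnorm[OF f3] by simp
    then show ?thesis using kc by simp
  next
    fix e g assume "(ac a ^ 2 - ac b ^ 2 * ac f - smult (2 * e) (ac a * ac w) - smult (2 * e ^ 2 + to_ac ?A) (ac w ^ 2)) ^ 2
       = smult (4 * g ^ 2) (ac w ^ 3 * (2 * ac a + smult e (ac w)))"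
    then show ?thesis using chord_impossible[OF f3' ka'] by blast
  qed simp
  have b0: "b = 0" and c0: "c = 0" using bc by auto
  have da: "degree w < degree a" using ka unfolding degree_qnorm[OF f3] b0 by simp
  obtain g N D s t where gN: "a = g * N" "w = g * D" "s * N + t * D = 1"
    using poly_bezout_cofactors[of a w] w0 by blast
  have nz: "g \<noteq> 0" "D \<noteq> 0" "N \<noteq> 0" using gN w0 da by auto
  have dND: "degree D < degree N" using da unfolding gN using nz by (simp add: degree_mult_eq)
  have "g ^ 3 * (f * d' ^ 2 * D ^ 3) = g ^ 3 * (w ^ 2 * (N ^ 3 + smult ?A (N * D ^ 2) + smult ?B (D ^ 3)))"
  proof -
    have "g ^ 3 * (f * d' ^ 2 * D ^ 3) = (d' ^ 2 * f) * w ^ 3" unfolding gN(2) by (simp add: power_mult_distrib mult_ac)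
    also have "\<dots> = w ^ 2 * (a ^ 3 + smult ?A (a * w ^ 2) + smult ?B (w ^ 3))"
      using eq1 unfolding b0 c0 by simp
    also have "a ^ 3 + smult ?A (a * w ^ 2) + smult ?B (w ^ 3) = g ^ 3 * (N ^ 3 + smult ?A (N * D ^ 2) + smult ?B (D ^ 3))"
      unfolding gN by (simp add: power2_eq_square power3_eq_cube algebra_simps)
    finally show ?thesis by (simp only: mult_ac)
  qed
  moreover have "g ^ 3 \<noteq> 0" using nz by simp
  ultimately have eqf: "f * d' ^ 2 * D ^ 3 = w ^ 2 * (N ^ 3 + smult ?A (N * D ^ 2) + smult ?B (D ^ 3))"
    using mult_left_cancel by blast
  have "d' \<noteq> 0" using kc unfolding c0 degree_qnorm[OF f3] by auto
  have final: "poly (ac D) x \<noteq> 0 \<and>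
       on_short E' (poly (ac N) x / poly (ac D) x) (y * poly (ac d') x / poly (ac w) x) \<and>
       \<phi> (from_short E x y) = from_short E' (poly (ac N) x / poly (ac D) x) (y * poly (ac d') x / poly (ac w) x)"
    if xy: "on_short E x y" and wx: "poly (ac w) x \<noteq> 0" for x y
  proof -
    obtain u v where uv: "\<phi> (from_short E x y) = from_short E' u v" "on_short E' u v"
      "u * poly (ac w) x = poly (ac a) x + poly (ac b) x * y" "v * poly (ac w) x = poly (ac c) x + poly (ac d') x * y"
      using good[OF xy wx] by blast
    have wg: "poly (ac w) x = poly (ac g) x * poly (ac D) x" and ag: "poly (ac a) x = poly (ac g) x * poly (ac N) x"
      unfolding gN by simp_all
    have nzx: "poly (ac g) x \<noteq> 0" "poly (ac D) x \<noteq> 0" using wx unfolding wg by auto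
    have "u = poly (ac N) x / poly (ac D) x"
      using uv(3) nzx unfolding b0 wg ag by (simp add: field_simps)
    moreover have "v = y * poly (ac d') x / poly (ac w) x"
      using uv(4) wx unfolding c0 by (simp add: field_simps)
    ultimately show ?thesis using uv nzx by simp
  qed
  show ?thesis
    by (rule that[OF gN(3) nz(2) w0 \<open>d' \<noteq> 0\<close> dND]) (use eqf final in \<open>auto simp: f_def\<close>)
qed

section \<open>Rational functions\<close>

lemma rational_function_rep:
  fixes E :: "'a::field weierstrass"
  assumes two: "(2::'a) \<noteq> 0" and three: "(3::'a) \<noteq> 0" and rat: "rational_function E h"
  shows "\<exists>u v w. w \<noteq> 0 \<and> (\<forall>x y. on_short E x y \<longrightarrow> poly (ac w) x \<noteq> 0 \<longrightarrow>
    h (from_short E x y) = (poly (ac u) x + poly (ac v) x * y) / poly (ac w) x)"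
proof -
  obtain d F G where P: "\<exists>P\<in>geom_points E. form_eval d G P \<noteq> 0"
    and h: "\<And>P. P \<in> geom_points E \<Longrightarrow> form_eval d G P \<noteq> 0 \<Longrightarrow> h P = form_eval d F P / form_eval d G P"
    using rat unfolding rational_function_def by blast
  define f where "f = cubic (short_A E) (short_B E)"
  obtain a b where F: "rep E a b (\<lambda>x y. form_eval d F (from_short E x y))"
    using rep_form[where E = E and d = d and c = F] by metis
  obtain a' b' where G: "rep E a' b' (\<lambda>x y. form_eval d G (from_short E x y))" "G 0 d \<noteq> 0 \<Longrightarrow> a' \<noteq> 0 \<or> b' \<noteq> 0"
    using rep_form[where E = E and d = d and c = G] by metis
  obtain P where P: "P \<in> geom_points E" "form_eval d G P \<noteq> 0" using P by blast
  have nz: "a' \<noteq> 0 \<or> b' \<noteq> 0"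
  proof (cases "P = Infty")
    case True then show ?thesis using P(2) G(2) by (simp add: form_eval_Infty)
  next
    case False
    then obtain x y where "P = from_short E x y" "on_short E x y" using geom_points_cases[OF two three P(1)] by blast
    then show ?thesis using G(1) P(2) by (auto simp: rep_def)
  qed
  define w where "w = qnorm f a' b'"
  have w0: "w \<noteq> 0" using nz by (simp add: w_def qnorm_eq_0_iff f_def)
  have "h (from_short E x y) = (poly (ac (a * a' - f * b * b')) x + poly (ac (b * a' - a * b')) x * y) / poly (ac w) x"
    if xy: "on_short E x y" and wx: "poly (ac w) x \<noteq> 0" for x y
  proof -
    have Gx: "form_eval d G (from_short E x y) \<noteq> 0"
      using rep_nonzero_off_norm[OF G(1) xy] wx by (simp add: w_def f_def)
    have FG: "form_eval d F (from_short E x y) = poly (ac a) x + poly (ac b) x * y"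
      "form_eval d G (from_short E x y) = poly (ac a') x + poly (ac b') x * y"
      using F G(1) xy by (simp_all add: rep_def)
    define cj where "cj = poly (ac a') x - poly (ac b') x * y"
    have fx: "poly (ac f) x = y ^ 2" using xy by (simp only: f_def)
    have ww: "poly (ac w) x = form_eval d G (from_short E x y) * cj"
      unfolding w_def qnorm_def FG cj_def ac_diff ac_mult ac_power poly_diff poly_mult poly_power fx
      by (simp add: algebra_simps power2_eq_square)
    then have cj: "cj \<noteq> 0" using wx by auto
    have "poly (ac (a * a' - f * b * b')) x + poly (ac (b * a' - a * b')) x * y = form_eval d F (from_short E x y) * cj"
      unfolding FG cj_def ac_diff ac_mult poly_diff poly_mult fx by (simp add: algebra_simps power2_eq_square)
    moreover have "h (from_short E x y) = form_eval d F (from_short E x y) / form_eval d G (from_short E x y)"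
      using h Gx Aff_geom_points_iff[OF two three] xy by blast
    ultimately show ?thesis unfolding ww using cj by simp
  qed
  then show ?thesis using w0 by blast
qed

lemma ac_pcompose: "ac (pcompose p q) = pcompose (ac p) (ac q)"
  by (induction p) (simp_all add: pcompose_pCons)

lemma poly_as_sum_le:
  fixes p :: "'c::field poly"
  assumes "degree p \<le> d"
  shows "poly p x = (\<Sum>i\<le>d. coeff p i * x ^ i)"
  unfolding poly_altdef by (rule sum.mono_neutral_left) (use assms in \<open>auto simp: coeff_eq_0\<close>)

lemma polynomial_rational_function:
  fixes E :: "'a::field weierstrass"
  assumes two: "(2::'a) \<noteq> 0" and three: "(3::'a) \<noteq> 0"
  shows "\<exists>h. rational_function E h \<and> (\<forall>x y. h (from_short E x y) = poly (ac u) x + poly (ac v) x * y)"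
proof -
  define \<beta> where "\<beta> = b\<^sub>2 E / 12"
  define V where "V = pcompose v [:\<beta>, 1:]"
  define U where "U = pcompose u [:\<beta>, 1:] + V * smult (1 / 2) [:a\<^sub>3 E, a\<^sub>1 E:]"
  \<comment> \<open>The successor leaves room for the extra factor y in a form of degree d, and
    makes Z^d vanish at infinity.\<close>
  define d where "d = Suc (max (degree U) (degree V))"
  define F where "F i j = (if j = 0 then coeff U i else if j = 1 then coeff V i else 0)" for i j :: nat
  define G where "G i j = (if i = 0 \<and> j = 0 then 1 else 0 :: 'a)" for i j :: nat
  define h where "h P = (case P of Infty \<Rightarrow> 0 | Aff x y \<Rightarrow> poly (ac U) x + poly (ac V) x * y)" for P
  have val: "h (from_short E x y) = poly (ac u) x + poly (ac v) x * y" for x y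
  proof -
    have "poly (ac V) (xc E x) = poly (ac v) x" by (simp add: V_def ac_pcompose poly_pcompose xc_def \<beta>_def)
    moreover have "poly (ac (pcompose u [:\<beta>, 1:])) (xc E x) = poly (ac u) x"
      by (simp add: ac_pcompose poly_pcompose xc_def \<beta>_def)
    ultimately have "poly (ac U) (xc E x) = poly (ac u) x + poly (ac v) x * ((to_ac (a\<^sub>1 E) * xc E x + to_ac (a\<^sub>3 E)) / 2)"
      unfolding U_def ac_add ac_mult poly_add poly_mult by (simp add: algebra_simps add_divide_distrib)
    moreover note \<open>poly (ac V) (xc E x) = poly (ac v) x\<close>
    ultimately show ?thesis by (simp add: h_def from_short_xc yc_def algebra_simps)
  qed
  have Fv: "form_eval d F (Aff x y) = poly (ac U) x + poly (ac V) x * y" for x y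
  proof -
    have "form_eval d F (Aff x y) = (\<Sum>i\<le>d. \<Sum>j\<le>d - i. to_ac (F i j) * x ^ i * y ^ j)"
      by (simp add: form_eval_def)
    also have "\<dots> = (\<Sum>i\<le>d. to_ac (coeff U i) * x ^ i + to_ac (coeff V i) * x ^ i * y)"
    proof (rule sum.cong[OF refl])
      fix i assume i: "i \<in> {..d}"
      show "(\<Sum>j\<le>d - i. to_ac (F i j) * x ^ i * y ^ j) = to_ac (coeff U i) * x ^ i + to_ac (coeff V i) * x ^ i * y"
      proof (cases "i = d")
        case True
        then have "coeff V i = 0" by (simp add: d_def coeff_eq_0)
        then show ?thesis using True by (simp add: F_def)
      next
        case False
        then obtain k where k: "d - i = Suc k" using i by (metis atMost_iff diff_is_0_eq le_antisym not0_implies_Suc)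
        have "(\<Sum>j\<le>Suc k. to_ac (F i j) * x ^ i * y ^ j) = (\<Sum>j\<in>{0, 1}. to_ac (F i j) * x ^ i * y ^ j)"
          by (rule sum.mono_neutral_right) (auto simp: F_def)
        then show ?thesis unfolding k by (simp add: F_def)
      qed
    qed
    also have "\<dots> = (\<Sum>i\<le>d. coeff (ac U) i * x ^ i) + (\<Sum>i\<le>d. coeff (ac V) i * x ^ i) * y"
      by (simp add: sum.distrib sum_distrib_right coeff_map_poly)
    also have "(\<Sum>i\<le>d. coeff (ac U) i * x ^ i) = poly (ac U) x" by (rule poly_as_sum_le[symmetric]) (simp add: d_def)
    also have "(\<Sum>i\<le>d. coeff (ac V) i * x ^ i) = poly (ac V) x" by (rule poly_as_sum_le[symmetric]) (simp add: d_def)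
    finally show ?thesis .
  qed
  have Gv: "form_eval d G P = (case proj_coords P of (x, y, z) \<Rightarrow> z ^ d)" for P
  proof -
    obtain x y z where xyz: "proj_coords P = (x, y, z)" by (cases "proj_coords P") auto
    have "form_eval d G P = (\<Sum>i\<le>d. \<Sum>j\<le>d - i. to_ac (G i j) * x ^ i * y ^ j * z ^ (d - i - j))"
      by (simp add: form_eval_def xyz)
    also have "\<dots> = (\<Sum>i\<le>d. if i = 0 then z ^ d else 0)"
    proof (rule sum.cong[OF refl])
      fix i
      have "(\<Sum>j\<le>d - i. to_ac (G i j) * x ^ i * y ^ j * z ^ (d - i - j)) = (\<Sum>j\<le>d - i. if j = 0 then (if i = 0 then z ^ d else 0) else 0)"
        by (rule sum.cong) (auto simp: G_def)
      then show "(\<Sum>j\<le>d - i. to_ac (G i j) * x ^ i * y ^ j * z ^ (d - i - j)) = (if i = 0 then z ^ d else 0)"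
        by simp
    qed
    finally show ?thesis by (simp add: xyz)
  qed
  have "rational_function E h"
    unfolding rational_function_def
  proof (rule exI[of _ d], rule exI[of _ F], rule exI[of _ G], intro conjI ballI impI)
    obtain y where "on_short E 0 y" using point_over by blast
    then have "from_short E 0 y \<in> geom_points E" using Aff_geom_points_iff[OF two three] by blast
    then show "\<exists>P\<in>geom_points E. form_eval d G P \<noteq> 0"
      by (rule bexI[rotated]) (simp add: Gv from_short_xc)
    fix P assume "P \<in> geom_points E" "form_eval d G P \<noteq> 0"
    moreover have "form_eval d G Infty = 0" unfolding Gv by (simp add: d_def)
    ultimately have "P \<noteq> Infty" by auto
    then obtain x y where P: "P = Aff x y" by (cases P) auto
    show "h P = form_eval d F P / form_eval d G P" unfolding P Fv by (simp add: Gv h_def)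
  qed
  then show ?thesis using val by blast
qed

section \<open>Linear algebra over the subfield of pulled back functions\<close>

text \<open>A homogeneous linear system with more unknowns than equations, solved without division.
  S consists of functions that behave on G like an integral domain, so functions can be used as
  coefficients without forming a quotient field; \<open>e\<close> is a nonzero element to start
  from.\<close>

lemma fraction_free_elimination:
  fixes S :: "('p \<Rightarrow> 'c::field) set" and \<beta> :: "'i \<Rightarrow> nat \<Rightarrow> 'p \<Rightarrow> 'c"
  assumes one: "e \<in> S" "\<exists>p\<in>G. e p \<noteq> 0"
    and diff: "\<And>h g. h \<in> S \<Longrightarrow> g \<in> S \<Longrightarrow> (\<lambda>p. h p - g p) \<in> S"
    and mult: "\<And>h g. h \<in> S \<Longrightarrow> g \<in> S \<Longrightarrow> (\<lambda>p. h p * g p) \<in> S"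
    and dom: "\<And>h g. h \<in> S \<Longrightarrow> g \<in> S \<Longrightarrow> (\<forall>p\<in>G. h p * g p = 0) \<Longrightarrow> (\<forall>p\<in>G. h p = 0) \<or> (\<forall>p\<in>G. g p = 0)"
    and "finite I" "m < card I" "\<And>i j. i \<in> I \<Longrightarrow> j < m \<Longrightarrow> \<beta> i j \<in> S"
  shows "\<exists>c. (\<forall>i\<in>I. c i \<in> S) \<and> (\<exists>i\<in>I. \<exists>p\<in>G. c i p \<noteq> 0) \<and> (\<forall>j<m. \<forall>p\<in>G. (\<Sum>i\<in>I. c i p * \<beta> i j p) = 0)"
  using assms(6-)
proof (induction m arbitrary: I \<beta>)
  case 0
  then obtain i where "i \<in> I" by fastforce
  then show ?case using one by (intro exI[of _ "\<lambda>i. e"]) auto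
next
  case (Suc m)
  have zero: "(\<lambda>p. 0) \<in> S" using diff[OF one(1) one(1)] by simp
  have sum: "(\<lambda>p. \<Sum>i\<in>J. h i p) \<in> S" if "finite J" "\<And>i. i \<in> J \<Longrightarrow> h i \<in> S" for J :: "'i set" and h
    using that
  proof (induction J rule: finite_induct)
    case (insert i J)
    have "(\<lambda>p. h i p - (0 - (\<Sum>i\<in>J. h i p))) \<in> S" using insert zero by (intro diff) auto
    then show ?case using insert by simp
  qed (simp add: zero)
  show ?case
  proof (cases "\<forall>i\<in>I. \<forall>p\<in>G. \<beta> i m p = 0")
    case True
    have "m < card I" using Suc.prems(2) by simp
    then obtain c where c: "\<forall>i\<in>I. c i \<in> S" "\<exists>i\<in>I. \<exists>p\<in>G. c i p \<noteq> 0" "\<forall>j<m. \<forall>p\<in>G. (\<Sum>i\<in>I. c i p * \<beta> i j p) = 0"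
      using Suc.IH[of I \<beta>] Suc.prems by auto
    have "(\<Sum>i\<in>I. c i p * \<beta> i m p) = 0" if "p \<in> G" for p using True that by simp
    then show ?thesis using c by (intro exI[of _ c]) (auto simp: less_Suc_eq)
  next
    case False
    then obtain i0 p0 where i0: "i0 \<in> I" "p0 \<in> G" "\<beta> i0 m p0 \<noteq> 0" by blast
    define \<pi> where "\<pi> = \<beta> i0 m"
    have \<pi>: "\<pi> \<in> S" using Suc.prems(3) i0 by (simp add: \<pi>_def)
    define J where "J = I - {i0}"
    have J: "finite J" "m < card J" "i0 \<notin> J" "I = insert i0 J"
      using Suc.prems(1,2) i0 by (auto simp: J_def)
    \<comment> \<open>Cross-multiplication with the pivot removes the unknown \<open>i0\<close> from
      the first m equations; its own value -s then settles the last one.\<close>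
    define \<beta>' where "\<beta>' i j = (\<lambda>p. \<pi> p * \<beta> i j p - \<beta> i m p * \<beta> i0 j p)" for i j
    have "\<beta>' i j \<in> S" if "i \<in> J" "j < m" for i j
      unfolding \<beta>'_def using that J Suc.prems(3) \<pi> by (intro diff mult) auto
    then obtain c where c: "\<forall>i\<in>J. c i \<in> S" "\<exists>i\<in>J. \<exists>p\<in>G. c i p \<noteq> 0" "\<forall>j<m. \<forall>p\<in>G. (\<Sum>i\<in>J. c i p * \<beta>' i j p) = 0"
      using Suc.IH[of J \<beta>'] J by blast
    define s where "s p = (\<Sum>i\<in>J. c i p * \<beta> i m p)" for p
    define c' where "c' i = (if i = i0 then (\<lambda>p. 0 - s p) else (\<lambda>p. \<pi> p * c i p))" for i
    have s: "s \<in> S" unfolding s_def[abs_def]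
      by (rule sum[OF J(1)], rule mult) (use c J Suc.prems(3) in auto)
    have "(\<lambda>p. - s p) \<in> S" using diff[OF zero s] by simp
    then have "\<forall>i\<in>I. c' i \<in> S"
      unfolding c'_def using c(1) \<pi> J by (auto intro!: mult)
    moreover have "\<exists>i\<in>I. \<exists>p\<in>G. c' i p \<noteq> 0"
    proof (rule ccontr)
      assume h: "\<not> ?thesis"
      obtain i where i: "i \<in> J" "\<exists>p\<in>G. c i p \<noteq> 0" using c(2) by blast
      have "i \<in> I" "i \<noteq> i0" using i J by auto
      then have "\<forall>p\<in>G. c' i p = 0" using h by blast
      then have "\<forall>p\<in>G. \<pi> p * c i p = 0" using \<open>i \<noteq> i0\<close> by (simp add: c'_def)
      then have "(\<forall>p\<in>G. \<pi> p = 0) \<or> (\<forall>p\<in>G. c i p = 0)" using dom \<pi> c(1) i by blast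
      then show False using i i0 by (auto simp: \<pi>_def)
    qed
    moreover have "(\<Sum>i\<in>I. c' i p * \<beta> i j p) = 0" if "j < Suc m" "p \<in> G" for j p
    proof -
      have "(\<Sum>i\<in>J. c' i p * \<beta> i j p) = (\<Sum>i\<in>J. \<pi> p * c i p * \<beta> i j p)"
        by (rule sum.cong) (use J in \<open>auto simp: c'_def\<close>)
      then have 1: "(\<Sum>i\<in>I. c' i p * \<beta> i j p) = (\<Sum>i\<in>J. \<pi> p * c i p * \<beta> i j p) - s p * \<beta> i0 j p"
        using J by (simp add: c'_def)
      show ?thesis
      proof (cases "j = m")
        case True
        show ?thesis using 1 unfolding True s_def \<pi>_def[symmetric] by (simp add: sum_distrib_left sum_distrib_right mult_ac)
      next
        case False
        then have "j < m" using that by simp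
        then have "(\<Sum>i\<in>J. c i p * \<beta>' i j p) = 0" using c(3) that by blast
        then have "(\<Sum>i\<in>J. \<pi> p * c i p * \<beta> i j p) - (\<Sum>i\<in>J. c i p * \<beta> i m p * \<beta> i0 j p) = 0"
          by (simp add: \<beta>'_def sum_subtractf[symmetric] algebra_simps)
        then show ?thesis unfolding 1 s_def by (simp add: sum_distrib_right)
      qed
    qed
    ultimately show ?thesis by (intro exI[of _ c']) blast
  qed
qed

section \<open>Powers of x over the functions of N/D\<close>

lemma coprime_power_dvd:
  fixes N D P :: "'c::field poly"
  assumes "s * N + t * D = 1" "N dvd P * D ^ k"
  shows "N dvd P"
  using assms(2)
proof (induction k)
  case (Suc k)
  have "P * D ^ k = P * D ^ k * (s * N + t * D)" using assms(1) by simp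
  also have "\<dots> = N * (P * D ^ k * s) + t * (P * D ^ Suc k)" by (simp add: algebra_simps)
  finally have "P * D ^ k = N * (P * D ^ k * s) + t * (P * D ^ Suc k)" .
  then have "N dvd P * D ^ k" using dvd_add[OF dvd_triv_left dvd_mult[OF Suc.prems]] by metis
  then show ?case by (rule Suc.IH)
qed simp

text \<open>Uniqueness of digits in base N/D: modulo N only P 0 D^k survives, D is invertible there,
  and P 0 has degree below that of N. Then N can be cancelled and the induction goes on.\<close>

lemma base_expansion_zero:
  fixes N D :: "'c::field poly" and P :: "nat \<Rightarrow> 'c poly"
  assumes bez: "s * N + t * D = 1" and "\<And>i. i \<le> k \<Longrightarrow> degree (P i) < degree N"
    and "(\<Sum>i\<le>k. P i * N ^ i * D ^ (k - i)) = 0"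
  shows "\<forall>i\<le>k. P i = 0"
  using assms(2,3)
proof (induction k arbitrary: P)
  case 0 then show ?case by simp
next
  case (Suc k)
  define R where "R = (\<Sum>i\<le>k. P (Suc i) * N ^ i * D ^ (k - i))"
  have "(\<Sum>i\<le>Suc k. P i * N ^ i * D ^ (Suc k - i)) = P 0 * D ^ Suc k + (\<Sum>i\<le>k. P (Suc i) * N ^ Suc i * D ^ (k - i))"
    by (subst sum.atMost_Suc_shift) simp
  also have "(\<Sum>i\<le>k. P (Suc i) * N ^ Suc i * D ^ (k - i)) = N * R"
    unfolding R_def sum_distrib_left by (rule sum.cong) (simp_all add: mult_ac)
  finally have e: "P 0 * D ^ Suc k + N * R = 0" using Suc.prems(2) by simp
  then have "P 0 * D ^ Suc k = N * (- R)" by (simp add: eq_neg_iff_add_eq_0)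
  then have "N dvd P 0 * D ^ Suc k" by (rule dvdI)
  then have d: "N dvd P 0" by (rule coprime_power_dvd[OF bez])
  have P0: "P 0 = 0"
  proof (rule ccontr)
    assume "P 0 \<noteq> 0"
    then have "degree N \<le> degree (P 0)" using d dvd_imp_degree_le by blast
    then show False using Suc.prems(1)[of 0] by simp
  qed
  have "N \<noteq> 0" using Suc.prems(1)[of 0] by auto
  then have "R = 0" using e P0 by simp
  then have IH: "\<forall>i\<le>k. P (Suc i) = 0" unfolding R_def by (intro Suc.IH) (use Suc.prems(1) in auto)
  show ?case
  proof (intro allI impI)
    fix i assume "i \<le> Suc k" then show "P i = 0" using P0 IH by (cases i) auto
  qed
qed

text \<open>Collecting the coefficients of the u j by powers of N/D and clearing the denominator
  gives an expansion in base N/D with digits of degree below that of N.\<close>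

lemma powers_independent:
  fixes N D :: "'c::alg_closed_field poly" and u :: "nat \<Rightarrow> 'c poly"
  assumes bez: "s * N + t * D = 1" and "finite F" and D0: "D \<noteq> 0"
    and eq: "\<And>x. x \<notin> F \<Longrightarrow> (\<Sum>j<degree N. poly (u j) (poly N x / poly D x) * x ^ j) = 0"
  shows "\<forall>j<degree N. u j = 0"
proof -
  let ?n = "degree N"
  define k where "k = (\<Sum>j<?n. degree (u j))"
  have k: "degree (u j) \<le> k" if "j < ?n" for j
    unfolding k_def using that by (intro member_le_sum) auto
  define P where "P i = (\<Sum>j<?n. monom (coeff (u j) i) j)" for i
  have cP: "coeff (P i) j = (if j < ?n then coeff (u j) i else 0)" for i j
    unfolding P_def by (simp add: coeff_sum)
  show ?thesis
  proof (cases "?n = 0")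
    case False
    have dP: "degree (P i) < ?n" for i
      using False by (intro degree_lessI) (auto simp: cP)
    have "(\<Sum>i\<le>k. P i * N ^ i * D ^ (k - i)) = 0"
    proof (rule ccontr)
      assume h: "(\<Sum>i\<le>k. P i * N ^ i * D ^ (k - i)) \<noteq> 0"
      define Q where "Q = (\<Sum>i\<le>k. P i * N ^ i * D ^ (k - i)) * D"
      have "Q \<noteq> 0" using h D0 by (simp add: Q_def)
      then have "finite ({x. poly Q x = 0} \<union> F)" using assms(2) poly_roots_finite by blast
      then obtain x where x: "poly Q x \<noteq> 0" "x \<notin> F"
        using infinite_UNIV_alg_closed_field[where 'c = 'c] by (metis (mono_tags, lifting) UNIV_eq_I UnCI mem_Collect_eq)
      have Dx: "poly D x \<noteq> 0" using x by (auto simp: Q_def)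
      have "poly (\<Sum>i\<le>k. P i * N ^ i * D ^ (k - i)) x
          = (\<Sum>i\<le>k. \<Sum>j<?n. coeff (u j) i * x ^ j * poly N x ^ i * poly D x ^ (k - i))"
        by (simp add: poly_sum P_def poly_monom sum_distrib_right)
      also have "\<dots> = (\<Sum>j<?n. \<Sum>i\<le>k. coeff (u j) i * x ^ j * poly N x ^ i * poly D x ^ (k - i))"
        by (rule sum.swap)
      also have "\<dots> = (\<Sum>j<?n. poly D x ^ k * (poly (u j) (poly N x / poly D x) * x ^ j))"
      proof (rule sum.cong[OF refl])
        fix j assume j: "j \<in> {..<?n}"
        have "poly D x ^ k * poly (u j) (poly N x / poly D x) = (\<Sum>i\<le>k. coeff (u j) i * poly N x ^ i * poly D x ^ (k - i))"
          using j k Dx by (subst poly_as_sum_le[of _ k])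
            (auto simp: sum_distrib_left power_divide power_diff intro!: sum.cong)
        moreover have "(\<Sum>i\<le>k. coeff (u j) i * x ^ j * poly N x ^ i * poly D x ^ (k - i))
            = x ^ j * (\<Sum>i\<le>k. coeff (u j) i * poly N x ^ i * poly D x ^ (k - i))"
          unfolding sum_distrib_left by (rule sum.cong) (simp_all only: mult_ac)
        ultimately show "(\<Sum>i\<le>k. coeff (u j) i * x ^ j * poly N x ^ i * poly D x ^ (k - i)) = poly D x ^ k * (poly (u j) (poly N x / poly D x) * x ^ j)"
          by (simp only: mult_ac)
      qed
      also have "\<dots> = 0" using eq[OF x(2)] by (simp add: sum_distrib_left[symmetric])
      finally show False using x by (simp add: Q_def)
    qed
    then have "\<forall>i\<le>k. P i = 0" using base_expansion_zero[OF bez] dP by blast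
    then have "coeff (u j) i = 0" if "j < ?n" "i \<le> k" for i j using cP[of i j] that by simp
    then have "coeff (u j) i = 0" if "j < ?n" for i j using that k[OF that] by (metis coeff_eq_0 le_less_trans not_le)
    then show ?thesis by (simp add: poly_eq_iff)
  qed simp
qed

text \<open>With \<xi> = N/D, x is a root of N - \<xi> D, whose leading coefficient is the constant
  one of N. So the top power of x is a combination of lower ones with coefficients linear in \<xi>,
  and no denominators in \<xi> arise.\<close>

lemma powers_span:
  fixes N D U :: "'a::field poly"
  assumes deg: "degree D < degree N"
  shows "\<exists>\<tau>. \<forall>x. poly (ac D) x \<noteq> 0 \<longrightarrow>
    poly (ac U) x = (\<Sum>j<degree N. poly (ac (\<tau> j)) (poly (ac N) x / poly (ac D) x) * x ^ j)"
proof (induction U)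
  case 0
  show ?case by (rule exI[of _ "\<lambda>j. 0"]) simp
next
  case (pCons c U)
  then obtain \<tau> where \<tau>: "\<And>x. poly (ac D) x \<noteq> 0 \<Longrightarrow>
    poly (ac U) x = (\<Sum>j<degree N. poly (ac (\<tau> j)) (poly (ac N) x / poly (ac D) x) * x ^ j)" by blast
  obtain m where m: "degree N = Suc m" using deg by (cases "degree N") auto
  define L where "L = lead_coeff N"
  have L0: "L \<noteq> 0" using deg by (auto simp: L_def)
  define \<rho> where "\<rho> j = [:- (coeff N j / L), coeff D j / L:]" for j
  define \<sigma> where "\<sigma> j = (if j = 0 then [:c:] else \<tau> (j - 1)) + \<tau> m * \<rho> j" for j
  show ?case
  proof (rule exI[of _ \<sigma>], intro allI impI)
    fix x assume Dx: "poly (ac D) x \<noteq> 0"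
    define \<xi> where xi_def: "\<xi> = poly (ac N) x / poly (ac D) x"
    have "poly (ac N) x = (\<Sum>j\<le>Suc m. to_ac (coeff N j) * x ^ j)"
      by (subst poly_as_sum_le[of _ "Suc m"]) (simp_all add: m coeff_map_poly)
    then have Nx: "poly (ac N) x = (\<Sum>j<Suc m. to_ac (coeff N j) * x ^ j) + to_ac L * x ^ Suc m"
      by (simp add: L_def m lessThan_Suc_atMost)
    have "poly (ac D) x = (\<Sum>j\<le>m. to_ac (coeff D j) * x ^ j)"
      by (subst poly_as_sum_le[of _ m]) (use deg m in \<open>simp_all add: coeff_map_poly\<close>)
    then have Dx': "poly (ac D) x = (\<Sum>j<Suc m. to_ac (coeff D j) * x ^ j)"
      by (simp add: lessThan_Suc_atMost)
    have rho: "to_ac L * poly (ac (\<rho> j)) \<xi> = \<xi> * to_ac (coeff D j) - to_ac (coeff N j)" for j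
    proof -
      have "to_ac L \<noteq> 0" using L0 by simp
      then show ?thesis by (simp add: \<rho>_def algebra_simps)
    qed
    have "to_ac L * (\<Sum>j<Suc m. poly (ac (\<rho> j)) \<xi> * x ^ j) = (\<Sum>j<Suc m. (to_ac L * poly (ac (\<rho> j)) \<xi>) * x ^ j)"
      by (simp only: sum_distrib_left mult.assoc)
    also have "\<dots> = \<xi> * poly (ac D) x - (\<Sum>j<Suc m. to_ac (coeff N j) * x ^ j)"
      unfolding rho Dx' by (simp only: left_diff_distrib sum_subtractf sum_distrib_left mult.assoc)
    also have "\<xi> * poly (ac D) x = poly (ac N) x" using Dx by (simp add: xi_def)
    also have "poly (ac N) x - (\<Sum>j<Suc m. to_ac (coeff N j) * x ^ j) = to_ac L * x ^ Suc m"
      unfolding Nx by (rule add_diff_cancel_left')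
    finally have e: "to_ac L * (\<Sum>j<Suc m. poly (ac (\<rho> j)) \<xi> * x ^ j) = to_ac L * x ^ Suc m" .
    have L': "to_ac L \<noteq> 0" using L0 by simp
    have xn: "x ^ Suc m = (\<Sum>j<Suc m. poly (ac (\<rho> j)) \<xi> * x ^ j)"
      by (rule sym) (rule mult_left_cancel[OF L', THEN iffD1, OF e])
    have "poly (ac (pCons c U)) x = to_ac c + x * (\<Sum>j<Suc m. poly (ac (\<tau> j)) \<xi> * x ^ j)"
      by (simp only: ac_pCons poly_pCons \<tau>[OF Dx] m xi_def)
    also have "x * (\<Sum>j<Suc m. poly (ac (\<tau> j)) \<xi> * x ^ j)
        = (\<Sum>j<m. poly (ac (\<tau> j)) \<xi> * x ^ Suc j) + poly (ac (\<tau> m)) \<xi> * x ^ Suc m"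
      unfolding sum.lessThan_Suc distrib_left sum_distrib_left by (simp only: power_Suc mult_ac)
    also have "to_ac c + ((\<Sum>j<m. poly (ac (\<tau> j)) \<xi> * x ^ Suc j) + poly (ac (\<tau> m)) \<xi> * x ^ Suc m)
        = (\<Sum>j<Suc m. poly (ac (if j = 0 then [:c:] else \<tau> (j - 1))) \<xi> * x ^ j) + poly (ac (\<tau> m)) \<xi> * x ^ Suc m"
      by (subst sum.lessThan_Suc_shift) (simp del: power_Suc)
    also have "\<dots> = (\<Sum>j<Suc m. poly (ac (\<sigma> j)) \<xi> * x ^ j)"
      unfolding xn sum_distrib_left sum.distrib[symmetric] \<sigma>_def
      by (rule sum.cong[OF refl]) (simp only: ac_add ac_mult poly_add poly_mult distrib_right mult.assoc)
    finally show "poly (ac (pCons c U)) x = (\<Sum>j<degree N. poly (ac (\<sigma> j)) (poly (ac N) x / poly (ac D) x) * x ^ j)"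
      by (simp only: m xi_def)
  qed
qed

section \<open>The degree of an isogeny\<close>

lemma finite_first_coordinates:
  assumes "finite A"
  shows "finite {x. \<exists>y. from_short E x y \<in> A}"
proof -
  define g where "g P = (case P of Infty \<Rightarrow> 0 | Aff a b \<Rightarrow> a + to_ac (b\<^sub>2 E / 12))" for P
  have "g (from_short E x y) = x" for x y by (simp add: g_def from_short_def)
  then have "{x. \<exists>y. from_short E x y \<in> A} \<subseteq> g ` A" by (auto intro: rev_image_eqI)
  then show ?thesis using assms finite_subset by blast
qed

lemma finite_points_over:
  assumes "finite B"
  shows "finite {from_short E x y | x y. on_short E x y \<and> x \<in> B}"
proof -
  have "finite {y. y ^ 2 = c}" for c :: "'a alg_closure"
  proof -
    have "{y. y ^ 2 = c} = {y. poly [:- c, 0, 1:] y = 0}" by (auto simp: power2_eq_square)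
    then show ?thesis using poly_roots_finite[of "[:- c, 0, 1:]"] by simp
  qed
  then have "finite (\<Union>x\<in>B. (\<lambda>y. from_short E x y) ` {y. on_short E x y})" using assms by blast
  then show ?thesis by (rule finite_subset[rotated]) auto
qed

locale isogeny_formula =
  fixes E E' :: "'a::field weierstrass" and \<phi> and N D V W s t :: "'a poly"
  assumes two: "(2::'a) \<noteq> 0" and three: "(3::'a) \<noteq> 0"
    and bez: "s * N + t * D = 1" and D0: "D \<noteq> 0" and W0: "W \<noteq> 0" and V0: "V \<noteq> 0" and deg: "degree D < degree N"
    and formula: "\<And>x y. on_short E x y \<Longrightarrow> poly (ac W) x \<noteq> 0 \<Longrightarrow> poly (ac D) x \<noteq> 0 \<and>
       on_short E' (poly (ac N) x / poly (ac D) x) (y * poly (ac V) x / poly (ac W) x) \<and>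
       \<phi> (from_short E x y) = from_short E' (poly (ac N) x / poly (ac D) x) (y * poly (ac V) x / poly (ac W) x)"
begin

definition \<xi> where "\<xi> x = poly (ac N) x / poly (ac D) x"

definition \<eta> where "\<eta> x y = y * poly (ac V) x / poly (ac W) x"

definition good where "good = {(x, y). on_short E x y \<and> poly (ac W) x \<noteq> 0 \<and> poly (ac V) x \<noteq> 0}"

text \<open>The pullback of \<open>u(x) + v(x) y\<close>, set to 0 outside the domain of the formula.\<close>

definition ev where "ev u v p = (if p \<in> good then
  (case p of (x, y) \<Rightarrow> poly (ac u) (\<xi> x) + poly (ac v) (\<xi> x) * \<eta> x y) else 0)"

lemma good_iff: "(x, y) \<in> good \<longleftrightarrow> on_short E x y \<and> poly (ac W) x \<noteq> 0 \<and> poly (ac V) x \<noteq> 0"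
  by (simp add: good_def)

lemma goodD:
  assumes "(x, y) \<in> good"
  shows "poly (ac D) x \<noteq> 0" "on_short E' (\<xi> x) (\<eta> x y)" "\<phi> (from_short E x y) = from_short E' (\<xi> x) (\<eta> x y)"
    "ev u v (x, y) = poly (ac u) (\<xi> x) + poly (ac v) (\<xi> x) * \<eta> x y"
proof -
  have "on_short E x y" "poly (ac W) x \<noteq> 0" using assms unfolding good_iff by blast+
  from formula[OF this] show "poly (ac D) x \<noteq> 0" "on_short E' (\<xi> x) (\<eta> x y)"
    "\<phi> (from_short E x y) = from_short E' (\<xi> x) (\<eta> x y)" unfolding \<xi>_def \<eta>_def by blast+
  show "ev u v (x, y) = poly (ac u) (\<xi> x) + poly (ac v) (\<xi> x) * \<eta> x y" using assms by (simp add: ev_def)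
qed

lemma ev_diff: "ev u v p - ev u' v' p = ev (u - u') (v - v') p"
  by (cases p) (simp add: ev_def algebra_simps)

lemma ev_mult:
  "ev u v p * ev u' v' p = ev (u * u' + cubic (short_A E') (short_B E') * v * v') (u * v' + u' * v) p"
proof (cases "p \<in> good")
  case True
  obtain x y where p: "p = (x, y)" by (cases p)
  note g = goodD[OF True[unfolded p]]
  have "poly (ac (u * u' + cubic (short_A E') (short_B E') * v * v')) (\<xi> x)
     = poly (ac u) (\<xi> x) * poly (ac u') (\<xi> x) + \<eta> x y ^ 2 * poly (ac v) (\<xi> x) * poly (ac v') (\<xi> x)"
    by (simp only: ac_add ac_mult poly_add poly_mult g(2))
  then show ?thesis unfolding p g(4) by (simp add: algebra_simps power2_eq_square)
qed (simp add: ev_def)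

definition pulled where "pulled = {ev u v | u v. True}"

lemma finite_bad: "finite ({x. poly (ac W) x = 0} \<union> {x. poly (ac V) x = 0})"
  using W0 V0 by (intro finite_UnI poly_roots_finite) simp_all

lemma finite_\<xi>_roots:
  assumes "w \<noteq> 0"
  shows "finite {x. poly (ac D) x \<noteq> 0 \<and> poly (ac w) (\<xi> x) = 0}"
proof -
  have "finite (\<Union>r\<in>{r. poly (ac w) r = 0}. {x. poly (ac N - smult r (ac D)) x = 0})"
  proof (intro finite_UN_I poly_roots_finite)
    show "ac w \<noteq> 0" using assms by simp
    fix r
    have "degree (smult r (ac D)) < degree (ac N)" using deg by (simp add: le_less_trans[OF degree_smult_le])
    then have "degree (ac N - smult r (ac D)) = degree N" by (simp add: degree_diff_eq_left)
    then show "ac N - smult r (ac D) \<noteq> 0" using deg by auto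
  qed
  then show ?thesis
    by (rule finite_subset[rotated]) (auto simp: \<xi>_def)
qed

text \<open>Replacing y by -y changes the sign of \<eta> and separates the u j from the v j; each
  half is \<open>powers_independent\<close>.\<close>

lemma independent:
  assumes "finite B"
    and eq: "\<And>x y. (x, y) \<in> good \<Longrightarrow> x \<notin> B \<Longrightarrow> (\<Sum>j<degree N. ev (u j) (v j) (x, y) * x ^ j) = 0"
  shows "\<forall>j<degree N. u j = 0 \<and> v j = 0"
proof -
  have two': "(2::'a alg_closure) \<noteq> 0" using ac_two_three[OF two three] by blast
  define f where "f = cubic (short_A E) (short_B E)"
  define F where "F = B \<union> ({x. poly (ac W) x = 0} \<union> {x. poly (ac V) x = 0}) \<union> {x. poly (ac f) x = 0}"
  have "ac f \<noteq> 0" by (simp add: f_def)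
  then have F: "finite F" unfolding F_def using assms(1) finite_bad poly_roots_finite by blast
  have z: "(\<Sum>j<degree N. poly (ac (u j)) (\<xi> x) * x ^ j) = 0 \<and> (\<Sum>j<degree N. poly (ac (v j)) (\<xi> x) * x ^ j) = 0"
    if x: "x \<notin> F" for x
  proof -
    obtain y where y: "on_short E x y" using point_over by blast
    have y0: "y \<noteq> 0" using x y by (auto simp: F_def f_def)
    have y': "on_short E x (- y)" using y by simp
    have g: "(x, y) \<in> good" "(x, - y) \<in> good" unfolding good_iff using y y' x by (simp_all add: F_def)
    define a b where "a = (\<Sum>j<degree N. poly (ac (u j)) (\<xi> x) * x ^ j)" and "b = (\<Sum>j<degree N. poly (ac (v j)) (\<xi> x) * x ^ j)"
    have \<eta>0: "\<eta> x y \<noteq> 0" using y0 x by (simp add: \<eta>_def F_def)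
    have sum: "(\<Sum>j<degree N. (poly (ac (u j)) (\<xi> x) + poly (ac (v j)) (\<xi> x) * e) * x ^ j) = a + b * e" for e
      unfolding a_def b_def sum_distrib_right sum.distrib[symmetric] by (rule sum.cong) (simp_all add: algebra_simps)
    have 1: "a + b * \<eta> x y = 0" using eq[OF g(1)] x unfolding goodD(4)[OF g(1)] sum by (simp add: F_def)
    have "\<eta> x (- y) = - \<eta> x y" by (simp add: \<eta>_def)
    then have 2: "a - b * \<eta> x y = 0" using eq[OF g(2)] x unfolding goodD(4)[OF g(2)] sum by (simp add: F_def)
    have "2 * a = (a + b * \<eta> x y) + (a - b * \<eta> x y)" by simp
    then have "2 * a = 0" unfolding 1 2 by simp
    then have "a = 0" using two' by simp
    then show ?thesis using 1 \<eta>0 by (simp add: a_def b_def)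
  qed
  have bez': "ac s * ac N + ac t * ac D = 1" using arg_cong[OF bez, of ac] by simp
  have D0': "ac D \<noteq> 0" using D0 by simp
  have "\<forall>j<degree (ac N). ac (u j) = 0"
    by (rule powers_independent[OF bez' F D0']) (use z in \<open>simp add: \<xi>_def\<close>)
  moreover have "\<forall>j<degree (ac N). ac (v j) = 0"
    by (rule powers_independent[OF bez' F D0']) (use z in \<open>simp add: \<xi>_def\<close>)
  ultimately show ?thesis by simp
qed

lemma ev_eq_0:
  assumes "\<forall>p\<in>good. ev u v p = 0"
  shows "u = 0 \<and> v = 0"
proof -
  have "\<forall>j<degree N. (if j = 0 then u else 0) = 0 \<and> (if j = 0 then v else 0) = 0"
  proof (rule independent[of "{}"])
    fix x y assume g: "(x, y) \<in> good"
    have "(\<Sum>j<degree N. ev (if j = 0 then u else 0) (if j = 0 then v else 0) (x, y) * x ^ j)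
      = (\<Sum>j<degree N. if j = 0 then ev u v (x, y) else 0)"
      by (rule sum.cong) (auto simp: ev_def)
    then show "(\<Sum>j<degree N. ev (if j = 0 then u else 0) (if j = 0 then v else 0) (x, y) * x ^ j) = 0"
      using assms g by simp
  qed simp
  then show ?thesis using deg by (metis gr_implies_not0 neq0_conv)
qed

lemma ev_mult_eq_0:
  assumes "\<forall>p\<in>good. ev u v p * ev u' v' p = 0"
  shows "(\<forall>p\<in>good. ev u v p = 0) \<or> (\<forall>p\<in>good. ev u' v' p = 0)"
proof -
  let ?g = "cubic (short_A E') (short_B E')"
  have "u * u' + ?g * v * v' = 0 \<and> u * v' + u' * v = 0" using assms unfolding ev_mult by (rule ev_eq_0)
  then have "qnorm ?g u v * qnorm ?g u' v' = 0" unfolding qnorm_mult[symmetric] by (simp add: qnorm_def)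
  then have "(u = 0 \<and> v = 0) \<or> (u' = 0 \<and> v' = 0)" by (simp add: qnorm_eq_0_iff)
  then show ?thesis by (auto simp: ev_def split: prod.splits)
qed

lemma elimination:
  fixes \<beta>u \<beta>v :: "'i \<Rightarrow> nat \<Rightarrow> 'a poly"
  assumes "finite I" "m < card I"
  shows "\<exists>cu cv. (\<exists>i\<in>I. cu i \<noteq> 0 \<or> cv i \<noteq> 0) \<and>
    (\<forall>j<m. \<forall>p\<in>good. (\<Sum>i\<in>I. ev (cu i) (cv i) p * ev (\<beta>u i j) (\<beta>v i j) p) = 0)"
proof -
  have "\<exists>c. (\<forall>i\<in>I. c i \<in> pulled) \<and> (\<exists>i\<in>I. \<exists>p\<in>good. c i p \<noteq> 0) \<and>
     (\<forall>j<m. \<forall>p\<in>good. (\<Sum>i\<in>I. c i p * ev (\<beta>u i j) (\<beta>v i j) p) = 0)"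
  proof (rule fraction_free_elimination[where e = "ev 1 0" and \<beta> = "\<lambda>i j. ev (\<beta>u i j) (\<beta>v i j)", OF _ _ _ _ _ assms])
    show "ev 1 0 \<in> pulled" by (auto simp: pulled_def)
    show "\<exists>p\<in>good. ev 1 0 p \<noteq> 0" using ev_eq_0[of 1 0] by auto
    fix h g assume "h \<in> pulled" "g \<in> pulled"
    then obtain u v u' v' where h: "h = ev u v" "g = ev u' v'" by (auto simp: pulled_def)
    show "(\<lambda>p. h p - g p) \<in> pulled" unfolding h ev_diff pulled_def by blast
    show "(\<lambda>p. h p * g p) \<in> pulled" unfolding h ev_mult pulled_def by blast
    show "(\<forall>p\<in>good. h p * g p = 0) \<Longrightarrow> (\<forall>p\<in>good. h p = 0) \<or> (\<forall>p\<in>good. g p = 0)"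
      unfolding h by (rule ev_mult_eq_0)
  qed (auto simp: pulled_def)
  then obtain c where c: "\<forall>i\<in>I. c i \<in> pulled" "\<exists>i\<in>I. \<exists>p\<in>good. c i p \<noteq> 0"
     "\<forall>j<m. \<forall>p\<in>good. (\<Sum>i\<in>I. c i p * ev (\<beta>u i j) (\<beta>v i j) p) = 0" by blast
  have "\<forall>i\<in>I. \<exists>uv. c i = ev (fst uv) (snd uv)" using c(1) by (auto simp: pulled_def)
  then obtain uv where uv: "\<And>i. i \<in> I \<Longrightarrow> c i = ev (fst (uv i)) (snd (uv i))" by metis
  have "\<exists>i\<in>I. fst (uv i) \<noteq> 0 \<or> snd (uv i) \<noteq> 0"
  proof (rule ccontr)
    assume "\<not> ?thesis"
    then have "c i p = 0" if "i \<in> I" for i p using uv[OF that] that by (simp add: ev_def split: prod.splits)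
    then show False using c(2) by blast
  qed
  moreover have "(\<Sum>i\<in>I. ev (fst (uv i)) (snd (uv i)) p * ev (\<beta>u i j) (\<beta>v i j) p) = 0" if "j < m" "p \<in> good" for j p
  proof -
    have "(\<Sum>i\<in>I. ev (fst (uv i)) (snd (uv i)) p * ev (\<beta>u i j) (\<beta>v i j) p) = (\<Sum>i\<in>I. c i p * ev (\<beta>u i j) (\<beta>v i j) p)"
      by (rule sum.cong) (simp_all add: uv)
    then show ?thesis using c(3) that by simp
  qed
  ultimately show ?thesis by (intro exI[of _ "\<lambda>i. fst (uv i)"] exI[of _ "\<lambda>i. snd (uv i)"]) blast
qed

lemma from_short_geom: "on_short E x y \<Longrightarrow> from_short E x y \<in> geom_points E"
  using Aff_geom_points_iff[OF two three] by blast

text \<open>Only the spanning property of a basis enters. Expressing 1, x, ..., x^(degree N - 1) by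
  fewer functions, elimination would give a relation between these powers with pulled back
  coefficients.\<close>

lemma degree_le_isogeny_degree:
  assumes "isogeny_degree E E' \<phi> l"
  shows "degree N \<le> l"
proof (rule ccontr)
  assume "\<not> degree N \<le> l"
  then have ln: "l < card {..<degree N}" by simp
  obtain b where span: "\<And>h. rational_function E h \<Longrightarrow>
           (\<exists>c. (\<forall>i<l. rational_function E' (c i)) \<and> same_function E h (\<lambda>P. \<Sum>i<l. c i (\<phi> P) * b i P))"
    using assms unfolding isogeny_degree_def by blast
  have "\<exists>h. rational_function E h \<and> (\<forall>x y. h (from_short E x y) = x ^ j)" for j
    using polynomial_rational_function[OF two three, of E "monom 1 j" 0] by (simp add: map_poly_monom poly_monom)
  then obtain \<gamma> where \<gamma>: "\<And>j. rational_function E (\<gamma> j)" "\<And>j x y. \<gamma> j (from_short E x y) = x ^ j" by metis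
  obtain cc where cc: "\<And>i j. i < l \<Longrightarrow> rational_function E' (cc j i)"
    "\<And>j. same_function E (\<gamma> j) (\<lambda>P. \<Sum>i<l. cc j i (\<phi> P) * b i P)"
    using choice[of "\<lambda>j c. (\<forall>i<l. rational_function E' (c i)) \<and> same_function E (\<gamma> j) (\<lambda>P. \<Sum>i<l. c i (\<phi> P) * b i P)"]
      span[OF \<gamma>(1)] by blast
  define Q where "Q j i z \<longleftrightarrow> snd (snd z) \<noteq> 0 \<and> (\<forall>x y. on_short E' x y \<longrightarrow> poly (ac (snd (snd z))) x \<noteq> 0 \<longrightarrow>
    cc j i (from_short E' x y) = (poly (ac (fst z)) x + poly (ac (fst (snd z))) x * y) / poly (ac (snd (snd z))) x)" for j i z
  have ex: "\<exists>z. Q j i z" if "i < l" for j i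
    using rational_function_rep[OF two three cc(1)[OF that]] unfolding Q_def by (metis fst_conv snd_conv)
  define uvw where "uvw j i = (SOME z. Q j i z)" for j i
  have "Q j i (uvw j i)" if "i < l" for j i unfolding uvw_def by (rule someI_ex[OF ex[OF that]])
  note uvw = this[unfolded Q_def]
  define u v w where "u j i = fst (uvw j i)" and "v j i = fst (snd (uvw j i))" and "w j i = snd (snd (uvw j i))" for j i
  have w0: "w j i \<noteq> 0" if "i < l" for j i using uvw[OF that] by (simp add: w_def)
  have ccv: "cc j i (from_short E' x y) = (poly (ac (u j i)) x + poly (ac (v j i)) x * y) / poly (ac (w j i)) x"
    if "i < l" "on_short E' x y" "poly (ac (w j i)) x \<noteq> 0" for j i x y
    using uvw[OF that(1), of j] that(2,3) unfolding u_def v_def w_def by blast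
  \<comment> \<open>A common denominator for the coefficients of x^j; elimination is run on the
    numerators.\<close>
  define \<Gamma> where "\<Gamma> j = (\<Prod>i<l. w j i)" for j
  define \<Gamma>' where "\<Gamma>' j i = (\<Prod>k\<in>{..<l} - {i}. w j k)" for j i
  have \<Gamma>: "\<Gamma> j = w j i * \<Gamma>' j i" if "i < l" for j i
    unfolding \<Gamma>_def \<Gamma>'_def using that by (intro prod.remove) auto
  have \<Gamma>0: "\<Gamma> j \<noteq> 0" for j unfolding \<Gamma>_def using w0 by simp
  obtain cu cv where c: "\<exists>j\<in>{..<degree N}. cu j \<noteq> 0 \<or> cv j \<noteq> 0"
    "\<forall>i<l. \<forall>p\<in>good. (\<Sum>j<degree N. ev (cu j) (cv j) p * ev (u j i * \<Gamma>' j i) (v j i * \<Gamma>' j i) p) = 0"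
    using elimination[OF finite_lessThan ln, of "\<lambda>j i. u j i * \<Gamma>' j i" "\<lambda>j i. v j i * \<Gamma>' j i"] by blast
  define B where "B = (\<Union>j\<in>{..<degree N}. {x. \<exists>y. from_short E x y \<in> {P \<in> geom_points E. \<gamma> j P \<noteq> (\<Sum>i<l. cc j i (\<phi> P) * b i P)}})
     \<union> (\<Union>j\<in>{..<degree N}. \<Union>i\<in>{..<l}. {x. poly (ac D) x \<noteq> 0 \<and> poly (ac (w j i)) (\<xi> x) = 0})"
  have "finite B"
    unfolding B_def
    by (intro finite_UnI finite_UN_I finite_lessThan finite_first_coordinates finite_\<xi>_roots w0)
      (use cc(2) in \<open>auto simp: same_function_def\<close>)
  then have "\<forall>j<degree N. cu j * \<Gamma> j = 0 \<and> cv j * \<Gamma> j = 0"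
  proof (rule independent)
    fix x y assume g: "(x, y) \<in> good" and x: "x \<notin> B"
    let ?P = "from_short E x y"
    have os: "on_short E x y" using g unfolding good_iff by blast
    note gd = goodD[OF g]
    have xj: "poly (ac (\<Gamma> j)) (\<xi> x) * x ^ j = (\<Sum>i<l. ev (u j i * \<Gamma>' j i) (v j i * \<Gamma>' j i) (x, y) * b i ?P)"
      if j: "j < degree N" for j
    proof -
      have "\<gamma> j ?P = (\<Sum>i<l. cc j i (\<phi> ?P) * b i ?P)"
        using x j from_short_geom[OF os] unfolding B_def by blast
      then have "poly (ac (\<Gamma> j)) (\<xi> x) * x ^ j = (\<Sum>i<l. poly (ac (\<Gamma> j)) (\<xi> x) * cc j i (\<phi> ?P) * b i ?P)"
        unfolding \<gamma>(2) by (simp add: sum_distrib_left mult.assoc)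
      also have "\<dots> = (\<Sum>i<l. ev (u j i * \<Gamma>' j i) (v j i * \<Gamma>' j i) (x, y) * b i ?P)"
      proof (rule sum.cong[OF refl])
        fix i assume "i \<in> {..<l}"
        then have i: "i < l" by simp
        have wx: "poly (ac (w j i)) (\<xi> x) \<noteq> 0" using x i j gd(1) unfolding B_def by auto
        have "cc j i (\<phi> ?P) = (poly (ac (u j i)) (\<xi> x) + poly (ac (v j i)) (\<xi> x) * \<eta> x y) / poly (ac (w j i)) (\<xi> x)"
          unfolding gd(3) by (rule ccv[OF i gd(2) wx])
        then show "poly (ac (\<Gamma> j)) (\<xi> x) * cc j i (\<phi> ?P) * b i ?P = ev (u j i * \<Gamma>' j i) (v j i * \<Gamma>' j i) (x, y) * b i ?P"
          unfolding gd(4) \<Gamma>[OF i] using wx by (simp add: algebra_simps)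
      qed
      finally show ?thesis .
    qed
    have "(\<Sum>j<degree N. ev (cu j * \<Gamma> j) (cv j * \<Gamma> j) (x, y) * x ^ j)
       = (\<Sum>j<degree N. \<Sum>i<l. ev (cu j) (cv j) (x, y) * ev (u j i * \<Gamma>' j i) (v j i * \<Gamma>' j i) (x, y) * b i ?P)"
    proof (rule sum.cong[OF refl])
      fix j assume "j \<in> {..<degree N}"
      then have "ev (cu j * \<Gamma> j) (cv j * \<Gamma> j) (x, y) * x ^ j = ev (cu j) (cv j) (x, y) * (poly (ac (\<Gamma> j)) (\<xi> x) * x ^ j)"
        unfolding gd(4) by (simp add: algebra_simps)
      also have "\<dots> = (\<Sum>i<l. ev (cu j) (cv j) (x, y) * ev (u j i * \<Gamma>' j i) (v j i * \<Gamma>' j i) (x, y) * b i ?P)"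
        using xj[of j] \<open>j \<in> {..<degree N}\<close> by (simp add: sum_distrib_left mult.assoc)
      finally show "ev (cu j * \<Gamma> j) (cv j * \<Gamma> j) (x, y) * x ^ j
        = (\<Sum>i<l. ev (cu j) (cv j) (x, y) * ev (u j i * \<Gamma>' j i) (v j i * \<Gamma>' j i) (x, y) * b i ?P)" .
    qed
    also have "\<dots> = (\<Sum>i<l. (\<Sum>j<degree N. ev (cu j) (cv j) (x, y) * ev (u j i * \<Gamma>' j i) (v j i * \<Gamma>' j i) (x, y)) * b i ?P)"
      unfolding sum_distrib_right by (rule sum.swap)
    also have "\<dots> = 0" using c(2) g by simp
    finally show "(\<Sum>j<degree N. ev (cu j * \<Gamma> j) (cv j * \<Gamma> j) (x, y) * x ^ j) = 0" .
  qed
  then show False using c(1) \<Gamma>0 by auto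
qed

text \<open>The counterpart, from linear independence of the basis: up to a common factor its
  members are combinations of the powers of x below degree N, and more functions than powers would
  be dependent.\<close>

lemma isogeny_degree_le_degree:
  assumes "isogeny_degree E E' \<phi> l"
  shows "l \<le> degree N"
proof (rule ccontr)
  assume "\<not> l \<le> degree N"
  then have ln: "degree N < card {..<l}" by simp
  obtain b where rat: "\<And>i. i < l \<Longrightarrow> rational_function E (b i)"
    and ind: "\<And>c. (\<forall>i<l. rational_function E' (c i)) \<Longrightarrow>
           same_function E (\<lambda>P. \<Sum>i<l. c i (\<phi> P) * b i P) (\<lambda>_. 0) \<Longrightarrow> (\<forall>i<l. same_function E' (c i) (\<lambda>_. 0))"
    using assms unfolding isogeny_degree_def by blast
  have "\<exists>uvw. snd (snd uvw) \<noteq> 0 \<and> (\<forall>x y. on_short E x y \<longrightarrow> poly (ac (snd (snd uvw))) x \<noteq> 0 \<longrightarrow>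
    b i (from_short E x y) = (poly (ac (fst uvw)) x + poly (ac (fst (snd uvw))) x * y) / poly (ac (snd (snd uvw))) x)"
    if "i < l" for i
    using rational_function_rep[OF two three rat[OF that]] by (metis fst_conv snd_conv)
  then obtain uvw where uvw: "\<And>i. i < l \<Longrightarrow> snd (snd (uvw i)) \<noteq> 0 \<and> (\<forall>x y. on_short E x y \<longrightarrow> poly (ac (snd (snd (uvw i)))) x \<noteq> 0 \<longrightarrow>
    b i (from_short E x y) = (poly (ac (fst (uvw i))) x + poly (ac (fst (snd (uvw i)))) x * y) / poly (ac (snd (snd (uvw i)))) x)"
    by metis
  define u v w where "u i = fst (uvw i)" and "v i = fst (snd (uvw i))" and "w i = snd (snd (uvw i))" for i
  have w0: "w i \<noteq> 0" if "i < l" for i using uvw[OF that] by (simp add: w_def)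
  have bv: "b i (from_short E x y) = (poly (ac (u i)) x + poly (ac (v i)) x * y) / poly (ac (w i)) x"
    if "i < l" "on_short E x y" "poly (ac (w i)) x \<noteq> 0" for i x y
    using uvw[OF that(1)] that(2,3) unfolding u_def v_def w_def by blast
  define \<Omega> where "\<Omega> = (\<Prod>i<l. w i)"
  define \<Omega>' where "\<Omega>' i = (\<Prod>k\<in>{..<l} - {i}. w k)" for i
  have \<Omega>: "\<Omega> = w i * \<Omega>' i" if "i < l" for i
    unfolding \<Omega>_def \<Omega>'_def using that by (intro prod.remove) auto
  have \<Omega>0: "\<Omega> \<noteq> 0" unfolding \<Omega>_def using w0 by simp
  have span: "\<exists>\<tau>. \<forall>i x. poly (ac D) x \<noteq> 0 \<longrightarrow>
    poly (ac (h i)) x = (\<Sum>j<degree N. poly (ac (\<tau> i j)) (poly (ac N) x / poly (ac D) x) * x ^ j)" for h :: "nat \<Rightarrow> 'a poly"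
  proof (rule choice, rule allI)
    fix i
    show "\<exists>\<tau>. \<forall>x. poly (ac D) x \<noteq> 0 \<longrightarrow>
      poly (ac (h i)) x = (\<Sum>j<degree N. poly (ac (\<tau> j)) (poly (ac N) x / poly (ac D) x) * x ^ j)"
      by (rule powers_span[OF deg])
  qed
  \<comment> \<open>The relation V y = W \<eta> makes y a pulled back function up to polynomials in
    x, so V \<Omega> clears the denominators and leaves polynomials in x to be spanned by
    powers.\<close>
  obtain \<tau> where \<tau>: "\<And>i x. poly (ac D) x \<noteq> 0 \<Longrightarrow>
    poly (ac (V * \<Omega>' i * u i)) x = (\<Sum>j<degree N. poly (ac (\<tau> i j)) (poly (ac N) x / poly (ac D) x) * x ^ j)"
    using span[of "\<lambda>i. V * \<Omega>' i * u i"] by blast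
  obtain \<tau>' where \<tau>': "\<And>i x. poly (ac D) x \<noteq> 0 \<Longrightarrow>
    poly (ac (W * \<Omega>' i * v i)) x = (\<Sum>j<degree N. poly (ac (\<tau>' i j)) (poly (ac N) x / poly (ac D) x) * x ^ j)"
    using span[of "\<lambda>i. W * \<Omega>' i * v i"] by blast
  obtain cu cv where c: "\<exists>i\<in>{..<l}. cu i \<noteq> 0 \<or> cv i \<noteq> 0"
    "\<forall>j<degree N. \<forall>p\<in>good. (\<Sum>i<l. ev (cu i) (cv i) p * ev (\<tau> i j) (\<tau>' i j) p) = 0"
    using elimination[OF finite_lessThan ln, of \<tau> \<tau>'] by blast
  obtain \<gamma> where \<gamma>: "\<And>i. rational_function E' (\<gamma> i)"
    "\<And>i x y. \<gamma> i (from_short E' x y) = poly (ac (cu i)) x + poly (ac (cv i)) x * y"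
  proof -
    have "\<exists>\<gamma>. \<forall>i. rational_function E' (\<gamma> i) \<and>
      (\<forall>x y. \<gamma> i (from_short E' x y) = poly (ac (cu i)) x + poly (ac (cv i)) x * y)"
    proof (rule choice, rule allI)
      fix i
      show "\<exists>h. rational_function E' h \<and>
        (\<forall>x y. h (from_short E' x y) = poly (ac (cu i)) x + poly (ac (cv i)) x * y)"
        using polynomial_rational_function[OF two three, of E' "cu i" "cv i"] by blast
    qed
    then show ?thesis using that by blast
  qed
  define B where "B = ({x. poly (ac W) x = 0} \<union> {x. poly (ac V) x = 0}) \<union> {x. poly (ac \<Omega>) x = 0}"
  have "ac \<Omega> \<noteq> 0" using \<Omega>0 by simp
  then have B: "finite B" unfolding B_def using finite_bad poly_roots_finite by blast
  have zero: "(\<Sum>i<l. \<gamma> i (\<phi> (from_short E x y)) * b i (from_short E x y)) = 0"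
    if os: "on_short E x y" and x: "x \<notin> B" for x y
  proof -
    let ?P = "from_short E x y"
    have g: "(x, y) \<in> good" unfolding good_iff using os x by (simp add: B_def)
    note gd = goodD[OF g]
    have Wx: "poly (ac W) x \<noteq> 0" "poly (ac V) x \<noteq> 0" "poly (ac \<Omega>) x \<noteq> 0" using x by (simp_all add: B_def)
    have bi: "poly (ac (V * \<Omega>)) x * b i ?P = (\<Sum>j<degree N. ev (\<tau> i j) (\<tau>' i j) (x, y) * x ^ j)" if i: "i < l" for i
    proof -
      have wx: "poly (ac (w i)) x \<noteq> 0" using Wx(3) unfolding \<Omega>[OF i] by simp
      have "poly (ac (V * \<Omega>)) x * b i ?P = poly (ac (V * \<Omega>' i * u i)) x + poly (ac (W * \<Omega>' i * v i)) x * \<eta> x y"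
        unfolding bv[OF i os wx] \<Omega>[OF i] using wx Wx by (simp add: \<eta>_def field_simps)
      also have "\<dots> = (\<Sum>j<degree N. ev (\<tau> i j) (\<tau>' i j) (x, y) * x ^ j)"
        unfolding \<tau>[OF gd(1)] \<tau>'[OF gd(1)] gd(4) \<xi>_def[symmetric] sum_distrib_right sum.distrib[symmetric]
        by (rule sum.cong) (simp_all add: algebra_simps)
      finally show ?thesis .
    qed
    have "poly (ac (V * \<Omega>)) x * (\<Sum>i<l. \<gamma> i (\<phi> ?P) * b i ?P) = (\<Sum>i<l. \<Sum>j<degree N. ev (cu i) (cv i) (x, y) * ev (\<tau> i j) (\<tau>' i j) (x, y) * x ^ j)"
      unfolding sum_distrib_left
    proof (rule sum.cong[OF refl])
      fix i assume "i \<in> {..<l}"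
      then have i: "i < l" by simp
      have "\<gamma> i (\<phi> ?P) = ev (cu i) (cv i) (x, y)" unfolding gd(3,4) \<gamma>(2) ..
      then have "poly (ac (V * \<Omega>)) x * (\<gamma> i (\<phi> ?P) * b i ?P) = ev (cu i) (cv i) (x, y) * (poly (ac (V * \<Omega>)) x * b i ?P)"
        by (simp only: mult_ac)
      also have "\<dots> = (\<Sum>j<degree N. ev (cu i) (cv i) (x, y) * ev (\<tau> i j) (\<tau>' i j) (x, y) * x ^ j)"
        unfolding bi[OF i] sum_distrib_left by (simp only: mult.assoc)
      finally show "poly (ac (V * \<Omega>)) x * (\<gamma> i (\<phi> ?P) * b i ?P)
        = (\<Sum>j<degree N. ev (cu i) (cv i) (x, y) * ev (\<tau> i j) (\<tau>' i j) (x, y) * x ^ j)" .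
    qed
    also have "\<dots> = (\<Sum>j<degree N. (\<Sum>i<l. ev (cu i) (cv i) (x, y) * ev (\<tau> i j) (\<tau>' i j) (x, y)) * x ^ j)"
      unfolding sum_distrib_right by (rule sum.swap)
    also have "\<dots> = 0" using c(2) g by simp
    finally show ?thesis using Wx by simp
  qed
  have "same_function E (\<lambda>P. \<Sum>i<l. \<gamma> i (\<phi> P) * b i P) (\<lambda>_. 0)"
    unfolding same_function_def
  proof (rule finite_subset)
    show "finite (insert Infty {from_short E x y | x y. on_short E x y \<and> x \<in> B})"
      using finite_points_over[OF B] by simp
    show "{P \<in> geom_points E. (\<Sum>i<l. \<gamma> i (\<phi> P) * b i P) \<noteq> 0} \<subseteq> insert Infty {from_short E x y | x y. on_short E x y \<and> x \<in> B}"
    proof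
      fix P assume P: "P \<in> {P \<in> geom_points E. (\<Sum>i<l. \<gamma> i (\<phi> P) * b i P) \<noteq> 0}"
      show "P \<in> insert Infty {from_short E x y | x y. on_short E x y \<and> x \<in> B}"
      proof (cases "P = Infty")
        case False
        then obtain x y where xy: "P = from_short E x y" "on_short E x y" using geom_points_cases[OF two three] P by blast
        then have "x \<in> B" using zero P by auto
        then show ?thesis using xy by blast
      qed simp
    qed
  qed
  then have sf: "\<forall>i<l. same_function E' (\<gamma> i) (\<lambda>_. 0)" using ind[of \<gamma>] \<gamma>(1) by blast
  obtain i where i: "i < l" "cu i \<noteq> 0 \<or> cv i \<noteq> 0" using c(1) by auto
  \<comment> \<open>A nonzero u + v y vanishes only over the finitely many roots of its norm, so it
    cannot represent the zero function.\<close>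
  define A where "A = {Q \<in> geom_points E'. \<gamma> i Q \<noteq> 0}"
  have "finite A" using sf i(1) by (simp add: same_function_def A_def)
  then have fA: "finite {x. \<exists>y. from_short E' x y \<in> A}" by (rule finite_first_coordinates)
  define q where "q = ac (qnorm (cubic (short_A E') (short_B E')) (cu i) (cv i))"
  have "q \<noteq> 0" using i(2) by (simp add: q_def qnorm_eq_0_iff del: ac_cubic)
  then have fq: "finite {x. poly q x = 0}" by (rule poly_roots_finite)
  have r: "rep E' (cu i) (cv i) (\<lambda>x y. \<gamma> i (from_short E' x y))" by (simp add: rep_def \<gamma>(2))
  have "UNIV \<subseteq> {x. \<exists>y. from_short E' x y \<in> A} \<union> {x. poly q x = 0}"
  proof
    fix x
    obtain y where y: "on_short E' x y" using point_over by blast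
    have "from_short E' x y \<in> A" if "poly q x \<noteq> 0"
      using rep_nonzero_off_norm[OF r y] that Aff_geom_points_iff[OF two three] y unfolding A_def q_def by blast
    then show "x \<in> {x. \<exists>y. from_short E' x y \<in> A} \<union> {x. poly q x = 0}" by blast
  qed
  then have "finite (UNIV :: 'a alg_closure set)" using fA fq by (metis finite_UnI finite_subset)
  then show False using infinite_UNIV_alg_closed_field by blast
qed

end

section \<open>Discrete valuations\<close>

locale dvr =
  fixes R :: "'a::field set"
  assumes is_dvr: "is_dvr R"
begin

abbreviation v :: "'a \<Rightarrow> int" where "v \<equiv> dvr_ord R"

lemma discrete_valuation: "discrete_valuation v" and R_eq: "R = valuation_ring v"
proof -
  have "\<exists>w. discrete_valuation w \<and> R = valuation_ring w" using is_dvr by (simp add: is_dvr_def)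
  from someI_ex[OF this] show "discrete_valuation v" "R = valuation_ring v" unfolding dvr_ord_def by blast+
qed

lemma v_mult: "x \<noteq> 0 \<Longrightarrow> y \<noteq> 0 \<Longrightarrow> v (x * y) = v x + v y"
  using discrete_valuation by (simp add: discrete_valuation_def)

lemma v_add: "x \<noteq> 0 \<Longrightarrow> y \<noteq> 0 \<Longrightarrow> x + y \<noteq> 0 \<Longrightarrow> min (v x) (v y) \<le> v (x + y)"
  using discrete_valuation by (simp add: discrete_valuation_def)

lemma uniformizer_exists: "\<exists>\<pi>. uniformizer R \<pi>"
  using discrete_valuation by (auto simp: discrete_valuation_def uniformizer_def)

lemma v_1 [simp]: "v 1 = 0"
  using v_mult[of 1 1] by simp

lemma v_minus [simp]: "v (- x) = v x"
proof (cases "x = 0")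
  case False
  have "v (- 1) + v (- 1) = 0" using v_mult[of "- 1" "- 1"] by simp
  then show ?thesis using v_mult[of "- 1" x] False by simp
qed simp

lemma v_power: "x \<noteq> 0 \<Longrightarrow> v (x ^ n) = int n * v x"
  by (induction n) (simp_all add: v_mult algebra_simps)

lemma v_inverse: "x \<noteq> 0 \<Longrightarrow> v (inverse x) = - v x"
  using v_mult[of x "inverse x"] by simp

lemma v_divide: "x \<noteq> 0 \<Longrightarrow> y \<noteq> 0 \<Longrightarrow> v (x / y) = v x - v y"
  using v_mult[of x "inverse y"] v_inverse[of y] by (simp add: divide_inverse)

lemma v_powi: "x \<noteq> 0 \<Longrightarrow> v (x powi n) = n * v x"
  by (cases "n \<ge> 0") (simp_all add: power_int_def v_power v_inverse power_inverse)

lemma mem_R_iff: "x \<in> R \<longleftrightarrow> x = 0 \<or> 0 \<le> v x"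
  by (subst R_eq) (simp add: valuation_ring_def)

lemma mem_max_pow_iff: "x \<in> max_pow R n \<longleftrightarrow> x = 0 \<or> int n \<le> v x"
  by (simp add: max_pow_def)

lemma max_pow_0: "max_pow R 0 = R"
  by (auto simp: mem_R_iff mem_max_pow_iff)

lemma max_pow_mono: "x \<in> max_pow R m \<Longrightarrow> n \<le> m \<Longrightarrow> x \<in> max_pow R n"
  by (auto simp: mem_max_pow_iff)

lemma max_pow_add: assumes "x \<in> max_pow R n" "y \<in> max_pow R n" shows "x + y \<in> max_pow R n"
  using assms v_add[of x y] by (cases "x = 0 \<or> y = 0 \<or> x + y = 0") (auto simp: mem_max_pow_iff)

lemma max_pow_minus: "x \<in> max_pow R n \<Longrightarrow> - x \<in> max_pow R n"
  by (auto simp: mem_max_pow_iff)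

lemma max_pow_diff: "x \<in> max_pow R n \<Longrightarrow> y \<in> max_pow R n \<Longrightarrow> x - y \<in> max_pow R n"
  using max_pow_add[of x n "- y"] max_pow_minus by simp

lemma max_pow_mult: "x \<in> max_pow R m \<Longrightarrow> y \<in> max_pow R n \<Longrightarrow> x * y \<in> max_pow R (m + n)"
  by (cases "x = 0 \<or> y = 0") (auto simp: mem_max_pow_iff v_mult)

lemma max_pow_power: "x \<in> max_pow R m \<Longrightarrow> x ^ n \<in> max_pow R (m * n)"
  using mult_right_mono[of "int m" "v x" "int n"]
  by (cases "x = 0") (auto simp: mem_max_pow_iff v_power mult.commute power_0_left)

lemma v_add_eq:
  assumes x: "x \<noteq> 0" and y: "y \<in> max_pow R n" and lt: "v x < int n"
  shows "x + y \<noteq> 0" "v (x + y) = v x"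
proof -
  show nz: "x + y \<noteq> 0"
  proof
    assume "x + y = 0"
    then have "x = - y" by (simp add: eq_neg_iff_add_eq_0)
    then have "x \<in> max_pow R n" using max_pow_minus[OF y] by simp
    then show False using x lt by (simp add: mem_max_pow_iff)
  qed
  show "v (x + y) = v x"
  proof (rule antisym)
    show "v x \<le> v (x + y)" using v_add[OF x _ nz] y lt by (cases "y = 0") (auto simp: mem_max_pow_iff)
    show "v (x + y) \<le> v x"
    proof (rule ccontr)
      assume "\<not> v (x + y) \<le> v x"
      have "min (v (x + y)) (v (- y)) \<le> v x" if "y \<noteq> 0"
        using v_add[of "x + y" "- y"] nz that x by simp
      then show False using \<open>\<not> v (x + y) \<le> v x\<close> y lt by (cases "y = 0") (auto simp: mem_max_pow_iff)
    qed
  qed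
qed

lemma one_R: "1 \<in> R" and zero_R: "0 \<in> R"
  by (simp_all add: mem_R_iff)

lemma R_add: "x \<in> R \<Longrightarrow> y \<in> R \<Longrightarrow> x + y \<in> R" and R_diff: "x \<in> R \<Longrightarrow> y \<in> R \<Longrightarrow> x - y \<in> R"
  and R_mult: "x \<in> R \<Longrightarrow> y \<in> R \<Longrightarrow> x * y \<in> R" and R_minus: "x \<in> R \<Longrightarrow> - x \<in> R"
  and R_power: "x \<in> R \<Longrightarrow> x ^ n \<in> R"
  using max_pow_add[of x 0 y] max_pow_diff[of x 0 y] max_pow_mult[of x 0 y 0] max_pow_minus[of x 0]
    max_pow_power[of x 0 n] by (simp_all add: max_pow_0)

lemma of_nat_R: "of_nat n \<in> R"
  by (induction n) (auto simp: zero_R one_R R_add)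

lemma numeral_R: "numeral k \<in> R"
  using of_nat_R[of "numeral k"] by simp

lemmas R_intros = zero_R one_R numeral_R of_nat_R R_minus R_add R_diff R_mult R_power

lemma max_pow_scale: "c \<in> R \<Longrightarrow> x \<in> max_pow R n \<Longrightarrow> c * x \<in> max_pow R n"
  using max_pow_mult[of c 0 x n] by (simp add: max_pow_0)

text \<open>The extension theorem with a uniformiser as t. The ring V meets the ground field in R
  only: for x outside R the quotient of 1/\<pi> by x lies in R, so x in V would put 1/\<pi> into
  V.\<close>

lemma extension_to_closure:
  obtains V where "valuation_subring V" "\<And>x. to_ac x \<in> V \<longleftrightarrow> x \<in> R"
    "\<And>x. to_ac x \<in> valuation_subring.M V \<longleftrightarrow> x \<in> max_pow R 1"
proof -
  obtain \<pi> where \<pi>: "\<pi> \<noteq> 0" "v \<pi> = 1" using uniformizer_exists by (auto simp: uniformizer_def)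
  have "\<exists>V. valuation_subring V \<and> to_ac ` R \<subseteq> V \<and> inverse (to_ac \<pi>) \<notin> V"
  proof (rule extend_to_valuation_subring)
    have "1 = to_ac (1::'a)" by simp
    then show "1 \<in> to_ac ` R" using one_R by blast
    show "to_ac \<pi> \<in> to_ac ` R" using \<pi> by (simp add: mem_R_iff)
    have "inverse \<pi> \<notin> R" using \<pi> by (simp add: mem_R_iff v_inverse)
    then have "to_ac (inverse \<pi>) \<notin> to_ac ` R" by (simp add: inj_image_mem_iff[OF inj_to_ac] del: to_ac_inverse)
    then show "inverse (to_ac \<pi>) \<notin> to_ac ` R" by simp
  qed (auto simp flip: to_ac_diff to_ac_mult intro!: imageI R_diff R_mult)
  then obtain V where V: "valuation_subring V" "to_ac ` R \<subseteq> V" "inverse (to_ac \<pi>) \<notin> V" by blast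
  interpret valuation_subring V by (rule V(1))
  have mem: "to_ac x \<in> V \<longleftrightarrow> x \<in> R" for x
  proof
    assume x: "to_ac x \<in> V"
    show "x \<in> R"
    proof (rule ccontr)
      assume n: "x \<notin> R"
      then have x0: "x \<noteq> 0" and neg: "v x < 0" by (auto simp: mem_R_iff)
      then have "inverse \<pi> / x \<in> R" using \<pi> by (auto simp: mem_R_iff v_divide v_inverse)
      then have "to_ac (inverse \<pi> / x) * to_ac x \<in> V" using V(2) x by (blast intro: mult_mem)
      then show False using V(3) x0 by simp
    qed
  qed (use V(2) in blast)
  have "to_ac x \<in> M \<longleftrightarrow> x \<in> max_pow R 1" for x
  proof -
    have "to_ac x \<in> M \<longleftrightarrow> x \<in> R \<and> (x = 0 \<or> inverse x \<notin> R)"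
      unfolding M_def using mem[of x] mem[of "inverse x"] by simp
    then show ?thesis by (cases "x = 0") (auto simp: mem_R_iff mem_max_pow_iff v_inverse)
  qed
  with V(1) mem show ?thesis by (rule that)
qed

end

locale dvr_residue = dvr R for R :: "'a::field set" +
  fixes res :: "'a \<Rightarrow> 'k::field"
  assumes residue: "residue_map R res" and char_gt_3: "CHAR('k) > 3"
begin

lemma res_add: "x \<in> R \<Longrightarrow> y \<in> R \<Longrightarrow> res (x + y) = res x + res y"
  and res_mult: "x \<in> R \<Longrightarrow> y \<in> R \<Longrightarrow> res (x * y) = res x * res y"
  and res_1 [simp]: "res 1 = 1"
  and res_eq_0_iff: "x \<in> R \<Longrightarrow> res x = 0 \<longleftrightarrow> x \<in> max_pow R 1"
  using residue by (simp_all add: residue_map_def)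

lemma res_0 [simp]: "res 0 = 0"
  using res_eq_0_iff[OF zero_R] by (simp add: mem_max_pow_iff)

lemma res_power: "x \<in> R \<Longrightarrow> res (x ^ n) = res x ^ n"
  by (induction n) (simp_all add: res_mult R_power)

lemma res_of_nat [simp]: "res (of_nat n) = of_nat n"
  by (induction n) (simp_all add: res_add one_R of_nat_R)

lemma res_numeral [simp]: "res (numeral k) = numeral k"
  using res_of_nat[of "numeral k"] by simp

lemma of_nat_max_pow_iff: "of_nat n \<in> max_pow R 1 \<longleftrightarrow> CHAR('k) dvd n"
  using res_eq_0_iff[OF of_nat_R[of n]] by (simp add: of_nat_eq_0_iff_char_dvd)

lemma prime_char: "prime CHAR('k)"
  using prime_CHAR_semidom[where ?'a = 'k] char_gt_3 by simp

lemma not_char_dvd_smooth: "\<not> CHAR('k) dvd 2 ^ i * 3 ^ j"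
proof
  assume "CHAR('k) dvd 2 ^ i * 3 ^ j"
  then have "CHAR('k) dvd 2 \<or> CHAR('k) dvd 3"
    using prime_char prime_dvd_mult_iff prime_dvd_power by blast
  then show False using char_gt_3 by (auto dest!: dvd_imp_le)
qed

lemma smooth_unit:
  "(2 ^ i * 3 ^ j :: 'a) \<noteq> 0" "v (2 ^ i * 3 ^ j) = 0"
proof -
  have "of_nat (2 ^ i * 3 ^ j) \<notin> max_pow R 1" using of_nat_max_pow_iff not_char_dvd_smooth by blast
  then have n: "(2 ^ i * 3 ^ j :: 'a) \<notin> max_pow R 1" by simp
  then show nz: "(2 ^ i * 3 ^ j :: 'a) \<noteq> 0" by (simp add: mem_max_pow_iff)
  have "(2 ^ i * 3 ^ j :: 'a) \<in> R" by (intro R_intros)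
  then show "v (2 ^ i * 3 ^ j) = 0" using n nz by (auto simp: mem_R_iff mem_max_pow_iff)
qed

lemma small_units:
  "(2::'a) \<noteq> 0" "(3::'a) \<noteq> 0" "(4::'a) \<noteq> 0" "(8::'a) \<noteq> 0" "(12::'a) \<noteq> 0" "(16::'a) \<noteq> 0" "(27::'a) \<noteq> 0"
  "v 2 = 0" "v 3 = 0" "v 4 = 0" "v 8 = 0" "v 12 = 0" "v 16 = 0" "v 27 = 0"
  using smooth_unit[of 1 0] smooth_unit[of 0 1] smooth_unit[of 2 0] smooth_unit[of 3 0] smooth_unit[of 2 1]
    smooth_unit[of 4 0] smooth_unit[of 0 3] by simp_all

lemma residue_two_three: "(2::'k) \<noteq> 0" "(3::'k) \<noteq> 0"
  using not_char_dvd_smooth[of 1 0] not_char_dvd_smooth[of 0 1]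
    of_nat_eq_0_iff_char_dvd[of 2, where ?'a = 'k] of_nat_eq_0_iff_char_dvd[of 3, where ?'a = 'k] by auto

lemma divide_R: "x \<in> R \<Longrightarrow> u \<noteq> 0 \<Longrightarrow> v u = 0 \<Longrightarrow> x / u \<in> R"
  by (cases "x = 0") (auto simp: mem_R_iff v_divide)

lemma max_pow_divide: "x \<in> max_pow R n \<Longrightarrow> u \<noteq> 0 \<Longrightarrow> v u = 0 \<Longrightarrow> x / u \<in> max_pow R n"
  by (cases "x = 0") (auto simp: mem_max_pow_iff v_divide)

end

section \<open>Minimal models and Kodaira types\<close>

lemma b_change_vars:
  fixes E :: "'a::field weierstrass"
  assumes "u \<noteq> 0"
  shows "b\<^sub>2 (change_vars u r s t E) = (b\<^sub>2 E + 12 * r) / u ^ 2"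
    "b\<^sub>4 (change_vars u r s t E) = (b\<^sub>4 E + r * b\<^sub>2 E + 6 * r ^ 2) / u ^ 4"
    "b\<^sub>6 (change_vars u r s t E) = (b\<^sub>6 E + 2 * r * b\<^sub>4 E + r ^ 2 * b\<^sub>2 E + 4 * r ^ 3) / u ^ 6"
proof -
  have sum: "(x / u) ^ 2 + 4 * (y / u ^ 2) = (x ^ 2 + 4 * y) / u ^ 2"
    "2 * (x / u ^ 4) + (y / u) * (z / u ^ 3) = (2 * x + y * z) / u ^ 4"
    "(x / u ^ 3) ^ 2 + 4 * (y / u ^ 6) = (x ^ 2 + 4 * y) / u ^ 6" for x y z
    using assms by (simp_all add: field_simps eval_nat_numeral)
  show "b\<^sub>2 (change_vars u r s t E) = (b\<^sub>2 E + 12 * r) / u ^ 2"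
    "b\<^sub>4 (change_vars u r s t E) = (b\<^sub>4 E + r * b\<^sub>2 E + 6 * r ^ 2) / u ^ 4"
    "b\<^sub>6 (change_vars u r s t E) = (b\<^sub>6 E + 2 * r * b\<^sub>4 E + r ^ 2 * b\<^sub>2 E + 4 * r ^ 3) / u ^ 6"
    unfolding b\<^sub>2_def b\<^sub>4_def b\<^sub>6_def change_vars_def weierstrass.sel sum
    by (rule arg_cong[where f = "\<lambda>x. x / _"], simp add: algebra_simps power2_eq_square power3_eq_cube)+
qed

lemma short_change_vars:
  fixes E :: "'a::field weierstrass"
  assumes two: "(2::'a) \<noteq> 0" and three: "(3::'a) \<noteq> 0" and u: "u \<noteq> 0"
  shows "short_A (change_vars u r s t E) = short_A E / u ^ 4"
    "short_B (change_vars u r s t E) = short_B E / u ^ 6"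
    "discr (change_vars u r s t E) = discr E / u ^ 12"
proof -
  note n = four_twelve[OF two three]
  define e where "e = b\<^sub>2 E / 12"
  define f where "f = b\<^sub>4 E / 2"
  define g where "g = b\<^sub>6 E / 4"
  have b: "b\<^sub>2 E = 12 * e" "b\<^sub>4 E = 2 * f" "b\<^sub>6 E = 4 * g" using n two by (simp_all add: e_def f_def g_def)
  have 2: "b\<^sub>2 (change_vars u r s t E) / 12 = (e + r) / u ^ 2"
    unfolding b_change_vars[OF u] b using n u by (simp add: field_simps)
  have 4: "b\<^sub>4 (change_vars u r s t E) / 2 = (f + 6 * r * e + 3 * r ^ 2) / u ^ 4"
  proof -
    have eq: "2 * f + r * (12 * e) + 6 * r ^ 2 = 2 * (f + 6 * r * e + 3 * r ^ 2)" by (simp add: algebra_simps)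
    have "2 * x / y / 2 = x / y" for x y :: 'a using two by simp
    then show ?thesis unfolding b_change_vars[OF u] b eq .
  qed
  have 6: "b\<^sub>6 (change_vars u r s t E) / 4 = (g + r * f + 3 * r ^ 2 * e + r ^ 3) / u ^ 6"
  proof -
    have eq: "4 * g + 2 * r * (2 * f) + r ^ 2 * (12 * e) + 4 * r ^ 3 = 4 * (g + r * f + 3 * r ^ 2 * e + r ^ 3)"
      by (simp add: algebra_simps)
    have "4 * x / y / 4 = x / y" for x y :: 'a using n by simp
    then show ?thesis unfolding b_change_vars[OF u] b eq .
  qed
  have "short_A (change_vars u r s t E) = ((f + 6 * r * e + 3 * r ^ 2) - 3 * (e + r) ^ 2) / u ^ 4"
    unfolding short_A_def 2 4 using u by (simp add: power_divide diff_divide_distrib flip: power_mult)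
  then show A: "short_A (change_vars u r s t E) = short_A E / u ^ 4"
    unfolding short_A_def[of E] e_def[symmetric] f_def[symmetric] by (simp add: algebra_simps power2_eq_square)
  have "short_B (change_vars u r s t E)
      = (2 * (e + r) ^ 3 - (e + r) * (f + 6 * r * e + 3 * r ^ 2) + (g + r * f + 3 * r ^ 2 * e + r ^ 3)) / u ^ 6"
  proof -
    have "2 * (x / u ^ 2) ^ 3 - x / u ^ 2 * (y / u ^ 4) + z / u ^ 6 = (2 * x ^ 3 - x * y + z) / u ^ 6" for x y z
      by (simp add: power_divide diff_divide_distrib add_divide_distrib flip: power_mult power_add)
    then show ?thesis unfolding short_B_def 2 4 6 .
  qed
  then show B: "short_B (change_vars u r s t E) = short_B E / u ^ 6"
    unfolding short_B_def[of E] e_def[symmetric] f_def[symmetric] g_def[symmetric]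
    by (simp add: algebra_simps power2_eq_square power3_eq_cube)
  have "4 * (short_A E / u ^ 4) ^ 3 + 27 * (short_B E / u ^ 6) ^ 2 = (4 * short_A E ^ 3 + 27 * short_B E ^ 2) / u ^ 12"
    by (simp add: power_divide add_divide_distrib flip: power_mult)
  then show "discr (change_vars u r s t E) = discr E / u ^ 12"
    unfolding short_discriminant[OF two three, symmetric] A B by simp
qed

text \<open>The short model with x replaced by x + c. The case c = 0 serves most types; a nonzero c
  is needed for I_n^* with n > 0, where a double root has to be moved to 0.\<close>

lemma change_vars_to_short:
  fixes E :: "'a::field weierstrass"
  assumes two: "(2::'a) \<noteq> 0" and three: "(3::'a) \<noteq> 0" and u: "u \<noteq> 0"
  defines "A \<equiv> short_A E / u ^ 4" and "B \<equiv> short_B E / u ^ 6"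
  shows "\<exists>r s t. change_vars u r s t E = Weierstrass 0 (3 * c) 0 (3 * c ^ 2 + A) (c ^ 3 + A * c + B)"
proof -
  note n = four_twelve[OF two three]
  define \<alpha> where "\<alpha> = a\<^sub>1 E / 2"
  define \<beta> where "\<beta> = a\<^sub>3 E / 2"
  define e where "e = b\<^sub>2 E / 12"
  define \<rho> where "\<rho> = u ^ 2 * c"
  define r where "r = \<rho> - e"
  have a1: "a\<^sub>1 E = 2 * \<alpha>" and a3: "a\<^sub>3 E = 2 * \<beta>" using two by (simp_all add: \<alpha>_def \<beta>_def)
  have "4 * a\<^sub>2 E = 4 * (3 * e - \<alpha> ^ 2)"
    using n by (simp add: e_def b\<^sub>2_def a1 algebra_simps power2_eq_square)
  then have a2: "a\<^sub>2 E = 3 * e - \<alpha> ^ 2" using n(1) mult_left_cancel by blast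
  have f: "b\<^sub>4 E / 2 = a\<^sub>4 E + 2 * \<alpha> * \<beta>" using two by (simp add: b\<^sub>4_def a1 a3 field_simps)
  have g: "b\<^sub>6 E / 4 = a\<^sub>6 E + \<beta> ^ 2" using n(1) by (simp add: b\<^sub>6_def a3 field_simps power2_eq_square)
  have sA: "short_A E = a\<^sub>4 E + 2 * \<alpha> * \<beta> - 3 * e ^ 2" unfolding short_A_def f e_def[symmetric] ..
  have sB: "short_B E = 2 * e ^ 3 - e * (a\<^sub>4 E + 2 * \<alpha> * \<beta>) + (a\<^sub>6 E + \<beta> ^ 2)"
    unfolding short_B_def f g e_def[symmetric] ..
  have "change_vars u r (- \<alpha>) (- \<beta> - r * \<alpha>) E = Weierstrass 0 (3 * \<rho> / u ^ 2) 0
     ((3 * \<rho> ^ 2 + short_A E) / u ^ 4) ((\<rho> ^ 3 + short_A E * \<rho> + short_B E) / u ^ 6)"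
    unfolding change_vars_def weierstrass.inject a1 a2 a3 sA sB r_def
    by (intro conjI arg_cong[where f = "\<lambda>x. x / _"])
      (simp_all add: algebra_simps power2_eq_square power3_eq_cube)
  also have "\<dots> = Weierstrass 0 (3 * c) 0 (3 * c ^ 2 + A) (c ^ 3 + A * c + B)"
    using u by (simp add: \<rho>_def A_def B_def add_divide_distrib power_mult_distrib eval_nat_numeral)
  finally show ?thesis by blast
qed

lemma distinct_roots_quadratic:
  fixes a c :: "'k::field"
  assumes two: "(2::'k) \<noteq> 0" and ac: "a \<noteq> 0" "c \<noteq> 0"
  shows "distinct_roots [:c, 0, a:]"
proof -
  have two': "(2::'k alg_closure) \<noteq> 0" using two to_ac_eq_0_iff[of "2::'k"] by simp
  obtain z where z: "z ^ 2 = to_ac (- c / a)" using sqrt_exists by blast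
  have "{w. poly (map_poly to_ac [:c, 0, a:]) w = 0} = {w. w ^ 2 = z ^ 2}"
    unfolding z using ac by (auto simp: field_simps power2_eq_square add_eq_0_iff)
  also have "\<dots> = {z, - z}" by (auto simp: power2_eq_iff)
  finally have "{w. poly (map_poly to_ac [:c, 0, a:]) w = 0} = {z, - z}" .
  moreover have "z \<noteq> - z"
  proof
    assume "z = - z"
    then have "2 * z = 0" by (metis add.right_inverse mult_2)
    then have "z = 0" using two' by simp
    then show False using z ac by simp
  qed
  ultimately show ?thesis using ac by (simp add: distinct_roots_def)
qed

lemma distinct_roots_cubic:
  fixes a b :: "'k::field"
  assumes "4 * a ^ 3 + 27 * b ^ 2 \<noteq> 0"
  shows "distinct_roots [:b, a, 0, 1:]"
proof -
  have p: "map_poly to_ac [:b, a, 0, 1:] = cubic (to_ac a) (to_ac b)" by (simp add: cubic_def)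
  have "to_ac (4 * a ^ 3 + 27 * b ^ 2) \<noteq> 0" using assms by (simp only: to_ac_eq_0_iff not_False_eq_True)
  then have o: "order r (cubic (to_ac a) (to_ac b)) = 1" if "poly (cubic (to_ac a) (to_ac b)) r = 0" for r
    using order_cubic[of "to_ac a" "to_ac b" r] that by simp
  have "(\<Sum>r | poly (cubic (to_ac a) (to_ac b)) r = 0. 1) = degree (cubic (to_ac a) (to_ac b))"
    unfolding sum_order_eq_degree[OF cubic_nonzero, symmetric] using o by (intro sum.cong) auto
  then show ?thesis unfolding distinct_roots_def p by simp
qed

lemma nonsingular_short:
  fixes a b :: "'k::field"
  assumes two: "(2::'k) \<noteq> 0" and disc: "4 * a ^ 3 + 27 * b ^ 2 \<noteq> 0"
  shows "nonsingular (Weierstrass 0 0 0 a b)"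
proof -
  have two': "(2::'k alg_closure) \<noteq> 0" using two to_ac_eq_0_iff[of "2::'k"] by simp
  have "to_ac (4 * a ^ 3 + 27 * b ^ 2) \<noteq> 0" using disc by (simp only: to_ac_eq_0_iff not_False_eq_True)
  then have d: "4 * to_ac a ^ 3 + 27 * to_ac b ^ 2 \<noteq> 0" by simp
  have False if "singular_at (map_weierstrass to_ac (Weierstrass 0 0 0 a b)) x y" for x y
  proof -
    have "y = 0" "x ^ 3 + to_ac a * x + to_ac b = 0" "3 * x ^ 2 + to_ac a = 0"
      using that two' by (auto simp: singular_at_def weier_eval_def add_eq_0_iff)
    then show False using singular_2_torsion[OF d] by blast
  qed
  then show ?thesis by (auto simp: nonsingular_def)
qed

text \<open>The cubic is (x - z)^2 (x + 2 z) with z = -3 b/(2 a), and the tangent slopes at (z, 0)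
  are the square roots of 3 z.\<close>

lemma node_short:
  fixes a b :: "'k::field"
  assumes two: "(2::'k) \<noteq> 0" and three: "(3::'k) \<noteq> 0" and disc: "4 * a ^ 3 + 27 * b ^ 2 = 0" and a: "a \<noteq> 0"
  shows "has_node (Weierstrass 0 0 0 a b)"
proof -
  note n = ac_two_three[OF two three]
  define A where "A = to_ac a"
  define B where "B = to_ac b"
  have A0: "A \<noteq> 0" using a by (simp add: A_def)
  have d: "4 * A ^ 3 + 27 * B ^ 2 = 0" using arg_cong[OF disc, of to_ac] by (simp add: A_def B_def)
  define z where "z = - (3 * B) / (2 * A)"
  have z: "2 * A * z = - (3 * B)" using A0 n by (simp add: z_def)
  have "4 * A ^ 2 * (3 * z ^ 2 + A) = 3 * (2 * A * z) ^ 2 + 4 * A ^ 3" by (simp add: algebra_simps eval_nat_numeral)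
  also have "\<dots> = 0" unfolding z using d by (simp add: power2_eq_square add.commute)
  finally have zA: "A = - (3 * z ^ 2)" using A0 four_twelve(1)[OF n] by (simp add: eq_neg_iff_add_eq_0 add.commute)
  have "3 * B = 3 * (2 * z ^ 3)" using z zA by (simp add: algebra_simps eval_nat_numeral)
  then have zB: "B = 2 * z ^ 3" using n(2) mult_left_cancel by blast
  have z0: "z \<noteq> 0" using zA A0 by auto
  obtain \<alpha> where \<alpha>: "\<alpha> ^ 2 = 3 * z" using sqrt_exists by blast
  have "\<alpha> \<noteq> 0" using \<alpha> z0 n by auto
  then have ne: "\<alpha> \<noteq> - \<alpha>" using n(1) by (metis add.right_inverse mult_2 mult_eq_0_iff)
  have "y ^ 2 - (x ^ 3 + A * x + B) = (y - 0 - \<alpha> * (x - z)) * (y - 0 - (- \<alpha>) * (x - z)) - (x - z) ^ 3" for x y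
  proof -
    have "(y - 0 - \<alpha> * (x - z)) * (y - 0 - (- \<alpha>) * (x - z)) = y ^ 2 - \<alpha> ^ 2 * (x - z) ^ 2"
      by (simp add: algebra_simps power2_eq_square)
    then show ?thesis unfolding \<alpha> zA zB by (simp add: algebra_simps power2_eq_square power3_eq_cube)
  qed
  moreover have "singular_at (map_weierstrass to_ac (Weierstrass 0 0 0 a b)) z 0"
    unfolding singular_at_def using zA zB by (simp add: weier_eval_def A_def B_def algebra_simps power2_eq_square power3_eq_cube)
  ultimately show ?thesis
    unfolding has_node_def node_at_def using ne
    by (intro exI[of _ z] exI[of _ "0 :: 'k alg_closure"] conjI exI[of _ \<alpha>] exI[of _ "- \<alpha>"])
      (simp_all add: weier_eval_def A_def B_def)
qed

context dvr_residue
begin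

lemma res_unit: "x \<noteq> 0 \<Longrightarrow> v x = 0 \<Longrightarrow> res x \<noteq> 0"
  using res_eq_0_iff[of x] by (simp add: mem_R_iff mem_max_pow_iff)

lemma integral_short:
  assumes "set_weierstrass W \<subseteq> R"
  shows "short_A W \<in> R" "short_B W \<in> R"
proof -
  have "a\<^sub>1 W \<in> R" "a\<^sub>2 W \<in> R" "a\<^sub>3 W \<in> R" "a\<^sub>4 W \<in> R" "a\<^sub>6 W \<in> R"
    using assms by (cases W, simp)+
  then have "b\<^sub>2 W \<in> R" "b\<^sub>4 W \<in> R" "b\<^sub>6 W \<in> R"
    unfolding b\<^sub>2_def b\<^sub>4_def b\<^sub>6_def by (simp_all add: R_intros)
  then have "b\<^sub>2 W / 12 \<in> R" "b\<^sub>4 W / 2 \<in> R" "b\<^sub>6 W / 4 \<in> R"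
    using divide_R small_units by blast+
  moreover define e f g where "e = b\<^sub>2 W / 12" and "f = b\<^sub>4 W / 2" and "g = b\<^sub>6 W / 4"
  ultimately have "e \<in> R" "f \<in> R" "g \<in> R" by blast+
  then show "short_A W \<in> R" "short_B W \<in> R"
    unfolding short_A_def short_B_def e_def[symmetric] f_def[symmetric] g_def[symmetric]
    by (simp_all add: R_intros)
qed

text \<open>A model with smaller discriminant differs by a scaling with v(w) >= 1. Its short
  invariants are integral, as 2 and 3 are units, so those of W would be divisible by w^4 and
  w^6.\<close>

lemma minimal_modelI:
  assumes W: "W = change_vars u r s t E" "u \<noteq> 0" "set_weierstrass W \<subseteq> R"
    and nd: "\<not> (short_A W \<in> max_pow R 4 \<and> short_B W \<in> max_pow R 6)" and ell: "elliptic E"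
  shows "minimal_model R E W"
  unfolding minimal_model_def
proof (intro conjI allI impI)
  show "integral_model R E W" unfolding integral_model_def using W by blast
  fix W' assume "integral_model R E W'"
  then obtain u' r' s' t' where u': "u' \<noteq> 0" and W': "W' = change_vars u' r' s' t' E" and int: "set_weierstrass W' \<subseteq> R"
    unfolding integral_model_def by blast
  note ch = short_change_vars[OF small_units(1,2)]
  define w where "w = u' / u"
  have w0: "w \<noteq> 0" using u' W(2) by (simp add: w_def)
  have vw: "v w = v u' - v u" using u' W(2) by (simp add: w_def v_divide)
  have "short_A W = w ^ 4 * short_A W'" "short_B W = w ^ 6 * short_B W'"
    unfolding W(1) W' ch[OF W(2)] ch[OF u'] using u' by (simp_all add: w_def power_divide)
  moreover have "w ^ 4 * short_A W' \<in> max_pow R 4" "w ^ 6 * short_B W' \<in> max_pow R 6" if "v w \<ge> 1"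
  proof -
    have "w ^ 4 \<in> max_pow R 4" "w ^ 6 \<in> max_pow R 6" using that w0 by (simp_all add: mem_max_pow_iff v_power)
    then show "w ^ 4 * short_A W' \<in> max_pow R 4" "w ^ 6 * short_B W' \<in> max_pow R 6"
      using max_pow_scale integral_short[OF int] by (metis mult.commute)+
  qed
  ultimately have "v w < 1" using nd by fastforce
  moreover have "discr E \<noteq> 0" using ell by (simp add: elliptic_def)
  ultimately show "v (discr W) \<le> v (discr W')"
    unfolding W(1) W' ch[OF W(2)] ch[OF u'] using u' W(2) vw by (simp add: v_divide v_power)
qed

lemma minimal_short_invariants:
  fixes E :: "'a weierstrass"
  assumes ell: "elliptic E"
  obtains u where "u \<noteq> 0" "short_A E / u ^ 4 \<in> R" "short_B E / u ^ 6 \<in> R"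
    "\<not> (short_A E / u ^ 4 \<in> max_pow R 4 \<and> short_B E / u ^ 6 \<in> max_pow R 6)"
proof -
  obtain \<pi> where \<pi>: "\<pi> \<noteq> 0" "v \<pi> = 1" using uniformizer_exists by (auto simp: uniformizer_def)
  define A where "A = short_A E"
  define B where "B = short_B E"
  \<comment> \<open>Division by u^4 and u^6 keeps A and B integral as long as v(u) is at most v(A)/4
    and v(B)/6. This is the largest such integer; an invariant that is 0 imposes no bound.\<close>
  define n where "n = (if A = 0 then v B div 6 else if B = 0 then v A div 4 else min (v A div 4) (v B div 6))"
  define u where "u = \<pi> powi n"
  have u: "u \<noteq> 0" "v u = n" using \<pi> by (simp_all add: u_def v_powi)
  have AB: "A \<noteq> 0 \<or> B \<noteq> 0"
    using short_discriminant[OF small_units(1,2), of E] ell by (auto simp: A_def B_def elliptic_def)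
  have vA: "v (A / u ^ 4) = v A - 4 * n" if "A \<noteq> 0" using that u by (simp add: v_divide v_power)
  have vB: "v (B / u ^ 6) = v B - 6 * n" if "B \<noteq> 0" using that u by (simp add: v_divide v_power)
  have nA: "n \<le> v A div 4" if "A \<noteq> 0" using that by (simp add: n_def)
  have nB: "n \<le> v B div 6" if "B \<noteq> 0" using that by (simp add: n_def)
  have "A / u ^ 4 \<in> R" using vA nA by (cases "A = 0") (auto simp: mem_R_iff)
  moreover have "B / u ^ 6 \<in> R" using vB nB by (cases "B = 0") (auto simp: mem_R_iff)
  moreover have "A \<noteq> 0 \<and> n = v A div 4 \<or> B \<noteq> 0 \<and> n = v B div 6"
    using AB by (auto simp: n_def min_def)
  then have "\<not> (A / u ^ 4 \<in> max_pow R 4 \<and> B / u ^ 6 \<in> max_pow R 6)"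
    using vA vB u by (auto simp: mem_max_pow_iff)
  ultimately show ?thesis using u(1) that unfolding A_def B_def by blast
qed

text \<open>\<open>c\<close> is the formula for a double root of X^3 + A X + B in the case of
  vanishing discriminant. Translated there, the lower coefficients f and g satisfy 4 A^2 f =
  \<Delta>' and 8 A^3 g = -B \<Delta>', so v(f) = n + 2 and v(g) = n + 3. Hence this one translation
  replaces all successive ones of the subprocedure.\<close>

lemma kodaira_I_star:
  fixes A B :: 'a
  assumes A: "A \<noteq> 0" "v A = 2" and B: "B \<noteq> 0" "v B = 3"
    and \<Delta>: "4 * A ^ 3 + 27 * B ^ 2 \<noteq> 0" "v (4 * A ^ 3 + 27 * B ^ 2) = 6 + int n" "n > 0"
    and \<pi>: "uniformizer R \<pi>"
  defines "c \<equiv> - 3 * B / (2 * A)"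
  shows "c \<in> R" "tate_form R res \<pi> (Weierstrass 0 (3 * c) 0 (3 * c ^ 2 + A) (c ^ 3 + A * c + B)) (Kod_I_star n)"
proof -
  note two_three = residue_two_three
  define \<Delta>' where "\<Delta>' = 4 * A ^ 3 + 27 * B ^ 2"
  have D: "\<Delta>' \<noteq> 0" "v \<Delta>' = 6 + int n" using \<Delta> by (simp_all add: \<Delta>'_def)
  have p: "\<pi> \<noteq> 0" "v \<pi> = 1" using \<pi> by (simp_all add: uniformizer_def)
  have c2: "2 * A * c = - 3 * B" using A small_units by (simp add: c_def)
  have vc: "c \<noteq> 0" "v c = 1"
    using A B small_units by (simp_all add: c_def v_divide v_mult)
  then show "c \<in> R" by (simp add: mem_R_iff)
  define f where "f = 3 * c ^ 2 + A"
  define g where "g = c ^ 3 + A * c + B"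
  have "4 * A ^ 2 * f = 3 * (2 * A * c) ^ 2 + 4 * A ^ 3" by (simp add: f_def algebra_simps eval_nat_numeral)
  also have "\<dots> = \<Delta>'" unfolding c2 \<Delta>'_def by (simp add: power2_eq_square)
  finally have f: "4 * A ^ 2 * f = \<Delta>'" .
  then have f0: "f \<noteq> 0" using D by auto
  have "v \<Delta>' = v f + 4" unfolding f[symmetric] using A f0 small_units by (simp add: v_mult v_power)
  then have vf: "v f = int n + 2" using D by simp
  have "8 * A ^ 3 * g = (2 * A * c) ^ 3 + 4 * A ^ 3 * (2 * A * c) + 8 * A ^ 3 * B"
    by (simp add: g_def algebra_simps eval_nat_numeral)
  also have "\<dots> = - (B * \<Delta>')" unfolding c2 \<Delta>'_def by (simp add: algebra_simps eval_nat_numeral)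
  finally have g: "8 * A ^ 3 * g = - (B * \<Delta>')" .
  then have g0: "g \<noteq> 0" using D B by auto
  have "v (B * \<Delta>') = v g + 6"
    using arg_cong[OF g, of v] A g0 small_units by (simp add: v_mult v_power)
  then have vg: "v g = int n + 3" using D B by (simp add: v_mult)
  have v3c: "3 * c \<noteq> 0" "v (3 * c) = 1" using vc small_units by (simp_all add: v_mult)
  have quot: "x / \<pi> ^ k \<noteq> 0 \<and> v (x / \<pi> ^ k) = v x - int k" if "x \<noteq> 0" for x k
    using that p by (simp add: v_divide v_power)
  have unit: "res (x / \<pi> ^ k) \<noteq> 0" if "x \<noteq> 0" "v x = int k" for x k
    using res_unit quot[of x k] that by simp
  have zero: "res (x / \<pi> ^ k) = 0" if "x \<noteq> 0" "v x > int k" for x k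
    using res_eq_0_iff[of "x / \<pi> ^ k"] quot[of x k] that by (simp add: mem_R_iff mem_max_pow_iff)
  have u: "res (3 * c / \<pi>) \<noteq> 0" using unit[of "3 * c" 1] v3c by simp
  have "tate_form R res \<pi> (Weierstrass 0 (3 * c) 0 f g) (Kod_I_star n)"
  proof (cases "odd n")
    case True
    define m where "m = (n + 1) div 2"
    have m: "n = 2 * m - 1" "m > 0" using True by (auto simp: m_def elim!: oddE)
    have "distinct_roots [:- res (g / \<pi> ^ (2 * m + 2)), 0, 1:]"
      using unit[of g "2 * m + 2"] g0 vg m by (intro distinct_roots_quadratic two_three) auto
    then show ?thesis
      using True m v3c vf vg \<Delta>(3) unfolding tate_form.simps m_def[symmetric] Let_def weierstrass.sel
      by (simp add: mem_max_pow_iff)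
  next
    case False
    define m where "m = n div 2"
    have m: "n = 2 * m" "m > 0" using False \<Delta>(3) by (auto simp: m_def elim!: evenE)
    have "res (f / \<pi> ^ (m + 2)) = 0" using zero[of f "m + 2"] f0 vf m by simp
    moreover have "distinct_roots [:res (g / \<pi> ^ (2 * m + 3)), 0, res (3 * c / \<pi>):]"
      using unit[of g "2 * m + 3"] g0 vg m u by (intro distinct_roots_quadratic two_three) auto
    ultimately show ?thesis
      using False m v3c vf vg \<Delta>(3) unfolding tate_form.simps m_def[symmetric] Let_def weierstrass.sel
      by (simp add: mem_max_pow_iff)
  qed
  then show "tate_form R res \<pi> (Weierstrass 0 (3 * c) 0 (3 * c ^ 2 + A) (c ^ 3 + A * c + B)) (Kod_I_star n)"
    by (simp only: f_def g_def)
qed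

text \<open>For a minimal short pair A, B with 3 v(A) < v(\<Delta>), cancellation forces 2 v(B) = 3
  v(A), and minimality v(A) = 2, v(B) = 3: type I_n^* with n = v(\<Delta>) - 6. Otherwise
  v(\<Delta>) is at most 3 v(A) and 2 v(B), so minimality gives 1 <= v(\<Delta>) <= 11 and
  v(\<Delta>) is the residue of v(discr E) modulo 12.\<close>

lemma additive_potentially_good:
  fixes E :: "'a weierstrass"
  assumes ell: "elliptic E" and ss: "\<not> semistable_reduction R res E"
    and star: "\<And>n. \<not> has_kodaira_type R res E (Kod_I_star n)"
  shows "short_A E = 0 \<or> v (discr E) \<le> 3 * v (short_A E)"
    "v (discr E) mod 12 \<noteq> 0" "v (discr E) mod 12 \<noteq> 6"
    "v (discr E) mod 12 = 3 \<Longrightarrow> has_kodaira_type R res E Kod_III"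
    "v (discr E) mod 12 = 9 \<Longrightarrow> has_kodaira_type R res E Kod_III_star"
proof -
  note two_three = residue_two_three
  obtain \<pi> where \<pi>: "uniformizer R \<pi>" using uniformizer_exists by blast
  then have p: "\<pi> \<noteq> 0" "v \<pi> = 1" by (simp_all add: uniformizer_def)
  obtain u where u: "u \<noteq> 0" "short_A E / u ^ 4 \<in> R" "short_B E / u ^ 6 \<in> R"
    "\<not> (short_A E / u ^ 4 \<in> max_pow R 4 \<and> short_B E / u ^ 6 \<in> max_pow R 6)"
    by (rule minimal_short_invariants[OF ell]) (rule that)
  define A where "A = short_A E / u ^ 4"
  define B where "B = short_B E / u ^ 6"
  define \<Delta> where "\<Delta> = 4 * A ^ 3 + 27 * B ^ 2"
  have AR: "A \<in> R" and BR: "B \<in> R" and nd: "\<not> (A \<in> max_pow R 4 \<and> B \<in> max_pow R 6)"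
    using u by (simp_all add: A_def B_def)
  have model: "minimal_model R E (Weierstrass 0 (3 * c) 0 (3 * c ^ 2 + A) (c ^ 3 + A * c + B))" if c: "c \<in> R" for c
  proof -
    let ?W = "Weierstrass 0 (3 * c) 0 (3 * c ^ 2 + A) (c ^ 3 + A * c + B)"
    obtain r s t where W: "change_vars u r s t E = ?W"
      using change_vars_to_short[OF small_units(1,2) u(1), of E c] unfolding A_def B_def by blast
    have "short_A ?W = A" "short_B ?W = B"
      using short_change_vars(1,2)[OF small_units(1,2) u(1), of r s t E]
      unfolding W A_def[symmetric] B_def[symmetric] by blast+
    moreover have "set_weierstrass ?W \<subseteq> R" using AR BR c by (simp add: R_intros)
    ultimately show ?thesis using nd by (intro minimal_modelI[OF W[symmetric] u(1) _ _ ell]) simp_all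
  qed
  have short_model: "minimal_model R E (Weierstrass 0 0 0 A B)" using model[OF zero_R] by simp
  have "- 16 * \<Delta> = discr E / u ^ 12"
  proof -
    have "\<Delta> = (4 * short_A E ^ 3 + 27 * short_B E ^ 2) / u ^ 12"
      by (simp add: \<Delta>_def A_def B_def power_divide add_divide_distrib flip: power_mult)
    then show ?thesis unfolding short_discriminant[OF small_units(1,2), symmetric] by simp
  qed
  moreover have "discr E \<noteq> 0" using ell by (simp add: elliptic_def)
  ultimately have \<Delta>0: "\<Delta> \<noteq> 0" and "v (16 * \<Delta>) = v (discr E / u ^ 12)" using u(1) v_minus[of "16 * \<Delta>"] by auto
  then have v\<Delta>: "v (discr E) = v \<Delta> + 12 * v u"
    using u(1) small_units \<open>discr E \<noteq> 0\<close> by (simp add: v_mult v_divide v_power)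
  have \<Delta>R: "\<Delta> \<in> R" unfolding \<Delta>_def by (intro R_intros AR BR)
  have res\<Delta>: "res \<Delta> = 4 * res A ^ 3 + 27 * res B ^ 2"
    unfolding \<Delta>_def using AR BR by (simp add: res_add res_mult res_power R_intros)
  have map: "map_weierstrass res (Weierstrass 0 0 0 A B) = Weierstrass 0 0 0 (res A) (res B)" by simp
  have pos: "\<Delta> \<in> max_pow R 1"
  proof (rule ccontr)
    assume "\<Delta> \<notin> max_pow R 1"
    then have "nonsingular (map_weierstrass res (Weierstrass 0 0 0 A B))"
      unfolding map using res\<Delta> res_eq_0_iff[OF \<Delta>R] by (intro nonsingular_short two_three) auto
    then show False using ss short_model unfolding semistable_reduction_def by blast
  qed
  \<comment> \<open>Since \<Delta> is in the maximal ideal, a unit A would mean a node.\<close>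
  have A1: "A \<in> max_pow R 1"
  proof (rule ccontr)
    assume "A \<notin> max_pow R 1"
    then have "has_node (map_weierstrass res (Weierstrass 0 0 0 A B))"
      unfolding map using pos res\<Delta> res_eq_0_iff[OF \<Delta>R] res_eq_0_iff[OF AR]
      by (intro node_short two_three) auto
    then show False using ss short_model unfolding semistable_reduction_def by blast
  qed
  have v4A: "v (4 * A ^ 3) = 3 * v A" if "A \<noteq> 0" using that small_units by (simp add: v_mult v_power)
  have v27B: "v (27 * B ^ 2) = 2 * v B" if "B \<noteq> 0" using that small_units by (simp add: v_mult v_power)
  have good: "A = 0 \<or> v \<Delta> \<le> 3 * v A"
  proof (rule ccontr)
    assume "\<not> ?thesis"
    then have A0: "A \<noteq> 0" and lt: "3 * v A < v \<Delta>" by auto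
    have vA: "v A \<ge> 1" using A1 A0 by (simp add: mem_max_pow_iff)
    have eq: "27 * B ^ 2 = - (4 * A ^ 3) + \<Delta>" by (simp add: \<Delta>_def)
    have "\<Delta> \<in> max_pow R (nat (v \<Delta>))" using \<Delta>R \<Delta>0 by (simp add: mem_max_pow_iff mem_R_iff)
    note vB = v_add_eq[of "- (4 * A ^ 3)" \<Delta> "nat (v \<Delta>)", folded eq]
    have "- (4 * A ^ 3) \<noteq> 0" using A0 small_units by simp
    moreover have "v (- (4 * A ^ 3)) < int (nat (v \<Delta>))" using v4A[OF A0] lt vA by simp
    ultimately have "27 * B ^ 2 \<noteq> 0" "v (27 * B ^ 2) = 3 * v A"
      using vB \<open>\<Delta> \<in> max_pow R (nat (v \<Delta>))\<close> v4A[OF A0] by simp_all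
    then have B0: "B \<noteq> 0" and e: "2 * v B = 3 * v A" using v27B by auto
    have "v A < 4 \<or> v B < 6" using nd A0 B0 by (auto simp: mem_max_pow_iff)
    then have vAB: "v A = 2" "v B = 3" using e vA by presburger+
    define n where "n = nat (v \<Delta> - 6)"
    have n: "v \<Delta> = 6 + int n" "n > 0" using lt vAB by (simp_all add: n_def)
    note I = kodaira_I_star[OF A0 vAB(1) B0 vAB(2) \<Delta>0[unfolded \<Delta>_def] n(1)[unfolded \<Delta>_def] n(2) \<pi>]
    have "has_kodaira_type R res E (Kod_I_star n)"
      unfolding has_kodaira_type_def using model[OF I(1)] \<pi> I(2) by blast
    then show False using star by blast
  qed
  show "short_A E = 0 \<or> v (discr E) \<le> 3 * v (short_A E)"
    using good u(1) v\<Delta> by (cases "short_A E = 0") (auto simp: A_def v_divide v_power)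
  have vA: "v \<Delta> \<le> 3 * v A" if "A \<noteq> 0" using good that by blast
  have vB: "v \<Delta> \<le> 2 * v B" if B0: "B \<noteq> 0"
  proof (rule ccontr)
    assume lt: "\<not> ?thesis"
    moreover have "4 * A ^ 3 \<in> max_pow R (nat (v \<Delta>))"
      using v4A vA AR by (cases "A = 0") (auto simp: mem_max_pow_iff mem_R_iff)
    moreover have "27 * B ^ 2 \<noteq> 0" using B0 small_units by simp
    moreover have "v B \<ge> 0" using BR B0 by (simp add: mem_R_iff)
    ultimately have "v (27 * B ^ 2 + 4 * A ^ 3) = v (27 * B ^ 2)"
      using v27B[OF B0] by (intro v_add_eq(2)[where n = "nat (v \<Delta>)"]) auto
    then show False using v27B[OF B0] lt by (simp add: \<Delta>_def add.commute)
  qed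
  have v\<Delta>1: "v \<Delta> \<ge> 1" using pos \<Delta>0 by (simp add: mem_max_pow_iff)
  have v\<Delta>12: "v \<Delta> < 12" using nd vA vB by (force simp: mem_max_pow_iff)
  have mod: "v (discr E) mod 12 = v \<Delta>" unfolding v\<Delta> using v\<Delta>1 v\<Delta>12 by simp
  show "v (discr E) mod 12 \<noteq> 0" unfolding mod using v\<Delta>1 by simp
  have quot: "x / \<pi> ^ k \<noteq> 0 \<and> v (x / \<pi> ^ k) = v x - int k" if "x \<noteq> 0" for x k
    using that p by (simp add: v_divide v_power)
  show "v (discr E) mod 12 \<noteq> 6"
  proof
    assume "v (discr E) mod 12 = 6"
    then have v6: "v \<Delta> = 6" using mod by simp
    have A2: "A \<in> max_pow R 2" and B3: "B \<in> max_pow R 3" using vA vB v6 by (auto simp: mem_max_pow_iff)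
    have q: "A / \<pi> ^ 2 \<in> R" "B / \<pi> ^ 3 \<in> R"
      using A2 B3 quot[of A 2] quot[of B 3] by (auto simp: mem_max_pow_iff mem_R_iff)
    have "\<Delta> / \<pi> ^ 6 = 4 * (A / \<pi> ^ 2) ^ 3 + 27 * (B / \<pi> ^ 3) ^ 2"
      by (simp add: \<Delta>_def power_divide add_divide_distrib flip: power_mult)
    then have "res (\<Delta> / \<pi> ^ 6) = 4 * res (A / \<pi> ^ 2) ^ 3 + 27 * res (B / \<pi> ^ 3) ^ 2"
      using q by (simp add: res_add res_mult res_power R_intros)
    moreover have "res (\<Delta> / \<pi> ^ 6) \<noteq> 0" using quot[OF \<Delta>0, of 6] v6 by (intro res_unit) auto
    ultimately have "distinct_roots [:res (B / \<pi> ^ 3), res (A / \<pi> ^ 2), 0, 1:]"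
      by (intro distinct_roots_cubic) simp
    then have "tate_form R res \<pi> (Weierstrass 0 0 0 A B) (Kod_I_star 0)"
      using A2 B3 by (simp add: mem_max_pow_iff)
    then show False using star short_model \<pi> unfolding has_kodaira_type_def by blast
  qed
  show "has_kodaira_type R res E Kod_III" if "v (discr E) mod 12 = 3"
  proof -
    have v3: "v \<Delta> = 3" using that mod by simp
    have B2: "B \<in> max_pow R 2" using vB v3 by (cases "B = 0") (simp_all add: mem_max_pow_iff)
    have "A \<notin> max_pow R 2"
    proof
      assume "A \<in> max_pow R 2"
      then have "\<Delta> \<in> max_pow R 4"
        unfolding \<Delta>_def using max_pow_power[of A 2 3] max_pow_power[OF B2, of 2]
        by (intro max_pow_add max_pow_scale numeral_R) (auto intro: max_pow_mono)
      then show False using v3 \<Delta>0 by (simp add: mem_max_pow_iff)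
    qed
    then have "A \<noteq> 0" "v A = 1" using A1 by (auto simp: mem_max_pow_iff)
    then have "tate_form R res \<pi> (Weierstrass 0 0 0 A B) Kod_III"
      using B2 by (simp add: mem_max_pow_iff b\<^sub>2_def b\<^sub>8_def v_power)
    then show ?thesis using short_model \<pi> unfolding has_kodaira_type_def by blast
  qed
  show "has_kodaira_type R res E Kod_III_star" if "v (discr E) mod 12 = 9"
  proof -
    have v9: "v \<Delta> = 9" using that mod by simp
    have A3: "A \<in> max_pow R 3" and B5: "B \<in> max_pow R 5"
      using vA vB v9 by (cases "A = 0"; cases "B = 0"; simp add: mem_max_pow_iff)+
    have "A \<notin> max_pow R 4"
    proof
      assume "A \<in> max_pow R 4"
      then have "\<Delta> \<in> max_pow R 10"
        unfolding \<Delta>_def using max_pow_power[of A 4 3] max_pow_power[OF B5, of 2]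
        by (intro max_pow_add max_pow_scale numeral_R) (auto intro: max_pow_mono)
      then show False using v9 \<Delta>0 by (simp add: mem_max_pow_iff)
    qed
    then have "tate_form R res \<pi> (Weierstrass 0 0 0 A B) Kod_III_star"
      using A3 B5 by (simp add: mem_max_pow_iff)
    then show ?thesis using short_model \<pi> unfolding has_kodaira_type_def by blast
  qed
qed

text \<open>
  Covers Tate's types III (\<open>i = j = 1\<close>, \<open>k = 2\<close>) and III$^*$ (\<open>i = 2\<close>, \<open>j = 3\<close>, \<open>k = 5\<close>):
  in both cases the discriminant is dominated by $-8 b_4^3$.
\<close>

lemma discr_dominated_by_b4:
  fixes W :: "'a weierstrass"
  assumes b: "b\<^sub>2 W \<in> max_pow R i" "b\<^sub>4 W \<noteq> 0" "v (b\<^sub>4 W) = int j" "b\<^sub>6 W \<in> max_pow R k"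
    and le: "j < 2 * i" "3 * j < 2 * k" "2 * j < i + k"
  shows "discr W \<noteq> 0" "v (discr W) = 3 * int j" "short_A W = 0 \<or> int j \<le> v (short_A W)"
proof -
  have b4: "b\<^sub>4 W \<in> max_pow R j" using b by (simp add: mem_max_pow_iff)
  have "4 * b\<^sub>8 W = b\<^sub>2 W * b\<^sub>6 W - b\<^sub>4 W ^ 2"
    by (simp add: b\<^sub>2_def b\<^sub>4_def b\<^sub>6_def b\<^sub>8_def algebra_simps power2_eq_square)
  then have b8: "b\<^sub>8 W = (b\<^sub>2 W * b\<^sub>6 W - b\<^sub>4 W ^ 2) / 4" using small_units by (simp add: field_simps)
  have m8: "b\<^sub>2 W * b\<^sub>6 W - b\<^sub>4 W ^ 2 \<in> max_pow R (2 * j)"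
    using max_pow_mult[OF b(1,4)] max_pow_power[OF b4, of 2] le
    by (intro max_pow_diff) (auto intro: max_pow_mono)
  have "b\<^sub>8 W \<in> max_pow R (2 * j)" unfolding b8 by (rule max_pow_divide[OF m8 small_units(3,10)])
  then have 1: "b\<^sub>2 W ^ 2 * b\<^sub>8 W \<in> max_pow R (3 * j + 1)"
  proof -
    have "b\<^sub>2 W ^ 2 * b\<^sub>8 W \<in> max_pow R (i * 2 + 2 * j)"
      by (intro max_pow_mult max_pow_power b(1)) (fact \<open>b\<^sub>8 W \<in> max_pow R (2 * j)\<close>)
    then show ?thesis using le by (auto intro: max_pow_mono)
  qed
  have 2: "27 * b\<^sub>6 W ^ 2 \<in> max_pow R (3 * j + 1)"
    by (rule max_pow_mono[OF max_pow_scale[OF numeral_R max_pow_power[OF b(4), of 2]]]) (use le in simp)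
  have "b\<^sub>2 W * b\<^sub>4 W * b\<^sub>6 W \<in> max_pow R (i + j + k)" by (intro max_pow_mult b b4)
  then have "9 * (b\<^sub>2 W * b\<^sub>4 W * b\<^sub>6 W) \<in> max_pow R (i + j + k)" by (rule max_pow_scale[OF numeral_R])
  then have 3: "9 * b\<^sub>2 W * b\<^sub>4 W * b\<^sub>6 W \<in> max_pow R (3 * j + 1)"
    using le by (auto simp: mult.assoc intro: max_pow_mono)
  define z where "z = - (b\<^sub>2 W ^ 2 * b\<^sub>8 W) - 27 * b\<^sub>6 W ^ 2 + 9 * b\<^sub>2 W * b\<^sub>4 W * b\<^sub>6 W"
  have z: "z \<in> max_pow R (3 * j + 1)" unfolding z_def by (intro max_pow_add max_pow_diff max_pow_minus 1 2 3)
  have d: "discr W = - (8 * b\<^sub>4 W ^ 3) + z" by (simp add: discr_def z_def)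
  have nz: "- (8 * b\<^sub>4 W ^ 3) \<noteq> 0" using b small_units by simp
  have "v (8 * b\<^sub>4 W ^ 3) = 3 * int j" using b small_units by (simp add: v_mult v_power)
  then have v8: "v (- (8 * b\<^sub>4 W ^ 3)) = 3 * int j" by (simp only: v_minus)
  show "discr W \<noteq> 0" "v (discr W) = 3 * int j"
    using v_add_eq[OF nz z] unfolding d v8 by simp_all
  have "b\<^sub>4 W / 2 \<in> max_pow R j" by (rule max_pow_divide[OF b4 small_units(1,8)])
  moreover have "(b\<^sub>2 W / 12) ^ 2 \<in> max_pow R j"
    using max_pow_power[OF max_pow_divide[OF b(1) small_units(5,12)], of 2] le by (auto intro: max_pow_mono)
  ultimately have "short_A W \<in> max_pow R j"
    unfolding short_A_def by (intro max_pow_diff max_pow_scale numeral_R)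
  then show "short_A W = 0 \<or> int j \<le> v (short_A W)" by (simp add: mem_max_pow_iff)
qed

text \<open>The discriminant of the minimal model has valuation 3 or 9, and changes of variables
  alter it by multiples of 12. In type III the condition on \<open>b\<^sub>8\<close> forces
  \<open>b\<^sub>4\<close> to have valuation 1; in type III^* the term 2 \<open>a\<^sub>4\<close>
  gives it valuation 3.\<close>

lemma kodaira_III_discriminant:
  fixes E :: "'a weierstrass"
  assumes ell: "elliptic E" and K: "has_kodaira_type R res E Kod_III \<or> has_kodaira_type R res E Kod_III_star"
  shows "odd (v (discr E))" "short_A E = 0 \<or> v (discr E) \<le> 3 * v (short_A E)"
proof -
  obtain W where min: "minimal_model R E W"
    and form: "(\<exists>\<pi>. tate_form R res \<pi> W Kod_III) \<or> (\<exists>\<pi>. tate_form R res \<pi> W Kod_III_star)"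
    using K unfolding has_kodaira_type_def by blast
  obtain u r s t where u: "u \<noteq> 0" and W: "W = change_vars u r s t E" and int: "set_weierstrass W \<subseteq> R"
    using min unfolding minimal_model_def integral_model_def by blast
  have a: "a\<^sub>1 W \<in> R" "a\<^sub>2 W \<in> R" "a\<^sub>3 W \<in> R" "a\<^sub>4 W \<in> R" "a\<^sub>6 W \<in> R"
    using int by (cases W, simp)+
  have "\<exists>j. odd j \<and> v (discr W) = 3 * int j \<and> (short_A W = 0 \<or> int j \<le> v (short_A W))"
    using form
  proof
    assume "\<exists>\<pi>. tate_form R res \<pi> W Kod_III"
    then have t: "a\<^sub>3 W \<in> max_pow R 1" "a\<^sub>4 W \<in> max_pow R 1" "a\<^sub>6 W \<in> max_pow R 2"
      "b\<^sub>2 W \<in> max_pow R 1" "b\<^sub>8 W \<notin> max_pow R 3" by simp_all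
    have b4: "b\<^sub>4 W \<in> max_pow R 1"
      unfolding b\<^sub>4_def by (intro max_pow_add max_pow_scale numeral_R a t)
    have b6: "b\<^sub>6 W \<in> max_pow R 2"
      unfolding b\<^sub>6_def using max_pow_power[OF t(1), of 2] by (intro max_pow_add max_pow_scale numeral_R t) simp
    have "b\<^sub>4 W \<notin> max_pow R 2"
    proof
      assume "b\<^sub>4 W \<in> max_pow R 2"
      then have "b\<^sub>2 W * b\<^sub>6 W - b\<^sub>4 W ^ 2 \<in> max_pow R 3"
        using max_pow_mult[OF t(4) b6] max_pow_power[of "b\<^sub>4 W" 2 2]
        by (intro max_pow_diff) (auto intro: max_pow_mono)
      moreover have "b\<^sub>2 W * b\<^sub>6 W - b\<^sub>4 W ^ 2 = 4 * b\<^sub>8 W"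
        by (simp add: b\<^sub>2_def b\<^sub>4_def b\<^sub>6_def b\<^sub>8_def algebra_simps power2_eq_square)
      ultimately have "4 * b\<^sub>8 W / 4 \<in> max_pow R 3" using max_pow_divide small_units(3,10) by metis
      then show False using t(5) small_units(3) by simp
    qed
    then have "b\<^sub>4 W \<noteq> 0" "v (b\<^sub>4 W) = int 1" using b4 by (auto simp: mem_max_pow_iff)
    from discr_dominated_by_b4[OF t(4) this b6] show ?thesis by (intro exI[of _ 1]) simp
  next
    assume "\<exists>\<pi>. tate_form R res \<pi> W Kod_III_star"
    then have t: "a\<^sub>1 W \<in> max_pow R 1" "a\<^sub>2 W \<in> max_pow R 2" "a\<^sub>3 W \<in> max_pow R 3"
      "a\<^sub>4 W \<in> max_pow R 3" "a\<^sub>6 W \<in> max_pow R 5" "a\<^sub>4 W \<notin> max_pow R 4" by simp_all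
    have b2: "b\<^sub>2 W \<in> max_pow R 2"
      unfolding b\<^sub>2_def using max_pow_power[OF t(1), of 2] by (intro max_pow_add max_pow_scale numeral_R t) simp
    have b6: "b\<^sub>6 W \<in> max_pow R 5"
      unfolding b\<^sub>6_def using max_pow_power[OF t(3), of 2]
      by (intro max_pow_add max_pow_scale numeral_R t) (auto intro: max_pow_mono)
    have a4: "a\<^sub>4 W \<noteq> 0" "v (a\<^sub>4 W) = 3" using t(4,6) by (auto simp: mem_max_pow_iff)
    have v2: "2 * a\<^sub>4 W \<noteq> 0" "v (2 * a\<^sub>4 W) = 3" using a4 small_units by (simp_all add: v_mult)
    have "a\<^sub>1 W * a\<^sub>3 W \<in> max_pow R 4" using max_pow_mult[OF t(1,3)] by simp
    from v_add_eq[OF v2(1) this] v2(2) have "b\<^sub>4 W \<noteq> 0" "v (b\<^sub>4 W) = int 3" by (simp_all add: b\<^sub>4_def)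
    from discr_dominated_by_b4[OF b2 this b6] show ?thesis by (intro exI[of _ 3]) simp
  qed
  then obtain j where j: "odd j" "v (discr W) = 3 * int j" "short_A W = 0 \<or> int j \<le> v (short_A W)" by blast
  note ch = short_change_vars[OF small_units(1,2) u, of r s t E, folded W]
  have "discr E \<noteq> 0" using ell by (simp add: elliptic_def)
  then have "v (discr E) = 3 * int j + 12 * v u" using j(2) u unfolding ch(3) by (simp add: v_divide v_power)
  then show "odd (v (discr E))" "short_A E = 0 \<or> v (discr E) \<le> 3 * v (short_A E)"
    using j(1,3) u unfolding ch(1) by (cases "short_A E = 0"; simp add: v_divide v_power)+
qed

end

section \<open>Kernels over the ground field\<close>

text \<open>If the derivative of N/D vanished, D would divide its own derivative by coprimality.
  Then D' = 0 by degree and N' = 0, although the top coefficient of N' is the degree of N times that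
  of N.\<close>

lemma coprime_imp_separable:
  fixes N D :: "'a::field poly"
  assumes bez: "s * N + t * D = 1" and D: "D \<noteq> 0" and N: "of_nat (degree N) \<noteq> (0::'a)"
  shows "pderiv N * D \<noteq> N * pderiv D"
proof
  assume eq: "pderiv N * D = N * pderiv D"
  have "pderiv D = (s * N + t * D) * pderiv D" by (simp add: bez)
  also have "\<dots> = s * (N * pderiv D) + t * D * pderiv D" by (simp add: algebra_simps)
  also have "\<dots> = (s * pderiv N + t * pderiv D) * D" unfolding eq[symmetric] by (simp add: algebra_simps)
  finally have "D dvd pderiv D" by (metis dvd_triv_right)
  then have D': "pderiv D = 0"
  proof (rule contrapos_pp)
    assume nz: "pderiv D \<noteq> 0"
    then have "degree D \<noteq> 0" using degree_eq_zeroE[of D] by (metis pderiv_singleton)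
    then have "degree (pderiv D) < degree D" using degree_pderiv_le_pred[of D] by linarith
    then show "\<not> D dvd pderiv D" using dvd_imp_degree_le[OF _ nz] by (metis leD)
  qed
  have "degree N \<noteq> 0" using N by (metis of_nat_0)
  then have "coeff (pderiv N) (degree N - 1) = of_nat (degree N) * lead_coeff N" by (simp add: coeff_pderiv)
  moreover have "lead_coeff N \<noteq> 0" using \<open>degree N \<noteq> 0\<close> by auto
  ultimately have "pderiv N \<noteq> 0" using N by auto
  then show False using eq D D' by simp
qed

text \<open>Comparison of coefficients from the top: the coefficient of s^2 at n + i is 2 s_i plus
  products of coefficients of s above i. This gives rationality over the ground field without Galois
  theory.\<close>

lemma monic_square_root_rational:
  fixes q :: "'a::field poly" and s :: "'a alg_closure poly"
  assumes two: "(2::'a) \<noteq> 0" and monic: "lead_coeff s = 1" and sq: "s ^ 2 = ac q"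
  shows "coeff s i \<in> range to_ac"
proof (induction "degree s - i" arbitrary: i rule: less_induct)
  case less
  define n where "n = degree s"
  have add: "x + y \<in> range to_ac" and mult: "x * y \<in> range to_ac" and diff: "x - y \<in> range to_ac"
    if "x \<in> range to_ac" "y \<in> range to_ac" for x y :: "'a alg_closure"
    using that by (auto simp flip: to_ac_add to_ac_mult to_ac_diff)
  consider "i > n" | "i = n" | "i < n" by linarith
  then show ?case
  proof cases
    case 1
    then have "coeff s i = to_ac 0" by (simp add: n_def coeff_eq_0)
    then show ?thesis by (simp only: rangeI)
  next
    case 2
    then have "coeff s i = to_ac 1" using monic by (simp add: n_def)
    then show ?thesis by (simp only: rangeI)
  next
    case 3
    define J where "J = {i<..<n}"
    have "coeff (s ^ 2) (n + i) = (\<Sum>j\<le>n + i. coeff s j * coeff s (n + i - j))"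
      by (simp add: power2_eq_square coeff_mult)
    also have "\<dots> = (\<Sum>j\<in>insert i (insert n J). coeff s j * coeff s (n + i - j))"
    proof (rule sum.mono_neutral_right)
      show "\<forall>j\<in>{..n + i} - insert i (insert n J). coeff s j * coeff s (n + i - j) = 0"
      proof
        fix j assume "j \<in> {..n + i} - insert i (insert n J)"
        then have "j < i \<or> n < j" by (auto simp: J_def)
        then have "n < n + i - j \<or> n < j" by linarith
        then show "coeff s j * coeff s (n + i - j) = 0" by (auto simp: n_def coeff_eq_0)
      qed
    qed (use 3 in \<open>auto simp: J_def\<close>)
    also have "\<dots> = 2 * coeff s i + (\<Sum>j\<in>J. coeff s j * coeff s (n + i - j))"
      using 3 monic by (simp add: J_def n_def)
    finally have e: "2 * coeff s i = coeff (ac q) (n + i) - (\<Sum>j\<in>J. coeff s j * coeff s (n + i - j))"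
      by (simp add: sq)
    have "(\<Sum>j\<in>J'. coeff s j * coeff s (n + i - j)) \<in> range to_ac" if "J' \<subseteq> J" for J'
    proof -
      have "finite J'" using that finite_subset by (auto simp: J_def)
      then show ?thesis using that
      proof (induction J')
        case empty
        have "0 = to_ac (0::'a)" by simp
        then show ?case by (metis sum.empty rangeI)
      next
        case (insert j J')
        have "coeff s j \<in> range to_ac" "coeff s (n + i - j) \<in> range to_ac"
          using insert.prems by (auto simp: J_def n_def intro!: less)
        then show ?case using insert add mult by simp
      qed
    qed
    moreover have "coeff (ac q) (n + i) \<in> range to_ac" by (simp add: coeff_map_poly)
    ultimately have "2 * coeff s i \<in> range to_ac" unfolding e using diff by blast
    then obtain c where c: "2 * coeff s i = to_ac c" by blast
    have "(2 :: 'a alg_closure) \<noteq> 0" using two to_ac_eq_0_iff[of "2::'a"] by simp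
    then have "coeff s i = to_ac (c / 2)" using c by (simp add: field_simps)
    then show ?thesis by (simp only: rangeI)
  qed
qed

lemma order_prod_linear:
  fixes A :: "'c::field set"
  assumes "finite A"
  shows "order r (\<Prod>x\<in>A. [:- x, 1:]) = (if r \<in> A then 1 else 0)"
  using assms
proof (induction A)
  case (insert a A)
  have nz: "[:- a, 1:] * (\<Prod>x\<in>A. [:- x, 1:]) \<noteq> 0"
    unfolding mult_eq_0_iff prod_zero_iff[OF insert(1)] by auto
  have "order r [:- a, 1:] = (if r = a then 1 else 0)"
    using order_power_n_n[of a 1] order_0I[of "[:- a, 1:]" r] by auto
  then show ?case using insert(2,3)
    unfolding prod.insert[OF insert(1,2)] order_mult[OF nz] by auto
qed simp

lemma eq_square_of_double_roots:
  fixes p :: "'c::alg_closed_field poly"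
  assumes p: "p \<noteq> 0" and double: "\<And>r. poly p r = 0 \<Longrightarrow> order r p = 2"
  shows "p = smult (lead_coeff p) ((\<Prod>x | poly p x = 0. [:- x, 1:]) ^ 2)"
proof -
  define A where "A = {x. poly p x = 0}"
  define q where "q = (\<Prod>x\<in>A. [:- x, 1:]) ^ 2"
  have fin: "finite A" unfolding A_def using poly_roots_finite[OF p] .
  have nz: "(\<Prod>x\<in>A. [:- x, 1:]) \<noteq> 0" using fin by (simp add: prod_zero_iff)
  have lq: "lead_coeff q = 1" unfolding q_def lead_coeff_power lead_coeff_prod by simp
  have "order r q \<le> order r p" for r
    unfolding q_def power2_eq_square using nz double[of r]
    by (subst order_mult) (auto simp: order_prod_linear[OF fin, unfolded A_def] A_def)
  then have "q dvd p" using nz p by (intro order_le_imp_dvd) (simp_all add: q_def)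
  then obtain h where h: "p = q * h" by (rule dvdE)
  have "degree p = 2 * card A"
    unfolding sum_order_eq_degree[OF p, symmetric] using double by (simp add: A_def)
  moreover have "degree q = 2 * card A"
    unfolding q_def by (subst degree_power_eq[OF nz], subst degree_prod_sum_eq) auto
  ultimately have "degree h = 0" using h p by (simp add: degree_mult_eq)
  then obtain c where c: "h = [:c:]" by (rule degree_eq_zeroE)
  then have "p = smult c q" using h by simp
  moreover from this have "lead_coeff p = c" using lq by simp
  ultimately show ?thesis by (simp add: q_def A_def)
qed

lemma isogeny_kernel:
  fixes E :: "'a::field weierstrass"
  assumes two: "(2::'a) \<noteq> 0" and three: "(3::'a) \<noteq> 0" and ell: "elliptic E"
    and iso: "admits_rational_isogeny E l" and l: "odd l" "of_nat l \<noteq> (0::'a)"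
  obtains S \<rho> where "finite S" "card S = l"
    "\<And>P. P \<in> S \<Longrightarrow> on_curve (to_ac (short_A E)) (to_ac (short_B E)) P"
    "\<And>P Q. P \<in> S \<Longrightarrow> Q \<in> S \<Longrightarrow> padd (to_ac (short_A E)) P Q \<in> S"
    "card {x. \<exists>y. Aff x y \<in> S} = (l - 1) div 2"
    "(\<Prod>x | \<exists>y. Aff x y \<in> S. x) = to_ac \<rho>"
proof -
  obtain E' \<phi> where ell': "elliptic E'" and rat: "rational_isogeny E E' \<phi>" and deg: "isogeny_degree E E' \<phi> l"
    using iso unfolding admits_rational_isogeny_def by blast
  obtain N D V W s t :: "'a poly" where f: "s * N + t * D = 1" "D \<noteq> 0" "W \<noteq> 0" "V \<noteq> 0" "degree D < degree N"
    "cubic (short_A E) (short_B E) * V ^ 2 * D ^ 3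
       = W ^ 2 * (N ^ 3 + smult (short_A E') (N * D ^ 2) + smult (short_B E') (D ^ 3))"
    "\<And>x y. on_short E x y \<Longrightarrow> poly (ac W) x \<noteq> 0 \<Longrightarrow> poly (ac D) x \<noteq> 0 \<and>
       on_short E' (poly (ac N) x / poly (ac D) x) (y * poly (ac V) x / poly (ac W) x) \<and>
       \<phi> (from_short E x y) = from_short E' (poly (ac N) x / poly (ac D) x) (y * poly (ac V) x / poly (ac W) x)"
    by (rule isogeny_short_form[OF two three ell' rat]) (rule that)
  interpret F: isogeny_formula E E' \<phi> N D V W s t
    by (rule isogeny_formula.intro[OF two three f(1-5) f(7)])
  have N: "degree N = l" using F.degree_le_isogeny_degree[OF deg] F.isogeny_degree_le_degree[OF deg] by simp
  interpret I: isogeny_x_coordinate "to_ac (short_A E)" "to_ac (short_B E)" "to_ac (short_A E')" "to_ac (short_B E')"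
    "ac N" "ac D" "ac V" "ac W"
  proof
    show "(2::'a alg_closure) \<noteq> 0" using ac_two_three[OF two three] by blast
    show "4 * to_ac (short_A E) ^ 3 + 27 * to_ac (short_B E) ^ 2 \<noteq> 0"
      "4 * to_ac (short_A E') ^ 3 + 27 * to_ac (short_B E') ^ 2 \<noteq> 0"
      using short_discriminant_nonzero(2)[OF two three] ell ell' by blast+
    have "ac s * ac N + ac t * ac D = ac (s * N + t * D)" by simp
    then have "ac s * ac N + ac t * ac D = 1" by (simp only: f(1) ac_1)
    then show "no_common_root (ac N) (ac D)" by (rule no_common_root_bezout)
    show "ac D \<noteq> 0" "ac W \<noteq> 0" "degree (ac D) < degree (ac N)" using f by simp_all
    show "cubic (to_ac (short_A E)) (to_ac (short_B E)) * ac V ^ 2 * ac D ^ 3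
       = ac W ^ 2 * (ac N ^ 3 + smult (to_ac (short_A E')) (ac N * ac D ^ 2) + smult (to_ac (short_B E')) (ac D ^ 3))"
      using arg_cong[OF f(6), of ac] by simp
    have "ac (pderiv N * D) \<noteq> ac (N * pderiv D)"
      using coprime_imp_separable[OF f(1,2)] l N by (simp del: ac_mult)
    then show "pderiv (ac N) * ac D \<noteq> ac N * pderiv (ac D)" by (simp add: pderiv_ac)
  qed
  note K = I.card_kernel I.kernel_on_curve I.padd_kernel
  have card: "card I.kernel = l" using K(1) N by simp
  have point: "\<exists>y. Aff x y \<in> I.kernel" if "poly (ac D) x = 0" for x
    using sqrt_exists[of "x ^ 3 + to_ac (short_A E) * x + to_ac (short_B E)"] that by (auto simp: I.kernel_def)
  have X: "{x. \<exists>y. Aff x y \<in> I.kernel} = {x. poly (ac D) x = 0}"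
    using point by (auto simp: I.kernel_def)
  \<comment> \<open>A root of another order would be the first coordinate of a point of order 2 in a
    kernel of odd order.\<close>
  have order: "order r (ac D) = 2" if r: "poly (ac D) r = 0" for r
  proof (rule ccontr)
    assume "order r (ac D) \<noteq> 2"
    then have "poly (cubic (to_ac (short_A E)) (to_ac (short_B E))) r = 0"
      using I.order_D_root[OF r] by (auto split: if_splits)
    then have "Aff r 0 \<in> I.kernel" using r by (simp add: I.kernel_def)
    from two_torsion_even_card[OF I.two I.disc _ I.kernel_on_curve I.padd_kernel this] K(1)
    have "even (card I.kernel)" by blast
    then show False using card l by simp
  qed
  define P where "P = (\<Prod>x | poly (ac D) x = 0. [:- x, 1:])"
  have sq: "ac D = smult (lead_coeff (ac D)) (P ^ 2)"
    unfolding P_def by (rule eq_square_of_double_roots) (use f order in auto)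
  have "2 * card {x. poly (ac D) x = 0} = degree (ac D)"
    using sum_order_eq_degree[of "ac D"] order f(2) by simp
  then have cardX: "card {x. poly (ac D) x = 0} = (l - 1) div 2" using I.degree_D N by simp
  \<comment> \<open>\<open>P\<close> is monic with a square over the ground field, so its constant
    coefficient, up to sign the product of the first coordinates, lies in that field.\<close>
  have "P ^ 2 = ac (smult (inverse (lead_coeff D)) D)"
  proof -
    have "ac (smult (inverse (lead_coeff D)) D) = smult (inverse (to_ac (lead_coeff D))) (ac D)" by simp
    also have "\<dots> = P ^ 2" by (subst sq) (simp add: coeff_map_poly f(2))
    finally show ?thesis ..
  qed
  moreover have "lead_coeff P = 1" unfolding P_def lead_coeff_prod by simp
  ultimately have "coeff P 0 \<in> range to_ac" by (intro monic_square_root_rational[OF two])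
  then obtain c where c: "coeff P 0 = to_ac c" by blast
  have "coeff P 0 = (\<Prod>x | poly (ac D) x = 0. - x)"
    by (simp add: P_def poly_0_coeff_0[symmetric] poly_prod)
  then have "to_ac c = (- 1) ^ card {x. poly (ac D) x = 0} * (\<Prod>x | poly (ac D) x = 0. x)"
    using c prod.distrib[of "\<lambda>_. - 1" "\<lambda>x. x" "{x. poly (ac D) x = 0}"] by simp
  then have "(\<Prod>x | poly (ac D) x = 0. x) = (- 1) ^ card {x. poly (ac D) x = 0} * to_ac c"
    by (simp add: mult.assoc[symmetric] power_mult_distrib[symmetric])
  then have "(\<Prod>x | poly (ac D) x = 0. x) = to_ac ((- 1) ^ card {x. poly (ac D) x = 0} * c)" by simp
  then show ?thesis using that[OF _ card K(2) K(3)] K(1) unfolding X using cardX by blast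
qed

lemma padd_scale:
  fixes u :: "'c::field"
  assumes "u \<noteq> 0"
  defines "f \<equiv> \<lambda>P. case P of Infty \<Rightarrow> Infty | Aff x y \<Rightarrow> Aff (x / u ^ 2) (y / u ^ 3)"
  shows "padd (a / u ^ 4) (f P) (f Q) = f (padd a P Q)"
proof (cases P; cases Q)
  fix x1 y1 x2 y2 assume PQ: "P = Aff x1 y1" "Q = Aff x2 y2"
  have y: "y1 / u ^ 3 = - (y2 / u ^ 3) \<longleftrightarrow> y1 = - y2" using assms(1) by (simp add: field_simps)
  have x: "x1 / u ^ 2 = x2 / u ^ 2 \<longleftrightarrow> x1 = x2" using assms(1) by (simp add: field_simps)
  define k where "k = (if x1 = x2 then (3 * x1 ^ 2 + a) / (2 * y1) else (y2 - y1) / (x2 - x1))"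
  have k: "(if x1 = x2 then (3 * (x1 / u ^ 2) ^ 2 + a / u ^ 4) / (2 * (y1 / u ^ 3))
        else (y2 / u ^ 3 - y1 / u ^ 3) / (x2 / u ^ 2 - x1 / u ^ 2)) = k / u"
  proof (cases "x1 = x2")
    case True
    have "(3 * (x1 / u ^ 2) ^ 2 + a / u ^ 4) / (2 * (y1 / u ^ 3)) = ((3 * x1 ^ 2 + a) / u ^ 4) / (2 * y1 / u ^ 3)"
      by (simp add: power_divide add_divide_distrib)
    also have "\<dots> = (3 * x1 ^ 2 + a) / (2 * y1) / u"
      using assms(1) by (cases "2 * y1 = 0") (auto simp: divide_simps eval_nat_numeral)
    finally show ?thesis using True by (simp add: k_def)
  next
    case False
    have "(y2 / u ^ 3 - y1 / u ^ 3) / (x2 / u ^ 2 - x1 / u ^ 2) = ((y2 - y1) / u ^ 3) / ((x2 - x1) / u ^ 2)"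
      by (simp add: diff_divide_distrib)
    also have "\<dots> = (y2 - y1) / (x2 - x1) / u"
      using assms(1) False by (auto simp: divide_simps eval_nat_numeral)
    finally show ?thesis using False by (simp add: k_def)
  qed
  have x3: "(k / u) ^ 2 - x1 / u ^ 2 - x2 / u ^ 2 = (k ^ 2 - x1 - x2) / u ^ 2"
    by (simp add: power_divide diff_divide_distrib)
  have y3: "- (y1 / u ^ 3 + k / u * (z / u ^ 2 - x1 / u ^ 2)) = - (y1 + k * (z - x1)) / u ^ 3" for z
    using assms(1) by (simp add: field_simps eval_nat_numeral)
  show ?thesis
    unfolding PQ f_def point.case padd.simps(3) x y k Let_def k_def[symmetric] x3 y3 by simp
qed (simp_all add: f_def)

section \<open>Potentially good reduction\<close>

lemma (in valuation_subring) prod_unit: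
  "(\<And>i. i \<in> I \<Longrightarrow> f i \<in> V \<and> f i \<notin> M) \<Longrightarrow> prod f I \<in> V \<and> prod f I \<notin> M"
  by (induction I rule: infinite_finite_induct) (auto simp: one_mem one_not_M mult_mem unit_mult)

context dvr_residue
begin

lemma v_discr:
  assumes "elliptic E"
  shows "4 * short_A E ^ 3 + 27 * short_B E ^ 2 \<noteq> 0" "v (4 * short_A E ^ 3 + 27 * short_B E ^ 2) = v (discr E)"
proof -
  show nz: "4 * short_A E ^ 3 + 27 * short_B E ^ 2 \<noteq> 0"
    by (rule short_discriminant_nonzero(1)[OF small_units(1,2) assms])
  have "v (discr E) = v (16 * (4 * short_A E ^ 3 + 27 * short_B E ^ 2))"
    using short_discriminant[OF small_units(1,2), of E] v_minus by (metis mult_minus_left)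
  then show "v (4 * short_A E ^ 3 + 27 * short_B E ^ 2) = v (discr E)"
    using v_mult[OF small_units(6) nz] small_units(13) by simp
qed

lemma isogeny_potentially_good:
  fixes E :: "'a weierstrass"
  assumes ell: "elliptic E" and iso: "admits_rational_isogeny E l" and l: "prime l" "l > 3" "CHAR('k) \<noteq> l"
    and good: "short_A E = 0 \<or> v (discr E) \<le> 3 * v (short_A E)"
    and alt: "odd (v (discr E)) \<or> \<not> 3 dvd v (discr E)"
  shows "6 dvd int ((l - 1) div 2) * v (discr E)"
proof -
  define A where "A = short_A E"
  define B where "B = short_B E"
  define \<Delta> where "\<Delta> = 4 * A ^ 3 + 27 * B ^ 2"
  have \<Delta>: "\<Delta> \<noteq> 0" "v \<Delta> = v (discr E)" using v_discr[OF ell] by (simp_all add: \<Delta>_def A_def B_def)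
  have AR: "A ^ 3 / \<Delta> \<in> R"
    using good \<Delta> by (cases "A = 0") (auto simp: mem_R_iff v_divide v_power A_def[symmetric])
  have BR: "B ^ 2 / \<Delta> \<in> R"
  proof -
    have "B ^ 2 / \<Delta> = (1 - 4 * (A ^ 3 / \<Delta>)) / 27"
    proof -
      have "1 - 4 * (A ^ 3 / \<Delta>) = (\<Delta> - 4 * A ^ 3) / \<Delta>" using \<Delta>(1) by (simp add: diff_divide_distrib)
      also have "\<dots> = 27 * (B ^ 2 / \<Delta>)" by (simp add: \<Delta>_def)
      finally show ?thesis using small_units(7) by simp
    qed
    moreover have "1 - 4 * (A ^ 3 / \<Delta>) \<in> R" by (intro R_intros AR)
    ultimately show ?thesis using divide_R small_units by metis
  qed
  have odd: "odd l" using l(1,2) prime_odd_nat by simp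
  have not3: "\<not> 3 dvd l" using l(1,2) primes_dvd_imp_eq[of 3 l] by auto
  have ndvd: "\<not> CHAR('k) dvd l" using l(1,3) prime_char primes_dvd_imp_eq by blast
  then have l0: "of_nat l \<noteq> (0::'a)" using of_nat_max_pow_iff[of l] by (auto simp: mem_max_pow_iff)
  obtain S \<rho> where S: "finite S" "card S = l" "\<And>P. P \<in> S \<Longrightarrow> on_curve (to_ac A) (to_ac B) P"
    "\<And>P Q. P \<in> S \<Longrightarrow> Q \<in> S \<Longrightarrow> padd (to_ac A) P Q \<in> S"
    and d: "card {x. \<exists>y. Aff x y \<in> S} = (l - 1) div 2" and \<rho>: "(\<Prod>x | \<exists>y. Aff x y \<in> S. x) = to_ac \<rho>"
    by (rule isogeny_kernel[OF small_units(1,2) ell iso odd l0, folded A_def B_def]) (rule that)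
  obtain V where V: "valuation_subring V" and mem: "\<And>x. to_ac x \<in> V \<longleftrightarrow> x \<in> R"
    and memM: "\<And>x. to_ac x \<in> valuation_subring.M V \<longleftrightarrow> x \<in> max_pow R 1"
    by (rule extension_to_closure) (rule that)
  interpret valuation_subring V by (rule V)
  \<comment> \<open>A, B and first coordinates have weights 4, 6 and 2, so scaling by this u makes 4
    a^3 + 27 b^2 equal to 1. It need not come from the ground field.\<close>
  obtain u where u: "u ^ 12 = to_ac \<Delta>" using nth_root_exists[of 12 "to_ac \<Delta>"] by auto
  have u0: "u \<noteq> 0" using u \<Delta>(1) by auto
  define a where "a = to_ac A / u ^ 4"
  define b where "b = to_ac B / u ^ 6"
  have a3: "a ^ 3 = to_ac (A ^ 3 / \<Delta>)" by (simp add: a_def power_divide u flip: power_mult)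
  have b2: "b ^ 2 = to_ac (B ^ 2 / \<Delta>)" by (simp add: b_def power_divide u flip: power_mult)
  have aV: "a \<in> V" using mem_power_cancel[of a 3] AR by (simp only: a3 mem)
  have bV: "b \<in> V" using mem_power_cancel[of b 2] BR by (simp only: b2 mem)
  have "4 * a ^ 3 + 27 * b ^ 2 = to_ac (4 * (A ^ 3 / \<Delta>) + 27 * (B ^ 2 / \<Delta>))"
    unfolding a3 b2 by simp
  also have "4 * (A ^ 3 / \<Delta>) + 27 * (B ^ 2 / \<Delta>) = 1"
    using \<Delta>(1) by (simp add: \<Delta>_def add_divide_distrib[symmetric])
  finally have disc: "4 * a ^ 3 + 27 * b ^ 2 \<notin> M" using one_not_M by simp
  have two: "(2 :: 'a alg_closure) \<notin> M"
    using memM[of 2] small_units(1,8) by (simp add: mem_max_pow_iff)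
  define f where "f = (\<lambda>P. case P of Infty \<Rightarrow> Infty | Aff x y \<Rightarrow> Aff (x / u ^ 2) (y / u ^ 3))"
  define T where "T = f ` S"
  have "inj f" by (rule injI) (auto simp: f_def u0 split: point.splits)
  then have cardT: "card T = l" using S(2) by (simp add: T_def card_image inj_on_def)
  have finT: "finite T" using S(1) by (simp add: T_def)
  have onT: "on_curve a b P" if "P \<in> T" for P
  proof -
    from that obtain Q where Q: "Q \<in> S" "P = f Q" unfolding T_def by blast
    then show ?thesis using S(3)[OF Q(1)]
      by (cases Q) (simp_all add: f_def a_def b_def power_divide u0 field_simps flip: power_mult power_add)
  qed
  have addT: "padd a P Q \<in> T" if "P \<in> T" "Q \<in> T" for P Q
    using that S(4) padd_scale[OF u0, of "to_ac A"] by (auto simp: T_def a_def f_def)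
  have charM: "CHAR('k) dvd n" if "of_nat n \<in> M" for n
    using that memM[of "of_nat n"] of_nat_max_pow_iff by simp
  have int: "x \<in> V" if "Aff x y \<in> T" for x y
    using torsion_point_integral[OF aV bV two disc charM finT onT addT _ that] ndvd cardT by blast
  have unit: "x \<notin> M" if xy: "Aff x y \<in> T" for x y
    using alt
  proof
    assume o: "odd (v (discr E))"
    \<comment> \<open>For B nonzero the valuation 2 v(B) - v(\<Delta>) is nonnegative and odd, hence
      positive.\<close>
    have "B ^ 2 / \<Delta> \<in> max_pow R 1"
    proof (cases "B = 0")
      case False
      then have e: "v (B ^ 2 / \<Delta>) = 2 * v B - v \<Delta>" using \<Delta>(1) by (simp add: v_divide v_power)
      moreover have "v (B ^ 2 / \<Delta>) \<ge> 0" using BR False \<Delta>(1) by (simp add: mem_R_iff)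
      ultimately have "v (B ^ 2 / \<Delta>) \<ge> 1" using o \<Delta>(2) by presburger
      then show ?thesis by (simp add: mem_max_pow_iff)
    qed (simp add: mem_max_pow_iff)
    then have "b ^ 2 \<in> M" by (simp only: b2 memM)
    then have bM: "b \<in> M" using M_power_cancel bV by blast
    show ?thesis
      by (rule torsion_point_unit_4[OF aV bM two disc finT _ _ _ _ xy])
        (use onT addT int cardT odd in blast)+
  next
    assume o: "\<not> 3 dvd v (discr E)"
    have "A ^ 3 / \<Delta> \<in> max_pow R 1"
    proof (cases "A = 0")
      case False
      then have e: "v (A ^ 3 / \<Delta>) = 3 * v A - v \<Delta>" using \<Delta>(1) by (simp add: v_divide v_power)
      moreover have "v (A ^ 3 / \<Delta>) \<ge> 0" using AR False \<Delta>(1) by (simp add: mem_R_iff)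
      ultimately have "v (A ^ 3 / \<Delta>) \<ge> 1" using o \<Delta>(2) by presburger
      then show ?thesis by (simp add: mem_max_pow_iff)
    qed (simp add: mem_max_pow_iff)
    then have "a ^ 3 \<in> M" by (simp only: a3 memM)
    then have aM: "a \<in> M" using M_power_cancel aV by blast
    show ?thesis
      by (rule torsion_point_unit_3[OF aM bV two disc finT _ _ _ _ xy])
        (use onT addT int cardT not3 in blast)+
  qed
  define J where "J = {x. \<exists>y. Aff x y \<in> S}"
  define d where "d = (l - 1) div 2"
  have cardJ: "card J = d" using d by (simp add: J_def d_def)
  have coord: "x / u ^ 2 \<in> V \<and> x / u ^ 2 \<notin> M" if "x \<in> J" for x
  proof -
    from that obtain y where "Aff x y \<in> S" unfolding J_def by blast
    then have "f (Aff x y) \<in> T" by (simp add: T_def)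
    then have "Aff (x / u ^ 2) (y / u ^ 3) \<in> T" by (simp add: f_def)
    then show ?thesis using int unit by blast
  qed
  \<comment> \<open>The scaled coordinates are units of V but involve u^2. The sixth power of their
    product involves only u^12 = \<Delta>, so it comes from the ground field, where its valuation is
    0.\<close>
  define q where "q = (\<Prod>x\<in>J. x / u ^ 2)"
  have q: "q \<in> V" "q \<notin> M" using prod_unit[of J "\<lambda>x. x / u ^ 2"] coord by (auto simp: q_def)
  have "q ^ 6 = (to_ac \<rho> / (u ^ 2) ^ d) ^ 6"
    by (simp add: q_def prod_dividef \<rho>[folded J_def] cardJ)
  also have "\<dots> = to_ac (\<rho> ^ 6 / \<Delta> ^ d)"
    by (simp add: power_divide u[symmetric] mult.commute flip: power_mult)
  finally have q6: "q ^ 6 = to_ac (\<rho> ^ 6 / \<Delta> ^ d)" .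
  have "q ^ 6 \<in> V" "q ^ 6 \<notin> M" using q power_mem M_power_cancel by blast+
  then have r: "\<rho> ^ 6 / \<Delta> ^ d \<in> R" "\<rho> ^ 6 / \<Delta> ^ d \<notin> max_pow R 1" unfolding q6 mem memM by blast+
  have "\<rho> \<noteq> 0"
  proof
    assume "\<rho> = 0"
    then have "\<rho> ^ 6 / \<Delta> ^ d = 0" by simp
    then show False using r(2) unfolding mem_max_pow_iff by blast
  qed
  then have "v (\<rho> ^ 6 / \<Delta> ^ d) = 6 * v \<rho> - int d * v \<Delta>" using \<Delta>(1) by (simp add: v_divide v_power)
  moreover have "v (\<rho> ^ 6 / \<Delta> ^ d) = 0" using r by (auto simp: mem_R_iff mem_max_pow_iff)
  ultimately have "int d * v \<Delta> = 6 * v \<rho>" by simp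
  then show ?thesis by (simp add: d_def \<Delta>(2))
qed

end

theorem theorem1p1:
  fixes R :: "'a::field set"
    and res :: "'a \<Rightarrow> 'k::field"
    and E :: "'a weierstrass"
    and p l :: nat
  assumes "complete_dvr R"
    and "residue_map R res"
    and "perfect_field TYPE('k)"
    and "CHAR('k) = p" and "p > 3"
    and "elliptic E"
    and "prime l" and "l > 3" and "p \<noteq> l"
    and "admits_rational_isogeny E l"
  shows
    "([l - 1 = 2] (mod 12) \<or> [l - 1 = 10] (mod 12) \<longrightarrow>
        semistable_reduction R res E \<or> (\<exists>n. has_kodaira_type R res E (Kod_I_star n))) \<and>
     ([l - 1 = 4] (mod 12) \<or> [l - 1 = 8] (mod 12) \<longrightarrow>
        semistable_reduction R res E \<or> has_kodaira_type R res E Kod_III \<or>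
        has_kodaira_type R res E Kod_III_star \<or>
        (\<exists>n. has_kodaira_type R res E (Kod_I_star n))) \<and>
     ([l - 1 = 6] (mod 12) \<longrightarrow>
        \<not> has_kodaira_type R res E Kod_III \<and> \<not> has_kodaira_type R res E Kod_III_star)"
proof -
  interpret dvr_residue R res
    using assms by unfold_locales (auto simp: complete_dvr_def)
  define d where "d = int ((l - 1) div 2)"
  have mod: "d mod 6 = int c" if "[l - 1 = 2 * c] (mod 12)" "c < 6" for c
  proof -
    have "(l - 1) mod (2 * 6) = 2 * c" using that by (simp add: cong_def)
    then have "(l - 1) div 2 mod 6 = c"
      using mod_mult2_eq[of "l - 1" 2 6] mod_less_divisor[of 2 "l - 1"] by linarith
    then show ?thesis unfolding d_def by (metis of_nat_mod of_nat_numeral)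
  qed
  have key: "6 dvd d * v (discr E)"
    if "short_A E = 0 \<or> v (discr E) \<le> 3 * v (short_A E)" "odd (v (discr E)) \<or> \<not> 3 dvd v (discr E)"
    unfolding d_def
    by (rule isogeny_potentially_good[OF assms(6,10,7,8) _ that]) (use assms in simp)
  \<comment> \<open>Where \<open>key\<close> does not apply, the valuation is divisible by 2 and by
    3, hence by every divisor k of 6.\<close>
  have dvd: "k dvd v (discr E)"
    if good: "short_A E = 0 \<or> v (discr E) \<le> 3 * v (short_A E)" and k: "k dvd 6" "coprime k d" for k
  proof (cases "odd (v (discr E)) \<or> \<not> 3 dvd v (discr E)")
    case True
    then have "k dvd d * v (discr E)" using key[OF good] k(1) dvd_trans by blast
    then show ?thesis using k(2) coprime_dvd_mult_right_iff by blast
  next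
    case False
    then have "6 dvd v (discr E)" by presburger
    then show ?thesis using k(1) dvd_trans by blast
  qed
  have coprime: "coprime (6::int) 5" "coprime (3::int) 2"
    by (simp_all add: coprime_iff_gcd_eq_1 gcd_non_0_int)
  have "semistable_reduction R res E \<or> (\<exists>n. has_kodaira_type R res E (Kod_I_star n))"
    if "[l - 1 = 2] (mod 12) \<or> [l - 1 = 10] (mod 12)"
  proof (rule ccontr)
    assume neg: "\<not> ?thesis"
    then have "\<not> semistable_reduction R res E" "\<And>n. \<not> has_kodaira_type R res E (Kod_I_star n)" by blast+
    note add = additive_potentially_good[OF assms(6) this]
    have "d mod 6 = 1 \<or> d mod 6 = 5" using that mod[of 1] mod[of 5] by auto
    then have "coprime 6 (d mod 6)" by (elim disjE) (simp_all only: coprime coprime_1_right)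
    then have "coprime 6 d" by simp
    then have "6 dvd v (discr E)" using dvd[OF add(1), of 6] by simp
    then have "v (discr E) mod 12 = 0 \<or> v (discr E) mod 12 = 6" by presburger
    then show False using add(2,3) by blast
  qed
  moreover have "semistable_reduction R res E \<or> has_kodaira_type R res E Kod_III \<or>
        has_kodaira_type R res E Kod_III_star \<or> (\<exists>n. has_kodaira_type R res E (Kod_I_star n))"
    if "[l - 1 = 4] (mod 12) \<or> [l - 1 = 8] (mod 12)"
  proof (rule ccontr)
    assume neg: "\<not> ?thesis"
    then have "\<not> semistable_reduction R res E" "\<And>n. \<not> has_kodaira_type R res E (Kod_I_star n)" by blast+
    note add = additive_potentially_good[OF assms(6) this]
    have "d mod 6 = 2 \<or> d mod 6 = 4" using that mod[of 2] mod[of 4] by auto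
    then have "d mod 3 = 2 \<or> d mod 3 = 1" by presburger
    then have "coprime 3 (d mod 3)" by (elim disjE) (simp_all only: coprime coprime_1_right)
    then have "coprime 3 d" by simp
    then have "3 dvd v (discr E)" using dvd[OF add(1), of 3] by simp
    then have "v (discr E) mod 12 = 0 \<or> v (discr E) mod 12 = 6 \<or> v (discr E) mod 12 = 3 \<or> v (discr E) mod 12 = 9"
      by presburger
    then show False using add(2-5) neg by blast
  qed
  moreover have "\<not> has_kodaira_type R res E Kod_III \<and> \<not> has_kodaira_type R res E Kod_III_star"
    if "[l - 1 = 6] (mod 12)"
  proof (rule ccontr)
    assume "\<not> ?thesis"
    then have K: "odd (v (discr E))" "short_A E = 0 \<or> v (discr E) \<le> 3 * v (short_A E)"
      using kodaira_III_discriminant[OF assms(6)] by blast+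
    have "d mod 6 = 3" using that mod[of 3] by simp
    then have "odd d" by presburger
    then have "coprime 2 d" by simp
    then show False using dvd[OF K(2), of 2] K(1) by simp
  qed
  ultimately show ?thesis by blast
qed

end
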